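(* Let $\lambda=(\ell_1,\ell_2)$ with $\ell_1>\ell_2>1$, let $\epsilon\in\{0,1\}$ with $\epsilon\equiv\ell_2\pmod 2$, and $\ell=(\ell_2+\epsilon)/2$. For $\hat u\in\mathfrak p_\ell$ and $\hat w\in\mathfrak o_{\ell-\epsilon}^\times$ let $\eta_{\hat u,\hat w}$ be the character of the abelian normal subgroup $K_\lambda^{\ell,\epsilon}$ of $G_\lambda$ defined in the context, and let $N_\lambda(\hat u,\hat w)=\mathrm{Stab}_{G_\lambda}(\eta_{\hat u,\hat w})$ be its stabilizer for the conjugation action. Write $\delta=\pi^{\ell_1-\ell_2}$. (1) $$N_\lambda(\hat u,\hat w)=\left\{\begin{pmatrix} a & b\delta \\ c & d \end{pmatrix}\in G_\lambda\ :\ b\equiv c\hat w\ (\mathrm{mod}\ \pi^{\ell-\epsilon}),\ d\equiv a-c\hat u\ (\mathrm{mod}\ \pi^{\ell})\right\}.$$ (2) The character $\eta_{\hat u,\hat w}$ can be extended to (a one-dimensional character of) $N_\lambda(\hat u,\hat w)$. (3) For any extension $\tilde\eta$ of $\eta_{\hat u,\hat w}$ to $N_\lambda(\hat u,\hat w)$, the induced representation $\rho_{\tilde\eta}=\mathrm{Ind}_{N_\lambda(\hat u,\hat w)}^{G_\lambda}(\tilde\eta)$ is irreducible and cuspidal, and distinct $\tilde\eta$'s give rise to inequivalent representations. Any cuspidal representation of $G_\lambda$ is of this form. There exist $q^{\ell_1+\ell_2-3}(q-1)^2$ such representations, and their dimension is $q^{\ell_2-1}(q-1)$.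
   Context: Let $\mathfrak o$ be a complete discrete valuation ring with finite residue field (the ring of integers of a non-Archimedean local field), $\mathfrak p$ its maximal ideal, $\pi$ a uniformizer, $q=|\mathfrak o/\mathfrak p|$, $\mathfrak o_\ell=\mathfrak o/\mathfrak p^\ell$, $\mathfrak p_\ell^m$ the image of $\mathfrak p^m$ in $\mathfrak o_\ell$ and $\mathfrak p_\ell=\mathfrak p_\ell^1$. Representations are complex and finite-dimensional. For $\lambda=(\ell_1,\ell_2)$ with $\ell_1>\ell_2\geq 1$, $M_\lambda=\mathfrak o_{\ell_1}e_1\oplus\mathfrak o_{\ell_2}e_2$ and $G_\lambda=\mathrm{Aut}_{\mathfrak o}(M_\lambda)$ is realized as the group of matrices $\begin{pmatrix} a & b\delta \\ c & d \end{pmatrix}$ with $a\in\mathfrak o_{\ell_1}^\times$, $b\delta\in\mathfrak p_{\ell_1}^{\ell_1-\ell_2}$ ($\delta=\pi^{\ell_1-\ell_2}$, $b\in\mathfrak o_{\ell_2}$), $c\in\mathfrak o_{\ell_2}$, $d\in\mathfrak o_{\ell_2}^\times$. The group $K_\lambda^{\ell,\epsilon}=I+\begin{bmatrix} \mathfrak p_{\ell_1}^{\ell_1-\ell} & \mathfrak p_{\ell_1}^{\ell_1-\ell} \\ \mathfrak p_{\ell_2}^{\ell_2-\ell+\epsilon} & \mathfrak p_{\ell_2}^{\ell_2-\ell+\epsilon} \end{bmatrix}$ is an abelian normal subgroup of $G_\lambda$, isomorphic to the additive group of matrices $\begin{pmatrix} u & v \\ w & z \end{pmatrix}$, $u,v\in\mathfrak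 o_\ell$, $w,z\in\mathfrak o_{\ell-\epsilon}$, via $I+\begin{pmatrix} \pi^{\ell_1-\ell}u & \pi^{\ell_1-\ell}v \\ \pi^{\ell_2-\ell+\epsilon}w & \pi^{\ell_2-\ell+\epsilon}z \end{pmatrix}\mapsto\begin{pmatrix} u & v \\ w & z \end{pmatrix}$. Fix a primitive additive character $\psi:\mathfrak o_\ell\to\mathbb C^\times$ (nontrivial on $\mathfrak p_\ell^{\ell-1}$). Then $\eta_{\hat u,\hat w}$ is the character corresponding to $\begin{pmatrix} u & v \\ w & z \end{pmatrix}\mapsto\psi(\hat uu+v+\pi^{\epsilon}\hat ww)$. $G_\lambda$ acts on characters by $(g\cdot\theta)(t)=\theta(g^{-1}tg)$. Cuspidality. Geometric induction: $P_+=\{c=0\}$ and $P_-=\{b\delta=0\}$ in $G_\lambda$ surject onto $\mathfrak o_{\ell_1}^\times\times\mathfrak o_{\ell_2}^\times$ by $(a,d)$; geometrically induced representations are those obtained by pulling back a representation of $\mathfrak o_{\ell_1}^\times\times\mathfrak o_{\ell_2}^\times$ to $P_+$ or $P_-$ and inducing to $G_\lambda$. Infinitesimal induction: for $\mu=(\ell_1,m)$, $0<m<\ell_2$, let $P_{\mu\hookrightarrow\lambda}\subset G_\lambda$ be the stabilizer of $\mathfrak o_{\ell_1}e_1\oplus\mathfrak p_{\ell_2}^{\ell_2-m}e_2$, which surjects onto $G_\mu$ by restriction to this submodule of type $\mu$, and let $P_{\lambda\twoheadrightarrow\mu}\subset G_\lambda$ be the stabilizer of $\mathfrak p_{\ell_2}^me_2$,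 which surjects onto $G_\mu$ by the action on $M_\lambda/\mathfrak p_{\ell_2}^me_2$; infinitesimally induced representations are obtained by pulling back a representation of $G_\mu$ to one of these groups and inducing to $G_\lambda$. A twist is a tensor product with a one-dimensional representation. With $\flat\lambda=(\ell_1-1,\ell_2-1)$ and the surjection $G_\lambda\to G_{\flat\lambda}=\mathrm{Aut}_{\mathfrak o}(\pi M_\lambda)$ given by restriction to $\pi M_\lambda$, an irreducible representation of $G_\lambda$ is primitive if none of its twists is a pullback from $G_{\flat\lambda}$. A primitive irreducible representation is cuspidal if none of its twists is contained in a geometrically or infinitesimally induced representation. *)

theory Defs
  imports
    "HOL-Algebra.Algebra"
    "HOL-Algebra.Chinese_Remainder"
    "Jordan_Normal_Form.Matrix"
begin

section \<open>The ring of integers and its finite quotients\<close>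

abbreviation ideal_pow :: "('a, 'b) ring_scheme \<Rightarrow> 'a set \<Rightarrow> nat \<Rightarrow> 'a set" where
  "ideal_pow R P m \<equiv> P [^]\<^bsub>ideals_set R\<^esub> m"

text \<open>
  A complete discrete valuation ring with finite residue field: a principal ideal domain with
  a unique maximal ideal \<open>P\<close>, which is nonzero, such that the canonical map from \<open>R\<close> to the
  inverse limit of the rings \<open>R / P^n\<close> is bijective and \<open>R / P\<close> is finite.
\<close>

locale complete_dvr = principal_domain R for R (structure) and P +
  assumes maximal: "maximalideal P R"
    and maximal_unique: "\<And>I. maximalideal I R \<Longrightarrow> I = P"
    and not_field: "P \<noteq> {\<zero>}"
    and complete: "\<And>f :: nat \<Rightarrow> 'a.
      \<lbrakk>\<And>n. f n \<in> carrier R; \<And>n. f (Suc n) \<ominus> f n \<in> ideal_pow R P n\<rbrakk>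
        \<Longrightarrow> \<exists>!x. x \<in> carrier R \<and> (\<forall>n. x \<ominus> f n \<in> ideal_pow R P n)"
    and finite_residue: "finite (carrier (R Quot P))"

definition quo :: "('a, 'b) ring_scheme \<Rightarrow> 'a set \<Rightarrow> nat \<Rightarrow> 'a set ring" where
  "quo R P n = R Quot (ideal_pow R P n)"

text \<open>The image of \<open>P^m\<close> in the ring \<open>R / P^n\<close>.\<close>

definition quo_ideal :: "('a, 'b) ring_scheme \<Rightarrow> 'a set \<Rightarrow> nat \<Rightarrow> nat \<Rightarrow> 'a set set" where
  "quo_ideal R P n m = (\<lambda>x. ideal_pow R P n +>\<^bsub>R\<^esub> x) ` ideal_pow R P m"

text \<open>The reduction map from \<open>R / P^n\<close> to \<open>R / P^m\<close>, for any \<open>n \<ge> m\<close>: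
  it sends \<open>x + P^n\<close> to \<open>x + P^m\<close>.\<close>

definition red :: "('a, 'b) ring_scheme \<Rightarrow> 'a set \<Rightarrow> nat \<Rightarrow> 'a set \<Rightarrow> 'a set" where
  "red R P m C = ideal_pow R P m <+>\<^bsub>R\<^esub> C"

text \<open>Multiplication by \<open>\<pi>^k\<close> as a map from \<open>R / P^m\<close> to \<open>R / P^(m + k)\<close>, for any \<open>m\<close>. As
  \<open>\<pi>\<close> generates \<open>P\<close>, the elementwise product of the coset \<open>x + P^m\<close> with \<open>\<pi>^k\<close> is the coset
  \<open>\<pi>^k x + P^(m + k)\<close>.\<close>

definition pimul :: "('a, 'b) ring_scheme \<Rightarrow> 'a \<Rightarrow> nat \<Rightarrow> 'a set \<Rightarrow> 'a set" where
  "pimul R \<pi> k C = (\<pi> [^]\<^bsub>R\<^esub> k) <#\<^bsub>R\<^esub> C"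


section \<open>Modules and their automorphism groups\<close>

definition mod_aut :: "('a, 'b) ring_scheme \<Rightarrow> ('a, 'c, 'd) module_scheme \<Rightarrow> ('c \<Rightarrow> 'c) monoid" where
  "mod_aut R M = BijGroup (carrier M)\<lparr>carrier :=
     {f \<in> Bij (carrier M). f \<in> hom (add_monoid M) (add_monoid M) \<and>
        (\<forall>r\<in>carrier R. \<forall>x\<in>carrier M. f (r \<odot>\<^bsub>M\<^esub> x) = r \<odot>\<^bsub>M\<^esub> f x)}\<rparr>"

text \<open>The multiplicative fields of the following two module records carry no meaning.\<close>

definition quot_module :: "('a, 'c) module \<Rightarrow> 'c set \<Rightarrow> ('a, 'c set) module" where
  "quot_module M N = ring.extend (M Quot N)
     \<lparr>smult = (\<lambda>r C. N <+>\<^bsub>M\<^esub> ((\<lambda>x. r \<odot>\<^bsub>M\<^esub> x) ` C))\<rparr>"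

definition Mlam :: "('a, 'b) ring_scheme \<Rightarrow> 'a set \<Rightarrow> nat \<Rightarrow> nat \<Rightarrow> ('a, 'a set \<times> 'a set) module" where
  "Mlam R P l1 l2 = ring.extend (RDirProd (quo R P l1) (quo R P l2))
     \<lparr>smult = (\<lambda>r (x, y). ((ideal_pow R P l1 +>\<^bsub>R\<^esub> r) \<otimes>\<^bsub>quo R P l1\<^esub> x,
                           (ideal_pow R P l2 +>\<^bsub>R\<^esub> r) \<otimes>\<^bsub>quo R P l2\<^esub> y))\<rparr>"

type_synonym 'a lam_aut = "'a set \<times> 'a set \<Rightarrow> 'a set \<times> 'a set"

definition Glam :: "('a, 'b) ring_scheme \<Rightarrow> 'a set \<Rightarrow> nat \<Rightarrow> nat \<Rightarrow> 'a lam_aut monoid" where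
  "Glam R P l1 l2 = mod_aut R (Mlam R P l1 l2)"

text \<open>The entries of the matrix of an automorphism with respect to the generators \<open>e\<^sub>1 = (1, 0)\<close>
  and \<open>e\<^sub>2 = (0, 1)\<close>: the columns are the images of \<open>e\<^sub>1\<close> and \<open>e\<^sub>2\<close>, so that the first row lies in
  \<open>R / P^l1\<close> and the second one in \<open>R / P^l2\<close>.\<close>

definition ent11 :: "('a, 'b) ring_scheme \<Rightarrow> 'a set \<Rightarrow> nat \<Rightarrow> nat \<Rightarrow> 'a lam_aut \<Rightarrow> 'a set" where
  "ent11 R P l1 l2 g = fst (g (\<one>\<^bsub>quo R P l1\<^esub>, \<zero>\<^bsub>quo R P l2\<^esub>))"

definition ent12 :: "('a, 'b) ring_scheme \<Rightarrow> 'a set \<Rightarrow> nat \<Rightarrow> nat \<Rightarrow> 'a lam_aut \<Rightarrow> 'a set" where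
  "ent12 R P l1 l2 g = fst (g (\<zero>\<^bsub>quo R P l1\<^esub>, \<one>\<^bsub>quo R P l2\<^esub>))"

definition ent21 :: "('a, 'b) ring_scheme \<Rightarrow> 'a set \<Rightarrow> nat \<Rightarrow> nat \<Rightarrow> 'a lam_aut \<Rightarrow> 'a set" where
  "ent21 R P l1 l2 g = snd (g (\<one>\<^bsub>quo R P l1\<^esub>, \<zero>\<^bsub>quo R P l2\<^esub>))"

definition ent22 :: "('a, 'b) ring_scheme \<Rightarrow> 'a set \<Rightarrow> nat \<Rightarrow> nat \<Rightarrow> 'a lam_aut \<Rightarrow> 'a set" where
  "ent22 R P l1 l2 g = snd (g (\<zero>\<^bsub>quo R P l1\<^esub>, \<one>\<^bsub>quo R P l2\<^esub>))"


section \<open>Complex representations\<close>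

definition complex_units :: "complex monoid" where
  "complex_units = \<lparr>carrier = - {0}, monoid.mult = (*), one = 1\<rparr>"

definition GL :: "nat \<Rightarrow> complex mat monoid" where
  "GL n = units_of (ring_mat TYPE(complex) n ())"

text \<open>A finite-dimensional representation is given by its dimension and the matrices by which
  the group elements act; the values outside the carrier of the group are irrelevant.\<close>

type_synonym 'g rep = "nat \<times> ('g \<Rightarrow> complex mat)"

definition is_rep :: "('g, 'x) monoid_scheme \<Rightarrow> 'g rep \<Rightarrow> bool" where
  "is_rep G \<rho> \<longleftrightarrow> snd \<rho> \<in> hom G (GL (fst \<rho>))"

definition irreducible_rep :: "('g, 'x) monoid_scheme \<Rightarrow> 'g rep \<Rightarrow> bool" where
  "irreducible_rep G \<rho> \<longleftrightarrow> is_rep G \<rho> \<and> fst \<rho> > 0 \<and>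
     (\<forall>W. W \<subseteq> carrier_vec (fst \<rho>) \<and> 0\<^sub>v (fst \<rho>) \<in> W \<and>
          (\<forall>v\<in>W. \<forall>w\<in>W. v + w \<in> W) \<and> (\<forall>c. \<forall>v\<in>W. c \<cdot>\<^sub>v v \<in> W) \<and>
          (\<forall>g\<in>carrier G. \<forall>v\<in>W. snd \<rho> g *\<^sub>v v \<in> W)
        \<longrightarrow> W = {0\<^sub>v (fst \<rho>)} \<or> W = carrier_vec (fst \<rho>))"

definition rep_iso :: "('g, 'x) monoid_scheme \<Rightarrow> 'g rep \<Rightarrow> 'g rep \<Rightarrow> bool" where
  "rep_iso G \<rho> \<sigma> \<longleftrightarrow> fst \<rho> = fst \<sigma> \<and>
     (\<exists>T\<in>carrier (GL (fst \<rho>)). \<forall>g\<in>carrier G. T * snd \<rho> g = snd \<sigma> g * T)"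

text \<open>\<open>\<rho>\<close> is contained in \<open>\<sigma>\<close>, i.e. isomorphic to a subrepresentation of \<open>\<sigma>\<close>.\<close>

definition rep_contained :: "('g, 'x) monoid_scheme \<Rightarrow> 'g rep \<Rightarrow> 'g rep \<Rightarrow> bool" where
  "rep_contained G \<rho> \<sigma> \<longleftrightarrow> (\<exists>T\<in>carrier_mat (fst \<sigma>) (fst \<rho>).
     inj_on (\<lambda>v. T *\<^sub>v v) (carrier_vec (fst \<rho>)) \<and>
     (\<forall>g\<in>carrier G. T * snd \<rho> g = snd \<sigma> g * T))"

definition char_rep :: "('g \<Rightarrow> complex) \<Rightarrow> 'g rep" where
  "char_rep \<chi> = (1, \<lambda>g. mat 1 1 (\<lambda>_. \<chi> g))"

definition twist :: "('g \<Rightarrow> complex) \<Rightarrow> 'g rep \<Rightarrow> 'g rep" where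
  "twist \<chi> \<rho> = (fst \<rho>, \<lambda>g. \<chi> g \<cdot>\<^sub>m snd \<rho> g)"

definition pullback :: "('g \<Rightarrow> 'h) \<Rightarrow> 'h rep \<Rightarrow> 'g rep" where
  "pullback \<phi> \<sigma> = (fst \<sigma>, snd \<sigma> \<circ> \<phi>)"

text \<open>The list \<open>xs\<close> contains exactly one element of each left coset of \<open>H\<close>.\<close>

definition transversal :: "('g, 'x) monoid_scheme \<Rightarrow> 'g set \<Rightarrow> 'g list \<Rightarrow> bool" where
  "transversal G H xs \<longleftrightarrow> set xs \<subseteq> carrier G \<and>
     (\<forall>g\<in>carrier G. \<exists>!i. i < length xs \<and> g \<in> (xs ! i) <#\<^bsub>G\<^esub> H)"

text \<open>The induced representation in the basis formed by the \<open>x\<^sub>i \<otimes> e\<^sub>j\<close>, where the \<open>x\<^sub>i\<close> run through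
  a transversal: the block at position \<open>(i, j)\<close> of the matrix of \<open>g\<close> is
  \<open>\<sigma> (x\<^sub>i\<inverse> g x\<^sub>j)\<close> if \<open>x\<^sub>i\<inverse> g x\<^sub>j \<in> H\<close> and zero otherwise. Up to isomorphism it does not depend on
  the transversal.\<close>

definition ind_rep :: "('g, 'x) monoid_scheme \<Rightarrow> 'g set \<Rightarrow> 'g rep \<Rightarrow> 'g rep" where
  "ind_rep G H \<sigma> =
     (let xs = (SOME xs. transversal G H xs); m = fst \<sigma>; n = length xs * m in
      (n, \<lambda>g. mat n n (\<lambda>(i, j).
         let h = inv\<^bsub>G\<^esub> (xs ! (i div m)) \<otimes>\<^bsub>G\<^esub> g \<otimes>\<^bsub>G\<^esub> (xs ! (j div m)) in
         if h \<in> H then snd \<sigma> h $$ (i mod m, j mod m) else 0)))"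


section \<open>Cuspidal representations\<close>

definition geom_induced :: "('a, 'b) ring_scheme \<Rightarrow> 'a set \<Rightarrow> nat \<Rightarrow> nat \<Rightarrow> 'a lam_aut rep \<Rightarrow> bool" where
  "geom_induced R P l1 l2 \<tau> \<longleftrightarrow>
     (\<exists>\<sigma>. is_rep (units_of (quo R P l1) \<times>\<times> units_of (quo R P l2)) \<sigma> \<and>
        (\<exists>Q \<in> {{g \<in> carrier (Glam R P l1 l2). ent21 R P l1 l2 g = \<zero>\<^bsub>quo R P l2\<^esub>},
               {g \<in> carrier (Glam R P l1 l2). ent12 R P l1 l2 g = \<zero>\<^bsub>quo R P l1\<^esub>}}.
           \<tau> = ind_rep (Glam R P l1 l2) Q
                 (pullback (\<lambda>g. (ent11 R P l1 l2 g, ent22 R P l1 l2 g)) \<sigma>)))"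

text \<open>For \<open>\<mu> = (l1, m)\<close>, the group \<open>G\<^sub>\<mu>\<close> is taken to be the automorphism group of the
  submodule or quotient module of type \<open>\<mu>\<close> on which the parabolic subgroup acts.\<close>

definition sub_mu :: "('a, 'b) ring_scheme \<Rightarrow> 'a set \<Rightarrow> nat \<Rightarrow> nat \<Rightarrow> nat \<Rightarrow> ('a set \<times> 'a set) set" where
  "sub_mu R P l1 l2 m = carrier (quo R P l1) \<times> quo_ideal R P l2 (l2 - m)"

definition ker_mu :: "('a, 'b) ring_scheme \<Rightarrow> 'a set \<Rightarrow> nat \<Rightarrow> nat \<Rightarrow> nat \<Rightarrow> ('a set \<times> 'a set) set" where
  "ker_mu R P l1 l2 m = {\<zero>\<^bsub>quo R P l1\<^esub>} \<times> quo_ideal R P l2 m"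

definition inf_induced :: "('a, 'b) ring_scheme \<Rightarrow> 'a set \<Rightarrow> nat \<Rightarrow> nat \<Rightarrow> 'a lam_aut rep \<Rightarrow> bool" where
  "inf_induced R P l1 l2 \<tau> \<longleftrightarrow> (\<exists>m. 0 < m \<and> m < l2 \<and>
     ((\<exists>\<sigma>. let N = sub_mu R P l1 l2 m in
         is_rep (mod_aut R ((Mlam R P l1 l2)\<lparr>carrier := N\<rparr>)) \<sigma> \<and>
         \<tau> = ind_rep (Glam R P l1 l2) (stabilizer (Glam R P l1 l2) image N)
               (pullback (\<lambda>g. restrict g N) \<sigma>)) \<or>
      (\<exists>\<sigma>. let N = ker_mu R P l1 l2 m; Q = quot_module (Mlam R P l1 l2) N in
         is_rep (mod_aut R Q) \<sigma> \<and>
         \<tau> = ind_rep (Glam R P l1 l2) (stabilizer (Glam R P l1 l2) image N)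
               (pullback (\<lambda>g. \<lambda>C\<in>carrier Q. g ` C) \<sigma>))))"

definition primitive_rep :: "('a, 'b) ring_scheme \<Rightarrow> 'a set \<Rightarrow> 'a \<Rightarrow> nat \<Rightarrow> nat \<Rightarrow> 'a lam_aut rep \<Rightarrow> bool" where
  "primitive_rep R P \<pi> l1 l2 \<rho> \<longleftrightarrow> irreducible_rep (Glam R P l1 l2) \<rho> \<and>
     (let M = Mlam R P l1 l2; N = (\<lambda>x. \<pi> \<odot>\<^bsub>M\<^esub> x) ` carrier M in
      \<forall>\<chi> \<in> hom (Glam R P l1 l2) complex_units.
        \<not> (\<exists>\<sigma>. is_rep (mod_aut R (M\<lparr>carrier := N\<rparr>)) \<sigma> \<and>
              rep_iso (Glam R P l1 l2) (twist \<chi> \<rho>) (pullback (\<lambda>g. restrict g N) \<sigma>)))"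

definition cuspidal_rep :: "('a, 'b) ring_scheme \<Rightarrow> 'a set \<Rightarrow> 'a \<Rightarrow> nat \<Rightarrow> nat \<Rightarrow> 'a lam_aut rep \<Rightarrow> bool" where
  "cuspidal_rep R P \<pi> l1 l2 \<rho> \<longleftrightarrow> primitive_rep R P \<pi> l1 l2 \<rho> \<and>
     (\<forall>\<chi> \<in> hom (Glam R P l1 l2) complex_units. \<forall>\<tau>.
        geom_induced R P l1 l2 \<tau> \<or> inf_induced R P l1 l2 \<tau>
          \<longrightarrow> \<not> rep_contained (Glam R P l1 l2) (twist \<chi> \<rho>) \<tau>)"


section \<open>The subgroup \<open>K\<close>, its characters and their stabilizers\<close>

definition K_coords :: "('a, 'b) ring_scheme \<Rightarrow> 'a set \<Rightarrow> 'a \<Rightarrow> nat \<Rightarrow> nat \<Rightarrow> nat \<Rightarrow> nat \<Rightarrow>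
    'a lam_aut \<Rightarrow> 'a set \<Rightarrow> 'a set \<Rightarrow> 'a set \<Rightarrow> 'a set \<Rightarrow> bool" where
  "K_coords R P \<pi> l1 l2 l \<epsilon> g u v w z \<longleftrightarrow>
     u \<in> carrier (quo R P l) \<and> v \<in> carrier (quo R P l) \<and>
     w \<in> carrier (quo R P (l - \<epsilon>)) \<and> z \<in> carrier (quo R P (l - \<epsilon>)) \<and>
     ent11 R P l1 l2 g = \<one>\<^bsub>quo R P l1\<^esub> \<oplus>\<^bsub>quo R P l1\<^esub> pimul R \<pi> (l1 - l) u \<and>
     ent12 R P l1 l2 g = pimul R \<pi> (l1 - l) v \<and>
     ent21 R P l1 l2 g = pimul R \<pi> (l2 - l + \<epsilon>) w \<and>
     ent22 R P l1 l2 g = \<one>\<^bsub>quo R P l2\<^esub> \<oplus>\<^bsub>quo R P l2\<^esub> pimul R \<pi> (l2 - l + \<epsilon>) z"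

definition K_group :: "('a, 'b) ring_scheme \<Rightarrow> 'a set \<Rightarrow> 'a \<Rightarrow> nat \<Rightarrow> nat \<Rightarrow> nat \<Rightarrow> nat \<Rightarrow> 'a lam_aut set" where
  "K_group R P \<pi> l1 l2 l \<epsilon> =
     {g \<in> carrier (Glam R P l1 l2). \<exists>u v w z. K_coords R P \<pi> l1 l2 l \<epsilon> g u v w z}"

text \<open>A primitive additive character of \<open>R / P^l\<close>.\<close>

definition primitive_char :: "('a, 'b) ring_scheme \<Rightarrow> 'a set \<Rightarrow> nat \<Rightarrow> ('a set \<Rightarrow> complex) \<Rightarrow> bool" where
  "primitive_char R P l \<psi> \<longleftrightarrow> \<psi> \<in> hom (add_monoid (quo R P l)) complex_units \<and>
     (\<exists>x \<in> quo_ideal R P l (l - 1). \<psi> x \<noteq> 1)"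

text \<open>The character \<open>\<eta>\<close> as a function on \<open>K\<close>, sending the element with coordinates \<open>u, v, w, z\<close> to
  \<open>\<psi> (uh u + v + \<pi>^\<epsilon> wh w)\<close>.\<close>

definition eta :: "('a, 'b) ring_scheme \<Rightarrow> 'a set \<Rightarrow> 'a \<Rightarrow> nat \<Rightarrow> nat \<Rightarrow> nat \<Rightarrow> nat \<Rightarrow>
    ('a set \<Rightarrow> complex) \<Rightarrow> 'a set \<Rightarrow> 'a set \<Rightarrow> 'a lam_aut \<Rightarrow> complex" where
  "eta R P \<pi> l1 l2 l \<epsilon> \<psi> uh wh = (\<lambda>g\<in>K_group R P \<pi> l1 l2 l \<epsilon>.
     THE y. \<exists>u v w z. K_coords R P \<pi> l1 l2 l \<epsilon> g u v w z \<and>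
       y = \<psi> (uh \<otimes>\<^bsub>quo R P l\<^esub> u \<oplus>\<^bsub>quo R P l\<^esub> v \<oplus>\<^bsub>quo R P l\<^esub>
              pimul R \<pi> \<epsilon> (wh \<otimes>\<^bsub>quo R P (l - \<epsilon>)\<^esub> w)))"

definition char_conj :: "('g, 'x) monoid_scheme \<Rightarrow> 'g set \<Rightarrow> 'g \<Rightarrow> ('g \<Rightarrow> complex) \<Rightarrow> 'g \<Rightarrow> complex" where
  "char_conj G K g \<theta> = (\<lambda>t\<in>K. \<theta> (inv\<^bsub>G\<^esub> g \<otimes>\<^bsub>G\<^esub> t \<otimes>\<^bsub>G\<^esub> g))"

definition N_stab :: "('a, 'b) ring_scheme \<Rightarrow> 'a set \<Rightarrow> 'a \<Rightarrow> nat \<Rightarrow> nat \<Rightarrow> nat \<Rightarrow> nat \<Rightarrow>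
    ('a set \<Rightarrow> complex) \<Rightarrow> 'a set \<Rightarrow> 'a set \<Rightarrow> 'a lam_aut set" where
  "N_stab R P \<pi> l1 l2 l \<epsilon> \<psi> uh wh =
     stabilizer (Glam R P l1 l2) (char_conj (Glam R P l1 l2) (K_group R P \<pi> l1 l2 l \<epsilon>))
       (eta R P \<pi> l1 l2 l \<epsilon> \<psi> uh wh)"

text \<open>One-dimensional characters of the stabilizer extending \<open>\<eta>\<close>. They are extensional, so that
  distinct ones are distinct as functions on the stabilizer.\<close>

definition eta_ext :: "('a, 'b) ring_scheme \<Rightarrow> 'a set \<Rightarrow> 'a \<Rightarrow> nat \<Rightarrow> nat \<Rightarrow> nat \<Rightarrow> nat \<Rightarrow>
    ('a set \<Rightarrow> complex) \<Rightarrow> 'a set \<Rightarrow> 'a set \<Rightarrow> ('a lam_aut \<Rightarrow> complex) set" where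
  "eta_ext R P \<pi> l1 l2 l \<epsilon> \<psi> uh wh =
     {\<theta> \<in> extensional (N_stab R P \<pi> l1 l2 l \<epsilon> \<psi> uh wh).
        \<theta> \<in> hom ((Glam R P l1 l2)\<lparr>carrier := N_stab R P \<pi> l1 l2 l \<epsilon> \<psi> uh wh\<rparr>) complex_units \<and>
        (\<forall>t \<in> K_group R P \<pi> l1 l2 l \<epsilon>. \<theta> t = eta R P \<pi> l1 l2 l \<epsilon> \<psi> uh wh t)}"

definition rho_ext :: "('a, 'b) ring_scheme \<Rightarrow> 'a set \<Rightarrow> 'a \<Rightarrow> nat \<Rightarrow> nat \<Rightarrow> nat \<Rightarrow> nat \<Rightarrow>
    ('a set \<Rightarrow> complex) \<Rightarrow> 'a set \<Rightarrow> 'a set \<Rightarrow> ('a lam_aut \<Rightarrow> complex) \<Rightarrow> 'a lam_aut rep" where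
  "rho_ext R P \<pi> l1 l2 l \<epsilon> \<psi> uh wh \<theta> =
     ind_rep (Glam R P l1 l2) (N_stab R P \<pi> l1 l2 l \<epsilon> \<psi> uh wh) (char_rep \<theta>)"

end

theory Submission
  imports Defs
begin

text \<open>Let \<open>K\<close> be the abelian normal subgroup and \<open>\<eta>\<close> one of the given characters. Conjugating in
  coordinates shows that the stabilizer \<open>N\<close> of \<open>\<eta>\<close> is the product of \<open>K\<close> and of a set of commuting
  matrices; hence \<open>\<eta>\<close> is trivial on the commutators of \<open>N\<close>, and it extends to \<open>N\<close> in \<open>[N : K]\<close> ways.
  The restriction to \<open>K\<close> of the representation induced from an extension is a sum of the distinct
  conjugates of \<open>\<eta>\<close>, which gives irreducibility, and inequivalence for distinct extensions, since
  the conjugates of the different \<open>\<eta>\<close> are disjoint.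

  By Frobenius reciprocity, a representation is contained in a geometrically or infinitesimally
  induced one if it has a vector fixed by a suitable unipotent group, and containment conversely
  provides a vector fixed by the upper or lower unitriangular matrices of the last layer
  \<open>c, b \<in> P ^ (l2 - 1)\<close>. The conjugates of \<open>\<eta>\<close> are nontrivial on these, so the induced representations
  are cuspidal. In a cuspidal representation, take an eigenvector of \<open>K\<close>. Twisting by a character of
  the determinant makes its character trivial on the lower right entry in the last layer. If it were
  nontrivial on the upper left entry there, conjugation would produce a vector fixed by all upper
  unitriangular matrices; if it were trivial there and on one of the off-diagonal entries, the twist would be
  infinitesimally induced. Otherwise conjugation turns it into some \<open>\<eta>\<close>, and the eigenvector can be
  chosen to be one for all of \<open>N\<close>.\<close>

section \<open>Extending characters of finite groups\<close>

text \<open>Put m = l - \<epsilon> and s = l1 - l2. After removal of \<delta> the upper right entry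
  of an element of K has depth m, while its lower row has depth l. For odd l2 one has 2 m < l2, yet
  K is abelian: every cross term is killed by m + l = l2 or by 2 m + s \<ge> l2, and the second
  bound rests on l1 > l2. This is why one-dimensional extensions suffice for both parities. Under
  the trace pairing a character of K is a matrix with rows (\<alpha>, \<beta> \<delta>) and
  (\<gamma>, \<kappa> \<delta>), and the group acts by conjugating it. The \<eta> are the
  companion-like ones, with second row (1, 0). An element that keeps this row fixes the whole
  matrix, so stabilizers are centralizers and different \<eta> are never conjugate. Representation
  theory enters only through averages over finite subgroups and the count of extensions. The four
  matrix entries live in different quotients. They are therefore lifted to one type class ring, and
  a congruence becomes membership in \<open>J n\<close>. The lift has a kernel, so identities hold
  modulo every \<open>J n\<close> rather than exactly.\<close>

locale finite_grp = group +
  assumes finite_carrier: "finite (carrier G)"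

text \<open>Values outside \<open>H\<close> are left free, so that one function can be a character
  of several nested subgroups. The value 1 at the identity follows from multiplicativity and
  nonvanishing.\<close>

definition is_char :: "('g, 'x) monoid_scheme \<Rightarrow> 'g set \<Rightarrow> ('g \<Rightarrow> complex) \<Rightarrow> bool" where
  "is_char G H \<chi> \<longleftrightarrow> (\<forall>x\<in>H. \<chi> x \<noteq> 0) \<and> (\<forall>x\<in>H. \<forall>y\<in>H. \<chi> (x \<otimes>\<^bsub>G\<^esub> y) = \<chi> x * \<chi> y)"

definition char_exts ::
    "('g, 'x) monoid_scheme \<Rightarrow> 'g set \<Rightarrow> 'g set \<Rightarrow> ('g \<Rightarrow> complex) \<Rightarrow> ('g \<Rightarrow> complex) set" where
  "char_exts G H K \<chi> = {\<theta> \<in> extensional H. is_char G H \<theta> \<and> (\<forall>k\<in>K. \<theta> k = \<chi> k)}"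

text \<open>For subgroups \<open>K\<close> of \<open>H\<close> this says that \<open>H\<close>
  modulo \<open>K\<close> is abelian and that \<chi> kills the commutators of \<open>H\<close>.
  Normality of \<open>K\<close> in \<open>H\<close> and invariance of \<chi> under \<open>H\<close>
  are consequences, so no quotient group has to be formed.\<close>

definition comm_in_ker :: "('g, 'x) monoid_scheme \<Rightarrow> 'g set \<Rightarrow> 'g set \<Rightarrow> ('g \<Rightarrow> complex) \<Rightarrow> bool" where
  "comm_in_ker G H K \<chi> \<longleftrightarrow>
     (\<forall>x\<in>H. \<forall>y\<in>H. \<exists>k\<in>K. \<chi> k = 1 \<and> x \<otimes>\<^bsub>G\<^esub> y = k \<otimes>\<^bsub>G\<^esub> (y \<otimes>\<^bsub>G\<^esub> x))"

lemma (in finite_grp) finite_sub: "subgroup H G \<Longrightarrow> finite H"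
  using finite_carrier finite_subset subgroup.subset by blast

lemma (in finite_grp) subgroup_finiteI:
  assumes "H \<subseteq> carrier G" "x \<in> H" "\<And>a b. a \<in> H \<Longrightarrow> b \<in> H \<Longrightarrow> a \<otimes> b \<in> H"
  shows "subgroup H G"
proof -
  have pow: "a [^] Suc n \<in> H" if "a \<in> H" for a and n :: nat
    using that assms by (induct n) auto
  have inv: "inv a \<in> H" if a: "a \<in> H" for a
  proof -
    have ac: "a \<in> carrier G" using a assms by auto
    have o: "order G > 0" using order_gt_0_iff_finite finite_carrier by blast
    \<comment> \<open>The factor 2 keeps the exponent positive when the group has order 1, since
      \<open>pow\<close> only covers exponents of the form \<open>Suc n\<close>.\<close>
    have "a [^] (2 * order G - 1) \<otimes> a = a [^] (2 * order G)"
      using o ac nat_pow_Suc[of a "2 * order G - 1"] by simp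
    also have "\<dots> = \<one>"
      by (metis ac mult.commute nat_pow_one nat_pow_pow pow_order_eq_1)
    finally have "inv a = a [^] (2 * order G - 1)"
      using ac inv_equality by auto
    moreover have "2 * order G - 1 = Suc (2 * order G - 2)" using o by simp
    ultimately show ?thesis using pow[OF a] by metis
  qed
  show ?thesis
    using assms inv by (intro subgroupI) auto
qed

lemma (in group) is_char_one: "subgroup H G \<Longrightarrow> is_char G H \<chi> \<Longrightarrow> \<chi> \<one> = 1"
  unfolding is_char_def by (metis l_one mult_cancel_left1 one_closed subgroup.one_closed)

lemma (in group) is_char_pow:
  "subgroup H G \<Longrightarrow> is_char G H \<chi> \<Longrightarrow> x \<in> H \<Longrightarrow> x [^] (n::nat) \<in> H \<and> \<chi> (x [^] n) = \<chi> x ^ n"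
proof (induct n)
  case 0
  then show ?case using is_char_one subgroup.one_closed by auto
next
  case (Suc n)
  then show ?case unfolding is_char_def by (simp add: subgroup.m_closed)
qed

lemma (in group) is_char_inv:
  assumes "subgroup H G" "is_char G H \<chi>" "x \<in> H" shows "\<chi> (inv x) = inverse (\<chi> x)"
proof -
  have "\<chi> (inv x) * \<chi> x = \<chi> (inv x \<otimes> x)" "inv x \<in> H"
    using assms unfolding is_char_def by (auto simp: subgroup.m_inv_closed)
  moreover have "inv x \<otimes> x = \<one>" using assms by (simp add: subgroup.mem_carrier)
  ultimately have "\<chi> (inv x) * \<chi> x = 1" using is_char_one[OF assms(1,2)] by simp
  then show ?thesis by (metis inverse_unique mult.commute)
qed

text \<open>Adjoining one element \<open>a\<close> to \<open>K\<close>: if \<open>m\<close> is the order of \<open>a\<close> modulo \<open>K\<close>, the extensions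
  correspond to the \<open>m\<close>-th roots of \<open>\<chi> (a ^ m)\<close>.\<close>

lemma (in finite_grp) adjoin_element:
  assumes H: "subgroup H G" and K: "subgroup K G" "K \<subseteq> H" and chi: "is_char G K \<chi>"
    and comm: "comm_in_ker G H K \<chi>" and a: "a \<in> H" "a \<notin> K"
  obtains m K' \<chi>' where "m > 0" "subgroup K' G" "K \<subset> K'" "K' \<subseteq> H" "a \<in> K'"
    "card K' = m * card K" "a [^] m \<in> K"
    "\<And>\<zeta>. \<zeta> ^ m = \<chi> (a [^] m) \<Longrightarrow> is_char G K' (\<chi>' \<zeta>) \<and> (\<forall>k\<in>K. \<chi>' \<zeta> k = \<chi> k) \<and> \<chi>' \<zeta> a = \<zeta>"
    "\<And>\<theta>. is_char G H \<theta> \<Longrightarrow> \<forall>k\<in>K. \<theta> k = \<chi> k \<Longrightarrow>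
        \<theta> a ^ m = \<chi> (a [^] m) \<and> (\<forall>x\<in>K'. \<theta> x = \<chi>' (\<theta> a) x)"
proof -
  have Hc: "x \<in> carrier G" if "x \<in> H" for x using H that by (simp add: subgroup.mem_carrier)
  have Kc: "x \<in> carrier G" if "x \<in> K" for x using K that by (simp add: subgroup.mem_carrier)
  have ac: "a \<in> carrier G" using a Hc by auto
  define m where "m = (LEAST m::nat. 0 < m \<and> a [^] m \<in> K)"
  have "0 < order G \<and> a [^] order G \<in> K"
    using order_gt_0_iff_finite finite_carrier pow_order_eq_1[OF ac] K(1) subgroup.one_closed by auto
  then have m: "0 < m" "a [^] m \<in> K" and mleast: "\<And>j. 0 < j \<Longrightarrow> a [^] (j::nat) \<in> K \<Longrightarrow> m \<le> j"
    unfolding m_def using LeastI[of "\<lambda>m. 0 < m \<and> a [^] m \<in> K"] Least_le[of "\<lambda>m. 0 < m \<and> a [^] m \<in> K"] by blast+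
  have amq: "a [^] (m * k) \<in> K" for k
    using is_char_pow[OF K(1) chi m(2), of k] nat_pow_pow[OF ac, of m k] by simp
  have split: "a [^] i = a [^] (m * (i div m)) \<otimes> a [^] (i mod m)" for i
    using nat_pow_mult[OF ac, of "m * (i div m)" "i mod m"] by simp
  have dvd: "m dvd i" if "a [^] i \<in> K" for i :: nat
  proof -
    have "a [^] (i mod m) = inv (a [^] (m * (i div m))) \<otimes> a [^] i"
      using arg_cong[OF split[of i], of "\<lambda>x. inv (a [^] (m * (i div m))) \<otimes> x"] ac by (simp flip: m_assoc)
    also have "\<dots> \<in> K" using that amq K(1) by (simp add: subgroup.m_closed subgroup.m_inv_closed)
    finally have "\<not> 0 < i mod m" using mleast[of "i mod m"] m(1) by (meson mod_less_divisor not_le)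
    then show ?thesis by (simp add: mod_greater_zero_iff_not_dvd)
  qed
  define K' where "K' = {k \<otimes> a [^] i | k i. k \<in> K \<and> i \<in> (UNIV :: nat set)}"
  have K'I: "k \<otimes> a [^] (i::nat) \<in> K'" if "k \<in> K" for k i using that K'_def by blast
  have powH: "a [^] (i::nat) \<in> H" for i using a H by (induct i) (auto simp: subgroup.one_closed subgroup.m_closed)
  have swap: "\<exists>c\<in>K. \<chi> c = 1 \<and> a [^] i \<otimes> k = c \<otimes> (k \<otimes> a [^] i)" if "k \<in> K" for k and i :: nat
    using comm powH that K(2) unfolding comm_in_ker_def by blast
  \<comment> \<open>Moving a power of \<open>a\<close> past \<open>k'\<close> costs a factor
    \<open>c\<close> with \<chi>-value 1. This keeps the extended character multiplicative although
    \<open>a\<close> need not commute with \<open>K\<close>.\<close>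
  have prod: "\<exists>c\<in>K. \<chi> c = 1 \<and> (k \<otimes> a [^] i) \<otimes> (k' \<otimes> a [^] j) = (k \<otimes> c \<otimes> k') \<otimes> a [^] (i + j)"
    if k: "k \<in> K" "k' \<in> K" for k k' and i j :: nat
  proof -
    obtain c where c: "c \<in> K" "\<chi> c = 1" "a [^] i \<otimes> k' = c \<otimes> (k' \<otimes> a [^] i)" using swap[OF k(2)] by blast
    have "(k \<otimes> a [^] i) \<otimes> (k' \<otimes> a [^] j) = k \<otimes> (a [^] i \<otimes> k') \<otimes> a [^] j"
      using k ac Kc by (simp add: m_assoc)
    also have "\<dots> = (k \<otimes> c \<otimes> k') \<otimes> (a [^] i \<otimes> a [^] j)"
      using k c ac Kc by (simp add: m_assoc)
    finally show ?thesis using c by (auto simp: nat_pow_mult ac)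
  qed
  have "K' \<subseteq> carrier G" using K'_def Kc ac by auto
  moreover have aK': "a \<in> K'" using K'I[of \<one> 1] K(1) ac by (simp add: subgroup.one_closed)
  moreover have "x \<otimes> y \<in> K'" if xy: "x \<in> K'" "y \<in> K'" for x y
  proof -
    obtain k i k' j where "k \<in> K" "k' \<in> K" "x = k \<otimes> a [^] (i::nat)" "y = k' \<otimes> a [^] (j::nat)"
      using xy K'_def by blast
    then show ?thesis using prod[of k k' i j] K'I K(1) by (metis subgroup.m_closed)
  qed
  ultimately have K'sub: "subgroup K' G" using subgroup_finiteI by blast
  have KK': "k \<in> K'" if "k \<in> K" for k using K'I[OF that, of 0] Kc[OF that] by simp
  have K'H: "K' \<subseteq> H" using K'_def K(2) powH H by (auto simp: subgroup.m_closed)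
  \<comment> \<open>Two expressions of one element differ by a power of \<open>a\<close> that lies
    in \<open>K\<close>. Both the count of \<open>K'\<close> and the consistency of the extended
    character rest on this.\<close>
  have wd: "k = k' \<otimes> a [^] (j - i) \<and> a [^] (j - i) \<in> K"
    if "k \<in> K" "k' \<in> K" "i \<le> j" "k \<otimes> a [^] i = k' \<otimes> a [^] j" for k k' and i j :: nat
  proof -
    have "k \<otimes> a [^] i = (k' \<otimes> a [^] (j - i)) \<otimes> a [^] i"
      using that Kc ac by (simp add: m_assoc nat_pow_mult)
    then have 1: "k = k' \<otimes> a [^] (j - i)" using that Kc ac by simp
    have "a [^] (j - i) = inv k' \<otimes> (k' \<otimes> a [^] (j - i))" using that Kc ac by (simp flip: m_assoc)
    then have "a [^] (j - i) = inv k' \<otimes> k" using 1 by simp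
    moreover have "inv k' \<otimes> k \<in> K" using that K(1) by (simp add: subgroup.m_closed subgroup.m_inv_closed)
    ultimately show ?thesis using 1 by simp
  qed
  have card: "card K' = m * card K"
  proof -
    have "inj_on (\<lambda>(k, i). k \<otimes> a [^] i) (K \<times> {..<m})"
    proof -
      have *: "k = k' \<and> i = j" if "k \<in> K" "k' \<in> K" "i \<le> j" "j < m" "k \<otimes> a [^] i = k' \<otimes> a [^] j" for k k' and i j
      proof -
        have w: "k = k' \<otimes> a [^] (j - i)" "a [^] (j - i) \<in> K" using wd[OF that(1-3,5)] by auto
        then have "j - i = 0" using mleast[of "j - i"] that by linarith
        then show ?thesis using w that Kc by simp
      qed
      show ?thesis
      proof (rule inj_onI, clarify)
        fix k i k' j assume "k \<in> K" "k' \<in> K" "i < m" "j < m" "k \<otimes> a [^] i = k' \<otimes> a [^] j"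
        then show "k = k' \<and> i = j" using *[of k k' i j] *[of k' k j i] by (cases "i \<le> j") auto
      qed
    qed
    moreover have "(\<lambda>(k, i). k \<otimes> a [^] i) ` (K \<times> {..<m}) = K'"
    proof
      show "(\<lambda>(k, i). k \<otimes> a [^] i) ` (K \<times> {..<m}) \<subseteq> K'" using K'I by auto
      show "K' \<subseteq> (\<lambda>(k, i). k \<otimes> a [^] i) ` (K \<times> {..<m})"
      proof
        fix x assume "x \<in> K'"
        then obtain k and i :: nat where x: "k \<in> K" "x = k \<otimes> a [^] i" using K'_def by blast
        then have "x = (k \<otimes> a [^] (m * (i div m))) \<otimes> a [^] (i mod m)"
          using Kc ac by (simp add: m_assoc flip: split[of i])
        moreover have "k \<otimes> a [^] (m * (i div m)) \<in> K" using x amq K(1) by (simp add: subgroup.m_closed)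
        ultimately show "x \<in> (\<lambda>(k, i). k \<otimes> a [^] i) ` (K \<times> {..<m})"
          using m(1) by (intro image_eqI[of _ _ "(k \<otimes> a [^] (m * (i div m)), i mod m)"]) auto
      qed
    qed
    ultimately have "card K' = card (K \<times> {..<m})" using card_image by metis
    then show ?thesis by (simp add: card_cartesian_product)
  qed
  \<comment> \<open>The value is read off an arbitrary expression
    \<open>k \<otimes> a [^] i\<close>. It is independent of the choice because a power of
    \<open>a\<close> lies in \<open>K\<close> only if m divides its exponent, and
    \<open>\<zeta> ^ m\<close> is prescribed.\<close>
  define \<chi>' where "\<chi>' = (\<lambda>\<zeta>::complex. \<lambda>x. THE z. \<exists>k\<in>K. \<exists>i::nat. x = k \<otimes> a [^] i \<and> z = \<chi> k * \<zeta> ^ i)"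
  have chi_prod: "\<chi> (x \<otimes> y) = \<chi> x * \<chi> y" if "x \<in> K" "y \<in> K" for x y
    using chi that unfolding is_char_def by blast
  have chi': "\<chi>' \<zeta> (k \<otimes> a [^] i) = \<chi> k * \<zeta> ^ i" if z: "\<zeta> ^ m = \<chi> (a [^] m)" and k: "k \<in> K" for \<zeta> k and i :: nat
  proof -
    have *: "\<chi> k * \<zeta> ^ i = \<chi> k' * \<zeta> ^ j"
      if kk: "k \<in> K" "k' \<in> K" "i \<le> j" "k \<otimes> a [^] i = k' \<otimes> a [^] j" for k k' and i j :: nat
    proof -
      have w: "k = k' \<otimes> a [^] (j - i)" "a [^] (j - i) \<in> K" using wd[OF kk] by auto
      obtain r where r: "j - i = m * r" using dvd[OF w(2)] by (auto simp: dvd_def)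
      have "\<chi> (a [^] (j - i)) = \<zeta> ^ (j - i)"
        using is_char_pow[OF K(1) chi m(2), of r] ac by (simp add: r nat_pow_pow power_mult z)
      then have "\<chi> k = \<chi> k' * \<zeta> ^ (j - i)" using chi_prod[OF kk(2) w(2)] w(1) by simp
      then show ?thesis using kk(3) by (simp add: mult.assoc flip: power_add)
    qed
    show ?thesis unfolding \<chi>'_def
    proof (rule the_equality)
      show "\<exists>k'\<in>K. \<exists>j. k \<otimes> a [^] i = k' \<otimes> a [^] j \<and> \<chi> k * \<zeta> ^ i = \<chi> k' * \<zeta> ^ j" using k by blast
      fix z assume "\<exists>k'\<in>K. \<exists>j::nat. k \<otimes> a [^] i = k' \<otimes> a [^] j \<and> z = \<chi> k' * \<zeta> ^ j"
      then show "z = \<chi> k * \<zeta> ^ i" using *[OF k] *[OF _ k] by (metis nat_le_linear)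
    qed
  qed
  show thesis
  proof (rule that[of m K' \<chi>'])
    show "m > 0" "subgroup K' G" "K' \<subseteq> H" "a \<in> K'" "card K' = m * card K" "a [^] m \<in> K"
      using m K'sub K'H aK' card by auto
    show "K \<subset> K'" using KK' aK' a by blast
  next
    fix \<zeta> assume z: "\<zeta> ^ m = \<chi> (a [^] m)"
    have z0: "\<zeta> \<noteq> 0" using z m chi unfolding is_char_def by (auto simp: power_0_left)
    have "\<chi>' \<zeta> x \<noteq> 0" if "x \<in> K'" for x
      using that chi' z z0 chi unfolding K'_def is_char_def by auto
    moreover have "\<chi>' \<zeta> (x \<otimes> y) = \<chi>' \<zeta> x * \<chi>' \<zeta> y" if xy: "x \<in> K'" "y \<in> K'" for x y
    proof -
      obtain k i k' j where kk: "k \<in> K" "k' \<in> K" "x = k \<otimes> a [^] (i::nat)" "y = k' \<otimes> a [^] (j::nat)"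
        using xy K'_def by blast
      obtain c where c: "c \<in> K" "\<chi> c = 1" "x \<otimes> y = (k \<otimes> c \<otimes> k') \<otimes> a [^] (i + j)"
        using prod kk by metis
      have "k \<otimes> c \<in> K" "k \<otimes> c \<otimes> k' \<in> K" using kk c K(1) by (auto simp: subgroup.m_closed)
      then show ?thesis using c kk chi'[OF z] chi_prod by (simp add: power_add)
    qed
    moreover have "\<chi>' \<zeta> k = \<chi> k" if "k \<in> K" for k
      using chi'[OF z that, of 0] that Kc by simp
    moreover have "\<chi>' \<zeta> a = \<zeta>"
      using chi'[OF z, of \<one> 1] K(1) ac is_char_one[OF K(1) chi] by (simp add: subgroup.one_closed)
    ultimately show "is_char G K' (\<chi>' \<zeta>) \<and> (\<forall>k\<in>K. \<chi>' \<zeta> k = \<chi> k) \<and> \<chi>' \<zeta> a = \<zeta>"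
      unfolding is_char_def by blast
  next
    fix \<theta> assume th: "is_char G H \<theta>" "\<forall>k\<in>K. \<theta> k = \<chi> k"
    have 1: "\<theta> a ^ m = \<chi> (a [^] m)" using is_char_pow[OF H th(1) a(1), of m] th(2) m by simp
    have "\<theta> x = \<chi>' (\<theta> a) x" if xK: "x \<in> K'" for x
    proof -
      obtain k and i :: nat where x: "k \<in> K" "x = k \<otimes> a [^] i" using xK K'_def by blast
      have "\<theta> x = \<theta> k * \<theta> (a [^] i)" using x th(1) K(2) powH unfolding is_char_def by blast
      then show ?thesis using chi'[OF 1 x(1)] x th(2) is_char_pow[OF H th(1) a(1), of i] by simp
    qed
    with 1 show "\<theta> a ^ m = \<chi> (a [^] m) \<and> (\<forall>x\<in>K'. \<theta> x = \<chi>' (\<theta> a) x)" by blast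
  qed
qed

text \<open>Induction on the gap between \<open>K\<close> and \<open>H\<close>: adjoining an element
  of order m modulo \<open>K\<close> offers m values, the m-th roots of a nonzero number. The
  product form of the count also yields existence, since \<open>card H\<close> is positive.\<close>

theorem (in finite_grp) card_char_exts:
  assumes H: "subgroup H G" and "subgroup K G" "K \<subseteq> H" "is_char G K \<chi>" "comm_in_ker G H K \<chi>"
  shows "finite (char_exts G H K \<chi>) \<and> card (char_exts G H K \<chi>) * card K = card H"
  using assms(2-)
proof (induct "card H - card K" arbitrary: K \<chi> rule: less_induct)
  case less
  note K = less(2,3) and chi = less(4) and comm = less(5)
  show ?case
  proof (cases "K = H")
    case True
    have "char_exts G H K \<chi> = {restrict \<chi> H}"
    proof
      show "char_exts G H K \<chi> \<subseteq> {restrict \<chi> H}"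
        unfolding char_exts_def True by (auto simp: extensional_def)
      have "is_char G H (restrict \<chi> H)"
        using chi H unfolding is_char_def True by (simp add: subgroup.m_closed)
      then show "{restrict \<chi> H} \<subseteq> char_exts G H K \<chi>" unfolding char_exts_def True by auto
    qed
    then show ?thesis using True by simp
  next
    case False
    then obtain a where a: "a \<in> H" "a \<notin> K" using K by blast
    obtain m K' \<chi>' where *: "m > 0" "subgroup K' G" "K \<subset> K'" "K' \<subseteq> H" "a \<in> K'"
      "card K' = m * card K" "a [^] m \<in> K"
      and ex: "\<And>\<zeta>. \<zeta> ^ m = \<chi> (a [^] m) \<Longrightarrow> is_char G K' (\<chi>' \<zeta>) \<and> (\<forall>k\<in>K. \<chi>' \<zeta> k = \<chi> k) \<and> \<chi>' \<zeta> a = \<zeta>"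
      and un: "\<And>\<theta>. is_char G H \<theta> \<Longrightarrow> \<forall>k\<in>K. \<theta> k = \<chi> k \<Longrightarrow>
        \<theta> a ^ m = \<chi> (a [^] m) \<and> (\<forall>x\<in>K'. \<theta> x = \<chi>' (\<theta> a) x)"
      using adjoin_element[OF H K chi comm a] by blast
    define Z where "Z = {z. z ^ m = \<chi> (a [^] m)}"
    have "\<chi> (a [^] m) \<noteq> 0" using chi * unfolding is_char_def by blast
    then have cZ: "card Z = m" "finite Z"
      using card_nth_roots * unfolding Z_def by (auto intro: finite_nth_roots)
    have fin: "finite H" using H finite_sub by auto
    have IH: "finite (char_exts G H K' (\<chi>' z)) \<and> card (char_exts G H K' (\<chi>' z)) * card K' = card H"
      if "z \<in> Z" for z
    proof (rule less(1))
      have "card K < card K'" "card K' \<le> card H" using * fin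
        by (meson finite_subset psubset_card_mono, meson card_mono)
      then show "card H - card K' < card H - card K" by simp
      show "subgroup K' G" "K' \<subseteq> H" "is_char G K' (\<chi>' z)" using * ex that Z_def by auto
      \<comment> \<open>The commutators of \<open>H\<close> already lie in the smaller group
        \<open>K\<close>, where the old and the new character agree.\<close>
      have "\<forall>k\<in>K. \<chi>' z k = \<chi> k" using ex that Z_def by auto
      then show "comm_in_ker G H K' (\<chi>' z)"
        using comm * unfolding comm_in_ker_def by (metis psubsetD)
    qed
    have "char_exts G H K \<chi> = (\<Union>z\<in>Z. char_exts G H K' (\<chi>' z))"
    proof (intro Set.set_eqI iffI)
      fix \<theta> assume "\<theta> \<in> char_exts G H K \<chi>"
      then have t: "\<theta> \<in> extensional H" "is_char G H \<theta>" "\<forall>k\<in>K. \<theta> k = \<chi> k" by (auto simp: char_exts_def)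
      then have "\<theta> a \<in> Z" "\<theta> \<in> char_exts G H K' (\<chi>' (\<theta> a))"
        using un[OF t(2,3)] by (auto simp: Z_def char_exts_def)
      then show "\<theta> \<in> (\<Union>z\<in>Z. char_exts G H K' (\<chi>' z))" by blast
    next
      fix \<theta> assume "\<theta> \<in> (\<Union>z\<in>Z. char_exts G H K' (\<chi>' z))"
      then obtain z where z: "z \<in> Z" "\<theta> \<in> char_exts G H K' (\<chi>' z)" by blast
      then have "\<forall>k\<in>K. \<theta> k = \<chi> k" using ex[of z] *(3) by (auto simp: Z_def char_exts_def)
      then show "\<theta> \<in> char_exts G H K \<chi>" using z by (auto simp: char_exts_def)
    qed
    moreover have "char_exts G H K' (\<chi>' z) \<inter> char_exts G H K' (\<chi>' z') = {}"
      if "z \<in> Z" "z' \<in> Z" "z \<noteq> z'" for z z'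
      using that ex[of z] ex[of z'] *(5) by (auto simp: char_exts_def Z_def)
    ultimately have "card (char_exts G H K \<chi>) = (\<Sum>z\<in>Z. card (char_exts G H K' (\<chi>' z)))"
      and f: "finite (char_exts G H K \<chi>)"
      using IH cZ card_UN_disjoint[of Z "\<lambda>z. char_exts G H K' (\<chi>' z)"] by auto
    then have "card (char_exts G H K \<chi>) * card K' = (\<Sum>z\<in>Z. card H)"
      using IH by (simp add: sum_distrib_right)
    then have "m * (card (char_exts G H K \<chi>) * card K) = m * card H" using * cZ by simp
    then show ?thesis using f *(1) by simp
  qed
qed

text \<open>Let \<open>K1\<close> be the common kernel of all characters of \<open>H\<close> that
  are trivial on \<open>K\<close>. The same characters extend the trivial one of \<open>K1\<close>,
  so comparing the two counts gives \<open>card K1 = card K\<close>.\<close>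

lemma (in finite_grp) char_exts_separate:
  assumes H: "subgroup H G" and K: "subgroup K G" "K \<subseteq> H" and comm: "comm_in_ker G H K (\<lambda>_. 1)"
    and g: "g \<in> H" "g \<notin> K"
  obtains \<omega> where "\<omega> \<in> char_exts G H K (\<lambda>_. 1)" "\<omega> g \<noteq> 1"
proof (rule ccontr)
  assume "\<not> thesis"
  then have triv: "\<omega> g = 1" if "\<omega> \<in> char_exts G H K (\<lambda>_. 1)" for \<omega>
    using \<open>\<And>\<omega>. \<omega> \<in> char_exts G H K (\<lambda>_. 1) \<Longrightarrow> \<omega> g \<noteq> 1 \<Longrightarrow> thesis\<close> that by blast
  let ?E = "char_exts G H K (\<lambda>_. 1)"
  define K1 where "K1 = {x\<in>H. \<forall>\<omega>\<in>?E. \<omega> x = 1}"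
  have one: "is_char G A (\<lambda>_. 1)" for A unfolding is_char_def by simp
  have KK1: "K \<subseteq> K1" using K unfolding K1_def char_exts_def by auto
  have gK1: "g \<in> K1" using triv g K1_def by blast
  have sub: "subgroup K1 G"
  proof (rule subgroup_finiteI)
    show "K1 \<subseteq> carrier G" using H unfolding K1_def by (auto simp: subgroup.mem_carrier)
    show "g \<in> K1" by fact
    show "x \<otimes> y \<in> K1" if "x \<in> K1" "y \<in> K1" for x y
      using that H unfolding K1_def char_exts_def is_char_def by (auto simp: subgroup.m_closed)
  qed
  have "?E = char_exts G H K1 (\<lambda>_. 1)"
    using KK1 unfolding K1_def char_exts_def by blast
  moreover have "comm_in_ker G H K1 (\<lambda>_. 1)" using comm KK1 unfolding comm_in_ker_def by blast
  moreover have "K1 \<subseteq> H" unfolding K1_def by auto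
  ultimately have "card ?E * card K = card H" "card ?E * card K1 = card H"
    using card_char_exts[OF H K one comm] card_char_exts[OF H sub _ one] by auto
  moreover have "card H > 0" using H finite_sub subgroup.one_closed card_gt_0_iff by blast
  ultimately have "card K = card K1" by (metis mult_cancel1 mult_zero_left not_gr_zero)
  then have "K = K1" using KK1 card_subset_eq[OF finite_sub[OF sub]] by blast
  then show False using gK1 g by blast
qed

text \<open>Multiplication by a character that is trivial on \<open>K\<close> but not at
  \<open>g\<close> permutes the extensions and scales the sum by a factor different from 1.\<close>

lemma (in finite_grp) sum_char_exts:
  assumes H: "subgroup H G" and K: "subgroup K G" "K \<subseteq> H" and chi: "is_char G K \<chi>"
    and comm: "comm_in_ker G H K \<chi>" and g: "g \<in> H" "g \<notin> K"
  shows "(\<Sum>\<theta>\<in>char_exts G H K \<chi>. inverse (\<theta> g)) = 0"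
proof -
  let ?E = "char_exts G H K \<chi>"
  have "comm_in_ker G H K (\<lambda>_. 1)" using comm unfolding comm_in_ker_def by blast
  then obtain \<omega> where w: "\<omega> \<in> char_exts G H K (\<lambda>_. 1)" "\<omega> g \<noteq> 1"
    using char_exts_separate[OF H K _ g] by blast
  have w0: "\<omega> x \<noteq> 0" if "x \<in> H" for x using that w unfolding char_exts_def is_char_def by auto
  have tw: "(\<lambda>x\<in>H. \<theta> x * c x) \<in> ?E" if "\<theta> \<in> ?E" "is_char G H c" "\<forall>k\<in>K. c k = 1" for \<theta> c
    using that H K unfolding char_exts_def is_char_def
    by (auto simp: subgroup.m_closed subset_iff)
  have iw: "is_char G H \<omega>" "is_char G H (\<lambda>x. inverse (\<omega> x))" "\<forall>k\<in>K. \<omega> k = 1"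
    using w unfolding char_exts_def is_char_def by auto
  have bij: "bij_betw (\<lambda>\<theta>. \<lambda>x\<in>H. \<theta> x * \<omega> x) ?E ?E"
  proof (rule bij_betwI[where g = "\<lambda>\<theta>. \<lambda>x\<in>H. \<theta> x * inverse (\<omega> x)"])
    show "(\<lambda>\<theta>. \<lambda>x\<in>H. \<theta> x * \<omega> x) \<in> ?E \<rightarrow> ?E" using tw iw by blast
    show "(\<lambda>\<theta>. \<lambda>x\<in>H. \<theta> x * inverse (\<omega> x)) \<in> ?E \<rightarrow> ?E" using tw iw by auto
    show "(\<lambda>x\<in>H. (\<lambda>x\<in>H. \<theta> x * \<omega> x) x * inverse (\<omega> x)) = \<theta>" if "\<theta> \<in> ?E" for \<theta>
      using that w0 unfolding char_exts_def by (auto simp: fun_eq_iff extensional_def)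
    show "(\<lambda>x\<in>H. (\<lambda>x\<in>H. \<theta> x * inverse (\<omega> x)) x * \<omega> x) = \<theta>" if "\<theta> \<in> ?E" for \<theta>
      using that w0 unfolding char_exts_def by (auto simp: fun_eq_iff extensional_def)
  qed
  let ?s = "\<Sum>\<theta>\<in>?E. inverse (\<theta> g)"
  have "?s = (\<Sum>\<theta>\<in>?E. inverse ((\<lambda>x\<in>H. \<theta> x * \<omega> x) g))"
    by (rule sum.reindex_bij_betw[OF bij, symmetric])
  also have "\<dots> = ?s * inverse (\<omega> g)" using g by (simp add: sum_distrib_right)
  finally have "?s * (1 - inverse (\<omega> g)) = 0" by (simp add: algebra_simps)
  then show ?thesis using w(2) by (simp add: inverse_eq_1_iff)
qed

text \<open>Translating the summation variable by \<open>h\<close> multiplies the sum by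
  \<open>\<chi> h\<close>.\<close>

lemma (in finite_grp) sum_char_eq_0:
  assumes H: "subgroup H G" and chi: "is_char G H \<chi>" and h: "h \<in> H" "\<chi> h \<noteq> 1"
  shows "(\<Sum>x\<in>H. \<chi> x) = 0"
proof -
  have Hc: "x \<in> carrier G" if "x \<in> H" for x using H that by (simp add: subgroup.mem_carrier)
  have bij: "bij_betw (\<lambda>x. h \<otimes> x) H H"
  proof (rule bij_betwI[where g = "\<lambda>x. inv h \<otimes> x"])
    show "(\<lambda>x. h \<otimes> x) \<in> H \<rightarrow> H" "(\<lambda>x. inv h \<otimes> x) \<in> H \<rightarrow> H"
      using H h by (auto simp: subgroup.m_closed subgroup.m_inv_closed)
  qed (use Hc h in \<open>auto simp flip: m_assoc\<close>)
  have "(\<Sum>x\<in>H. \<chi> x) = (\<Sum>x\<in>H. \<chi> (h \<otimes> x))" by (rule sum.reindex_bij_betw[OF bij, symmetric])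
  also have "\<dots> = \<chi> h * (\<Sum>x\<in>H. \<chi> x)" using chi h unfolding is_char_def by (simp add: sum_distrib_left)
  finally have "(1 - \<chi> h) * (\<Sum>x\<in>H. \<chi> x) = 0" by (simp add: algebra_simps)
  then show ?thesis using h by simp
qed

section \<open>Matrix representations of finite groups\<close>

lemma mat_vec_index:
  "A \<in> carrier_mat m n \<Longrightarrow> v \<in> carrier_vec n \<Longrightarrow> i < m \<Longrightarrow> (A *\<^sub>v v) $ i = (\<Sum>j<n. A $$ (i, j) * v $ j)"
  by (auto simp: scalar_prod_def lessThan_atLeast0)

lemma mat_mult_index:
  "A \<in> carrier_mat m n \<Longrightarrow> B \<in> carrier_mat n p \<Longrightarrow> i < m \<Longrightarrow> k < p \<Longrightarrow>
    (A * B) $$ (i, k) = (\<Sum>j<n. A $$ (i, j) * B $$ (j, k))"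
  by (auto simp: scalar_prod_def lessThan_atLeast0)

text \<open>The dimension is an explicit argument, so that the empty sum is the zero vector of the
  right length.\<close>

definition vsum :: "nat \<Rightarrow> 'i set \<Rightarrow> ('i \<Rightarrow> complex vec) \<Rightarrow> complex vec" where
  "vsum n A f = vec n (\<lambda>i. \<Sum>a\<in>A. f a $ i)"

lemma vsum_carrier [simp]: "vsum n A f \<in> carrier_vec n"
  by (simp add: vsum_def)

lemma vsum_index [simp]: "i < n \<Longrightarrow> vsum n A f $ i = (\<Sum>a\<in>A. f a $ i)"
  by (simp add: vsum_def)

lemma mult_vsum:
  assumes "M \<in> carrier_mat m n" "\<And>a. a \<in> A \<Longrightarrow> f a \<in> carrier_vec n"
  shows "M *\<^sub>v vsum n A f = vsum m A (\<lambda>a. M *\<^sub>v f a)"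
proof (rule eq_vecI)
  fix i assume "i < dim_vec (vsum m A (\<lambda>a. M *\<^sub>v f a))"
  then have i: "i < m" by (simp add: vsum_def)
  have "(M *\<^sub>v vsum n A f) $ i = (\<Sum>j<n. \<Sum>a\<in>A. M $$ (i, j) * f a $ j)"
    using assms i by (simp add: mat_vec_index[OF assms(1)] sum_distrib_left del: index_mult_mat_vec)
  also have "\<dots> = (\<Sum>a\<in>A. (M *\<^sub>v f a) $ i)"
    by (subst sum.swap) (use assms i in \<open>simp add: mat_vec_index[OF assms(1)] del: index_mult_mat_vec\<close>)
  finally show "(M *\<^sub>v vsum n A f) $ i = vsum m A (\<lambda>a. M *\<^sub>v f a) $ i" using i by simp
qed (use assms in \<open>simp add: vsum_def\<close>)

text \<open>Invertibility of the matrices follows from these conditions by applying them to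
  inverses; \<open>is_rep_iff\<close> makes the connection with \<open>is_rep\<close>.\<close>

definition mat_rep :: "('g, 'x) monoid_scheme \<Rightarrow> nat \<Rightarrow> ('g \<Rightarrow> complex mat) \<Rightarrow> bool" where
  "mat_rep G n r \<longleftrightarrow> (\<forall>g\<in>carrier G. r g \<in> carrier_mat n n) \<and>
     (\<forall>g\<in>carrier G. \<forall>h\<in>carrier G. r (g \<otimes>\<^bsub>G\<^esub> h) = r g * r h) \<and> r \<one>\<^bsub>G\<^esub> = 1\<^sub>m n"

lemma GL_simps:
  "carrier (GL n) = Units (ring_mat TYPE(complex) n ())" "monoid.mult (GL n) = (*)" "one (GL n) = 1\<^sub>m n"
  by (auto simp: GL_def units_of_def ring_mat_simps)

lemma GL_I: "A \<in> carrier_mat n n \<Longrightarrow> B \<in> carrier_mat n n \<Longrightarrow> A * B = 1\<^sub>m n \<Longrightarrow> B * A = 1\<^sub>m n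
    \<Longrightarrow> A \<in> carrier (GL n)"
  unfolding GL_simps Units_def by (auto simp: ring_mat_simps)

lemma GL_carrier_mat: "A \<in> carrier (GL n) \<Longrightarrow> A \<in> carrier_mat n n"
  unfolding GL_simps Units_def by (auto simp: ring_mat_simps)

lemma GL_E:
  assumes "A \<in> carrier (GL n)"
  obtains B where "B \<in> carrier (GL n)" "A * B = 1\<^sub>m n" "B * A = 1\<^sub>m n"
  using assms unfolding GL_simps Units_def by (auto simp: ring_mat_simps)

lemma group_GL: "group (GL n)"
  unfolding GL_def by (rule monoid.units_group) (rule ring.axioms(2)[OF ring_mat])

lemma (in group) is_rep_iff: "is_rep G \<rho> \<longleftrightarrow> mat_rep G (fst \<rho>) (snd \<rho>)"
proof
  assume "is_rep G \<rho>"
  then have h: "snd \<rho> \<in> hom G (GL (fst \<rho>))" by (simp add: is_rep_def)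
  have "snd \<rho> \<one> = 1\<^sub>m (fst \<rho>)" using hom_one[OF h is_group group_GL] by (simp add: GL_simps)
  moreover have "snd \<rho> g \<in> carrier_mat (fst \<rho>) (fst \<rho>)" if "g \<in> carrier G" for g
    using h that GL_carrier_mat unfolding hom_def by blast
  ultimately show "mat_rep G (fst \<rho>) (snd \<rho>)" using h unfolding mat_rep_def hom_def by (auto simp: GL_simps)
next
  assume r: "mat_rep G (fst \<rho>) (snd \<rho>)"
  have "snd \<rho> g \<in> carrier (GL (fst \<rho>))" if g: "g \<in> carrier G" for g
  proof (rule GL_I[where B = "snd \<rho> (inv g)"])
    have m: "\<And>g h. g \<in> carrier G \<Longrightarrow> h \<in> carrier G \<Longrightarrow> snd \<rho> g * snd \<rho> h = snd \<rho> (g \<otimes> h)"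
      and one: "snd \<rho> \<one> = 1\<^sub>m (fst \<rho>)"
      using r unfolding mat_rep_def by auto
    show "snd \<rho> g * snd \<rho> (inv g) = 1\<^sub>m (fst \<rho>)" "snd \<rho> (inv g) * snd \<rho> g = 1\<^sub>m (fst \<rho>)"
      using m[OF g inv_closed[OF g]] m[OF inv_closed[OF g] g] one g by simp_all
  qed (use r g in \<open>auto simp: mat_rep_def\<close>)
  then show "is_rep G \<rho>" using r unfolding is_rep_def mat_rep_def hom_def by (auto simp: GL_simps)
qed

lemma (in group) mat_rep_inv:
  assumes "mat_rep G n r" "g \<in> carrier G" "v \<in> carrier_vec n"
  shows "r (inv g) *\<^sub>v (r g *\<^sub>v v) = v" "r g *\<^sub>v (r (inv g) *\<^sub>v v) = v"
proof -
  have "r (inv g) * r g = 1\<^sub>m n" "r g * r (inv g) = 1\<^sub>m n"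
    using assms unfolding mat_rep_def by (metis inv_closed l_inv, metis inv_closed r_inv)
  then show "r (inv g) *\<^sub>v (r g *\<^sub>v v) = v" "r g *\<^sub>v (r (inv g) *\<^sub>v v) = v"
    using assms unfolding mat_rep_def
    by (metis assoc_mult_mat_vec inv_closed one_mult_mat_vec)+
qed

lemma mat_rep_carrier: "mat_rep G n r \<Longrightarrow> g \<in> carrier G \<Longrightarrow> r g \<in> carrier_mat n n"
  unfolding mat_rep_def by blast

lemma mat_rep_vec: "mat_rep G n r \<Longrightarrow> g \<in> carrier G \<Longrightarrow> v \<in> carrier_vec n \<Longrightarrow> r g *\<^sub>v v \<in> carrier_vec n"
  unfolding mat_rep_def by auto

lemma mat_rep_mult: "mat_rep G n r \<Longrightarrow> g \<in> carrier G \<Longrightarrow> h \<in> carrier G \<Longrightarrow> v \<in> carrier_vec n \<Longrightarrow>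
    r (g \<otimes>\<^bsub>G\<^esub> h) *\<^sub>v v = r g *\<^sub>v (r h *\<^sub>v v)"
  unfolding mat_rep_def by (metis assoc_mult_mat_vec)

lemma (in group) mat_rep_nonzero:
  assumes "mat_rep G n r" "g \<in> carrier G" "v \<in> carrier_vec n" "v \<noteq> 0\<^sub>v n"
  shows "r g *\<^sub>v v \<noteq> 0\<^sub>v n"
proof
  assume "r g *\<^sub>v v = 0\<^sub>v n"
  then have "v = r (inv g) *\<^sub>v 0\<^sub>v n" using mat_rep_inv(1)[OF assms(1-3)] by simp
  also have "\<dots> = 0\<^sub>v n" using mat_rep_carrier[OF assms(1), of "inv g"] assms(2) by (intro eq_vecI) auto
  finally show False using assms by simp
qed

lemma vec_nonzeroE:
  assumes "v \<in> carrier_vec n" "v \<noteq> 0\<^sub>v n"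
  obtains i where "i < n" "v $ i \<noteq> (0::complex)"
proof (rule ccontr)
  assume "\<not> thesis"
  then have "v $ i = 0" if "i < n" for i using that \<open>\<And>i. i < n \<Longrightarrow> v $ i \<noteq> 0 \<Longrightarrow> thesis\<close> by blast
  then have "v = 0\<^sub>v n" using assms(1) by (intro eq_vecI) auto
  then show False using assms by simp
qed

lemma (in group) bij_left_mult:
  assumes "subgroup H G" "h \<in> H" shows "bij_betw (\<lambda>x. h \<otimes> x) H H"
proof (rule bij_betwI[where g = "\<lambda>x. inv h \<otimes> x"])
  show "(\<lambda>x. h \<otimes> x) \<in> H \<rightarrow> H" "(\<lambda>x. inv h \<otimes> x) \<in> H \<rightarrow> H"
    using assms by (auto simp: subgroup.m_closed subgroup.m_inv_closed)
qed (use assms in \<open>auto simp: subgroup.mem_carrier simp flip: m_assoc\<close>)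

lemma (in group) inv_cancel [simp]:
  "a \<in> carrier G \<Longrightarrow> b \<in> carrier G \<Longrightarrow> a \<otimes> (inv a \<otimes> b) = b"
  "a \<in> carrier G \<Longrightarrow> b \<in> carrier G \<Longrightarrow> inv a \<otimes> (a \<otimes> b) = b"
  by (simp_all flip: m_assoc)

text \<open>The average \<open>e \<theta>\<close> of the vectors \<open>r g *\<^sub>v w\<close> with
  weights \<open>inverse (\<theta> g)\<close> is an eigenvector for \<theta>, but it may vanish.
  Summed over all extensions \<theta>, the terms outside \<open>K\<close> cancel by
  \<open>sum_char_exts\<close> and a nonzero multiple of \<open>w\<close> remains, so some
  \<open>e \<theta>\<close> is nonzero.\<close>

lemma (in finite_grp) eigenvector_extend:
  assumes H: "subgroup H G" and K: "subgroup K G" "K \<subseteq> H" and chi: "is_char G K \<chi>"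
    and comm: "comm_in_ker G H K \<chi>" and r: "mat_rep G n r"
    and w: "w \<in> carrier_vec n" "w \<noteq> 0\<^sub>v n" "\<And>k. k \<in> K \<Longrightarrow> r k *\<^sub>v w = \<chi> k \<cdot>\<^sub>v w"
  obtains \<theta> w' where "\<theta> \<in> char_exts G H K \<chi>" "w' \<in> carrier_vec n" "w' \<noteq> 0\<^sub>v n"
    "\<And>h. h \<in> H \<Longrightarrow> r h *\<^sub>v w' = \<theta> h \<cdot>\<^sub>v w'"
proof -
  let ?E = "char_exts G H K \<chi>"
  have Hc: "x \<in> carrier G" if "x \<in> H" for x using H that by (simp add: subgroup.mem_carrier)
  define e where "e = (\<lambda>\<theta>. vsum n H (\<lambda>g. inverse (\<theta> g) \<cdot>\<^sub>v (r g *\<^sub>v w)))"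
  have ec: "e \<theta> \<in> carrier_vec n" for \<theta> by (simp add: e_def)
  have rw: "r g *\<^sub>v w \<in> carrier_vec n" if "g \<in> H" for g using mat_rep_vec[OF r Hc[OF that] w(1)] .
  have rd: "dim_row (r g) = n" if "g \<in> H" for g using mat_rep_carrier[OF r Hc[OF that]] by simp
  have ei: "e \<theta> $ i = (\<Sum>g\<in>H. inverse (\<theta> g) * (r g *\<^sub>v w) $ i)" if "i < n" for \<theta> i
    unfolding e_def vsum_index[OF that] by (rule sum.cong) (use rd that in \<open>auto simp del: index_mult_mat_vec\<close>)
  have eig: "r h *\<^sub>v e \<theta> = \<theta> h \<cdot>\<^sub>v e \<theta>" if th: "\<theta> \<in> ?E" and h: "h \<in> H" for \<theta> h
  proof (rule eq_vecI)
    have tc: "is_char G H \<theta>" using th unfolding char_exts_def by auto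
    have rh: "r h \<in> carrier_mat n n" using mat_rep_carrier[OF r Hc[OF h]] .
    have t0: "\<theta> x \<noteq> 0" if "x \<in> H" for x using tc that unfolding is_char_def by auto
    show "dim_vec (r h *\<^sub>v e \<theta>) = dim_vec (\<theta> h \<cdot>\<^sub>v e \<theta>)" using rh by (simp add: e_def vsum_def)
    fix i assume "i < dim_vec (\<theta> h \<cdot>\<^sub>v e \<theta>)"
    then have i: "i < n" by (simp add: e_def vsum_def)
    have "r h *\<^sub>v e \<theta> = vsum n H (\<lambda>g. r h *\<^sub>v (inverse (\<theta> g) \<cdot>\<^sub>v (r g *\<^sub>v w)))"
      unfolding e_def by (rule mult_vsum[OF rh]) (use rw in auto)
    also have "\<dots> $ i = (\<Sum>g\<in>H. inverse (\<theta> g) * (r (h \<otimes> g) *\<^sub>v w) $ i)"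
    proof -
      have "(r h *\<^sub>v (inverse (\<theta> g) \<cdot>\<^sub>v (r g *\<^sub>v w))) $ i = inverse (\<theta> g) * (r (h \<otimes> g) *\<^sub>v w) $ i"
        if "g \<in> H" for g
      proof -
        have "r h *\<^sub>v (inverse (\<theta> g) \<cdot>\<^sub>v (r g *\<^sub>v w)) = inverse (\<theta> g) \<cdot>\<^sub>v (r h *\<^sub>v (r g *\<^sub>v w))"
          using rh rw[OF that] by (simp add: mult_mat_vec)
        then show ?thesis using mat_rep_mult[OF r Hc[OF h] Hc[OF that] w(1)] i rh by simp
      qed
      then show ?thesis using i by simp
    qed
    also have "\<dots> = \<theta> h * (\<Sum>g\<in>H. inverse (\<theta> (h \<otimes> g)) * (r (h \<otimes> g) *\<^sub>v w) $ i)"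
      unfolding sum_distrib_left
    proof (rule sum.cong[OF refl])
      fix g assume "g \<in> H"
      then have "\<theta> (h \<otimes> g) = \<theta> h * \<theta> g" using tc h unfolding is_char_def by blast
      then show "inverse (\<theta> g) * (r (h \<otimes> g) *\<^sub>v w) $ i = \<theta> h * (inverse (\<theta> (h \<otimes> g)) * (r (h \<otimes> g) *\<^sub>v w) $ i)"
        using t0[OF h] by (simp add: field_simps)
    qed
    also have "(\<Sum>g\<in>H. inverse (\<theta> (h \<otimes> g)) * (r (h \<otimes> g) *\<^sub>v w) $ i) = (\<Sum>g\<in>H. inverse (\<theta> g) * (r g *\<^sub>v w) $ i)"
      by (rule sum.reindex_bij_betw[OF bij_left_mult[OF H h]])
    finally show "(r h *\<^sub>v e \<theta>) $ i = (\<theta> h \<cdot>\<^sub>v e \<theta>) $ i" using i ec[of \<theta>] by (simp add: ei)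
  qed
  have "\<exists>\<theta>\<in>?E. e \<theta> \<noteq> 0\<^sub>v n"
  proof (rule ccontr)
    assume "\<not> ?thesis"
    then have z: "e \<theta> = 0\<^sub>v n" if "\<theta> \<in> ?E" for \<theta> using that by blast
    obtain i where i: "i < n" "w $ i \<noteq> 0" using vec_nonzeroE[OF w(1,2)] by blast
    have "0 = (\<Sum>\<theta>\<in>?E. e \<theta> $ i)" using z i by simp
    also have "\<dots> = (\<Sum>g\<in>H. (\<Sum>\<theta>\<in>?E. inverse (\<theta> g)) * (r g *\<^sub>v w) $ i)"
      unfolding ei[OF i(1)] by (subst sum.swap) (simp add: sum_distrib_right)
    also have "\<dots> = (\<Sum>g\<in>K. (\<Sum>\<theta>\<in>?E. inverse (\<theta> g)) * (r g *\<^sub>v w) $ i)"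
      by (rule sum.mono_neutral_right[OF finite_sub[OF H] K(2)]) (use sum_char_exts[OF H K chi comm] in auto)
    also have "\<dots> = (\<Sum>g\<in>K. of_nat (card ?E) * w $ i)"
    proof (rule sum.cong[OF refl])
      fix g assume g: "g \<in> K"
      have "(\<Sum>\<theta>\<in>?E. inverse (\<theta> g)) = (\<Sum>\<theta>\<in>?E. inverse (\<chi> g))"
        by (rule sum.cong) (use g in \<open>auto simp: char_exts_def\<close>)
      moreover have "\<chi> g \<noteq> 0" using chi g unfolding is_char_def by auto
      ultimately show "(\<Sum>\<theta>\<in>?E. inverse (\<theta> g)) * (r g *\<^sub>v w) $ i = of_nat (card ?E) * w $ i"
        using w i g by simp
    qed
    finally have "card ?E * card K = 0" using i by (auto simp del: mult_eq_0_iff simp flip: of_nat_mult) simp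
    then have "card H = 0" using card_char_exts[OF H K chi comm] by simp
    then show False using finite_sub[OF H] H subgroup.one_closed by fastforce
  qed
  then show thesis using that eig ec by blast
qed

subsection \<open>Induced representations\<close>

lemma (in finite_grp) transversal_exists:
  assumes N: "subgroup N G" shows "\<exists>xs. transversal G N xs"
proof -
  have Nc: "x \<in> carrier G" if "x \<in> N" for x using N that by (simp add: subgroup.mem_carrier)
  define C where "C = (\<lambda>g. g <# N) ` carrier G"
  have C: "finite C" using finite_carrier C_def by auto
  obtain cs where cs: "set cs = C" "distinct cs" using finite_distinct_list[OF C] by blast
  define f where "f = (\<lambda>c. SOME x. x \<in> carrier G \<and> c = x <# N)"
  have f: "f c \<in> carrier G \<and> c = f c <# N" if "c \<in> C" for c
    unfolding f_def by (rule someI_ex) (use that C_def in auto)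
  have self: "g \<in> g <# N" if "g \<in> carrier G" for g
    unfolding l_coset_def using that subgroup.one_closed[OF N] by force
  have uniq: "c = g <# N" if c: "c \<in> C" and g: "g \<in> c" "g \<in> carrier G" for c g
  proof -
    obtain x where x: "x \<in> carrier G" "c = x <# N" using c C_def by blast
    then show ?thesis using l_repr_independence[of g x N] g N by simp
  qed
  have "transversal G N (map f cs)"
    unfolding transversal_def
  proof (intro conjI ballI)
    show "set (map f cs) \<subseteq> carrier G" using f cs by auto
    fix g assume g: "g \<in> carrier G"
    then have "g <# N \<in> C" by (simp add: C_def)
    then obtain i where i: "i < length cs" "cs ! i = g <# N" using cs by (metis in_set_conv_nth)
    show "\<exists>!i. i < length (map f cs) \<and> g \<in> map f cs ! i <# N"
    proof (rule ex1I[of _ i])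
      show "i < length (map f cs) \<and> g \<in> map f cs ! i <# N"
        using i f[of "cs ! i"] cs self[OF g] by (metis length_map nth_map nth_mem)
      fix j assume j: "j < length (map f cs) \<and> g \<in> map f cs ! j <# N"
      then have jc: "j < length cs" "cs ! j \<in> C" using cs by auto
      then have "g \<in> cs ! j" using j f[OF jc(2)] by simp
      then have "cs ! j = cs ! i" using uniq[OF jc(2) _ g] i by simp
      then show "j = i" using cs(2) i jc nth_eq_iff_index_eq by blast
    qed
  qed
  then show ?thesis by blast
qed

locale left_transversal = finite_grp +
  fixes N and xs
  assumes N: "subgroup N G" and tr: "transversal G N xs"
begin

abbreviation "r \<equiv> length xs"
abbreviation "x i \<equiv> xs ! i"

lemma Nc: "a \<in> N \<Longrightarrow> a \<in> carrier G"
  using N by (simp add: subgroup.mem_carrier)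

lemma xc [simp]: "i < r \<Longrightarrow> x i \<in> carrier G"
  using tr unfolding transversal_def by auto

lemma coset_iff: "i < r \<Longrightarrow> g \<in> carrier G \<Longrightarrow> g \<in> x i <# N \<longleftrightarrow> inv (x i) \<otimes> g \<in> N"
proof
  assume i: "i < r" "g \<in> carrier G"
  { assume "g \<in> x i <# N"
    then obtain h where "h \<in> N" "g = x i \<otimes> h" unfolding l_coset_def by blast
    then show "inv (x i) \<otimes> g \<in> N" using i Nc by (simp flip: m_assoc) }
  assume "inv (x i) \<otimes> g \<in> N"
  moreover have "g = x i \<otimes> (inv (x i) \<otimes> g)" using i by (simp flip: m_assoc)
  ultimately show "g \<in> x i <# N" unfolding l_coset_def by blast
qed

lemma ex1: "g \<in> carrier G \<Longrightarrow> \<exists>!i. i < r \<and> inv (x i) \<otimes> g \<in> N"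
  using tr coset_iff unfolding transversal_def by metis

lemma uniq: "g \<in> carrier G \<Longrightarrow> i < r \<Longrightarrow> j < r \<Longrightarrow> inv (x i) \<otimes> g \<in> N \<Longrightarrow> inv (x j) \<otimes> g \<in> N \<Longrightarrow> i = j"
  using ex1 by blast

lemma same: "i < r \<Longrightarrow> j < r \<Longrightarrow> inv (x i) \<otimes> x j \<in> N \<longleftrightarrow> i = j"
  using uniq[of "x j" i j] N by (auto simp: subgroup.one_closed)

lemma card_index: "card (carrier G) = r * card N"
proof -
  have "bij_betw (\<lambda>(i, h). x i \<otimes> h) ({..<r} \<times> N) (carrier G)"
    unfolding bij_betw_def
  proof
    show "inj_on (\<lambda>(i, h). x i \<otimes> h) ({..<r} \<times> N)"
    proof (rule inj_onI, clarify)
      fix i h j k assume a: "i < r" "j < r" "h \<in> N" "k \<in> N" and e: "x i \<otimes> h = x j \<otimes> k"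
      have "inv (x i) \<otimes> (x i \<otimes> h) = h" "inv (x j) \<otimes> (x j \<otimes> k) = k" using a Nc by (auto simp flip: m_assoc)
      then have "i = j" using uniq[of "x i \<otimes> h" i j] a Nc e by simp
      then show "i = j \<and> h = k" using e a Nc by simp
    qed
    show "(\<lambda>(i, h). x i \<otimes> h) ` ({..<r} \<times> N) = carrier G"
    proof
      show "(\<lambda>(i, h). x i \<otimes> h) ` ({..<r} \<times> N) \<subseteq> carrier G" using Nc by auto
      show "carrier G \<subseteq> (\<lambda>(i, h). x i \<otimes> h) ` ({..<r} \<times> N)"
      proof
        fix g assume g: "g \<in> carrier G"
        then obtain i where i: "i < r" "inv (x i) \<otimes> g \<in> N" using ex1 by blast
        then have "g = x i \<otimes> (inv (x i) \<otimes> g)" using g by (simp flip: m_assoc)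
        then show "g \<in> (\<lambda>(i, h). x i \<otimes> h) ` ({..<r} \<times> N)" using i by force
      qed
    qed
  qed
  then show ?thesis using bij_betw_same_card card_cartesian_product by (metis card_lessThan)
qed

end

text \<open>Removes the choice operator once and for all: afterwards only the defining property of a
  transversal is used.\<close>

lemma (in finite_grp) ind_rep_cases:
  assumes N: "subgroup N G"
  obtains xs where "left_transversal G N xs" "ind_rep G N \<sigma> = (length xs * fst \<sigma>, \<lambda>g.
      mat (length xs * fst \<sigma>) (length xs * fst \<sigma>) (\<lambda>(i, j).
         let h = inv (xs ! (i div fst \<sigma>)) \<otimes> g \<otimes> (xs ! (j div fst \<sigma>)) in
         if h \<in> N then snd \<sigma> h $$ (i mod fst \<sigma>, j mod fst \<sigma>) else 0))"
proof (rule that)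
  show "left_transversal G N (SOME xs. transversal G N xs)"
    using someI_ex[OF transversal_exists[OF N]] N
    by (intro left_transversal.intro finite_grp_axioms left_transversal_axioms.intro)
qed (simp add: ind_rep_def Let_def)

text \<open>Induction from a one-dimensional character, with blocks of size 1, so that the
  arithmetic of block positions in \<open>ind_rep\<close> disappears.\<close>

definition ind_char ::
    "('g, 'x) monoid_scheme \<Rightarrow> 'g set \<Rightarrow> 'g list \<Rightarrow> ('g \<Rightarrow> complex) \<Rightarrow> 'g \<Rightarrow> complex mat" where
  "ind_char G N xs \<theta> g = mat (length xs) (length xs) (\<lambda>(i, j).
     let h = inv\<^bsub>G\<^esub> (xs ! i) \<otimes>\<^bsub>G\<^esub> g \<otimes>\<^bsub>G\<^esub> xs ! j in if h \<in> N then \<theta> h else 0)"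

lemma ind_char_carrier [simp]: "ind_char G N xs \<theta> g \<in> carrier_mat (length xs) (length xs)"
  by (simp add: ind_char_def)

lemma (in finite_grp) ind_rep_char_cases:
  assumes N: "subgroup N G"
  obtains xs where "left_transversal G N xs" "ind_rep G N (char_rep \<theta>) = (length xs, ind_char G N xs \<theta>)"
proof -
  obtain xs where "left_transversal G N xs" and *: "ind_rep G N (char_rep \<theta>) = (length xs * 1, \<lambda>g.
      mat (length xs * 1) (length xs * 1) (\<lambda>(i, j).
         let h = inv (xs ! (i div 1)) \<otimes> g \<otimes> (xs ! (j div 1)) in
         if h \<in> N then snd (char_rep \<theta>) h $$ (i mod 1, j mod 1) else 0))"
    by (rule ind_rep_cases[OF N, of "char_rep \<theta>"]) (simp only: char_rep_def fst_conv)
  moreover have "ind_rep G N (char_rep \<theta>) = (length xs, ind_char G N xs \<theta>)"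
    unfolding * ind_char_def by (auto simp: char_rep_def Let_def fun_eq_iff intro!: eq_matI)
  ultimately show thesis using that by blast
qed

lemma sum_single: "finite A \<Longrightarrow> a \<in> A \<Longrightarrow> (\<And>b. b \<in> A \<Longrightarrow> b \<noteq> a \<Longrightarrow> f b = 0) \<Longrightarrow> sum f A = (f a :: complex)"
  by (metis (no_types, lifting) DiffE Diff_cancel insert_Diff insert_iff sum.neutral sum.remove add.right_neutral)

context left_transversal
begin

lemma ind_char_index: "i < r \<Longrightarrow> j < r \<Longrightarrow> ind_char G N xs \<theta> g $$ (i, j) =
    (if inv (x i) \<otimes> g \<otimes> x j \<in> N then \<theta> (inv (x i) \<otimes> g \<otimes> x j) else 0)"
  by (simp add: ind_char_def Let_def)

text \<open>The matrix is monomial: two columns with a nonzero entry in row \<open>i\<close> would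
  belong to the same coset.\<close>

lemma ind_char_apply:
  assumes g: "g \<in> carrier G" and ij: "i < r" "j < r" and h: "inv (x i) \<otimes> g \<otimes> x j \<in> N" and v: "v \<in> carrier_vec r"
  shows "(ind_char G N xs \<theta> g *\<^sub>v v) $ i = \<theta> (inv (x i) \<otimes> g \<otimes> x j) * v $ j"
proof -
  have "(ind_char G N xs \<theta> g *\<^sub>v v) $ i = (\<Sum>k<r. ind_char G N xs \<theta> g $$ (i, k) * v $ k)"
    by (rule mat_vec_index) (use v ij in auto)
  also have "\<dots> = ind_char G N xs \<theta> g $$ (i, j) * v $ j"
  proof (rule sum_single)
    fix k assume k: "k \<in> {..<r}" "k \<noteq> j"
    have "inv (x i) \<otimes> g \<otimes> x k \<notin> N"
    proof
      assume "inv (x i) \<otimes> g \<otimes> x k \<in> N"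
      then have "inv (inv (x i) \<otimes> g \<otimes> x j) \<otimes> (inv (x i) \<otimes> g \<otimes> x k) \<in> N"
        using h N by (simp add: subgroup.m_closed subgroup.m_inv_closed)
      moreover have "inv (inv (x i) \<otimes> g \<otimes> x j) \<otimes> (inv (x i) \<otimes> g \<otimes> x k) = inv (x j) \<otimes> x k"
        using g ij k by (simp add: inv_mult_group m_assoc)
      ultimately show False using same[of j k] g ij k by simp
    qed
    then show "ind_char G N xs \<theta> g $$ (i, k) * v $ k = 0" using ij k by (simp add: ind_char_index)
  qed (use ij in auto)
  finally show ?thesis using ij h by (simp add: ind_char_index)
qed

lemma ex_row: assumes "g \<in> carrier G" "i < r"
  shows "\<exists>j<r. inv (x i) \<otimes> g \<otimes> x j \<in> N"
proof -
  obtain j where j: "j < r" "inv (x j) \<otimes> (inv g \<otimes> x i) \<in> N" using ex1[of "inv g \<otimes> x i"] assms by auto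
  then have "inv (inv (x j) \<otimes> (inv g \<otimes> x i)) \<in> N" using N by (simp add: subgroup.m_inv_closed)
  then have "inv (x i) \<otimes> g \<otimes> x j \<in> N" using assms j by (simp add: inv_mult_group)
  then show ?thesis using j by blast
qed

lemma ind_char_rep:
  assumes th: "is_char G N \<theta>" shows "mat_rep G r (ind_char G N xs \<theta>)"
  unfolding mat_rep_def
proof (intro conjI ballI)
  fix g h assume gh: "g \<in> carrier G" "h \<in> carrier G"
  show "ind_char G N xs \<theta> (g \<otimes> h) = ind_char G N xs \<theta> g * ind_char G N xs \<theta> h"
  proof (rule eq_matI)
    fix i k assume "i < dim_row (ind_char G N xs \<theta> g * ind_char G N xs \<theta> h)" "k < dim_col (ind_char G N xs \<theta> g * ind_char G N xs \<theta> h)"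
    then have ik: "i < r" "k < r" by (simp_all add: ind_char_def)
    obtain j where j: "j < r" "inv (x i) \<otimes> g \<otimes> x j \<in> N" using ex_row gh ik by blast
    have "(ind_char G N xs \<theta> g * ind_char G N xs \<theta> h) $$ (i, k) = (ind_char G N xs \<theta> g *\<^sub>v col (ind_char G N xs \<theta> h) k) $ i"
      using ik by (simp add: ind_char_def)
    also have "\<dots> = \<theta> (inv (x i) \<otimes> g \<otimes> x j) * ind_char G N xs \<theta> h $$ (j, k)"
      by (subst ind_char_apply[OF gh(1) ik(1) j]) (use ik j in \<open>auto simp: ind_char_def\<close>)
    also have "\<dots> = ind_char G N xs \<theta> (g \<otimes> h) $$ (i, k)"
    proof -
      have *: "inv (x i) \<otimes> (g \<otimes> h) \<otimes> x k = (inv (x i) \<otimes> g \<otimes> x j) \<otimes> (inv (x j) \<otimes> h \<otimes> x k)"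
        using gh ik j by (simp add: m_assoc)
      have "inv (x i) \<otimes> (g \<otimes> h) \<otimes> x k \<in> N \<longleftrightarrow> inv (x j) \<otimes> h \<otimes> x k \<in> N"
      proof
        assume "inv (x i) \<otimes> (g \<otimes> h) \<otimes> x k \<in> N"
        then have "inv (inv (x i) \<otimes> g \<otimes> x j) \<otimes> (inv (x i) \<otimes> (g \<otimes> h) \<otimes> x k) \<in> N"
          using j N by (simp add: subgroup.m_closed subgroup.m_inv_closed)
        moreover have "inv (inv (x i) \<otimes> g \<otimes> x j) \<otimes> (inv (x i) \<otimes> (g \<otimes> h) \<otimes> x k)
            = (inv (inv (x i) \<otimes> g \<otimes> x j) \<otimes> (inv (x i) \<otimes> g \<otimes> x j)) \<otimes> (inv (x j) \<otimes> h \<otimes> x k)"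
          unfolding * using gh ik j by (intro m_assoc[symmetric]) auto
        ultimately show "inv (x j) \<otimes> h \<otimes> x k \<in> N" using gh ik j by simp
      qed (use * j N in \<open>simp add: subgroup.m_closed\<close>)
      then show ?thesis using * j th ik unfolding is_char_def by (simp add: ind_char_index)
    qed
    finally show "ind_char G N xs \<theta> (g \<otimes> h) $$ (i, k) = (ind_char G N xs \<theta> g * ind_char G N xs \<theta> h) $$ (i, k)" by simp
  qed (simp_all add: ind_char_def)
next
  show "ind_char G N xs \<theta> \<one> = 1\<^sub>m r"
    using is_char_one[OF N th] same by (intro eq_matI) (auto simp: ind_char_index N subgroup.one_closed ind_char_def)
qed simp

lemma ind_char_unit:
  assumes g: "g \<in> carrier G" and ij: "i < r" "j < r" and h: "inv (x i) \<otimes> g \<otimes> x j \<in> N"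
  shows "ind_char G N xs \<theta> g *\<^sub>v unit_vec r j = \<theta> (inv (x i) \<otimes> g \<otimes> x j) \<cdot>\<^sub>v unit_vec r i"
proof (rule eq_vecI)
  fix k assume "k < dim_vec (\<theta> (inv (x i) \<otimes> g \<otimes> x j) \<cdot>\<^sub>v unit_vec r i)"
  then have k: "k < r" by simp
  obtain l where l: "l < r" "inv (x k) \<otimes> g \<otimes> x l \<in> N" using ex_row g k by blast
  have e: "(ind_char G N xs \<theta> g *\<^sub>v unit_vec r j) $ k = \<theta> (inv (x k) \<otimes> g \<otimes> x l) * unit_vec r j $ l"
    by (rule ind_char_apply[OF g k l]) simp
  show "(ind_char G N xs \<theta> g *\<^sub>v unit_vec r j) $ k = (\<theta> (inv (x i) \<otimes> g \<otimes> x j) \<cdot>\<^sub>v unit_vec r i) $ k"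
  proof (cases "l = j")
    case True
    have "inv (x k) \<otimes> (g \<otimes> x j) \<in> N" "inv (x i) \<otimes> (g \<otimes> x j) \<in> N"
      using l(2) h g ij k by (simp_all add: m_assoc True)
    then have ki: "k = i" using uniq[of "g \<otimes> x j" k i] k ij g by simp
    show ?thesis unfolding e unfolding True ki using ij by simp
  next
    case False
    have "k \<noteq> i"
    proof
      assume "k = i"
      have "(ind_char G N xs (\<lambda>_. 1) g *\<^sub>v unit_vec r j) $ i = 1 * unit_vec r j $ j"
        by (rule ind_char_apply[OF g ij h]) simp
      moreover have "(ind_char G N xs (\<lambda>_. 1) g *\<^sub>v unit_vec r j) $ i = 1 * unit_vec r j $ l"
        by (rule ind_char_apply[OF g ij(1) l(1)]) (use l \<open>k = i\<close> in auto)
      ultimately show False using False ij l by simp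
    qed
    then show ?thesis using e False l ij k by simp
  qed
qed (simp add: ind_char_def)

end

section \<open>Invariant subspaces and Schur's lemma\<close>

definition invariant_subspace :: "('g, 'x) monoid_scheme \<Rightarrow> nat \<Rightarrow> ('g \<Rightarrow> complex mat) \<Rightarrow> complex vec set \<Rightarrow> bool" where
  "invariant_subspace G n r W \<longleftrightarrow> W \<subseteq> carrier_vec n \<and> 0\<^sub>v n \<in> W \<and>
          (\<forall>v\<in>W. \<forall>w\<in>W. v + w \<in> W) \<and> (\<forall>c. \<forall>v\<in>W. c \<cdot>\<^sub>v v \<in> W) \<and>
          (\<forall>g\<in>carrier G. \<forall>v\<in>W. r g *\<^sub>v v \<in> W)"

lemma (in group) irreducible_rep_iff: "irreducible_rep G \<rho> \<longleftrightarrow> mat_rep G (fst \<rho>) (snd \<rho>) \<and> fst \<rho> > 0 \<and>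
    (\<forall>W. invariant_subspace G (fst \<rho>) (snd \<rho>) W \<longrightarrow> W = {0\<^sub>v (fst \<rho>)} \<or> W = carrier_vec (fst \<rho>))"
  unfolding irreducible_rep_def invariant_subspace_def is_rep_iff ..

lemma vsum_mem:
  assumes W: "invariant_subspace G n r W" and "finite A" "\<And>a. a \<in> A \<Longrightarrow> f a \<in> W"
  shows "vsum n A f \<in> W"
  using assms(2,3)
proof (induct A rule: finite_induct)
  case empty
  have "vsum n {} f = 0\<^sub>v n" by (rule eq_vecI) (auto simp: vsum_def)
  then show ?case using W by (simp add: invariant_subspace_def)
next
  case (insert a A)
  have "f a \<in> carrier_vec n" using W insert by (auto simp: invariant_subspace_def)
  then have "vsum n (insert a A) f = f a + vsum n A f"
    using insert by (intro eq_vecI) (auto simp: vsum_def)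
  moreover have "f a \<in> W" "vsum n A f \<in> W" using insert by auto
  ultimately show ?case using W by (simp add: invariant_subspace_def)
qed

lemma vec_expand: "v \<in> carrier_vec n \<Longrightarrow> v = vsum n {..<n} (\<lambda>j. v $ j \<cdot>\<^sub>v unit_vec n j)"
proof (rule eq_vecI)
  fix i assume v: "v \<in> carrier_vec n" and "i < dim_vec (vsum n {..<n} (\<lambda>j. v $ j \<cdot>\<^sub>v unit_vec n j))"
  then have i: "i < n" by (simp add: vsum_def)
  have "(\<Sum>j<n. (v $ j \<cdot>\<^sub>v unit_vec n j) $ i) = (v $ i \<cdot>\<^sub>v unit_vec n i) $ i"
    by (rule sum_single) (use i in auto)
  then show "v $ i = vsum n {..<n} (\<lambda>j. v $ j \<cdot>\<^sub>v unit_vec n j) $ i" using i by simp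
qed (auto simp: vsum_def)

lemma mat_eq_by_vec:
  assumes A: "A \<in> carrier_mat m n" and B: "B \<in> carrier_mat m n"
    and e: "\<And>j. j < n \<Longrightarrow> A *\<^sub>v unit_vec n j = B *\<^sub>v unit_vec n j"
  shows "A = (B :: complex mat)"
proof (rule eq_matI)
  fix i j assume ij: "i < dim_row B" "j < dim_col B"
  have "A *\<^sub>v unit_vec n j = col A j" "B *\<^sub>v unit_vec n j = col B j" using A B ij by auto
  then have "col A j $ i = col B j $ i" using e B ij by auto
  then show "A $$ (i, j) = B $$ (i, j)" using A B ij by auto
qed (use A B in auto)

text \<open>The products \<open>A * B\<close> and \<open>B * A\<close> have the same trace, and here
  the traces are the two dimensions.\<close>

lemma two_sided_inverse_square:
  assumes A: "A \<in> carrier_mat n m" and B: "B \<in> carrier_mat m n" and "A * B = 1\<^sub>m n" "B * A = (1\<^sub>m m :: complex mat)"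
  shows "n = m"
proof -
  have "(\<Sum>i<n. (A * B) $$ (i, i)) = (\<Sum>i<n. \<Sum>j<m. A $$ (i, j) * B $$ (j, i))"
    by (rule sum.cong) (auto simp: mat_mult_index[OF A B])
  also have "\<dots> = (\<Sum>j<m. \<Sum>i<n. B $$ (j, i) * A $$ (i, j))"
    by (subst sum.swap) (simp add: mult.commute)
  also have "\<dots> = (\<Sum>j<m. (B * A) $$ (j, j))"
    by (rule sum.cong) (auto simp: mat_mult_index[OF B A])
  finally have "of_nat n = (of_nat m :: complex)" using assms(3,4) by simp
  then show ?thesis by simp
qed

lemma (in group) kernel_invariant:
  assumes T: "T \<in> carrier_mat n m" and s: "mat_rep G m s" and r: "\<And>g. g \<in> carrier G \<Longrightarrow> r g \<in> carrier_mat n n"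
    and int: "\<And>g. g \<in> carrier G \<Longrightarrow> T * s g = r g * T"
  shows "invariant_subspace G m s {v \<in> carrier_vec m. T *\<^sub>v v = 0\<^sub>v n}"
proof -
  have "T *\<^sub>v (s g *\<^sub>v v) = 0\<^sub>v n" if "g \<in> carrier G" "v \<in> carrier_vec m" "T *\<^sub>v v = 0\<^sub>v n" for g v
  proof -
    have sg: "s g \<in> carrier_mat m m" and rg: "r g \<in> carrier_mat n n" using mat_rep_carrier[OF s] r that by auto
    have "T *\<^sub>v (s g *\<^sub>v v) = (T * s g) *\<^sub>v v" using T sg that by simp
    also have "\<dots> = r g *\<^sub>v (T *\<^sub>v v)" unfolding int[OF that(1)] using T rg that by simp
    also have "\<dots> = 0\<^sub>v n" unfolding that(3) using rg by (intro eq_vecI) auto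
    finally show ?thesis .
  qed
  then show ?thesis unfolding invariant_subspace_def
    using T mat_rep_vec[OF s] by (auto simp: mult_add_distrib_mat_vec mult_mat_vec)
qed

lemma (in group) image_invariant:
  assumes T: "T \<in> carrier_mat n m" and s: "mat_rep G m s" and r: "mat_rep G n r"
    and int: "\<And>g. g \<in> carrier G \<Longrightarrow> T * s g = r g * T"
  shows "invariant_subspace G n r ((\<lambda>v. T *\<^sub>v v) ` carrier_vec m)"
  unfolding invariant_subspace_def
proof (intro conjI ballI allI)
  show "(\<lambda>v. T *\<^sub>v v) ` carrier_vec m \<subseteq> carrier_vec n" using T by auto
  show "0\<^sub>v n \<in> (\<lambda>v. T *\<^sub>v v) ` carrier_vec m"
    by (rule image_eqI[of _ _ "0\<^sub>v m"]) (use T in auto)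
  fix v w assume "v \<in> (\<lambda>v. T *\<^sub>v v) ` carrier_vec m" "w \<in> (\<lambda>v. T *\<^sub>v v) ` carrier_vec m"
  then obtain a b where ab: "a \<in> carrier_vec m" "b \<in> carrier_vec m" "v = T *\<^sub>v a" "w = T *\<^sub>v b" by auto
  have "v + w = T *\<^sub>v (a + b)" unfolding ab(3,4) by (rule mult_add_distrib_mat_vec[OF T ab(1,2), symmetric])
  then show "v + w \<in> (\<lambda>v. T *\<^sub>v v) ` carrier_vec m" using ab(1,2) by simp
next
  fix c v assume "v \<in> (\<lambda>v. T *\<^sub>v v) ` carrier_vec m"
  then obtain a where a: "a \<in> carrier_vec m" "v = T *\<^sub>v a" by auto
  have "c \<cdot>\<^sub>v v = T *\<^sub>v (c \<cdot>\<^sub>v a)" unfolding a(2) by (rule mult_mat_vec[OF T a(1), symmetric])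
  then show "c \<cdot>\<^sub>v v \<in> (\<lambda>v. T *\<^sub>v v) ` carrier_vec m" using a(1) by simp
next
  fix g v assume g: "g \<in> carrier G" and "v \<in> (\<lambda>v. T *\<^sub>v v) ` carrier_vec m"
  then obtain a where a: "a \<in> carrier_vec m" "v = T *\<^sub>v a" by auto
  have sg: "s g \<in> carrier_mat m m" and rg: "r g \<in> carrier_mat n n" using mat_rep_carrier[OF s g] mat_rep_carrier[OF r g] by auto
  have "r g *\<^sub>v v = (r g * T) *\<^sub>v a" using a T rg by simp
  also have "\<dots> = T *\<^sub>v (s g *\<^sub>v a)" unfolding int[OF g, symmetric] using T sg a by simp
  finally show "r g *\<^sub>v v \<in> (\<lambda>v. T *\<^sub>v v) ` carrier_vec m" using a sg by auto
qed

text \<open>The kernel is invariant and misses \<open>u\<close>, hence it is zero by irreducibility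
  of the source. The target is not assumed irreducible, as it will be an induced
  representation.\<close>

lemma (in group) intertwiner_injective:
  assumes irr: "irreducible_rep G (m, s)" and T: "T \<in> carrier_mat n m" and r: "\<And>g. g \<in> carrier G \<Longrightarrow> r g \<in> carrier_mat n n"
    and int: "\<And>g. g \<in> carrier G \<Longrightarrow> T * s g = r g * T"
    and nz: "u \<in> carrier_vec m" "T *\<^sub>v u \<noteq> 0\<^sub>v n"
  shows "inj_on (\<lambda>v. T *\<^sub>v v) (carrier_vec m)"
proof -
  let ?W = "{v \<in> carrier_vec m. T *\<^sub>v v = 0\<^sub>v n}"
  have s: "mat_rep G m s" using irr irreducible_rep_iff by auto
  have "?W = {0\<^sub>v m} \<or> ?W = carrier_vec m"
    using irr kernel_invariant[OF T s r int] irreducible_rep_iff by auto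
  moreover have "?W \<noteq> carrier_vec m" using nz by blast
  ultimately have W: "?W = {0\<^sub>v m}" by blast
  show ?thesis
  proof (rule inj_onI)
    fix v w assume vw: "v \<in> carrier_vec m" "w \<in> carrier_vec m" "T *\<^sub>v v = T *\<^sub>v w"
    have "T *\<^sub>v (v - w) = T *\<^sub>v v - T *\<^sub>v w" using T vw by (intro mult_minus_distrib_mat_vec)
    also have "\<dots> = 0\<^sub>v n" using vw T by (intro eq_vecI) auto
    finally have "v - w \<in> ?W" using vw by simp
    then have "v - w = 0\<^sub>v m" using W by blast
    then have "v $ i = w $ i" if "i < m" for i using that vw by (metis carrier_vecD eq_iff_diff_eq_0 index_minus_vec(1) index_zero_vec(1))
    then show "v = w" using vw by (intro eq_vecI) auto
  qed
qed

text \<open>Schur's lemma: the kernel is zero and the image is everything. The inverse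
  \<open>S\<close> is assembled columnwise from preimages of the unit vectors, and it is
  \<open>S\<close> that witnesses the isomorphism.\<close>

lemma (in group) intertwiner_iso:
  assumes irs: "irreducible_rep G (m, s)" and irr: "irreducible_rep G (n, r)" and T: "T \<in> carrier_mat n m"
    and int: "\<And>g. g \<in> carrier G \<Longrightarrow> T * s g = r g * T"
    and nz: "u \<in> carrier_vec m" "T *\<^sub>v u \<noteq> 0\<^sub>v n"
  shows "rep_iso G (n, r) (m, s)"
proof -
  have s: "mat_rep G m s" and r: "mat_rep G n r" using irr irs irreducible_rep_iff by auto
  have inj: "inj_on (\<lambda>v. T *\<^sub>v v) (carrier_vec m)" by (rule intertwiner_injective[OF irs T mat_rep_carrier[OF r] int nz])
  have "(\<lambda>v. T *\<^sub>v v) ` carrier_vec m \<noteq> {0\<^sub>v n}" using nz by blast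
  then have surj: "(\<lambda>v. T *\<^sub>v v) ` carrier_vec m = carrier_vec n"
    using irr image_invariant[OF T s r int] unfolding irreducible_rep_iff fst_conv snd_conv by blast
  define p where "p j = (SOME v. v \<in> carrier_vec m \<and> T *\<^sub>v v = unit_vec n j)" for j
  have p: "p j \<in> carrier_vec m \<and> T *\<^sub>v p j = unit_vec n j" for j
  proof -
    have "unit_vec n j \<in> (\<lambda>v. T *\<^sub>v v) ` carrier_vec m" unfolding surj by simp
    then obtain v where "v \<in> carrier_vec m \<and> T *\<^sub>v v = unit_vec n j" by (metis (no_types, lifting) imageE)
    then show ?thesis unfolding p_def by (rule someI)
  qed
  define S where "S = mat m n (\<lambda>(i, j). p j $ i)"
  have S: "S \<in> carrier_mat m n" by (simp add: S_def)
  have colS: "S *\<^sub>v unit_vec n j = p j" if "j < n" for j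
    using that p[of j] by (intro eq_vecI) (auto simp: S_def)
  have TS: "T * S = 1\<^sub>m n"
  proof (rule mat_eq_by_vec)
    fix j assume j: "j < n"
    have "(T * S) *\<^sub>v unit_vec n j = T *\<^sub>v (S *\<^sub>v unit_vec n j)" using T S by simp
    then show "(T * S) *\<^sub>v unit_vec n j = 1\<^sub>m n *\<^sub>v unit_vec n j" using colS[OF j] p[of j] by simp
  qed (use T S in auto)
  have ST: "S * T = 1\<^sub>m m"
  proof (rule mat_eq_by_vec)
    fix j assume j: "j < m"
    have "T *\<^sub>v ((S * T) *\<^sub>v unit_vec m j) = (T * (S * T)) *\<^sub>v unit_vec m j"
      by (rule assoc_mult_mat_vec[OF T mult_carrier_mat[OF S T] unit_vec_carrier, symmetric])
    also have "T * (S * T) = (T * S) * T" by (rule assoc_mult_mat[OF T S T, symmetric])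
    also have "\<dots> = T" unfolding TS using T by simp
    finally have "(S * T) *\<^sub>v unit_vec m j = unit_vec m j"
      using inj_onD[OF inj, of "(S * T) *\<^sub>v unit_vec m j" "unit_vec m j"] T S by simp
    then show "(S * T) *\<^sub>v unit_vec m j = 1\<^sub>m m *\<^sub>v unit_vec m j" by simp
  qed (use T S in auto)
  have nm: "n = m" by (rule two_sided_inverse_square[OF T S TS ST])
  have "S * r g = s g * S" if g: "g \<in> carrier G" for g
  proof -
    have sg: "s g \<in> carrier_mat m m" and rg: "r g \<in> carrier_mat n n" using mat_rep_carrier[OF s g] mat_rep_carrier[OF r g] by auto
    have "S * r g = S * (r g * (T * S))" unfolding TS using rg by simp
    also have "\<dots> = S * ((r g * T) * S)" unfolding assoc_mult_mat[OF rg T S] ..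
    also have "\<dots> = S * (r g * T) * S" by (rule assoc_mult_mat[OF S mult_carrier_mat[OF rg T] S, symmetric])
    also have "\<dots> = S * (T * s g) * S" unfolding int[OF g] ..
    also have "S * (T * s g) = (S * T) * s g" by (rule assoc_mult_mat[OF S T sg, symmetric])
    also have "S * T * s g * S = s g * S" unfolding ST using sg S by simp
    finally show ?thesis .
  qed
  moreover have "S \<in> carrier (GL n)" by (rule GL_I[of _ _ T]) (use S T TS ST nm in auto)
  ultimately show ?thesis unfolding rep_iso_def using nm by auto
qed

context left_transversal
begin

text \<open>The induced representation restricted to a normal subgroup \<open>K\<close> on which \<open>\<theta>\<close> has stabilizer
  \<open>N\<close> is diagonal with distinct characters, so the coordinate projections are in the span of \<open>K\<close>.\<close>

lemma ind_char_diag: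
  assumes "k \<in> carrier G" "inv (x i) \<otimes> k \<otimes> x i \<in> N" "i < r" "v \<in> carrier_vec r"
  shows "(ind_char G N xs \<theta> k *\<^sub>v v) $ i = \<theta> (inv (x i) \<otimes> k \<otimes> x i) * v $ i"
  by (rule ind_char_apply) (use assms in auto)

lemma ind_char_irreducible:
  assumes th: "is_char G N \<theta>" and K: "subgroup K G" "K \<subseteq> N"
    and norm: "\<And>g k. g \<in> carrier G \<Longrightarrow> k \<in> K \<Longrightarrow> inv g \<otimes> k \<otimes> g \<in> K"
    and stab: "\<And>g. g \<in> carrier G \<Longrightarrow> \<forall>k\<in>K. \<theta> (inv g \<otimes> k \<otimes> g) = \<theta> k \<Longrightarrow> g \<in> N"
  shows "irreducible_rep G (r, ind_char G N xs \<theta>)"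
  unfolding irreducible_rep_iff fst_conv snd_conv
proof (intro conjI allI impI)
  let ?I = "ind_char G N xs \<theta>"
  show rep: "mat_rep G r ?I" by (rule ind_char_rep[OF th])
  show "0 < r" using ex1[OF one_closed] by auto
  fix W assume W: "invariant_subspace G r ?I W"
  have Kc: "k \<in> carrier G" if "k \<in> K" for k using that K Nc by auto
  have Wc: "v \<in> carrier_vec r" if "v \<in> W" for v using W that unfolding invariant_subspace_def by auto
  define \<eta> where "\<eta> i k = \<theta> (inv (x i) \<otimes> k \<otimes> x i)" for i k
  have kN: "inv (x i) \<otimes> k \<otimes> x i \<in> K" if "i < r" "k \<in> K" for i k using norm that by auto
  have e0: "\<eta> i k \<noteq> 0" if "i < r" "k \<in> K" for i k
    using kN[OF that] th K unfolding \<eta>_def is_char_def by auto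
  have em: "\<eta> i (k \<otimes> l) = \<eta> i k * \<eta> i l" if "i < r" "k \<in> K" "l \<in> K" for i k l
  proof -
    have "inv (x i) \<otimes> (k \<otimes> l) \<otimes> x i = (inv (x i) \<otimes> k \<otimes> x i) \<otimes> (inv (x i) \<otimes> l \<otimes> x i)"
      using that Kc by (simp add: m_assoc)
    then show ?thesis using kN[OF that(1,2)] kN[OF that(1,3)] th K unfolding \<eta>_def is_char_def by auto
  qed
  have distinct: "\<exists>k\<in>K. \<eta> i k \<noteq> \<eta> j k" if ij: "i < r" "j < r" "i \<noteq> j" for i j
  proof (rule ccontr)
    assume "\<not> ?thesis"
    then have eq: "\<eta> i k = \<eta> j k" if "k \<in> K" for k using that by blast
    \<comment> \<open>If two coordinate characters agreed on \<open>K\<close>, this quotient of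
      coset representatives would stabilize \<theta> on \<open>K\<close>, hence lie in
      \<open>N\<close>, against the choice of a transversal.\<close>
    let ?g = "inv (x j) \<otimes> x i"
    have "\<theta> (inv ?g \<otimes> k \<otimes> ?g) = \<theta> k" if k: "k \<in> K" for k
    proof -
      let ?k = "x j \<otimes> k \<otimes> inv (x j)"
      have "?k \<in> K" using norm[of "inv (x j)" k] ij k by simp
      from eq[OF this] show ?thesis using ij Kc[OF k] by (simp add: \<eta>_def m_assoc inv_mult_group)
    qed
    then have "?g \<in> N" using stab[of ?g] ij by simp
    then show False using same[of j i] ij by simp
  qed
  have unit: "unit_vec r i \<in> W" if w: "w \<in> W" "i < r" "w $ i \<noteq> 0" for w i
  proof -
    have wc: "w \<in> carrier_vec r" using Wc w by auto
    \<comment> \<open>Up to the factor \<open>card K\<close> this is the projection onto the i-th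
      coordinate, because distinct characters of \<open>K\<close> are orthogonal.\<close>
    let ?v = "vsum r K (\<lambda>k. inverse (\<eta> i k) \<cdot>\<^sub>v (?I k *\<^sub>v w))"
    have "?v \<in> W"
      by (rule vsum_mem[OF W finite_sub[OF K(1)]]) (use W w Kc in \<open>auto simp: invariant_subspace_def\<close>)
    moreover have "?v = (of_nat (card K) * w $ i) \<cdot>\<^sub>v unit_vec r i"
    proof (rule eq_vecI)
      fix j assume "j < dim_vec ((of_nat (card K) * w $ i) \<cdot>\<^sub>v unit_vec r i)"
      then have j: "j < r" by simp
      have c: "(inverse (\<eta> i k) \<cdot>\<^sub>v (?I k *\<^sub>v w)) $ j = (inverse (\<eta> i k) * \<eta> j k) * w $ j" if k: "k \<in> K" for k
      proof -
        have "(?I k *\<^sub>v w) $ j = \<eta> j k * w $ j"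
          unfolding \<eta>_def by (rule ind_char_diag) (use kN k j K Kc wc in auto)
        moreover have "dim_vec (?I k *\<^sub>v w) = r" by (simp add: ind_char_def)
        ultimately show ?thesis using j by (simp del: index_mult_mat_vec dim_mult_mat_vec)
      qed
      have "?v $ j = (\<Sum>k\<in>K. inverse (\<eta> i k) * \<eta> j k) * w $ j"
        using j c by (simp add: sum_distrib_right del: index_mult_mat_vec index_smult_vec)
      also have "\<dots> = ((of_nat (card K) * w $ i) \<cdot>\<^sub>v unit_vec r i) $ j"
      proof (cases "j = i")
        case True
        have "(\<Sum>k\<in>K. inverse (\<eta> i k) * \<eta> i k) = (\<Sum>k\<in>K. 1)"
          by (rule sum.cong) (use e0 w in auto)
        then show ?thesis using True j by simp
      next
        case False
        obtain k where k: "k \<in> K" "\<eta> i k \<noteq> \<eta> j k" using distinct[of i j] j w False by auto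
        have "(\<Sum>k\<in>K. inverse (\<eta> i k) * \<eta> j k) = 0"
          by (rule sum_char_eq_0[OF K(1) _ k(1)])
            (use e0[OF w(2)] e0[OF j] em[OF w(2)] em[OF j] k in \<open>auto simp: is_char_def field_simps\<close>)
        then show ?thesis using False j w(2) by simp
      qed
      finally show "?v $ j = ((of_nat (card K) * w $ i) \<cdot>\<^sub>v unit_vec r i) $ j" .
    qed (simp add: vsum_def)
    moreover have "card K > 0" using K finite_sub subgroup.one_closed card_gt_0_iff by blast
    ultimately have "inverse (of_nat (card K) * w $ i) \<cdot>\<^sub>v ((of_nat (card K) * w $ i) \<cdot>\<^sub>v unit_vec r i) \<in> W"
      using W unfolding invariant_subspace_def by metis
    moreover have "inverse (of_nat (card K) * w $ i) * (of_nat (card K) * w $ i) = 1"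
      using \<open>card K > 0\<close> w by (intro left_inverse) simp
    ultimately show ?thesis by (metis one_smult_vec smult_smult_assoc)
  qed
  show "W = {0\<^sub>v r} \<or> W = carrier_vec r"
  proof (cases "W = {0\<^sub>v r}")
    case False
    then obtain w where "w \<in> W" "w \<noteq> 0\<^sub>v r" using W unfolding invariant_subspace_def by blast
    then obtain i where i: "i < r" "unit_vec r i \<in> W" using unit Wc vec_nonzeroE by metis
    have all: "unit_vec r j \<in> W" if j: "j < r" for j
    proof -
      let ?g = "x j \<otimes> inv (x i)"
      have h: "inv (x j) \<otimes> ?g \<otimes> x i = \<one>" using i j by (simp add: m_assoc)
      have "?I ?g *\<^sub>v unit_vec r i = \<theta> (inv (x j) \<otimes> ?g \<otimes> x i) \<cdot>\<^sub>v unit_vec r j"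
        by (rule ind_char_unit) (use i j h N in \<open>auto simp: subgroup.one_closed\<close>)
      then have "?I ?g *\<^sub>v unit_vec r i = unit_vec r j" using h is_char_one[OF N th] by simp
      then show ?thesis using W i j unfolding invariant_subspace_def by (metis inv_closed m_closed xc)
    qed
    have "v \<in> W" if v: "v \<in> carrier_vec r" for v
    proof -
      have "vsum r {..<r} (\<lambda>j. v $ j \<cdot>\<^sub>v unit_vec r j) \<in> W"
        by (rule vsum_mem[OF W]) (use all W in \<open>auto simp: invariant_subspace_def\<close>)
      then show ?thesis using vec_expand[OF v] by simp
    qed
    then show ?thesis using Wc by blast
  qed simp
qed

text \<open>Take the representative of the coset \<open>N\<close> itself: its basis vector spans a
  copy of the inducing character.\<close>

lemma ind_char_eigenvector:
  obtains i where "i < r" "x i \<in> N"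
    "\<And>\<theta> n. is_char G N \<theta> \<Longrightarrow> n \<in> N \<Longrightarrow> ind_char G N xs \<theta> n *\<^sub>v unit_vec r i = \<theta> n \<cdot>\<^sub>v unit_vec r i"
proof -
  obtain i where i: "i < r" "inv (x i) \<otimes> \<one> \<in> N" using ex1[OF one_closed] by blast
  then have "inv (inv (x i)) \<in> N" using N subgroup.m_inv_closed by fastforce
  then have xi: "x i \<in> N" using i by simp
  have "ind_char G N xs \<theta> n *\<^sub>v unit_vec r i = \<theta> n \<cdot>\<^sub>v unit_vec r i" if th: "is_char G N \<theta>" and n: "n \<in> N" for \<theta> n
  proof -
    have h: "inv (x i) \<otimes> n \<otimes> x i \<in> N" using n xi N by (simp add: subgroup.m_closed subgroup.m_inv_closed)
    have ix: "inv (x i) \<in> N" "inv (x i) \<otimes> n \<in> N" using xi n N by (auto simp: subgroup.m_closed subgroup.m_inv_closed)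
    have tm: "\<And>a b. a \<in> N \<Longrightarrow> b \<in> N \<Longrightarrow> \<theta> (a \<otimes> b) = \<theta> a * \<theta> b" and t0: "\<theta> (x i) \<noteq> 0" using th xi unfolding is_char_def by auto
    have "\<theta> (inv (x i) \<otimes> n \<otimes> x i) = \<theta> n"
      using tm[OF ix(2) xi] tm[OF ix(1) n] is_char_inv[OF N th xi] t0 by (simp add: field_simps)
    then show ?thesis using ind_char_unit[OF Nc[OF n] i(1) i(1) h, of \<theta>] by simp
  qed
  then show thesis using that i xi by blast
qed

end

text \<open>Frobenius reciprocity: sending the basis vector of the coset of \<open>x i\<close> to
  \<open>\<sigma> (x i) *\<^sub>v v\<close> is an intertwiner from the induced representation. It is
  nonzero, so Schur's lemma applies.\<close>

lemma (in finite_grp) eigenvector_ind_iso: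
  assumes irr: "irreducible_rep G \<rho>" and N: "subgroup N G" and th: "is_char G N \<theta>"
    and ind: "irreducible_rep G (ind_rep G N (char_rep \<theta>))"
    and v: "v \<in> carrier_vec (fst \<rho>)" "v \<noteq> 0\<^sub>v (fst \<rho>)" "\<And>h. h \<in> N \<Longrightarrow> snd \<rho> h *\<^sub>v v = \<theta> h \<cdot>\<^sub>v v"
  shows "rep_iso G \<rho> (ind_rep G N (char_rep \<theta>))"
proof -
  obtain n \<sigma> where rho: "\<rho> = (n, \<sigma>)" by (cases \<rho>)
  have rep: "mat_rep G n \<sigma>" using irr rho irreducible_rep_iff by auto
  obtain xs where lt: "left_transversal G N xs" and e: "ind_rep G N (char_rep \<theta>) = (length xs, ind_char G N xs \<theta>)"
    using ind_rep_char_cases[OF N] by blast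
  interpret left_transversal G N xs by (rule lt)
  define T where "T = mat n r (\<lambda>(a, i). (\<sigma> (x i) *\<^sub>v v) $ a)"
  have T: "T \<in> carrier_mat n r" by (simp add: T_def)
  have vn: "v \<in> carrier_vec n" using v rho by simp
  have xv: "\<sigma> (x i) *\<^sub>v v \<in> carrier_vec n" if "i < r" for i by (rule mat_rep_vec[OF rep xc[OF that] vn])
  have Tu: "T *\<^sub>v unit_vec r i = \<sigma> (x i) *\<^sub>v v" if "i < r" for i
  proof (rule eq_vecI)
    show "dim_vec (T *\<^sub>v unit_vec r i) = dim_vec (\<sigma> (x i) *\<^sub>v v)" using carrier_vecD[OF xv[OF that]] T by simp
    fix k assume "k < dim_vec (\<sigma> (x i) *\<^sub>v v)"
    then have k: "k < n" using carrier_vecD[OF xv[OF that]] by simp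
    have "(T *\<^sub>v unit_vec r i) $ k = T $$ (k, i)" using k that T by simp
    then show "(T *\<^sub>v unit_vec r i) $ k = (\<sigma> (x i) *\<^sub>v v) $ k" using k that by (simp add: T_def)
  qed
  have int: "T * ind_char G N xs \<theta> g = \<sigma> g * T" if g: "g \<in> carrier G" for g
  proof (rule mat_eq_by_vec)
    have sg: "\<sigma> g \<in> carrier_mat n n" using mat_rep_carrier[OF rep g] .
    show "T * ind_char G N xs \<theta> g \<in> carrier_mat n r" "\<sigma> g * T \<in> carrier_mat n r" using T sg by auto
    fix j assume j: "j < r"
    obtain i where i: "i < r" "inv (x i) \<otimes> (g \<otimes> x j) \<in> N" using ex1[of "g \<otimes> x j"] g j by auto
    let ?h = "inv (x i) \<otimes> g \<otimes> x j"
    have h: "?h \<in> N" using i g j by (simp add: m_assoc)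
    have "(T * ind_char G N xs \<theta> g) *\<^sub>v unit_vec r j = T *\<^sub>v (\<theta> ?h \<cdot>\<^sub>v unit_vec r i)"
      unfolding ind_char_unit[OF g i(1) j h, symmetric] by (rule assoc_mult_mat_vec[OF T ind_char_carrier]) simp
    also have "\<dots> = \<sigma> (x i) *\<^sub>v (\<theta> ?h \<cdot>\<^sub>v v)"
      unfolding mult_mat_vec[OF T unit_vec_carrier] Tu[OF i(1)]
      by (rule mult_mat_vec[OF mat_rep_carrier[OF rep xc[OF i(1)]] vn, symmetric])
    also have "\<dots> = \<sigma> (x i) *\<^sub>v (\<sigma> ?h *\<^sub>v v)" using v(3)[OF h] rho by simp
    also have "\<dots> = \<sigma> (x i \<otimes> ?h) *\<^sub>v v" by (rule mat_rep_mult[OF rep _ _ vn, symmetric]) (use i h Nc in auto)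
    also have "x i \<otimes> ?h = g \<otimes> x j" using i g j by (simp add: m_assoc)
    also have "\<sigma> (g \<otimes> x j) *\<^sub>v v = \<sigma> g *\<^sub>v (T *\<^sub>v unit_vec r j)"
      unfolding Tu[OF j] by (rule mat_rep_mult[OF rep g _ vn]) (use j in simp)
    also have "\<dots> = (\<sigma> g * T) *\<^sub>v unit_vec r j" by (rule assoc_mult_mat_vec[OF sg T, symmetric]) simp
    finally show "(T * ind_char G N xs \<theta> g) *\<^sub>v unit_vec r j = (\<sigma> g * T) *\<^sub>v unit_vec r j" .
  qed
  obtain i where i: "i < r" using ex1[OF one_closed] by blast
  have "T *\<^sub>v unit_vec r i \<noteq> 0\<^sub>v n"
    unfolding Tu[OF i] by (rule mat_rep_nonzero[OF rep]) (use i v rho in auto)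
  then show ?thesis
    unfolding rho e by (intro intertwiner_iso[OF _ _ T int]) (use ind irr e rho in auto)
qed

text \<open>The isomorphism carries over the basis vector of the coset \<open>N\<close>.\<close>

lemma (in finite_grp) rep_iso_ind_eigenvector:
  assumes N: "subgroup N G" and th: "is_char G N \<theta>" and N': "subgroup N' G"
    and iso: "rep_iso G (ind_rep G N (char_rep \<theta>)) (ind_rep G N' (char_rep \<theta>'))"
  obtains xs v where "left_transversal G N' xs" "v \<in> carrier_vec (length xs)" "v \<noteq> 0\<^sub>v (length xs)"
    "\<And>n. n \<in> N \<Longrightarrow> ind_char G N' xs \<theta>' n *\<^sub>v v = \<theta> n \<cdot>\<^sub>v v"
proof -
  obtain xs where lt: "left_transversal G N xs" and e: "ind_rep G N (char_rep \<theta>) = (length xs, ind_char G N xs \<theta>)"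
    using ind_rep_char_cases[OF N] by blast
  interpret left_transversal G N xs by (rule lt)
  obtain ys where lt': "left_transversal G N' ys" and e': "ind_rep G N' (char_rep \<theta>') = (length ys, ind_char G N' ys \<theta>')"
    using ind_rep_char_cases[OF N'] by blast
  from iso obtain T where len: "length xs = length ys" and T: "T \<in> carrier (GL r)"
    and int: "\<And>g. g \<in> carrier G \<Longrightarrow> T * ind_char G N xs \<theta> g = ind_char G N' ys \<theta>' g * T"
    unfolding rep_iso_def e e' by auto
  obtain S where S: "S \<in> carrier (GL r)" "S * T = 1\<^sub>m r" using GL_E[OF T] by metis
  have Tc: "T \<in> carrier_mat r r" and Sc: "S \<in> carrier_mat r r" using T S GL_carrier_mat by auto
  obtain i where i: "i < r" "\<And>n. n \<in> N \<Longrightarrow> ind_char G N xs \<theta> n *\<^sub>v unit_vec r i = \<theta> n \<cdot>\<^sub>v unit_vec r i"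
    using ind_char_eigenvector th by metis
  let ?v = "T *\<^sub>v unit_vec r i"
  have "?v \<noteq> 0\<^sub>v r"
  proof
    assume "?v = 0\<^sub>v r"
    then have "S *\<^sub>v ?v = 0\<^sub>v r" using Sc by (intro eq_vecI) auto
    moreover have "S *\<^sub>v ?v = (S * T) *\<^sub>v unit_vec r i" by (rule assoc_mult_mat_vec[OF Sc Tc, symmetric]) simp
    ultimately have "unit_vec r i = (0\<^sub>v r :: complex vec)" using S by simp
    then have "unit_vec r i $ i = (0 :: complex)" using i by simp
    then show False using i by simp
  qed
  moreover have "ind_char G N' ys \<theta>' n *\<^sub>v ?v = \<theta> n \<cdot>\<^sub>v ?v" if n: "n \<in> N" for n
  proof -
    have c: "ind_char G N' ys \<theta>' n \<in> carrier_mat r r" using len ind_char_carrier by metis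
    have "ind_char G N' ys \<theta>' n *\<^sub>v ?v = (T * ind_char G N xs \<theta> n) *\<^sub>v unit_vec r i"
      unfolding int[OF Nc[OF n]] by (rule assoc_mult_mat_vec[OF c Tc, symmetric]) simp
    also have "\<dots> = T *\<^sub>v (ind_char G N xs \<theta> n *\<^sub>v unit_vec r i)"
      by (rule assoc_mult_mat_vec[OF Tc ind_char_carrier]) simp
    also have "\<dots> = \<theta> n \<cdot>\<^sub>v ?v" unfolding i(2)[OF n] by (rule mult_mat_vec[OF Tc]) simp
    finally show ?thesis .
  qed
  ultimately show thesis using that[OF lt', of ?v] len Tc by simp
qed

text \<open>On the second induced representation \<open>K\<close> acts diagonally by conjugates of
  \<theta>'. At a coordinate where the transported eigenvector is nonzero, the conjugate must equal
  \<theta> on \<open>K\<close>.\<close>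

lemma (in finite_grp) rep_iso_ind_conj:
  assumes N: "subgroup N G" and th: "is_char G N \<theta>" and N': "subgroup N' G"
    and iso: "rep_iso G (ind_rep G N (char_rep \<theta>)) (ind_rep G N' (char_rep \<theta>'))"
    and K: "K \<subseteq> N" "K \<subseteq> N'"
    and norm: "\<And>g k. g \<in> carrier G \<Longrightarrow> k \<in> K \<Longrightarrow> inv g \<otimes> k \<otimes> g \<in> K"
  shows "\<exists>g\<in>carrier G. \<forall>k\<in>K. \<theta>' (inv g \<otimes> k \<otimes> g) = \<theta> k"
proof -
  obtain xs v where lt: "left_transversal G N' xs" and v: "v \<in> carrier_vec (length xs)" "v \<noteq> 0\<^sub>v (length xs)"
    "\<And>n. n \<in> N \<Longrightarrow> ind_char G N' xs \<theta>' n *\<^sub>v v = \<theta> n \<cdot>\<^sub>v v"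
    using rep_iso_ind_eigenvector[OF N th N' iso] by metis
  interpret left_transversal G N' xs by (rule lt)
  obtain i where i: "i < r" "v $ i \<noteq> 0" using vec_nonzeroE[OF v(1,2)] by blast
  have "\<theta>' (inv (x i) \<otimes> k \<otimes> x i) = \<theta> k" if k: "k \<in> K" for k
  proof -
    have kc: "k \<in> carrier G" using k K Nc by auto
    have "(ind_char G N' xs \<theta>' k *\<^sub>v v) $ i = \<theta>' (inv (x i) \<otimes> k \<otimes> x i) * v $ i"
      by (rule ind_char_diag[OF kc _ i(1) v(1)]) (use norm[OF _ k] K i in auto)
    moreover have "(ind_char G N' xs \<theta>' k *\<^sub>v v) $ i = \<theta> k * v $ i"
      using v(3)[of k] k K i v(1) by (auto simp del: index_mult_mat_vec)
    ultimately show ?thesis using i by simp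
  qed
  then show ?thesis using i xc by blast
qed

text \<open>As in \<open>rep_iso_ind_conj\<close>, a coordinate \<open>i\<close> gives a conjugate
  of \<theta>' agreeing with \<theta>. By \<open>stab\<close> the conjugating element
  \<open>x i\<close> lies in \<open>N\<close>, where conjugation does not change a one-dimensional
  character.\<close>

lemma (in finite_grp) rep_iso_ind_eq:
  assumes N: "subgroup N G" and th: "is_char G N \<theta>" and th': "is_char G N \<theta>'"
    and iso: "rep_iso G (ind_rep G N (char_rep \<theta>)) (ind_rep G N (char_rep \<theta>'))"
    and K: "K \<subseteq> N"
    and norm: "\<And>g k. g \<in> carrier G \<Longrightarrow> k \<in> K \<Longrightarrow> inv g \<otimes> k \<otimes> g \<in> K"
    and stab: "\<And>g. g \<in> carrier G \<Longrightarrow> \<forall>k\<in>K. \<theta>' (inv g \<otimes> k \<otimes> g) = \<theta> k \<Longrightarrow> g \<in> N"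
    and n: "n \<in> N"
  shows "\<theta> n = \<theta>' n"
proof -
  obtain xs v where lt: "left_transversal G N xs" and v: "v \<in> carrier_vec (length xs)" "v \<noteq> 0\<^sub>v (length xs)"
    "\<And>n. n \<in> N \<Longrightarrow> ind_char G N xs \<theta>' n *\<^sub>v v = \<theta> n \<cdot>\<^sub>v v"
    using rep_iso_ind_eigenvector[OF N th N iso] by metis
  interpret left_transversal G N xs by (rule lt)
  obtain i where i: "i < r" "v $ i \<noteq> 0" using vec_nonzeroE[OF v(1,2)] by blast
  have ev: "\<theta>' (inv (x i) \<otimes> k \<otimes> x i) = \<theta> k" if k: "k \<in> N" "inv (x i) \<otimes> k \<otimes> x i \<in> N" for k
  proof -
    have "(ind_char G N xs \<theta>' k *\<^sub>v v) $ i = \<theta>' (inv (x i) \<otimes> k \<otimes> x i) * v $ i"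
      by (rule ind_char_diag[OF Nc[OF k(1)] k(2) i(1) v(1)])
    moreover have "(ind_char G N xs \<theta>' k *\<^sub>v v) $ i = \<theta> k * v $ i"
      using v(3)[of k] k i v(1) by (auto simp del: index_mult_mat_vec)
    ultimately show ?thesis using i by simp
  qed
  have xi: "x i \<in> N"
    by (rule stab) (use ev norm[of "x i"] K i in auto)
  then have ix: "inv (x i) \<in> N" "inv (x i) \<otimes> n \<in> N" "inv (x i) \<otimes> n \<otimes> x i \<in> N"
    using n N by (auto simp: subgroup.m_closed subgroup.m_inv_closed)
  have tm: "\<And>a b. a \<in> N \<Longrightarrow> b \<in> N \<Longrightarrow> \<theta>' (a \<otimes> b) = \<theta>' a * \<theta>' b" and t0: "\<theta>' (x i) \<noteq> 0"
    using th' xi unfolding is_char_def by auto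
  have "\<theta>' (inv (x i) \<otimes> n \<otimes> x i) = \<theta>' n"
    using tm[OF ix(2) xi] tm[OF ix(1) n] is_char_inv[OF N th' xi] t0 by (simp add: field_simps)
  then show ?thesis using ev[OF n ix(3)] by simp
qed

section \<open>Frobenius reciprocity for representations pulled back from a quotient\<close>

lemma (in group) bij_right_mult:
  assumes "subgroup H G" "h \<in> H" shows "bij_betw (\<lambda>x. x \<otimes> h) H H"
proof (rule bij_betwI[where g = "\<lambda>x. x \<otimes> inv h"])
  show "(\<lambda>x. x \<otimes> h) \<in> H \<rightarrow> H" "(\<lambda>x. x \<otimes> inv h) \<in> H \<rightarrow> H"
    using assms by (auto simp: subgroup.m_closed subgroup.m_inv_closed)
  have Hc: "a \<in> carrier G" if "a \<in> H" for a using assms that by (simp add: subgroup.mem_carrier)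
  show "x \<otimes> h \<otimes> inv h = x" "x \<otimes> inv h \<otimes> h = x" if "x \<in> H" for x
    using Hc[OF that] Hc[OF assms(2)] by (simp_all add: m_assoc)
qed

definition regular_rep :: "('g, 'x) monoid_scheme \<Rightarrow> 'g list \<Rightarrow> 'g \<Rightarrow> complex mat" where
  "regular_rep L ys l = mat (length ys) (length ys) (\<lambda>(a, b). if ys ! a = l \<otimes>\<^bsub>L\<^esub> ys ! b then 1 else 0)"

lemma (in group) regular_rep:
  assumes ys: "set ys = carrier G" "distinct ys"
  shows "mat_rep G (length ys) (regular_rep G ys)"
  unfolding mat_rep_def
proof (intro conjI ballI)
  let ?m = "length ys"
  have yc: "ys ! a \<in> carrier G" if "a < ?m" for a using nth_mem[OF that] ys by simp
  have inj: "ys ! a = ys ! b \<longleftrightarrow> a = b" if "a < ?m" "b < ?m" for a b by (rule nth_eq_iff_index_eq[OF ys(2) that])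
  show "regular_rep G ys g \<in> carrier_mat ?m ?m" for g by (simp add: regular_rep_def)
  show "regular_rep G ys \<one> = 1\<^sub>m ?m"
    using yc inj by (intro eq_matI) (auto simp: regular_rep_def)
  fix g h assume gh: "g \<in> carrier G" "h \<in> carrier G"
  show "regular_rep G ys (g \<otimes> h) = regular_rep G ys g * regular_rep G ys h"
  proof (rule eq_matI)
    fix a c assume "a < dim_row (regular_rep G ys g * regular_rep G ys h)" "c < dim_col (regular_rep G ys g * regular_rep G ys h)"
    then have ac: "a < ?m" "c < ?m" by (simp_all add: regular_rep_def)
    obtain b where b: "b < ?m" "ys ! b = h \<otimes> ys ! c" using in_set_conv_nth[of "h \<otimes> ys ! c" ys] ys(1) gh yc[OF ac(2)] by auto
    have "(regular_rep G ys g * regular_rep G ys h) $$ (a, c) =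
        (\<Sum>b<?m. regular_rep G ys g $$ (a, b) * regular_rep G ys h $$ (b, c))"
      by (rule mat_mult_index) (use ac in \<open>auto simp: regular_rep_def\<close>)
    also have "\<dots> = regular_rep G ys g $$ (a, b) * regular_rep G ys h $$ (b, c)"
    proof (rule sum_single)
      fix b' assume b': "b' \<in> {..<?m}" "b' \<noteq> b"
      then have "ys ! b' \<noteq> h \<otimes> ys ! c" using inj[of b' b] b by simp
      then show "regular_rep G ys g $$ (a, b') * regular_rep G ys h $$ (b', c) = 0"
        using b' ac by (simp add: regular_rep_def)
    qed (use b in auto)
    also have "\<dots> = regular_rep G ys (g \<otimes> h) $$ (a, c)"
      using ac b gh yc by (simp add: regular_rep_def m_assoc)
    finally show "regular_rep G ys (g \<otimes> h) $$ (a, c) = (regular_rep G ys g * regular_rep G ys h) $$ (a, c)" by simp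
  qed (simp_all add: regular_rep_def)
qed

text \<open>Frobenius reciprocity with the regular representation of \<open>L\<close>: an \<open>U\<close>-invariant functional on
  \<open>\<rho>\<close>, where \<open>U\<close> is the kernel of \<open>\<phi>\<close>, embeds \<open>\<rho>\<close> into the representation induced from its pullback.\<close>

lemma (in finite_grp) fixed_vector_contained:
  assumes irr: "irreducible_rep G \<rho>" and Q: "subgroup Q G" and L: "group L" "finite (carrier L)"
    and phi: "\<And>a. a \<in> Q \<Longrightarrow> \<phi> a \<in> carrier L"
      "\<And>a b. a \<in> Q \<Longrightarrow> b \<in> Q \<Longrightarrow> \<phi> (a \<otimes> b) = \<phi> a \<otimes>\<^bsub>L\<^esub> \<phi> b"
    and w: "w \<in> carrier_vec (fst \<rho>)" "w \<noteq> 0\<^sub>v (fst \<rho>)"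
      "\<And>a. a \<in> Q \<Longrightarrow> \<phi> a = \<one>\<^bsub>L\<^esub> \<Longrightarrow> snd \<rho> a *\<^sub>v w = w"
  shows "\<exists>\<sigma>. is_rep L \<sigma> \<and> rep_contained G \<rho> (ind_rep G Q (pullback \<phi> \<sigma>))"
proof -
  interpret L: group L by fact
  obtain n s where rho: "\<rho> = (n, s)" by (cases \<rho>)
  have s: "mat_rep G n s" using irr rho irreducible_rep_iff by auto
  have wn: "w \<in> carrier_vec n" "w \<noteq> 0\<^sub>v n" "\<And>a. a \<in> Q \<Longrightarrow> \<phi> a = \<one>\<^bsub>L\<^esub> \<Longrightarrow> s a *\<^sub>v w = w" using w rho by auto
  have Qc: "a \<in> carrier G" if "a \<in> Q" for a using Q that by (simp add: subgroup.mem_carrier)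
  obtain ys where ys: "set ys = carrier L" "distinct ys" using finite_distinct_list[OF L(2)] by blast
  define m where "m = length ys"
  let ?\<sigma> = "(m, regular_rep L ys)"
  have is_rep: "is_rep L ?\<sigma>" unfolding L.is_rep_iff using L.regular_rep[OF ys] m_def by simp
  have yc: "ys ! a \<in> carrier L" if "a < m" for a using nth_mem[of a ys] that ys m_def by simp
  define U where "U = {a \<in> Q. \<phi> a = \<one>\<^bsub>L\<^esub>}"
  have phi1: "\<phi> \<one> = \<one>\<^bsub>L\<^esub>"
    using phi(1)[of \<one>] phi(2)[of \<one> \<one>] Q by (simp add: subgroup.one_closed L.r_cancel_one')
  have U: "subgroup U G"
    by (rule subgroup_finiteI[of _ \<one>])
      (use Q Qc phi phi1 in \<open>auto simp: U_def subgroup.one_closed subgroup.m_closed\<close>)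
  obtain i0 where i0: "i0 < n" "w $ i0 \<noteq> 0" using vec_nonzeroE[OF wn(1,2)] by blast
  have sc: "s g \<in> carrier_mat n n" if "g \<in> carrier G" for g using mat_rep_carrier[OF s that] .
  \<comment> \<open>A coordinate functional averaged over \<open>U\<close>. It is nonzero on
    \<open>w\<close> because \<open>U\<close> fixes \<open>w\<close> and the coordinate
    \<open>i0\<close> of \<open>w\<close> is nonzero.\<close>
  define f where "f v = (\<Sum>h\<in>U. (s h *\<^sub>v v) $ i0)" for v
  have Xc: "h \<in> carrier G" if "h \<in> U" for h using that Qc U_def by auto
  have f_inv: "f (s h *\<^sub>v v) = f v" if h: "h \<in> U" and v: "v \<in> carrier_vec n" for h v
  proof -
    have "f (s h *\<^sub>v v) = (\<Sum>k\<in>U. (s (k \<otimes> h) *\<^sub>v v) $ i0)"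
      unfolding f_def by (rule sum.cong) (use mat_rep_mult[OF s Xc Xc[OF h] v] in auto)
    also have "\<dots> = f v" unfolding f_def by (rule sum.reindex_bij_betw[OF bij_right_mult[OF U h]])
    finally show ?thesis .
  qed
  have "f w = (\<Sum>h\<in>U. w $ i0)" unfolding f_def by (rule sum.cong) (use wn U_def in auto)
  moreover have "card U > 0" using U finite_sub subgroup.one_closed card_gt_0_iff by blast
  ultimately have fw: "f w \<noteq> 0" using i0 by simp
  define c where "c k = (\<Sum>h\<in>U. s h $$ (i0, k))" for k
  have fc: "f v = (\<Sum>k<n. c k * v $ k)" if v: "v \<in> carrier_vec n" for v
  proof -
    have "f v = (\<Sum>h\<in>U. \<Sum>k<n. s h $$ (i0, k) * v $ k)"
      unfolding f_def by (rule sum.cong[OF refl]) (rule mat_vec_index[OF sc[OF Xc] v i0(1)])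
    then show ?thesis unfolding c_def by (subst (asm) sum.swap) (simp add: sum_distrib_right)
  qed
  obtain xs where lt: "left_transversal G Q xs" and e: "ind_rep G Q (pullback \<phi> ?\<sigma>) = (length xs * m, \<lambda>g.
      mat (length xs * m) (length xs * m) (\<lambda>(i, j).
         let h = inv (xs ! (i div m)) \<otimes> g \<otimes> (xs ! (j div m)) in
         if h \<in> Q then regular_rep L ys (\<phi> h) $$ (i mod m, j mod m) else 0))" (is "_ = (_, ?I)")
    by (rule ind_rep_cases[OF Q, of "pullback \<phi> ?\<sigma>"]) (simp only: pullback_def fst_conv snd_conv comp_def)
  interpret left_transversal G Q xs by (rule lt)
  \<comment> \<open>A section of \<phi> over its image. Since \<phi> may miss elements of
    \<open>L\<close>, the rows of \<open>T\<close> indexed by missed elements are set to zero by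
    means of \<open>ok\<close>.\<close>
  define qq where "qq l = (SOME a. a \<in> Q \<and> \<phi> a = l)" for l
  have qq: "qq l \<in> Q \<and> \<phi> (qq l) = l" if "l \<in> \<phi> ` Q" for l
    unfolding qq_def by (rule someI_ex) (use that in auto)
  define y where "y p = x (p div m) \<otimes> qq (ys ! (p mod m))" for p
  define ok where "ok p \<longleftrightarrow> ys ! (p mod m) \<in> \<phi> ` Q" for p
  \<comment> \<open>The row of the coset \<open>x i\<close> and the group element
    \<open>\<phi> a\<close> is the functional sending \<open>v\<close> to \<open>f\<close> of the
    translate of \<open>v\<close> by the inverse of \<open>x i \<otimes> a\<close>. Invariance of
    \<open>f\<close> under \<open>U\<close> makes the choice of \<open>a\<close> harmless.\<close>
  define T where "T = mat (r * m) n (\<lambda>(p, j). if ok p then (\<Sum>k<n. c k * s (inv (y p)) $$ (k, j)) else 0)"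
  have T: "T \<in> carrier_mat (r * m) n" by (simp add: T_def)
  have dm: "p div m < r" "p mod m < m" if "p < r * m" for p
    using that less_mult_imp_div_less[of p r m] by (cases "m = 0"; simp)+
  have ycl: "y p \<in> carrier G" if "p < r * m" "ok p" for p
    using dm[OF that(1)] qq[of "ys ! (p mod m)"] that(2) Qc unfolding y_def ok_def by auto
  have Tv: "(T *\<^sub>v v) $ p = (if ok p then f (s (inv (y p)) *\<^sub>v v) else 0)" if p: "p < r * m" and v: "v \<in> carrier_vec n" for p v
  proof (cases "ok p")
    case True
    have "f (s (inv (y p)) *\<^sub>v v) = (\<Sum>k<n. c k * (\<Sum>j<n. s (inv (y p)) $$ (k, j) * v $ j))"
      using fc[OF mat_rep_vec[OF s inv_closed[OF ycl[OF p True]] v]] mat_vec_index[OF sc[OF inv_closed[OF ycl[OF p True]]] v]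
      by (simp del: index_mult_mat_vec)
    also have "\<dots> = (\<Sum>j<n. T $$ (p, j) * v $ j)"
      unfolding sum_distrib_left by (subst sum.swap) (simp add: T_def p True sum_distrib_right mult.assoc)
    finally show ?thesis using mat_vec_index[OF T v p] True by simp
  next
    case False
    then show ?thesis unfolding mat_vec_index[OF T v p] by (simp add: T_def p)
  qed
  have I: "?I g \<in> carrier_mat (r * m) (r * m)" for g by simp
  have int: "T * s g = ?I g * T" if g: "g \<in> carrier G" for g
  proof (rule mat_eq_by_vec)
    show "T * s g \<in> carrier_mat (r * m) n" "?I g * T \<in> carrier_mat (r * m) n" using T sc[OF g] by auto
    fix k assume k: "k < n"
    let ?u = "unit_vec n k :: complex vec"
    have u: "?u \<in> carrier_vec n" by simp
    have su: "s g *\<^sub>v ?u \<in> carrier_vec n" by (rule mat_rep_vec[OF s g u])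
    have "T *\<^sub>v (s g *\<^sub>v ?u) = ?I g *\<^sub>v (T *\<^sub>v ?u)"
    proof (rule eq_vecI)
      fix p assume "p < dim_vec (?I g *\<^sub>v (T *\<^sub>v ?u))"
      then have p: "p < r * m" by simp
      define i a where "i = p div m" and "a = p mod m"
      have ia: "i < r" "a < m" using dm[OF p] i_def a_def by auto
      obtain j where j: "j < r" "inv (x i) \<otimes> g \<otimes> x j \<in> Q" using ex_row[OF g ia(1)] by blast
      define h where "h = inv (x i) \<otimes> g \<otimes> x j"
      have hQ: "h \<in> Q" using j h_def by simp
      have "inv\<^bsub>L\<^esub> (\<phi> h) \<otimes>\<^bsub>L\<^esub> ys ! a \<in> carrier L" using phi(1)[OF hQ] yc[OF ia(2)] by simp
      then obtain b where b: "b < m" "ys ! b = inv\<^bsub>L\<^esub> (\<phi> h) \<otimes>\<^bsub>L\<^esub> ys ! a" using in_set_conv_nth[of "inv\<^bsub>L\<^esub> (\<phi> h) \<otimes>\<^bsub>L\<^esub> ys ! a" ys] ys(1) m_def by auto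
      have ab: "ys ! a = \<phi> h \<otimes>\<^bsub>L\<^esub> ys ! b" unfolding b(2) using phi(1)[OF hQ] yc[OF ia(2)] by simp
      \<comment> \<open>The only column at which row \<open>p\<close> of the induced matrix is
        nonzero, and the entry there is 1: block \<open>j\<close> is determined by \<open>g\<close>,
        and position \<open>b\<close> by left translation in \<open>L\<close>.\<close>
      define p' where "p' = j * m + b"
      have p': "p' div m = j" "p' mod m = b" using b p'_def by auto
      have p'r: "p' < r * m"
      proof -
        have "p' < Suc j * m" using b by (simp add: p'_def)
        also have "\<dots> \<le> r * m" using j by (intro mult_le_mono1) simp
        finally show ?thesis .
      qed
      have "(?I g *\<^sub>v (T *\<^sub>v ?u)) $ p = (\<Sum>p'<r * m. ?I g $$ (p, p') * (T *\<^sub>v ?u) $ p')"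
        by (rule mat_vec_index[OF I _ p]) (use T in auto)
      also have "\<dots> = ?I g $$ (p, p') * (T *\<^sub>v ?u) $ p'"
      proof (rule sum_single)
        fix p'' assume p'': "p'' \<in> {..<r * m}" "p'' \<noteq> p'"
        have "?I g $$ (p, p'') = 0"
        proof (rule ccontr)
          assume nz: "?I g $$ (p, p'') \<noteq> 0"
          have d: "p'' div m < r" "p'' mod m < m" using dm p'' by auto
          let ?h = "inv (x i) \<otimes> g \<otimes> x (p'' div m)"
          have ent: "?I g $$ (p, p'') = (if ?h \<in> Q then regular_rep L ys (\<phi> ?h) $$ (a, p'' mod m) else 0)"
            using p p'' by (simp add: i_def a_def Let_def)
          have h'': "?h \<in> Q" and reg: "regular_rep L ys (\<phi> ?h) $$ (a, p'' mod m) \<noteq> 0"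
            using nz unfolding ent by presburger+
          have pj: "p'' div m = j"
          proof -
            have "inv (inv (x i) \<otimes> g \<otimes> x (p'' div m)) \<in> Q" "inv h \<in> Q" using h'' hQ Q by (auto simp: subgroup.m_inv_closed)
            then have "inv (x (p'' div m)) \<otimes> (inv g \<otimes> x i) \<in> Q" "inv (x j) \<otimes> (inv g \<otimes> x i) \<in> Q"
              using d j g ia unfolding h_def by (simp_all add: inv_mult_group m_assoc)
            then show ?thesis by (intro uniq[of "inv g \<otimes> x i"]) (use d j g ia in auto)
          qed
          have "regular_rep L ys (\<phi> h) $$ (a, p'' mod m) \<noteq> 0" using reg unfolding pj h_def .
          then have "ys ! a = \<phi> h \<otimes>\<^bsub>L\<^esub> ys ! (p'' mod m)"
            using ia(2) d(2) unfolding m_def by (auto simp: regular_rep_def split: if_splits)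
          then have "\<phi> h \<otimes>\<^bsub>L\<^esub> ys ! (p'' mod m) = \<phi> h \<otimes>\<^bsub>L\<^esub> ys ! b" using ab by (rule trans[OF sym])
          then have "ys ! (p'' mod m) = ys ! b"
            by (rule L.l_cancel[OF _ yc[OF d(2)] yc[OF b(1)] phi(1)[OF hQ]])
          then have "p'' mod m = b" using nth_eq_iff_index_eq[OF ys(2), of "p'' mod m" b] d(2) b(1) unfolding m_def by blast
          then have "p'' = p'" using div_mult_mod_eq[of p'' m] unfolding pj p'_def by simp
          then show False using p''(2) by simp
        qed
        then show "?I g $$ (p, p'') * (T *\<^sub>v ?u) $ p'' = 0" by (simp del: index_mult_mat_vec)
      qed (use p'r in auto)
      also have "?I g $$ (p, p') = 1"
      proof -
        have "?I g $$ (p, p') = (if h \<in> Q then regular_rep L ys (\<phi> h) $$ (a, b) else 0)"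
          using p p'r by (simp add: i_def[symmetric] a_def[symmetric] p' h_def[symmetric] Let_def)
        also have "\<dots> = 1" using hQ ia(2) b(1) ab unfolding m_def by (simp add: regular_rep_def)
        finally show ?thesis .
      qed
      also have "1 * (T *\<^sub>v ?u) $ p' = (T *\<^sub>v (s g *\<^sub>v ?u)) $ p"
      proof -
        have okp: "ok p \<longleftrightarrow> ok p'"
        proof
          assume "ok p"
          then obtain a' where a': "a' \<in> Q" "ys ! a = \<phi> a'" unfolding ok_def a_def by auto
          have "\<phi> h \<otimes>\<^bsub>L\<^esub> \<phi> (inv h \<otimes> a') = \<phi> (h \<otimes> (inv h \<otimes> a'))"
            using phi(2)[of h "inv h \<otimes> a'"] hQ a' Q by (simp add: subgroup.m_closed subgroup.m_inv_closed)
          also have "\<dots> = \<phi> h \<otimes>\<^bsub>L\<^esub> ys ! b" using a' ab Qc hQ by simp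
          finally have "\<phi> (inv h \<otimes> a') = ys ! b"
            using phi(1) hQ a' Q yc[OF b(1)] by (simp add: subgroup.m_closed subgroup.m_inv_closed)
          moreover have "inv h \<otimes> a' \<in> Q" using hQ a' Q by (simp add: subgroup.m_closed subgroup.m_inv_closed)
          ultimately show "ok p'" unfolding ok_def p' by force
        next
          assume "ok p'"
          then obtain a' where "a' \<in> Q" "ys ! b = \<phi> a'" unfolding ok_def p' by auto
          then have "ys ! a = \<phi> (h \<otimes> a')" "h \<otimes> a' \<in> Q" using phi(2)[OF hQ, of a'] ab hQ Q by (auto simp: subgroup.m_closed)
          then show "ok p" unfolding ok_def a_def[symmetric] by force
        qed
        show ?thesis
        proof (cases "ok p")
          case True
          then have True': "ok p'" using okp by simp
          have qa: "qq (ys ! a) \<in> Q" "\<phi> (qq (ys ! a)) = ys ! a" "qq (ys ! b) \<in> Q" "\<phi> (qq (ys ! b)) = ys ! b"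
            using qq True True' unfolding ok_def p' a_def by auto
          \<comment> \<open>The two sections differ by an element of the kernel of \<phi>, which
            \<open>f\<close> absorbs.\<close>
          define h0 where "h0 = inv (qq (ys ! a)) \<otimes> (h \<otimes> qq (ys ! b))"
          have h0Q: "h0 \<in> Q" unfolding h0_def using qa hQ Q by (simp add: subgroup.m_closed subgroup.m_inv_closed)
          have "qq (ys ! a) \<otimes> h0 = h \<otimes> qq (ys ! b)" unfolding h0_def using qa hQ Qc by simp
          then have "ys ! a \<otimes>\<^bsub>L\<^esub> \<phi> h0 = ys ! a"
            using phi(2)[OF qa(1) h0Q] phi(2)[OF hQ qa(3)] qa ab by simp
          then have "\<phi> h0 = \<one>\<^bsub>L\<^esub>" using L.l_cancel_one[OF yc[OF ia(2)] phi(1)[OF h0Q]] by simp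
          then have h0X: "h0 \<in> U" using h0Q U_def by simp
          have yp: "y p = x i \<otimes> qq (ys ! a)" "y p' = x j \<otimes> qq (ys ! b)" unfolding y_def p' i_def a_def by auto
          have eq: "inv (y p) \<otimes> g = h0 \<otimes> inv (y p')"
            unfolding yp h0_def h_def using qa Qc ia j g by (simp add: inv_mult_group m_assoc)
          have "(T *\<^sub>v (s g *\<^sub>v ?u)) $ p = f (s (inv (y p)) *\<^sub>v (s g *\<^sub>v ?u))" using Tv[OF p su] True by simp
          also have "s (inv (y p)) *\<^sub>v (s g *\<^sub>v ?u) = s (inv (y p) \<otimes> g) *\<^sub>v ?u"
            by (rule mat_rep_mult[OF s inv_closed[OF ycl[OF p True]] g u, symmetric])
          also have "\<dots> = s h0 *\<^sub>v (s (inv (y p')) *\<^sub>v ?u)"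
            unfolding eq by (rule mat_rep_mult[OF s Xc[OF h0X] inv_closed[OF ycl[OF p'r True']] u])
          also have "f \<dots> = f (s (inv (y p')) *\<^sub>v ?u)"
            by (rule f_inv[OF h0X mat_rep_vec[OF s inv_closed[OF ycl[OF p'r True']] u]])
          also have "\<dots> = (T *\<^sub>v ?u) $ p'" using Tv[OF p'r u] True' by simp
          finally show ?thesis by simp
        next
          case False
          then show ?thesis using Tv[OF p su] Tv[OF p'r u] okp by simp
        qed
      qed
      finally show "(T *\<^sub>v (s g *\<^sub>v ?u)) $ p = (?I g *\<^sub>v (T *\<^sub>v ?u)) $ p" by simp
    qed (use T in auto)
    then show "(T * s g) *\<^sub>v ?u = (?I g * T) *\<^sub>v ?u"
      using assoc_mult_mat_vec[OF T sc[OF g] u] assoc_mult_mat_vec[OF I T u] by metis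
  qed
  obtain i where i: "i < r" using ex1[OF one_closed] by blast
  obtain a where a: "a < m" "ys ! a = \<one>\<^bsub>L\<^esub>" using in_set_conv_nth[of "\<one>\<^bsub>L\<^esub>" ys] ys(1) m_def by auto
  define p where "p = i * m + a"
  have pd: "p div m = i" "p mod m = a" using a p_def by auto
  have p: "p < r * m"
  proof -
    have "p < Suc i * m" using a by (simp add: p_def)
    also have "\<dots> \<le> r * m" using i by (intro mult_le_mono1) simp
    finally show ?thesis .
  qed
  have okp: "ok p" unfolding ok_def pd a(2) using phi1 Q subgroup.one_closed by (metis image_eqI)
  \<comment> \<open>The translation by \<open>y p\<close> is undone by row \<open>p\<close>, so that
    this coordinate of the image is \<open>f w\<close>.\<close>
  let ?u = "s (y p) *\<^sub>v w"
  have u: "?u \<in> carrier_vec n" by (rule mat_rep_vec[OF s ycl[OF p okp] wn(1)])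
  have "(T *\<^sub>v ?u) $ p = f w" using Tv[OF p u] okp mat_rep_inv(1)[OF s ycl[OF p okp] wn(1)] by simp
  then have "T *\<^sub>v ?u \<noteq> 0\<^sub>v (r * m)" using fw p by auto
  then have "inj_on (\<lambda>v. T *\<^sub>v v) (carrier_vec n)"
    by (intro intertwiner_injective[OF _ T I int u]) (use irr rho in auto)
  then have "rep_contained G \<rho> (ind_rep G Q (pullback \<phi> ?\<sigma>))"
    unfolding rep_contained_def e rho fst_conv snd_conv using T int by blast
  then show ?thesis using is_rep by blast
qed

text \<open>A row \<open>p\<close> of the embedding that does not kill the first unit vector is a
  functional invariant under the conjugate of \<open>U\<close> by \<open>x i\<close>. Averaging that
  unit vector over the conjugate therefore gives a nonzero fixed vector, and translating it by
  \<open>inv (x i)\<close> gives one fixed by \<open>U\<close> itself.\<close>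

lemma (in finite_grp) contained_fixed_vector:
  assumes s: "mat_rep G n s" and n: "n > 0" and Q: "subgroup Q G" and U: "subgroup U G" "U \<subseteq> Q"
    and triv: "\<And>h. h \<in> U \<Longrightarrow> snd \<tau> h = 1\<^sub>m (fst \<tau>)"
    and cont: "rep_contained G (n, s) (ind_rep G Q \<tau>)"
  obtains v where "v \<in> carrier_vec n" "v \<noteq> 0\<^sub>v n" "\<And>h. h \<in> U \<Longrightarrow> s h *\<^sub>v v = v"
proof -
  define m where "m = fst \<tau>"
  obtain xs where lt: "left_transversal G Q xs" and e: "ind_rep G Q \<tau> = (length xs * m, \<lambda>g.
      mat (length xs * m) (length xs * m) (\<lambda>(i, j).
         let h = inv (xs ! (i div m)) \<otimes> g \<otimes> (xs ! (j div m)) in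
         if h \<in> Q then snd \<tau> h $$ (i mod m, j mod m) else 0))" (is "_ = (_, ?I)")
    unfolding m_def using ind_rep_cases[OF Q] by blast
  interpret left_transversal G Q xs by (rule lt)
  have I: "?I g \<in> carrier_mat (r * m) (r * m)" for g by simp
  obtain T where T: "T \<in> carrier_mat (r * m) n" and inj: "inj_on (\<lambda>v. T *\<^sub>v v) (carrier_vec n)"
    and int: "\<And>g. g \<in> carrier G \<Longrightarrow> T * s g = ?I g * T"
    using cont unfolding rep_contained_def e fst_conv snd_conv by blast
  let ?u = "unit_vec n 0 :: complex vec"
  have u: "?u \<in> carrier_vec n" by simp
  have "?u \<noteq> 0\<^sub>v n" using n by (metis index_unit_vec(1) index_zero_vec(1) zero_neq_one)
  then have "T *\<^sub>v ?u \<noteq> T *\<^sub>v 0\<^sub>v n" using inj_onD[OF inj, of ?u "0\<^sub>v n"] by auto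
  moreover have "T *\<^sub>v 0\<^sub>v n = 0\<^sub>v (r * m)" using T by (intro eq_vecI) auto
  ultimately obtain p where p: "p < r * m" "(T *\<^sub>v ?u) $ p \<noteq> 0" using vec_nonzeroE[of "T *\<^sub>v ?u" "r * m"] T by auto
  define i where "i = p div m"
  have i: "i < r" "p mod m < m"
    using p less_mult_imp_div_less[of p r m] by (cases "m = 0"; simp add: i_def)+
  have Xc: "h \<in> carrier G" if "h \<in> U" for h using that U by (simp add: subgroup.mem_carrier)
  define k where "k h = x i \<otimes> h \<otimes> inv (x i)" for h
  have kc: "k h \<in> carrier G" if "h \<in> U" for h using Xc[OF that] i k_def by simp
  have row: "(T *\<^sub>v (s (k h) *\<^sub>v ?u)) $ p = (T *\<^sub>v ?u) $ p" if h: "h \<in> U" for h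
  proof -
    define F where "F p' = ?I (k h) $$ (p, p') * (T *\<^sub>v ?u) $ p'" for p'
    have eq: "T *\<^sub>v (s (k h) *\<^sub>v ?u) = ?I (k h) *\<^sub>v (T *\<^sub>v ?u)"
      using assoc_mult_mat_vec[OF T mat_rep_carrier[OF s kc[OF h]] u] assoc_mult_mat_vec[OF I T u] int[OF kc[OF h]] by metis
    have "(T *\<^sub>v (s (k h) *\<^sub>v ?u)) $ p = (\<Sum>p'<r * m. ?I (k h) $$ (p, p') * (T *\<^sub>v ?u) $ p')"
      unfolding eq by (rule mat_vec_index[OF I _ p(1)]) (use T in auto)
    also have "\<dots> = (\<Sum>p'<r * m. F p')" unfolding F_def ..
    also have "\<dots> = F p"
    proof (rule sum_single)
      fix p' assume p': "p' \<in> {..<r * m}" "p' \<noteq> p"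
      have "0 < m" using i(2) by simp
      then have j: "p' div m < r" "p' mod m < m" using p'(1) less_mult_imp_div_less[of p' r m] by simp_all
      have "?I (k h) $$ (p, p') = 0"
      proof (rule ccontr)
        assume nz: "?I (k h) $$ (p, p') \<noteq> 0"
        have 1: "inv (x i) \<otimes> k h \<otimes> x (p' div m) = h \<otimes> (inv (x i) \<otimes> x (p' div m))"
          unfolding k_def using Xc[OF h] i j by (simp add: m_assoc)
        have ent: "?I (k h) $$ (p, p') = (if h \<otimes> (inv (x i) \<otimes> x (p' div m)) \<in> Q
            then snd \<tau> (h \<otimes> (inv (x i) \<otimes> x (p' div m))) $$ (p mod m, p' mod m) else 0)"
          using p(1) p'(1) by (simp add: i_def[symmetric] 1 Let_def)
        have hh: "h \<otimes> (inv (x i) \<otimes> x (p' div m)) \<in> Q"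
          using nz unfolding ent by presburger
        have "inv h \<in> Q" using h U Q by (auto simp: subgroup.m_inv_closed)
        then have "inv h \<otimes> (h \<otimes> (inv (x i) \<otimes> x (p' div m))) \<in> Q" using hh Q by (simp add: subgroup.m_closed)
        then have "inv (x i) \<otimes> x (p' div m) \<in> Q" using Xc[OF h] i j by simp
        then have ij: "p' div m = i" using same i j by simp
        have "snd \<tau> h $$ (p mod m, p' mod m) \<noteq> 0"
          using nz hh i Xc[OF h] unfolding ent ij by simp
        then have "(1\<^sub>m m :: complex mat) $$ (p mod m, p' mod m) \<noteq> 0" using triv[OF h] m_def by simp
        then have "p mod m = p' mod m" using i(2) j(2) by (simp split: if_splits)
        then have "p' = p" using ij div_mult_mod_eq[of p m] div_mult_mod_eq[of p' m] unfolding i_def by simp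
        then show False using p'(2) by simp
      qed
      then show "F p' = 0" unfolding F_def by (simp only: mult_zero_left)
    qed (use p in auto)
    also have "F p = 1 * (T *\<^sub>v ?u) $ p"
    proof -
      have "inv (x i) \<otimes> k h \<otimes> x i = h" unfolding k_def using Xc[OF h] i by (simp add: m_assoc)
      moreover have "h \<in> Q" "snd \<tau> h $$ (p mod m, p mod m) = 1" using h U triv[OF h] i(2) m_def by auto
      ultimately have "?I (k h) $$ (p, p) = 1" using p(1) by (simp add: i_def[symmetric] Let_def)
      then show ?thesis unfolding F_def by (simp only:)
    qed
    finally show ?thesis by simp
  qed
  define v where "v = vsum n U (\<lambda>h. s (k h) *\<^sub>v ?u)"
  have vc: "v \<in> carrier_vec n" by (simp add: v_def)
  have "T *\<^sub>v v = vsum (r * m) U (\<lambda>h. T *\<^sub>v (s (k h) *\<^sub>v ?u))"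
    unfolding v_def by (rule mult_vsum[OF T]) (use mat_rep_vec[OF s kc u] in auto)
  then have "(T *\<^sub>v v) $ p = (\<Sum>h\<in>U. (T *\<^sub>v ?u) $ p)" using p row by (simp del: index_mult_mat_vec)
  moreover have "card U > 0" using U finite_sub subgroup.one_closed card_gt_0_iff by blast
  ultimately have "(T *\<^sub>v v) $ p \<noteq> 0" using p by (simp del: index_mult_mat_vec)
  moreover have "(T *\<^sub>v 0\<^sub>v n) $ p = 0" unfolding \<open>T *\<^sub>v 0\<^sub>v n = 0\<^sub>v (r * m)\<close> using p by simp
  ultimately have v0: "v \<noteq> 0\<^sub>v n" by metis
  have fix1: "s (k h) *\<^sub>v v = v" if h: "h \<in> U" for h
  proof -
    have kk: "k (h \<otimes> h') = k h \<otimes> k h'" if "h' \<in> U" for h'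
      unfolding k_def using Xc[OF h] Xc[OF that] i by (simp add: m_assoc)
    have "s (k h) *\<^sub>v v = vsum n U (\<lambda>h'. s (k h) *\<^sub>v (s (k h') *\<^sub>v ?u))"
      unfolding v_def by (rule mult_vsum[OF mat_rep_carrier[OF s kc[OF h]]]) (use mat_rep_vec[OF s kc u] in auto)
    also have "\<dots> = vsum n U (\<lambda>h'. s (k (h \<otimes> h')) *\<^sub>v ?u)"
      unfolding vsum_def using kk mat_rep_mult[OF s kc[OF h] kc u] by (intro eq_vecI) (auto simp del: index_mult_mat_vec)
    also have "\<dots> = v" unfolding v_def vsum_def
      by (intro eq_vecI) (auto simp: sum.reindex_bij_betw[OF bij_left_mult[OF U(1) h], of "\<lambda>h. (s (k h) *\<^sub>v ?u) $ _"]
        simp del: index_mult_mat_vec)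
    finally show ?thesis .
  qed
  show thesis
  proof (rule that[of "s (inv (x i)) *\<^sub>v v"])
    have ix: "inv (x i) \<in> carrier G" using i by simp
    show "s (inv (x i)) *\<^sub>v v \<in> carrier_vec n" by (rule mat_rep_vec[OF s ix vc])
    show "s (inv (x i)) *\<^sub>v v \<noteq> 0\<^sub>v n" by (rule mat_rep_nonzero[OF s ix vc v0])
    fix h assume h: "h \<in> U"
    have "s h *\<^sub>v (s (inv (x i)) *\<^sub>v v) = s (h \<otimes> inv (x i)) *\<^sub>v v" by (rule mat_rep_mult[OF s Xc[OF h] ix vc, symmetric])
    also have "h \<otimes> inv (x i) = inv (x i) \<otimes> k h" unfolding k_def using Xc[OF h] i by (simp add: m_assoc)
    also have "s (inv (x i) \<otimes> k h) *\<^sub>v v = s (inv (x i)) *\<^sub>v (s (k h) *\<^sub>v v)" by (rule mat_rep_mult[OF s ix kc[OF h] vc])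
    also have "\<dots> = s (inv (x i)) *\<^sub>v v" unfolding fix1[OF h] ..
    finally show "s h *\<^sub>v (s (inv (x i)) *\<^sub>v v) = s (inv (x i)) *\<^sub>v v" .
  qed
qed

section \<open>Filtrations by powers of a uniformizer\<close>

text \<open>Counts a set given by a redundant parametrization \<open>f\<close> through a second map
  \<open>g\<close> with the same fibres. The quotients, the groups and the characters below are all
  counted in this way.\<close>

lemma card_image_same_kernel:
  assumes "\<And>x y. x \<in> D \<Longrightarrow> y \<in> D \<Longrightarrow> f x = f y \<longleftrightarrow> g x = g y"
  shows "card (f ` D) = card (g ` D)"
proof -
  define h where "h c = g (SOME x. x \<in> D \<and> f x = c)" for c
  have h: "h (f x) = g x" if "x \<in> D" for x
  proof -
    have "(SOME y. y \<in> D \<and> f y = f x) \<in> D \<and> f (SOME y. y \<in> D \<and> f y = f x) = f x"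
      by (rule someI[of _ x]) (use that in auto)
    then show ?thesis unfolding h_def using assms[OF _ that] by blast
  qed
  have "bij_betw h (f ` D) (g ` D)"
    unfolding bij_betw_def inj_on_def using h assms by (auto simp: image_iff)
  then show ?thesis by (rule bij_betw_same_card)
qed

text \<open>A type class ring lying over the integers: \<open>J m\<close> is the preimage of the
  m-th power of the maximal ideal, \<open>t\<close> lifts a uniformizer, and \<open>cs m\<close> is
  reduction modulo that power. The intersection of all \<open>J n\<close> may be nonzero, so
  \<open>J_dec\<close> states divisibility by \<open>t\<close> only modulo every
  \<open>J n\<close>.\<close>

locale filtration =
  fixes J :: "nat \<Rightarrow> 'r::comm_ring_1 set" and t :: 'r and cs :: "nat \<Rightarrow> 'r \<Rightarrow> 'c"
  assumes J_0 [simp]: "J 0 = UNIV"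
    and J_diff: "x \<in> J m \<Longrightarrow> y \<in> J m \<Longrightarrow> x - y \<in> J m"
    and J_mult: "x \<in> J m \<Longrightarrow> y * x \<in> J m"
    and J_zero [simp]: "0 \<in> J m"
    and J_Suc: "x \<in> J (Suc m) \<Longrightarrow> x \<in> J m"
    and J_t: "t * x \<in> J (Suc m) \<longleftrightarrow> x \<in> J m"
    and J_dec: "x \<in> J 1 \<Longrightarrow> \<exists>y. \<forall>n. x - t * y \<in> J n"
    and J_unit: "x \<notin> J 1 \<Longrightarrow> \<exists>y. x * y - 1 \<in> J m"
    and one_notin: "1 \<notin> J 1"
    and cs_eq: "cs m x = cs m y \<longleftrightarrow> x - y \<in> J m"
    and finite_cs1: "finite (range (cs 1))"
begin

definition q :: nat where "q = card (range (cs 1))"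

lemma J_neg: "x \<in> J m \<Longrightarrow> - x \<in> J m"
  using J_diff[of 0 m x] by simp

lemma J_add: "x \<in> J m \<Longrightarrow> y \<in> J m \<Longrightarrow> x + y \<in> J m"
  using J_diff[of x m "- y"] J_neg by simp

lemma J_mult': "x \<in> J m \<Longrightarrow> x * y \<in> J m"
  using J_mult[of x m y] by (simp add: mult.commute)

lemma J_mono: "m \<le> n \<Longrightarrow> x \<in> J n \<Longrightarrow> x \<in> J m"
  by (induct n) (auto simp: le_Suc_eq intro: J_Suc)

lemma J_cong: "x - y \<in> J m \<Longrightarrow> x \<in> J m \<longleftrightarrow> y \<in> J m"
  using J_add[of "x - y" m y] J_diff[of x m "x - y"] by auto

lemma J_minus_commute: "x - y \<in> J m \<longleftrightarrow> y - x \<in> J m"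
  using J_neg[of "x - y" m] J_neg[of "y - x" m] by auto

lemma J_tpow: "t ^ k * x \<in> J (m + k) \<longleftrightarrow> x \<in> J m"
  by (induct k) (auto simp: J_t mult.assoc)

lemma J_tpow': "k \<le> m \<Longrightarrow> t ^ k * x \<in> J m \<longleftrightarrow> x \<in> J (m - k)"
  using J_tpow[of k x "m - k"] by simp

lemma tpow_in: "m \<le> k \<Longrightarrow> t ^ k * x \<in> J m"
  using J_tpow[of k x 0] J_mono[of m k] by simp

lemma J_decpow: "x \<in> J k \<Longrightarrow> \<exists>y. \<forall>n. x - t ^ k * y \<in> J n"
proof (induct k)
  case 0
  have "\<forall>n. x - t ^ 0 * x \<in> J n" by simp
  then show ?case by blast
next
  case (Suc k)
  then obtain y where y: "\<forall>n. x - t ^ k * y \<in> J n" using J_Suc by blast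
  then have "t ^ k * y \<in> J (1 + k)" using Suc(2) J_cong[of x "t ^ k * y" "Suc k"] by simp
  then obtain z where z: "\<forall>n. y - t * z \<in> J n" using J_dec J_tpow by blast
  have "x - t ^ Suc k * z \<in> J n" for n
  proof -
    have "x - t ^ Suc k * z = (x - t ^ k * y) + t ^ k * (y - t * z)" by (simp add: algebra_simps)
    also have "\<dots> \<in> J n" using y z by (intro J_add J_mult) auto
    finally show ?thesis .
  qed
  then show ?case by blast
qed

lemma unit_cancel: "x \<notin> J 1 \<Longrightarrow> x * y \<in> J m \<Longrightarrow> y \<in> J m"
proof -
  assume "x \<notin> J 1" and xy: "x * y \<in> J m"
  then obtain z where "x * z - 1 \<in> J m" using J_unit by blast
  then have "z * (x * y) - (x * z - 1) * y \<in> J m" using xy J_diff J_mult J_mult' by simp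
  then show ?thesis by (simp add: algebra_simps)
qed

lemma prime_J: "x * y \<in> J 1 \<longleftrightarrow> x \<in> J 1 \<or> y \<in> J 1"
  using unit_cancel[of x y 1] J_mult J_mult' by blast

lemma unit_cong: "x - y \<in> J m \<Longrightarrow> 0 < m \<Longrightarrow> x \<in> J 1 \<longleftrightarrow> y \<in> J 1"
  using J_cong J_mono[of 1 m] by (metis One_nat_def Suc_leI)

lemma unit_add: "x \<notin> J 1 \<Longrightarrow> y \<in> J 1 \<Longrightarrow> x + y \<notin> J 1"
  using J_cong[of "x + y" x 1] by simp

lemma t_in: "t \<in> J 1"
  using tpow_in[of 1 1 1] by simp

lemma unit_1t: "0 < k \<Longrightarrow> 1 + t ^ k * x \<notin> J 1"
  using unit_add[OF one_notin] tpow_in[of 1 k x] by simp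

text \<open>Digit expansion: modulo \<open>J (Suc m)\<close> every element is
  \<open>s + t * y\<close> with a unique \<open>s\<close> in a set \<open>S\<close> of
  representatives modulo \<open>J 1\<close> and with \<open>y\<close> unique modulo
  \<open>J m\<close>.\<close>

lemma card_cs: "finite (range (cs m)) \<and> card (range (cs m)) = q ^ m"
proof (induct m)
  case 0
  have "range (cs 0) = {cs 0 0}" using cs_eq[of 0] by auto
  then show ?case by simp
next
  case (Suc m)
  define S where "S = (\<lambda>C. SOME x. cs 1 x = C) ` range (cs 1)"
  have some: "cs 1 (SOME x. cs 1 x = C) = C" if "C \<in> range (cs 1)" for C
    by (rule someI_ex) (use that in auto)
  have S1: "s = s'" if "s \<in> S" "s' \<in> S" "s - s' \<in> J 1" for s s'
    using that some unfolding S_def by (auto simp: cs_eq[symmetric])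
  have finS: "finite S" and cS: "card S = q"
  proof -
    have "inj_on (\<lambda>C. SOME x. cs 1 x = C) (range (cs 1))" using some by (intro inj_onI) metis
    then show "finite S" "card S = q" unfolding S_def q_def using finite_cs1 card_image by auto
  qed
  have S2: "\<exists>s\<in>S. x - s \<in> J 1" for x
  proof
    show "(SOME y. cs 1 y = cs 1 x) \<in> S" unfolding S_def by blast
    show "x - (SOME y. cs 1 y = cs 1 x) \<in> J 1" unfolding cs_eq[symmetric] using some[of "cs 1 x"] by simp
  qed
  let ?f = "\<lambda>(s, y). cs (Suc m) (s + t * y)" and ?g = "\<lambda>(s, y). (s, cs m y)"
  have img: "?f ` (S \<times> UNIV) = range (cs (Suc m))"
  proof
    show "range (cs (Suc m)) \<subseteq> ?f ` (S \<times> UNIV)"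
    proof clarify
      fix x
      obtain s where s: "s \<in> S" "x - s \<in> J 1" using S2 by blast
      then obtain y where "\<forall>n. (x - s) - t * y \<in> J n" using J_dec by blast
      then have "cs (Suc m) x = cs (Suc m) (s + t * y)" unfolding cs_eq by (simp add: algebra_simps)
      then show "cs (Suc m) x \<in> ?f ` (S \<times> UNIV)" using s by force
    qed
  qed auto
  have ker: "?f a = ?f b \<longleftrightarrow> ?g a = ?g b" if ab: "a \<in> S \<times> UNIV" "b \<in> S \<times> UNIV" for a b
  proof -
    obtain s y s' y' where e: "a = (s, y)" "b = (s', y')" "s \<in> S" "s' \<in> S" using ab by auto
    have r: "(s + t * y) - (s' + t * y') = (s - s') + t * (y - y')" by (simp add: algebra_simps)
    have "?f a = ?f b \<longleftrightarrow> (s - s') + t * (y - y') \<in> J (Suc m)" using e by (simp add: cs_eq r)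
    also have "\<dots> \<longleftrightarrow> s = s' \<and> y - y' \<in> J m"
    proof
      assume h: "(s - s') + t * (y - y') \<in> J (Suc m)"
      then have "(s - s') + t * (y - y') \<in> J 1" using J_mono[of 1 "Suc m"] by simp
      moreover have "t * (y - y') \<in> J 1" using t_in J_mult' by blast
      ultimately have "s - s' \<in> J 1" using J_diff by force
      then have "s = s'" using S1 e by blast
      then show "s = s' \<and> y - y' \<in> J m" using h J_t by simp
    qed (simp add: J_t)
    finally show ?thesis using e by (simp add: cs_eq)
  qed
  have g: "?g ` (S \<times> UNIV) = S \<times> range (cs m)" by force
  have "card (range (cs (Suc m))) = card (S \<times> range (cs m))"
    using card_image_same_kernel[of "S \<times> UNIV" ?f ?g, OF ker] img g by simp
  then have c: "card (range (cs (Suc m))) = q ^ Suc m" using Suc cS by (simp add: card_cartesian_product)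
  have "q > 0" unfolding q_def using finite_cs1 by (simp add: card_gt_0_iff)
  then have "card (range (cs (Suc m))) > 0" using c by simp
  then show ?case using c card_ge_0_finite by blast
qed

lemma q_pos: "q > 0"
  unfolding q_def using finite_cs1 by (simp add: card_gt_0_iff)

lemma card_cs_J: assumes "k \<le> m" shows "card (cs m ` J k) = q ^ (m - k)"
proof -
  have "cs m ` J k = range (\<lambda>y. cs m (t ^ k * y))"
  proof
    show "cs m ` J k \<subseteq> range (\<lambda>y. cs m (t ^ k * y))"
    proof clarify
      fix x assume "x \<in> J k"
      then obtain y where "\<forall>n. x - t ^ k * y \<in> J n" using J_decpow by blast
      then have "cs m x = cs m (t ^ k * y)" by (simp add: cs_eq)
      then show "cs m x \<in> range (\<lambda>y. cs m (t ^ k * y))" by simp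
    qed
    show "range (\<lambda>y. cs m (t ^ k * y)) \<subseteq> cs m ` J k" using tpow_in by auto
  qed
  moreover have "card (range (\<lambda>y. cs m (t ^ k * y))) = card (range (cs (m - k)))"
    by (rule card_image_same_kernel) (simp add: cs_eq J_tpow'[OF assms] flip: right_diff_distrib)
  ultimately show ?thesis using card_cs by simp
qed

lemma card_cs_units: assumes "0 < m" shows "card (cs m ` (- J 1)) = q ^ (m - 1) * (q - 1)"
proof -
  have UU: "range (cs m) = cs m ` J 1 \<union> cs m ` (- J 1)" by auto
  have D: "cs m ` J 1 \<inter> cs m ` (- J 1) = {}" using unit_cong[OF _ assms] by (auto simp: cs_eq)
  have fin: "finite (cs m ` J 1)" "finite (cs m ` (- J 1))" using card_cs[of m] UU by auto
  have "q ^ m = q ^ (m - 1) + card (cs m ` (- J 1))"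
    using card_Un_disjoint[OF fin D] card_cs[of m] UU card_cs_J[of 1 m] assms by simp
  moreover have "q ^ m = q ^ (m - 1) * q" using assms by (metis power_minus_mult)
  ultimately show ?thesis by (simp add: diff_mult_distrib2)
qed

section \<open>Additive characters of the finite quotients\<close>

definition add_char :: "nat \<Rightarrow> ('r \<Rightarrow> complex) \<Rightarrow> bool" where
  "add_char n \<omega> \<longleftrightarrow> (\<forall>x y. \<omega> (x + y) = \<omega> x * \<omega> y) \<and> (\<forall>x\<in>J n. \<omega> x = 1)"

definition prim_char :: "nat \<Rightarrow> ('r \<Rightarrow> complex) \<Rightarrow> bool" where
  "prim_char n \<omega> \<longleftrightarrow> 0 < n \<and> add_char n \<omega> \<and> (\<exists>x\<in>J (n - 1). \<omega> x \<noteq> 1)"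

lemma add_char_zero: "add_char n \<omega> \<Longrightarrow> \<omega> 0 = 1"
  unfolding add_char_def by simp

lemma add_char_add: "add_char n \<omega> \<Longrightarrow> \<omega> (x + y) = \<omega> x * \<omega> y"
  unfolding add_char_def by simp

lemma add_char_nonzero: "add_char n \<omega> \<Longrightarrow> \<omega> x \<noteq> 0"
proof -
  assume a: "add_char n \<omega>"
  have "\<omega> x * \<omega> (- x) = 1" using add_char_add[OF a, of x "- x"] add_char_zero[OF a] by simp
  then show "\<omega> x \<noteq> 0" by auto
qed

lemma add_char_cong: "add_char n \<omega> \<Longrightarrow> x - y \<in> J n \<Longrightarrow> \<omega> x = \<omega> y"
  using add_char_add[of n \<omega> "x - y" y] unfolding add_char_def by simp

lemma add_char_eq_iff: "add_char n \<omega> \<Longrightarrow> \<omega> x = \<omega> y \<longleftrightarrow> \<omega> (x - y) = 1"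
  using add_char_add[of n \<omega> "x - y" y] add_char_nonzero[of n \<omega> y] by auto

lemma add_char_scale: "add_char n \<omega> \<Longrightarrow> k \<le> n \<Longrightarrow> add_char (n - k) (\<lambda>x. \<omega> (t ^ k * x))"
  unfolding add_char_def by (simp add: distrib_left J_tpow')

text \<open>Used with k = \<epsilon> to pass from precision l to precision l - \<epsilon>, and with
  k = l - 1 to obtain a nontrivial character of the residue field.\<close>

lemma prim_char_scale: assumes "prim_char n \<omega>" "k < n" shows "prim_char (n - k) (\<lambda>x. \<omega> (t ^ k * x))"
proof -
  have a: "add_char n \<omega>" using assms unfolding prim_char_def by simp
  obtain x where x: "x \<in> J (n - 1)" "\<omega> x \<noteq> 1" using assms unfolding prim_char_def by blast
  then obtain y where y: "\<forall>m. x - t ^ (n - 1) * y \<in> J m" using J_decpow by blast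
  have "\<omega> x = \<omega> (t ^ (n - 1) * y)" using add_char_cong[OF a] y by blast
  also have "t ^ (n - 1) * y = t ^ k * (t ^ (n - k - 1) * y)"
    using assms(2) by (simp flip: power_add mult.assoc)
  finally have "\<exists>x\<in>J (n - k - 1). \<omega> (t ^ k * x) \<noteq> 1" using x tpow_in[of "n - k - 1" "n - k - 1" y] by auto
  then show ?thesis using add_char_scale[OF a, of k] assms unfolding prim_char_def by simp
qed

text \<open>If \<open>x\<close> had exact valuation k < n, its multiples would fill
  \<open>J k\<close>, modulo \<open>J n\<close>, and in particular the last layer
  \<open>J (n - 1)\<close>, where \<psi> is nontrivial.\<close>

lemma prim_char_nondegenerate:
  assumes P: "prim_char n \<psi>" and x: "\<And>y. \<psi> (x * y) = 1" shows "x \<in> J n"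
proof (rule ccontr)
  have a: "add_char n \<psi>" and n: "0 < n" using P unfolding prim_char_def by auto
  assume "x \<notin> J n"
  define k where "k = (LEAST k. x \<notin> J (Suc k))"
  have ex: "x \<notin> J (Suc (n - 1))" using \<open>x \<notin> J n\<close> n by simp
  have k: "x \<notin> J (Suc k)" unfolding k_def by (rule LeastI[where P = "\<lambda>k. x \<notin> J (Suc k)", OF ex])
  have kn: "k \<le> n - 1" unfolding k_def by (rule Least_le[where P = "\<lambda>k. x \<notin> J (Suc k)", OF ex])
  have xk: "x \<in> J k"
  proof (cases k)
    case (Suc k')
    then show ?thesis using not_less_Least[of k' "\<lambda>k. x \<notin> J (Suc k)"] k_def by auto
  qed simp
  obtain z where z: "\<forall>m. x - t ^ k * z \<in> J m" using J_decpow[OF xk] by blast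
  have z1: "z \<notin> J 1"
  proof
    assume "z \<in> J 1"
    then have "t ^ k * z \<in> J (1 + k)" using J_tpow by blast
    then show False using k z J_cong[of x "t ^ k * z" "Suc k"] by simp
  qed
  obtain z' where z': "z * z' - 1 \<in> J n" using J_unit[OF z1] by blast
  obtain y where y: "y \<in> J (n - 1)" "\<psi> y \<noteq> 1" using P unfolding prim_char_def by blast
  obtain s where s: "\<forall>m. y - t ^ (n - 1) * s \<in> J m" using J_decpow[OF y(1)] by blast
  \<comment> \<open>Chosen so that \<open>x * ?Y\<close> is congruent to \<open>y\<close> modulo
    \<open>J n\<close>: \<open>z'\<close> inverts the unit part of \<open>x\<close>, and the power
    of \<open>t\<close> raises its valuation from k to n - 1.\<close>
  let ?Y = "z' * (t ^ (n - 1 - k) * s)"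
  have "t ^ k * t ^ (n - 1 - k) = t ^ (n - 1)" using le_add_diff_inverse[OF kn] by (metis power_add)
  then have "x * ?Y - y = (x - t ^ k * z) * ?Y + (z * z' - 1) * (t ^ (n - 1) * s) - (y - t ^ (n - 1) * s)"
    by (simp add: algebra_simps)
  also have "\<dots> \<in> J n"
    by (rule J_diff[OF J_add[OF J_mult'[OF z[rule_format]] J_mult'[OF z']] s[rule_format]])
  finally have "\<psi> (x * ?Y) = \<psi> y" by (rule add_char_cong[OF a])
  then show False using x y by simp
qed

text \<open>Since \<open>\<psi>\<close> is nondegenerate, the characters \<open>x \<mapsto> \<psi> (\<alpha> x)\<close> are as many as the elements
  \<open>\<alpha>\<close> of the quotient, hence they are all characters.\<close>

lemma prim_char_duality:
  assumes P: "prim_char n \<psi>" and w: "add_char n \<omega>"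
  shows "\<exists>\<alpha>. \<forall>x. \<omega> x = \<psi> (\<alpha> * x)"
proof -
  have a: "add_char n \<psi>" using P unfolding prim_char_def by auto
  define rp where "rp C = (SOME x. cs n x = C)" for C
  have rp: "cs n (rp C) = C" if "C \<in> range (cs n)" for C
    unfolding rp_def by (rule someI_ex) (use that in auto)
  have rpx: "rp (cs n x) - x \<in> J n" for x using rp[OF rangeI] by (simp add: cs_eq)
  \<comment> \<open>The additive group of the quotient as a group record, so that
    \<open>card_char_exts\<close> with the trivial subgroup counts its characters.\<close>
  define A where "A = \<lparr>carrier = range (cs n), monoid.mult = (\<lambda>C D. cs n (rp C + rp D)), one = cs n 0\<rparr>"
  have m: "cs n x \<otimes>\<^bsub>A\<^esub> cs n y = cs n (x + y)" for x y
    using J_add[OF rpx[of x] rpx[of y]] by (simp add: A_def cs_eq algebra_simps)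
  have cA: "carrier A = range (cs n)" "one A = cs n 0" by (simp_all add: A_def)
  have "group A"
  proof (rule groupI)
    fix U assume "U \<in> carrier A"
    then obtain x where x: "U = cs n x" using cA by auto
    have "cs n (- x) \<in> carrier A" "cs n (- x) \<otimes>\<^bsub>A\<^esub> U = \<one>\<^bsub>A\<^esub>" using x m cA by auto
    then show "\<exists>y\<in>carrier A. y \<otimes>\<^bsub>A\<^esub> U = \<one>\<^bsub>A\<^esub>" by blast
  qed (auto simp: cA m add.assoc)
  then interpret A: group A .
  interpret A: finite_grp A by unfold_locales (simp add: cA card_cs)
  define hat where "hat \<omega> = restrict (\<lambda>C. \<omega> (rp C)) (carrier A)" for \<omega> :: "'r \<Rightarrow> complex"
  have hat: "hat \<omega> (cs n x) = \<omega> x" if "add_char n \<omega>" for \<omega> x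
    using add_char_cong[OF that rpx] by (simp add: hat_def cA)
  let ?E = "char_exts A (carrier A) {\<one>\<^bsub>A\<^esub>} (\<lambda>_. 1)"
  have hatE: "hat \<omega> \<in> ?E" if "add_char n \<omega>" for \<omega>
    unfolding char_exts_def is_char_def using hat[OF that] add_char_nonzero[OF that] add_char_add[OF that] add_char_zero[OF that]
    by (auto simp: cA m) (simp add: hat_def cA)
  have "finite ?E \<and> card ?E * card {\<one>\<^bsub>A\<^esub>} = card (carrier A)"
  proof (rule A.card_char_exts)
    show "is_char A {\<one>\<^bsub>A\<^esub>} (\<lambda>_. 1)" unfolding is_char_def by simp
    show "comm_in_ker A (carrier A) {\<one>\<^bsub>A\<^esub>} (\<lambda>_. 1)" unfolding comm_in_ker_def by (auto simp: cA m add.commute)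
  qed (auto simp: A.subgroup_self A.triv_subgroup)
  then have E: "finite ?E" "card ?E = q ^ n" using card_cs cA by auto
  have sc: "add_char n (\<lambda>x. \<psi> (\<alpha> * x))" for \<alpha>
    using a unfolding add_char_def by (auto simp: distrib_left J_mult)
  let ?F = "\<lambda>\<alpha>. hat (\<lambda>x. \<psi> (\<alpha> * x))"
  have "card (range ?F) = card (range (cs n))"
  proof (rule card_image_same_kernel)
    fix \<alpha> \<beta>
    show "?F \<alpha> = ?F \<beta> \<longleftrightarrow> cs n \<alpha> = cs n \<beta>"
    proof
      assume e: "?F \<alpha> = ?F \<beta>"
      have "\<psi> ((\<alpha> - \<beta>) * y) = 1" for y
      proof -
        have "\<psi> (\<alpha> * y) = \<psi> (\<beta> * y)" using hat[OF sc[of \<alpha>], of y] hat[OF sc[of \<beta>], of y] e by simp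
        then show ?thesis using add_char_eq_iff[OF a] by (simp add: algebra_simps)
      qed
      then show "cs n \<alpha> = cs n \<beta>" unfolding cs_eq by (rule prim_char_nondegenerate[OF P])
    next
      assume "cs n \<alpha> = cs n \<beta>"
      then have "\<alpha> * x - \<beta> * x \<in> J n" for x
        unfolding cs_eq using J_mult'[of "\<alpha> - \<beta>" n x] by (simp add: algebra_simps)
      then show "?F \<alpha> = ?F \<beta>" using add_char_cong[OF a] by (metis (no_types, lifting) ext)
    qed
  qed
  then have "card (range ?F) = card ?E" using E card_cs by simp
  moreover have "range ?F \<subseteq> ?E" using hatE sc by blast
  ultimately have "range ?F = ?E" using card_subset_eq[OF E(1)] by blast
  then obtain \<alpha> where "hat \<omega> = ?F \<alpha>" using hatE[OF w] by blast
  then have "\<omega> x = \<psi> (\<alpha> * x)" for x using hat[OF w, of x] hat[OF sc[of \<alpha>], of x] by simp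
  then show ?thesis by blast
qed

end

section \<open>The automorphism group in coordinates\<close>

text \<open>Elements of the group are written with entries lifted to a commutative ring of a type class;
  \<open>mk a b c d\<close> is the matrix with rows \<open>(a, b \<delta>)\<close> and \<open>(c, d)\<close>, where \<open>\<delta> = t ^ s\<close>. The integers
  of the paper are \<open>\<ell> = l\<close>, \<open>\<ell> - \<epsilon> = m\<close>, \<open>\<ell>\<^sub>2 = l + m\<close> and \<open>\<ell>\<^sub>1 = \<ell>\<^sub>2 + s\<close>.\<close>

locale lam_group = filtration J t cs + finite_grp G
  for J :: "nat \<Rightarrow> 'r::comm_ring_1 set" and t :: 'r and cs :: "nat \<Rightarrow> 'r \<Rightarrow> 'c"
    and G :: "('g, 'x) monoid_scheme" (structure) +
  fixes mk :: "'r \<Rightarrow> 'r \<Rightarrow> 'r \<Rightarrow> 'r \<Rightarrow> 'g" and l1 l2 l \<epsilon> m s :: nat and \<Psi> :: "'r \<Rightarrow> complex"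
  assumes dims: "l = m + \<epsilon>" "l2 = m + l" "l1 = l2 + s" "\<epsilon> \<le> 1" "0 < m" "0 < s" "1 < l2"
    and mk_closed: "a \<notin> J 1 \<Longrightarrow> d \<notin> J 1 \<Longrightarrow> mk a b c d \<in> carrier G"
    and mk_exh: "g \<in> carrier G \<Longrightarrow> \<exists>a b c d. a \<notin> J 1 \<and> d \<notin> J 1 \<and> g = mk a b c d"
    and mk_eq: "a \<notin> J 1 \<Longrightarrow> d \<notin> J 1 \<Longrightarrow> a' \<notin> J 1 \<Longrightarrow> d' \<notin> J 1 \<Longrightarrow> mk a b c d = mk a' b' c' d' \<longleftrightarrow>
       a - a' \<in> J l1 \<and> b - b' \<in> J l2 \<and> c - c' \<in> J l2 \<and> d - d' \<in> J l2"
    and mk_mult: "a \<notin> J 1 \<Longrightarrow> d \<notin> J 1 \<Longrightarrow> a' \<notin> J 1 \<Longrightarrow> d' \<notin> J 1 \<Longrightarrow> mk a b c d \<otimes> mk a' b' c' d' =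
       mk (a * a' + b * c' * t ^ s) (a * b' + b * d') (c * a' + d * c') (c * b' * t ^ s + d * d')"
    and Psi: "prim_char l \<Psi>"
begin

lemma l_pos: "0 < l" and eps_l: "\<epsilon> < l" and l_eps: "l - \<epsilon> = m"
  using dims by auto

lemma ts: "t ^ s = t ^ \<epsilon> * t ^ (s - \<epsilon>)"
  using dims by (simp flip: power_add)

lemma ts_in: "x * t ^ s \<in> J 1"
  using tpow_in[of 1 s x] dims by (simp add: mult.commute)

lemma unit_mult: "a \<notin> J 1 \<Longrightarrow> a' \<notin> J 1 \<Longrightarrow> a * a' + y * t ^ s \<notin> J 1"
  using unit_add[of "a * a'"] ts_in prime_J by blast

lemma unit_mult': "a \<notin> J 1 \<Longrightarrow> a' \<notin> J 1 \<Longrightarrow> y * t ^ s + a * a' \<notin> J 1"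
  using unit_mult by (simp add: add.commute)

lemma unit_det: "a \<notin> J 1 \<Longrightarrow> d \<notin> J 1 \<Longrightarrow> a * d - b * c * t ^ s \<notin> J 1"
  using unit_mult[of a d "- (b * c)"] by simp

lemma Psi_add: "add_char l \<Psi>"
  using Psi unfolding prim_char_def by auto

lemma mk_one: "mk 1 0 0 1 = \<one>"
proof -
  have "mk 1 0 0 1 \<otimes> mk 1 0 0 1 = mk 1 0 0 1" using mk_mult[of 1 1 1 1] one_notin by simp
  then show ?thesis using l_cancel_one mk_closed[of 1 1] one_notin by blast
qed

text \<open>Since \<open>mk\<close> has \<delta> = \<open>t ^ s\<close> built into its second
  argument, depth l1 - l = m + s of the upper right entry becomes \<open>t ^ m\<close>. The lower
  row has depth l2 - l + \<epsilon>, which equals l.\<close>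

definition km :: "'r \<Rightarrow> 'r \<Rightarrow> 'r \<Rightarrow> 'r \<Rightarrow> 'g" where
  "km u v w z = mk (1 + t ^ (m + s) * u) (t ^ m * v) (t ^ l * w) (1 + t ^ l * z)"

definition Kg :: "'g set" where
  "Kg = {km u v w z | u v w z. True}"

lemma km_units: "1 + t ^ (m + s) * u \<notin> J 1" "1 + t ^ l * z \<notin> J 1"
  using unit_1t dims by auto

lemma km_closed: "km u v w z \<in> carrier G"
  unfolding km_def by (rule mk_closed) (rule km_units)+

lemma km_in: "km u v w z \<in> Kg"
  unfolding Kg_def by blast

lemma km_eq: "km u v w z = km u' v' w' z' \<longleftrightarrow> u - u' \<in> J l \<and> v - v' \<in> J l \<and> w - w' \<in> J m \<and> z - z' \<in> J m"
proof -
  have "km u v w z = km u' v' w' z' \<longleftrightarrow> t ^ (m + s) * (u - u') \<in> J l1 \<and> t ^ m * (v - v') \<in> J l2 \<and>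
      t ^ l * (w - w') \<in> J l2 \<and> t ^ l * (z - z') \<in> J l2"
    unfolding km_def mk_eq[OF km_units km_units] by (simp add: right_diff_distrib)
  then show ?thesis using dims by (simp add: J_tpow')
qed

text \<open>All cross terms vanish. Where m + l = l2 does not suffice, the terms of order 2 m + s
  need s \<ge> \<epsilon>, which holds because s is positive and \<epsilon> is at most 1.\<close>

lemma km_mult: "km u v w z \<otimes> km u' v' w' z' = km (u + u') (v + v') (w + w') (z + z')"
proof -
  have "l1 \<le> (m + s) + (m + s)" "l1 \<le> m + l + s" "l2 \<le> (m + s) + m" "l2 \<le> m + l" "l2 \<le> l + (m + s)" "l2 \<le> l + l"
    using dims by auto
  then have h: "t ^ ((m + s) + (m + s)) * x \<in> J l1" "t ^ (m + l + s) * x \<in> J l1" "t ^ ((m + s) + m) * x \<in> J l2"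
     "t ^ (m + l) * x \<in> J l2" "t ^ (l + (m + s)) * x \<in> J l2" "t ^ (l + l) * x \<in> J l2" for x
    using tpow_in by blast+
  show ?thesis
    unfolding km_def mk_mult[OF km_units km_units]
  proof (subst mk_eq[OF unit_mult unit_mult' km_units], safe)
    show "(1 + t ^ (m + s) * u) * (1 + t ^ (m + s) * u') + t ^ m * v * (t ^ l * w') * t ^ s - (1 + t ^ (m + s) * (u + u')) \<in> J l1"
      using J_add[OF h(1)[of "u * u'"] h(2)[of "v * w'"]] by (simp add: algebra_simps power_add)
    show "(1 + t ^ (m + s) * u) * (t ^ m * v') + t ^ m * v * (1 + t ^ l * z') - t ^ m * (v + v') \<in> J l2"
      using J_add[OF h(3)[of "u * v'"] h(4)[of "v * z'"]] by (simp add: algebra_simps power_add)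
    show "t ^ l * w * (1 + t ^ (m + s) * u') + (1 + t ^ l * z) * (t ^ l * w') - t ^ l * (w + w') \<in> J l2"
      using J_add[OF h(5)[of "w * u'"] h(6)[of "z * w'"]] by (simp add: algebra_simps power_add)
    show "t ^ l * w * (t ^ m * v') * t ^ s + (1 + t ^ l * z) * (1 + t ^ l * z') - (1 + t ^ l * (z + z')) \<in> J l2"
      using J_add[OF h(5)[of "w * v'"] h(6)[of "z * z'"]] by (simp add: algebra_simps power_add)
  qed (use km_units in auto)
qed

lemma km_one: "km 0 0 0 0 = \<one>"
  by (simp add: km_def mk_one)

lemma Kg_E: assumes "k \<in> Kg" obtains u v w z where "k = km u v w z"
  using assms unfolding Kg_def by blast

lemma Kg_subgroup: "subgroup Kg G"
proof (rule subgroup_finiteI[of _ "km 0 0 0 0"])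
  show "h \<otimes> k \<in> Kg" if "h \<in> Kg" "k \<in> Kg" for h k
    using that by (elim Kg_E) (simp add: km_mult km_in)
qed (auto simp: Kg_def km_closed)

lemma Kg_comm: "h \<in> Kg \<Longrightarrow> k \<in> Kg \<Longrightarrow> h \<otimes> k = k \<otimes> h"
  by (elim Kg_E) (simp add: km_mult add.commute)

lemma card_Kg: "card Kg = q ^ (2 * l2)"
proof -
  let ?f = "\<lambda>(u, v, w, z). km u v w z" and ?g = "\<lambda>(u, v, w, z). (cs l u, cs l v, cs m w, cs m z)"
  have "?f ` UNIV = Kg"
  proof
    show "Kg \<subseteq> ?f ` UNIV"
    proof
      fix k assume "k \<in> Kg"
      then obtain u v w z where "k = km u v w z" by (rule Kg_E)
      then show "k \<in> ?f ` UNIV" by (intro image_eqI[of _ _ "(u, v, w, z)"]) auto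
    qed
  qed (auto simp: km_in)
  moreover have "?g ` UNIV = range (cs l) \<times> range (cs l) \<times> range (cs m) \<times> range (cs m)" by (auto simp: image_iff)
  moreover have "card (?f ` UNIV) = card (?g ` UNIV)"
    by (rule card_image_same_kernel) (auto simp: km_eq cs_eq)
  ultimately have "card Kg = q ^ l * (q ^ l * (q ^ m * q ^ m))" using card_cs by (simp add: card_cartesian_product)
  moreover have "2 * l2 = l + (l + (m + m))" using dims by simp
  ultimately show ?thesis by (simp add: power_add)
qed

lemma det_inverse: "a \<notin> J 1 \<Longrightarrow> d \<notin> J 1 \<Longrightarrow> \<exists>e. e * (a * d - b * c * t ^ s) - 1 \<in> J n"
  using J_unit[OF unit_det] by (metis mult.commute)

text \<open>The right side is adjugate times coordinates times matrix, with \<open>e\<close>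
  inverting the determinant. An inverse modulo \<open>J l\<close> is precise enough because the
  coordinates matter at most modulo \<open>J l\<close>. The factors \<open>t ^ \<epsilon>\<close>
  and \<open>t ^ (s - \<epsilon>)\<close> compare the scalings of the two rows.\<close>

lemma km_conj:
  assumes ad: "a \<notin> J 1" "d \<notin> J 1" and e: "e * (a * d - b * c * t ^ s) - 1 \<in> J l"
  shows "inv (mk a b c d) \<otimes> km u v w z \<otimes> mk a b c d =
    km (e * (d * (u * a + v * c) - b * t ^ \<epsilon> * (w * a + z * c)))
       (e * (d * (u * b * t ^ s + v * d) - b * t ^ \<epsilon> * (w * b * t ^ s + z * d)))
       (e * (a * (w * a + z * c) - c * t ^ (s - \<epsilon>) * (u * a + v * c)))
       (e * (a * (w * b * t ^ s + z * d) - c * t ^ (s - \<epsilon>) * (u * b * t ^ s + v * d)))"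
    (is "_ = km ?u ?v ?w ?z")
proof -
  let ?g = "mk a b c d" and ?D = "1 - e * (a * d - b * c * t ^ s)"
  have D: "?D \<in> J l" using e J_minus_commute by blast
  then have Dm: "?D \<in> J m" using J_mono[of m l] dims by simp
  have Dx: "t ^ (m + s) * (?D * x) \<in> J l1" "t ^ m * (?D * x) \<in> J l2" "t ^ l * (?D * x) \<in> J l2" for x
    using J_mult'[OF D, of x] J_mult'[OF Dm, of x] dims by (simp_all add: J_tpow')
  have tl: "t ^ l = t ^ m * t ^ \<epsilon>" and tms: "t ^ (m + s) = t ^ m * t ^ \<epsilon> * t ^ (s - \<epsilon>)"
    using dims ts by (simp_all add: power_add)
  \<comment> \<open>Verified without inverting the conjugating matrix: in each entry the two sides
    differ by a multiple of \<open>?D\<close>, which the scaling of that entry kills.\<close>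
  have "km u v w z \<otimes> ?g = ?g \<otimes> km ?u ?v ?w ?z"
    unfolding km_def mk_mult[OF km_units ad] mk_mult[OF ad km_units]
  proof (subst mk_eq, goal_cases)
    case 5
    show ?case
    proof (intro conjI)
      show "(1 + t ^ (m + s) * u) * a + t ^ m * v * c * t ^ s - (a * (1 + t ^ (m + s) * ?u) + b * (t ^ l * ?w) * t ^ s) \<in> J l1"
        using Dx(1)[of "u * a + v * c"] unfolding tl tms ts by (simp add: algebra_simps)
      show "(1 + t ^ (m + s) * u) * b + t ^ m * v * d - (a * (t ^ m * ?v) + b * (1 + t ^ l * ?z)) \<in> J l2"
        using Dx(2)[of "u * b * t ^ s + v * d"] unfolding tl tms ts by (simp add: algebra_simps)
      show "t ^ l * w * a + (1 + t ^ l * z) * c - (c * (1 + t ^ (m + s) * ?u) + d * (t ^ l * ?w)) \<in> J l2"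
        using Dx(3)[of "w * a + z * c"] unfolding tl tms ts by (simp add: algebra_simps)
      show "t ^ l * w * b * t ^ s + (1 + t ^ l * z) * d - (c * (t ^ m * ?v) * t ^ s + d * (1 + t ^ l * ?z)) \<in> J l2"
        using Dx(3)[of "w * b * t ^ s + z * d"] unfolding tl tms ts by (simp add: algebra_simps)
    qed
  qed (use ad km_units unit_mult unit_mult' in auto)
  then have "inv ?g \<otimes> (km u v w z \<otimes> ?g) = km ?u ?v ?w ?z"
    using mk_closed[OF ad] km_closed by simp
  then show ?thesis using mk_closed[OF ad] km_closed by (simp add: m_assoc)
qed

lemma Kg_normal: "g \<in> carrier G \<Longrightarrow> k \<in> Kg \<Longrightarrow> inv g \<otimes> k \<otimes> g \<in> Kg"
proof -
  assume "g \<in> carrier G" "k \<in> Kg"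
  then obtain a b c d u v w z where *: "a \<notin> J 1" "d \<notin> J 1" "g = mk a b c d" "k = km u v w z"
    using mk_exh Kg_E by metis
  obtain e where "e * (a * d - b * c * t ^ s) - 1 \<in> J l" using det_inverse[OF *(1,2)] by blast
  from km_conj[OF *(1,2) this] show ?thesis unfolding *(3,4) using km_in by simp
qed

text \<open>The parameters form the matrix with rows (\<alpha>, \<beta>) and (\<gamma>, \<kappa>),
  paired by the trace with the coordinates; hence \<beta> goes with w and \<gamma> with v. The
  factor \<open>t ^ \<epsilon>\<close> reflects that w and z are known only modulo
  \<open>J m\<close>.\<close>

definition Kchar :: "'r \<Rightarrow> 'r \<Rightarrow> 'r \<Rightarrow> 'r \<Rightarrow> ('g \<Rightarrow> complex) \<Rightarrow> bool" where
  "Kchar \<alpha> \<beta> \<gamma> \<kappa> \<omega> \<longleftrightarrow> (\<forall>u v w z. \<omega> (km u v w z) = \<Psi> (\<alpha> * u + \<gamma> * v + t ^ \<epsilon> * (\<beta> * w + \<kappa> * z)))"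

lemma te_J: "t ^ \<epsilon> * x \<in> J l \<longleftrightarrow> x \<in> J m"
  using dims by (simp add: J_tpow')

lemma Psi_coeffs_cong:
  assumes "\<alpha> - \<alpha>' \<in> J l" "\<beta> - \<beta>' \<in> J m" "\<gamma> - \<gamma>' \<in> J l" "\<kappa> - \<kappa>' \<in> J m"
  shows "\<Psi> (\<alpha> * u + \<gamma> * v + t ^ \<epsilon> * (\<beta> * w + \<kappa> * z)) = \<Psi> (\<alpha>' * u + \<gamma>' * v + t ^ \<epsilon> * (\<beta>' * w + \<kappa>' * z))"
proof (rule add_char_cong[OF Psi_add])
  have "(\<alpha> - \<alpha>') * u + (\<gamma> - \<gamma>') * v + t ^ \<epsilon> * ((\<beta> - \<beta>') * w + (\<kappa> - \<kappa>') * z) \<in> J l"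
    using assms by (intro J_add iffD2[OF te_J]) (auto intro: J_mult' J_add)
  then show "\<alpha> * u + \<gamma> * v + t ^ \<epsilon> * (\<beta> * w + \<kappa> * z) - (\<alpha>' * u + \<gamma>' * v + t ^ \<epsilon> * (\<beta>' * w + \<kappa>' * z)) \<in> J l"
    by (simp add: algebra_simps)
qed

lemma Psi_coeffs_eqD:
  assumes "\<And>u v w z. \<Psi> (\<alpha> * u + \<gamma> * v + t ^ \<epsilon> * (\<beta> * w + \<kappa> * z)) = \<Psi> (\<alpha>' * u + \<gamma>' * v + t ^ \<epsilon> * (\<beta>' * w + \<kappa>' * z))"
  shows "\<alpha> - \<alpha>' \<in> J l \<and> \<beta> - \<beta>' \<in> J m \<and> \<gamma> - \<gamma>' \<in> J l \<and> \<kappa> - \<kappa>' \<in> J m"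
proof -
  have nd: "x \<in> J l" if "\<And>y. \<Psi> (f * y) = \<Psi> (f' * y)" "x = f - f'" for x f f'
  proof (rule prim_char_nondegenerate[OF Psi])
    show "\<Psi> (x * y) = 1" for y
      using that(1)[of y] add_char_eq_iff[OF Psi_add, of "f * y" "f' * y"] by (simp add: that(2) left_diff_distrib)
  qed
  have "t ^ \<epsilon> * (\<beta> - \<beta>') \<in> J l"
    by (rule nd[of "t ^ \<epsilon> * \<beta>" "t ^ \<epsilon> * \<beta>'"]) (use assms[of 0 0 _ 0] in \<open>simp_all add: algebra_simps\<close>)
  moreover have "t ^ \<epsilon> * (\<kappa> - \<kappa>') \<in> J l"
    by (rule nd[of "t ^ \<epsilon> * \<kappa>" "t ^ \<epsilon> * \<kappa>'"]) (use assms[of 0 0 0 _] in \<open>simp_all add: algebra_simps\<close>)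
  moreover have "\<alpha> - \<alpha>' \<in> J l" by (rule nd[of \<alpha> \<alpha>']) (use assms[of _ 0 0 0] in simp_all)
  moreover have "\<gamma> - \<gamma>' \<in> J l" by (rule nd[of \<gamma> \<gamma>']) (use assms[of 0 _ 0 0] in simp_all)
  ultimately show ?thesis by (simp add: te_J)
qed

lemma Kchar_unique: "Kchar \<alpha> \<beta> \<gamma> \<kappa> \<omega> \<Longrightarrow> Kchar \<alpha>' \<beta>' \<gamma>' \<kappa>' \<omega> \<Longrightarrow>
    \<alpha> - \<alpha>' \<in> J l \<and> \<beta> - \<beta>' \<in> J m \<and> \<gamma> - \<gamma>' \<in> J l \<and> \<kappa> - \<kappa>' \<in> J m"
  by (rule Psi_coeffs_eqD) (simp add: Kchar_def)

lemma Kchar_cong: "Kchar \<alpha> \<beta> \<gamma> \<kappa> \<omega> \<Longrightarrow> \<alpha> - \<alpha>' \<in> J l \<Longrightarrow> \<beta> - \<beta>' \<in> J m \<Longrightarrow> \<gamma> - \<gamma>' \<in> J l \<Longrightarrow> \<kappa> - \<kappa>' \<in> J m \<Longrightarrow>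
    Kchar \<alpha>' \<beta>' \<gamma>' \<kappa>' \<omega>"
  unfolding Kchar_def using Psi_coeffs_cong[of \<alpha> \<alpha>' \<beta> \<beta>' \<gamma> \<gamma>' \<kappa> \<kappa>'] by simp

lemma Kchar_is_char: "Kchar \<alpha> \<beta> \<gamma> \<kappa> \<omega> \<Longrightarrow> is_char G Kg \<omega>"
  unfolding is_char_def
proof (intro conjI ballI)
  assume w: "Kchar \<alpha> \<beta> \<gamma> \<kappa> \<omega>"
  fix h assume h: "h \<in> Kg"
  then show "\<omega> h \<noteq> 0" using w add_char_nonzero[OF Psi_add] unfolding Kchar_def by (metis Kg_E)
  fix k assume k: "k \<in> Kg"
  obtain u v w z where 1: "h = km u v w z" using h by (rule Kg_E)
  obtain u' v' w' z' where 2: "k = km u' v' w' z'" using k by (rule Kg_E)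
  show "\<omega> (h \<otimes> k) = \<omega> h * \<omega> k"
    unfolding 1 2 km_mult w[unfolded Kchar_def, rule_format] add_char_add[OF Psi_add, symmetric]
    by (simp add: algebra_simps)
qed

text \<open>Duality is applied to each coordinate separately. For w and z it is used with the
  character \<open>\<Psi> (t ^ \<epsilon> * x)\<close>, which is primitive at precision m.\<close>

lemma Kchar_exists:
  assumes w: "is_char G Kg \<omega>" shows "\<exists>\<alpha> \<beta> \<gamma> \<kappa>. Kchar \<alpha> \<beta> \<gamma> \<kappa> \<omega>"
proof -
  have mult: "\<omega> (km u v w z \<otimes> km u' v' w' z') = \<omega> (km u v w z) * \<omega> (km u' v' w' z')" for u v w z u' v' w' z'
    using w km_in unfolding is_char_def by blast
  have one: "\<omega> (km 0 0 0 0) = 1" using is_char_one[OF Kg_subgroup w] km_one by simp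
  have P: "prim_char m (\<lambda>x. \<Psi> (t ^ \<epsilon> * x))" using prim_char_scale[OF Psi eps_l] l_eps by simp
  have z: "\<omega> (km u v w z) = 1" if "u \<in> J l" "v \<in> J l" "w \<in> J m" "z \<in> J m" for u v w z
  proof -
    have "km u v w z = km 0 0 0 0" unfolding km_eq using that by simp
    then show ?thesis using one by simp
  qed
  have c: "add_char l (\<lambda>u. \<omega> (km u 0 0 0))" "add_char l (\<lambda>v. \<omega> (km 0 v 0 0))"
    "add_char m (\<lambda>w. \<omega> (km 0 0 w 0))" "add_char m (\<lambda>z. \<omega> (km 0 0 0 z))"
    unfolding add_char_def mult[symmetric] km_mult using z by simp_all
  obtain \<alpha> where 1: "\<And>u. \<omega> (km u 0 0 0) = \<Psi> (\<alpha> * u)" using prim_char_duality[OF Psi c(1)] by blast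
  obtain \<gamma> where 2: "\<And>v. \<omega> (km 0 v 0 0) = \<Psi> (\<gamma> * v)" using prim_char_duality[OF Psi c(2)] by blast
  obtain \<beta> where 3: "\<And>w. \<omega> (km 0 0 w 0) = \<Psi> (t ^ \<epsilon> * (\<beta> * w))" using prim_char_duality[OF P c(3)] by blast
  obtain \<kappa> where 4: "\<And>z. \<omega> (km 0 0 0 z) = \<Psi> (t ^ \<epsilon> * (\<kappa> * z))" using prim_char_duality[OF P c(4)] by blast
  note * = 1 2 3 4
  have "\<omega> (km u v w z) = \<Psi> (\<alpha> * u + \<gamma> * v + t ^ \<epsilon> * (\<beta> * w + \<kappa> * z))" for u v w z
  proof -
    have "\<omega> (km u v w z) = \<omega> (km u v 0 0 \<otimes> km 0 0 w z)" by (simp add: km_mult)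
    also have "\<dots> = \<omega> (km u v 0 0) * \<omega> (km 0 0 w z)" by (rule mult)
    also have "\<omega> (km u v 0 0) = \<omega> (km u 0 0 0) * \<omega> (km 0 v 0 0)"
      using mult[of u 0 0 0 0 v 0 0] by (simp add: km_mult)
    also have "\<omega> (km 0 0 w z) = \<omega> (km 0 0 w 0) * \<omega> (km 0 0 0 z)"
      using mult[of 0 0 w 0 0 0 0 z] by (simp add: km_mult)
    finally show ?thesis unfolding * by (simp add: add_char_add[OF Psi_add] distrib_left)
  qed
  then show ?thesis unfolding Kchar_def by blast
qed

text \<open>By cyclicity of the trace, conjugating the argument by g conjugates the matrix with rows
  (\<alpha>, \<beta> \<delta>) and (\<gamma>, \<kappa> \<delta>). The four expressions are the
  entries of the conjugate, with \<delta> removed from the second column.\<close>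

lemma Kchar_conj:
  assumes w: "Kchar \<alpha> \<beta> \<gamma> \<kappa> \<omega>" and ad: "a \<notin> J 1" "d \<notin> J 1" and e: "e * (a * d - b * c * t ^ s) - 1 \<in> J l"
  shows "Kchar (e * (\<alpha> * d * a + \<gamma> * d * b * t ^ s - \<beta> * t ^ s * c * a - \<kappa> * t ^ s * c * b * t ^ s))
       (e * (\<beta> * a * a - \<alpha> * b * a - \<gamma> * b * b * t ^ s + \<kappa> * a * b * t ^ s))
       (e * (\<alpha> * d * c + \<gamma> * d * d - \<beta> * t ^ s * c * c - \<kappa> * t ^ s * c * d))
       (e * (\<beta> * a * c - \<alpha> * b * c - \<gamma> * b * d + \<kappa> * a * d))
       (\<lambda>k. \<omega> (inv (mk a b c d) \<otimes> k \<otimes> mk a b c d))"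
  unfolding Kchar_def km_conj[OF ad e] w[unfolded Kchar_def, rule_format]
  by (intro allI arg_cong[of _ _ \<Psi>]) (simp add: ts algebra_simps)

section \<open>The characters \<eta> and their stabilizers\<close>

abbreviation eta_on :: "'r \<Rightarrow> 'r \<Rightarrow> ('g \<Rightarrow> complex) \<Rightarrow> bool" where
  "eta_on uh wh \<equiv> Kchar uh wh 1 0"

definition Nset :: "'r \<Rightarrow> 'r \<Rightarrow> 'g set" where
  "Nset uh wh = {mk a b c d | a b c d. a \<notin> J 1 \<and> d \<notin> J 1 \<and> b - c * wh \<in> J m \<and> d - a + c * uh \<in> J l}"

text \<open>The two congruences say that the matrix commutes with the one with rows (uh, wh
  \<delta>) and (1, 0), to the available precision. In the converse only the second row (1, 0) is
  assumed to persist: this already forces commutation, so it also separates the orbits of different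
  \<eta>.\<close>

lemma stab_coeffs:
  assumes w: "eta_on uh wh \<omega>" and ad: "a \<notin> J 1" "d \<notin> J 1"
  shows "b - c * wh \<in> J m \<and> d - a + c * uh \<in> J l \<Longrightarrow> eta_on uh wh (\<lambda>k. \<omega> (inv (mk a b c d) \<otimes> k \<otimes> mk a b c d))"
    and "Kchar \<alpha> \<beta> 1 0 (\<lambda>k. \<omega> (inv (mk a b c d) \<otimes> k \<otimes> mk a b c d)) \<Longrightarrow> b - c * wh \<in> J m \<and> d - a + c * uh \<in> J l"
proof -
  let ?D = "a * d - b * c * t ^ s" and ?B = "b - c * wh" and ?C = "d - a + c * uh"
  obtain e where e: "e * ?D - 1 \<in> J l" using det_inverse[OF ad] by blast
  have em: "e * ?D - 1 \<in> J m" using e J_mono[of m l] dims by simp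
  have e1: "e \<notin> J 1"
  proof
    assume "e \<in> J 1"
    then have "e * ?D - (e * ?D - 1) \<in> J 1"
      by (rule J_diff[OF J_mult' J_mono[OF _ e]]) (use l_pos in simp_all)
    then show False using one_notin by simp
  qed
  note cj = Kchar_conj[OF w ad e]
  have wt: "t ^ s * x \<in> J l" if "x \<in> J m" for x
  proof -
    have "t ^ s * x = t ^ \<epsilon> * (t ^ (s - \<epsilon>) * x)" by (simp add: ts mult.assoc)
    then show ?thesis using that te_J J_mult by simp
  qed
  { assume h: "?B \<in> J m \<and> ?C \<in> J l"
    then have Cm: "?C \<in> J m" using J_mono[of m l] dims by simp
    have h4: "b * ?C + a * ?B \<in> J m" by (rule J_add[OF J_mult[OF Cm] J_mult[OF conjunct1[OF h]]])
    show "eta_on uh wh (\<lambda>k. \<omega> (inv (mk a b c d) \<otimes> k \<otimes> mk a b c d))"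
    proof (rule Kchar_cong[OF cj])
      have "e * (t ^ s * (b * ?C + a * ?B)) + (e * ?D - 1) * uh \<in> J l"
        by (rule J_add[OF J_mult[OF wt[OF h4]] J_mult'[OF e]])
      then show "e * (uh * d * a + 1 * d * b * t ^ s - wh * t ^ s * c * a - 0 * t ^ s * c * b * t ^ s) - uh \<in> J l"
        by (simp add: algebra_simps)
      have "(e * ?D - 1) * wh - e * (a * uh * ?B + b * t ^ s * ?B + wh * a * ?C) \<in> J m"
        by (rule J_diff[OF J_mult'[OF em] J_mult[OF J_add[OF J_add[OF J_mult[OF conjunct1[OF h]] J_mult[OF conjunct1[OF h]]] J_mult[OF Cm]]]])
      then show "e * (wh * a * a - uh * b * a - 1 * b * b * t ^ s + 0 * a * b * t ^ s) - wh \<in> J m"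
        by (simp add: algebra_simps)
      have "e * (d * ?C + c * (t ^ s * ?B)) + (e * ?D - 1) \<in> J l"
        by (rule J_add[OF J_mult[OF J_add[OF J_mult[OF conjunct2[OF h]] J_mult[OF wt[OF conjunct1[OF h]]]]] e])
      then show "e * (uh * d * c + 1 * d * d - wh * t ^ s * c * c - 0 * t ^ s * c * d) - 1 \<in> J l"
        by (simp add: algebra_simps)
      have "- (e * (b * ?C + a * ?B)) \<in> J m" using h4 J_mult J_neg by blast
      then show "e * (wh * a * c - uh * b * c - 1 * b * d + 0 * a * d) - 0 \<in> J m"
        by (simp add: algebra_simps)
    qed }
  { assume "Kchar \<alpha> \<beta> 1 0 (\<lambda>k. \<omega> (inv (mk a b c d) \<otimes> k \<otimes> mk a b c d))"
    from Kchar_unique[OF cj this]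
    have g: "e * (uh * d * c + 1 * d * d - wh * t ^ s * c * c - 0 * t ^ s * c * d) - 1 \<in> J l"
      and k: "e * (wh * a * c - uh * b * c - 1 * b * d + 0 * a * d) - 0 \<in> J m" by auto
    have "e * (d * ?C + c * (t ^ s * ?B)) \<in> J l" using J_diff[OF g e] by (simp add: algebra_simps)
    then have g': "d * ?C + c * (t ^ s * ?B) \<in> J l" by (rule unit_cancel[OF e1])
    have "e * (b * ?C + a * ?B) \<in> J m" using J_neg[OF k] by (simp add: algebra_simps)
    then have k': "b * ?C + a * ?B \<in> J m" by (rule unit_cancel[OF e1])
    \<comment> \<open>Cramer's rule for the two linear conditions \<open>g'\<close> and
      \<open>k'\<close> on \<open>?B\<close> and \<open>?C\<close>: eliminating \<open>?B\<close>
      leaves the determinant, a unit, times \<open>?C\<close>.\<close>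
    have "a * (d * ?C + c * (t ^ s * ?B)) - c * (t ^ s * (b * ?C + a * ?B)) \<in> J l"
      by (rule J_diff[OF J_mult[OF g'] J_mult[OF wt[OF k']]])
    then have "?D * ?C \<in> J l" by (simp add: algebra_simps)
    then have C: "?C \<in> J l" by (rule unit_cancel[OF unit_det[OF ad]])
    then have "b * ?C \<in> J m" using J_mono[of m l] dims J_mult by simp
    then have "a * ?B \<in> J m" using J_diff[OF k', of "b * ?C"] by simp
    then have "?B \<in> J m" by (rule unit_cancel[OF ad(1)])
    with C show "?B \<in> J m \<and> ?C \<in> J l" by simp }
qed

lemma Kchar_eqI: "(\<And>k. k \<in> Kg \<Longrightarrow> \<omega> k = \<omega>' k) \<Longrightarrow> Kchar \<alpha> \<beta> \<gamma> \<kappa> \<omega> \<Longrightarrow> Kchar \<alpha> \<beta> \<gamma> \<kappa> \<omega>'"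
  unfolding Kchar_def using km_in by auto

lemma Kchar_agree: "Kchar \<alpha> \<beta> \<gamma> \<kappa> \<omega> \<Longrightarrow> Kchar \<alpha> \<beta> \<gamma> \<kappa> \<omega>' \<Longrightarrow> k \<in> Kg \<Longrightarrow> \<omega> k = \<omega>' k"
  unfolding Kchar_def by (metis Kg_E)

lemma Nset_iff_stab:
  assumes w: "eta_on uh wh \<omega>"
  shows "Nset uh wh = {g \<in> carrier G. \<forall>k\<in>Kg. \<omega> (inv g \<otimes> k \<otimes> g) = \<omega> k}"
proof (intro Set.set_eqI iffI)
  fix g assume "g \<in> Nset uh wh"
  then obtain a b c d where g: "g = mk a b c d" "a \<notin> J 1" "d \<notin> J 1" "b - c * wh \<in> J m \<and> d - a + c * uh \<in> J l"
    unfolding Nset_def by blast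
  have "eta_on uh wh (\<lambda>k. \<omega> (inv g \<otimes> k \<otimes> g))" unfolding g(1) by (rule stab_coeffs(1)[OF w g(2,3,4)])
  then have "\<omega> (inv g \<otimes> k \<otimes> g) = \<omega> k" if "k \<in> Kg" for k using Kchar_agree[OF _ w that] by blast
  then show "g \<in> {g \<in> carrier G. \<forall>k\<in>Kg. \<omega> (inv g \<otimes> k \<otimes> g) = \<omega> k}" using g mk_closed by auto
next
  fix g assume "g \<in> {g \<in> carrier G. \<forall>k\<in>Kg. \<omega> (inv g \<otimes> k \<otimes> g) = \<omega> k}"
  then have g: "g \<in> carrier G" "\<And>k. k \<in> Kg \<Longrightarrow> \<omega> k = \<omega> (inv g \<otimes> k \<otimes> g)" by auto
  obtain a b c d where *: "a \<notin> J 1" "d \<notin> J 1" "g = mk a b c d" using mk_exh[OF g(1)] by blast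
  have "eta_on uh wh (\<lambda>k. \<omega> (inv g \<otimes> k \<otimes> g))" by (rule Kchar_eqI[OF g(2) w])
  then have "b - c * wh \<in> J m \<and> d - a + c * uh \<in> J l" unfolding *(3) by (rule stab_coeffs(2)[OF w *(1,2)])
  then show "g \<in> Nset uh wh" unfolding Nset_def using * by blast
qed

text \<open>If a conjugate of one \<eta> is again of this form, the conjugating element already
  stabilizes it by the second part of \<open>stab_coeffs\<close>, so the parameters agree.\<close>

lemma eta_conj_eq:
  assumes w: "eta_on uh wh \<omega>" and w': "eta_on uh' wh' \<omega>'" and g: "g \<in> carrier G"
    and conj: "\<And>k. k \<in> Kg \<Longrightarrow> \<omega>' (inv g \<otimes> k \<otimes> g) = \<omega> k"
  shows "uh - uh' \<in> J l \<and> wh - wh' \<in> J m"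
proof -
  obtain a b c d where *: "a \<notin> J 1" "d \<notin> J 1" "g = mk a b c d" using mk_exh[OF g] by blast
  have k: "eta_on uh wh (\<lambda>k. \<omega>' (inv g \<otimes> k \<otimes> g))" by (rule Kchar_eqI[OF _ w]) (simp add: conj)
  then have "b - c * wh' \<in> J m \<and> d - a + c * uh' \<in> J l" unfolding *(3) by (rule stab_coeffs(2)[OF w' *(1,2)])
  then have "eta_on uh' wh' (\<lambda>k. \<omega>' (inv g \<otimes> k \<otimes> g))" unfolding *(3) by (rule stab_coeffs(1)[OF w' *(1,2)])
  with k show ?thesis using Kchar_unique by blast
qed

lemma eta_exists: "\<exists>\<omega>. eta_on uh wh \<omega>"
proof -
  define \<omega> where "\<omega> k = (THE y. \<exists>u v w z. k = km u v w z \<and> y = \<Psi> (uh * u + v + t ^ \<epsilon> * (wh * w)))" for k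
  have "\<omega> (km u v w z) = \<Psi> (uh * u + v + t ^ \<epsilon> * (wh * w))" for u v w z
    unfolding \<omega>_def
  proof (rule the_equality)
    fix y assume "\<exists>u' v' w' z'. km u v w z = km u' v' w' z' \<and> y = \<Psi> (uh * u' + v' + t ^ \<epsilon> * (wh * w'))"
    then obtain u' v' w' z' where h: "km u v w z = km u' v' w' z'" and y: "y = \<Psi> (uh * u' + v' + t ^ \<epsilon> * (wh * w'))" by blast
    from h have "u - u' \<in> J l" "v - v' \<in> J l" "w - w' \<in> J m" unfolding km_eq by auto
    then have "uh * (u - u') + (v - v') + t ^ \<epsilon> * (wh * (w - w')) \<in> J l"
      by (intro J_add iffD2[OF te_J] J_mult) auto
    then have "\<Psi> (uh * u + v + t ^ \<epsilon> * (wh * w)) = y" unfolding y by (intro add_char_cong[OF Psi_add]) (simp add: algebra_simps)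
    then show "y = \<Psi> (uh * u + v + t ^ \<epsilon> * (wh * w))" ..
  qed blast
  then have "eta_on uh wh \<omega>" unfolding Kchar_def by simp
  then show ?thesis by blast
qed

lemma Nset_subgroup: "subgroup (Nset uh wh) G" and Kg_Nset: "Kg \<subseteq> Nset uh wh"
proof -
  obtain \<omega> where w: "eta_on uh wh \<omega>" using eta_exists by blast
  have Kc: "k \<in> carrier G" if "k \<in> Kg" for k using that km_closed unfolding Kg_def by auto
  show K: "Kg \<subseteq> Nset uh wh"
  proof
    fix k assume k: "k \<in> Kg"
    have "inv k \<otimes> h \<otimes> k = h" if h: "h \<in> Kg" for h
      using Kg_comm[OF h k] Kc[OF h] Kc[OF k] by (simp add: m_assoc)
    then show "k \<in> Nset uh wh" unfolding Nset_iff_stab[OF w] using Kc[OF k] by simp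
  qed
  show "subgroup (Nset uh wh) G"
  proof (rule subgroup_finiteI)
    show "Nset uh wh \<subseteq> carrier G" unfolding Nset_iff_stab[OF w] by auto
    show "km 0 0 0 0 \<in> Nset uh wh" using K km_in by blast
    fix g h assume gh: "g \<in> Nset uh wh" "h \<in> Nset uh wh"
    then have c: "g \<in> carrier G" "h \<in> carrier G" unfolding Nset_iff_stab[OF w] by auto
    have "\<omega> (inv (g \<otimes> h) \<otimes> k \<otimes> (g \<otimes> h)) = \<omega> k" if k: "k \<in> Kg" for k
    proof -
      have "inv (g \<otimes> h) \<otimes> k \<otimes> (g \<otimes> h) = inv h \<otimes> (inv g \<otimes> k \<otimes> g) \<otimes> h"
        using c Kc[OF k] by (simp add: inv_mult_group m_assoc)
      then show ?thesis using gh k Kg_normal[OF c(1) k] unfolding Nset_iff_stab[OF w] by auto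
    qed
    then show "g \<otimes> h \<in> Nset uh wh" unfolding Nset_iff_stab[OF w] using c by simp
  qed
qed

text \<open>The second factor is a linear polynomial in the matrix with rows \<open>(uh, wh \<delta>)\<close> and \<open>(1, 0)\<close>, so
  all these factors commute.\<close>

lemma Nset_decomp:
  assumes uh: "uh \<in> J 1" and g: "g \<in> Nset uh wh"
  obtains k a c where "k \<in> Kg" "a \<notin> J 1" "a - c * uh \<notin> J 1" "g = k \<otimes> mk a (c * wh) c (a - c * uh)"
proof -
  obtain a b c d where g: "g = mk a b c d" and ad: "a \<notin> J 1" "d \<notin> J 1" and B: "b - c * wh \<in> J m" and C: "d - a + c * uh \<in> J l"
    using g unfolding Nset_def by blast
  obtain \<beta> where b: "\<forall>n. (b - c * wh) - t ^ m * \<beta> \<in> J n" using J_decpow[OF B] by blast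
  obtain \<kappa> where d: "\<forall>n. (d - a + c * uh) - t ^ l * \<kappa> \<in> J n" using J_decpow[OF C] by blast
  let ?d = "a - c * uh"
  have du: "?d \<notin> J 1" using unit_add[OF ad(1), of "- (c * uh)"] uh J_mult J_neg by simp
  let ?D = "a * ?d - c * wh * c * t ^ s"
  obtain e where e: "e * ?D - 1 \<in> J l2" using det_inverse[OF ad(1) du] by blast
  \<comment> \<open>With C the second factor, this is 1 + (g - C) times the inverse of C. The
    difference g - C has second column (t ^ m \<beta> \<delta>, t ^ l \<kappa>) and first column
    zero.\<close>
  let ?k = "km (- (e * c * \<beta>)) (e * a * \<beta>) (- (e * c * \<kappa>)) (e * a * \<kappa>)"
  have tms: "t ^ (m + s) = t ^ m * t ^ s" by (simp add: power_add)
  have "?k \<otimes> mk a (c * wh) c ?d = g"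
    unfolding km_def g mk_mult[OF km_units ad(1) du]
  proof (subst mk_eq, goal_cases)
    case 1 show ?case by (rule unit_mult[OF km_units(1) ad(1)])
  next
    case 2 show ?case by (rule unit_mult'[OF km_units(2) du])
  next
    case 3 show ?case by (rule ad(1))
  next
    case 4 show ?case by (rule ad(2))
  next
    case 5
    show ?case
    proof (intro conjI)
      show "(1 + t ^ (m + s) * - (e * c * \<beta>)) * a + t ^ m * (e * a * \<beta>) * c * t ^ s - a \<in> J l1"
        by (simp add: tms algebra_simps)
      show "(1 + t ^ (m + s) * - (e * c * \<beta>)) * (c * wh) + t ^ m * (e * a * \<beta>) * ?d - b \<in> J l2"
        using J_diff[OF J_mult[OF e, of "t ^ m * \<beta>"] b[rule_format]] unfolding tms by (simp add: algebra_simps)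
      show "t ^ l * - (e * c * \<kappa>) * a + (1 + t ^ l * (e * a * \<kappa>)) * c - c \<in> J l2"
        by (simp add: algebra_simps)
      show "t ^ l * - (e * c * \<kappa>) * (c * wh) * t ^ s + (1 + t ^ l * (e * a * \<kappa>)) * ?d - d \<in> J l2"
        using J_diff[OF J_mult[OF e, of "t ^ l * \<kappa>"] d[rule_format]] by (simp add: algebra_simps)
    qed
  qed
  then show thesis using that[of ?k a c] km_in ad du by metis
qed

text \<open>Writing the elements as products of members of \<open>Kg\<close> and commuting matrices
  \<open>?C\<close>, \<open>?C'\<close>, the commutator becomes a quotient of two elements of
  \<open>Kg\<close>. Their \<omega>-values agree because \<open>?C\<close> and \<open>?C'\<close>
  stabilize \<omega>.\<close>

lemma Nset_comm:
  assumes uh: "uh \<in> J 1" and w: "eta_on uh wh \<omega>"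
  shows "comm_in_ker G (Nset uh wh) Kg \<omega>"
  unfolding comm_in_ker_def
proof (intro ballI)
  fix x y assume xy: "x \<in> Nset uh wh" "y \<in> Nset uh wh"
  obtain k a c where x: "k \<in> Kg" "a \<notin> J 1" "a - c * uh \<notin> J 1" "x = k \<otimes> mk a (c * wh) c (a - c * uh)"
    using Nset_decomp[OF uh xy(1)] by blast
  obtain k' a' c' where y: "k' \<in> Kg" "a' \<notin> J 1" "a' - c' * uh \<notin> J 1" "y = k' \<otimes> mk a' (c' * wh) c' (a' - c' * uh)"
    using Nset_decomp[OF uh xy(2)] by blast
  let ?C = "mk a (c * wh) c (a - c * uh)" and ?C' = "mk a' (c' * wh) c' (a' - c' * uh)"
  have Kc: "k \<in> carrier G" if "k \<in> Kg" for k using that km_closed unfolding Kg_def by auto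
  have cc: "?C \<in> carrier G" "?C' \<in> carrier G" using mk_closed x y by auto
  have CN: "?C \<in> Nset uh wh" "?C' \<in> Nset uh wh" unfolding Nset_def using x y by force+
  have comm: "?C \<otimes> ?C' = ?C' \<otimes> ?C"
    unfolding mk_mult[OF x(2,3) y(2,3)] mk_mult[OF y(2,3) x(2,3)] by (simp add: algebra_simps)
  have wc: "is_char G Kg \<omega>" by (rule Kchar_is_char[OF w])
  have conj: "g \<otimes> h \<otimes> inv g \<in> Kg \<and> \<omega> (g \<otimes> h \<otimes> inv g) = \<omega> h" if g: "g \<in> Nset uh wh" and h: "h \<in> Kg" for g h
  proof -
    have gc: "g \<in> carrier G" using g Nset_subgroup subgroup.mem_carrier by metis
    have K: "g \<otimes> h \<otimes> inv g \<in> Kg" using Kg_normal[of "inv g" h] gc h by simp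
    have "\<omega> (inv g \<otimes> (g \<otimes> h \<otimes> inv g) \<otimes> g) = \<omega> (g \<otimes> h \<otimes> inv g)" using g K unfolding Nset_iff_stab[OF w] by auto
    moreover have "inv g \<otimes> (g \<otimes> h \<otimes> inv g) \<otimes> g = h" using gc Kc[OF h] by (simp add: m_assoc)
    ultimately show ?thesis using K by simp
  qed
  let ?p = "k \<otimes> (?C \<otimes> k' \<otimes> inv ?C)" and ?r = "k' \<otimes> (?C' \<otimes> k \<otimes> inv ?C')"
  have pr: "?p \<in> Kg" "?r \<in> Kg" using x y conj[OF CN(1) y(1)] conj[OF CN(2) x(1)] Kg_subgroup by (auto simp: subgroup.m_closed)
  have wm: "\<omega> (g \<otimes> h) = \<omega> g * \<omega> h" if "g \<in> Kg" "h \<in> Kg" for g h using wc that unfolding is_char_def by blast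
  have w0: "\<omega> g \<noteq> 0" if "g \<in> Kg" for g using wc that unfolding is_char_def by blast
  have "\<omega> ?p = \<omega> ?r" using wm x y conj[OF CN(1) y(1)] conj[OF CN(2) x(1)] by simp
  then have "\<omega> (?p \<otimes> inv ?r) = 1"
    using wm[OF pr(1), of "inv ?r"] is_char_inv[OF Kg_subgroup wc pr(2)] w0[OF pr(2)] pr Kg_subgroup by (simp add: subgroup.m_inv_closed)
  moreover have "?p \<otimes> inv ?r \<in> Kg" using pr Kg_subgroup by (simp add: subgroup.m_closed subgroup.m_inv_closed)
  moreover have "x \<otimes> y = (?p \<otimes> inv ?r) \<otimes> (y \<otimes> x)"
  proof -
    have "x \<otimes> y = ?p \<otimes> (?C \<otimes> ?C')" unfolding x(4) y(4) using Kc x(1) y(1) cc by (simp add: m_assoc)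
    moreover have "y \<otimes> x = ?r \<otimes> (?C \<otimes> ?C')" unfolding comm unfolding x(4) y(4) using Kc x(1) y(1) cc by (simp add: m_assoc)
    ultimately show ?thesis using Kc[OF pr(1)] Kc[OF pr(2)] cc by (simp add: m_assoc)
  qed
  ultimately show "\<exists>k\<in>Kg. \<omega> k = 1 \<and> x \<otimes> y = k \<otimes> (y \<otimes> x)" by blast
qed

section \<open>Orders of the groups, the index of the stabilizer and the number of
  extensions\<close>

lemma card_G: "card (carrier G) = q ^ (l1 - 1) * (q - 1) * (q ^ (2 * l2) * (q ^ (l2 - 1) * (q - 1)))"
proof -
  let ?D = "(- J 1) \<times> UNIV \<times> UNIV \<times> (- J 1)"
  let ?f = "\<lambda>(a, b, c, d). mk a b c d" and ?g = "\<lambda>(a, b, c, d). (cs l1 a, cs l2 b, cs l2 c, cs l2 d)"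
  have "carrier G = ?f ` ?D"
  proof
    show "carrier G \<subseteq> ?f ` ?D"
    proof
      fix g assume "g \<in> carrier G"
      then obtain a b c d where "a \<notin> J 1" "d \<notin> J 1" "g = mk a b c d" using mk_exh by blast
      then show "g \<in> ?f ` ?D" by (intro image_eqI[of _ _ "(a, b, c, d)"]) auto
    qed
  qed (auto simp: mk_closed)
  moreover have "?g ` ?D = (cs l1 ` (- J 1)) \<times> range (cs l2) \<times> range (cs l2) \<times> (cs l2 ` (- J 1))" by (auto simp: image_iff)
  moreover have "card (?f ` ?D) = card (?g ` ?D)"
    by (rule card_image_same_kernel) (auto simp: mk_eq cs_eq)
  ultimately have "card (carrier G) = (q ^ (l1 - 1) * (q - 1)) * (q ^ l2 * (q ^ l2 * (q ^ (l2 - 1) * (q - 1))))"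
    using card_cs card_cs_units dims by (simp add: card_cartesian_product)
  then show ?thesis by (simp add: mult_2 power_add)
qed

text \<open>Free parameters are the unit a modulo \<open>J l1\<close>, c modulo \<open>J l2\<close>,
  and the deviations \<beta> modulo \<open>J l\<close> and \<kappa> modulo \<open>J m\<close> in the
  two congruences. The last three contribute l2 + l + m = 2 l2 to the exponent.\<close>

lemma card_Nset:
  assumes uh: "uh \<in> J 1"
  shows "card (Nset uh wh) = q ^ (l1 - 1) * (q - 1) * q ^ (2 * l2)"
proof -
  let ?D = "(- J 1) \<times> UNIV \<times> UNIV \<times> UNIV"
  let ?f = "\<lambda>(a, c, \<beta>, \<kappa>). mk a (c * wh + t ^ m * \<beta>) c (a - c * uh + t ^ l * \<kappa>)"
  let ?g = "\<lambda>(a, c, \<beta>, \<kappa>). (cs l1 a, cs l2 c, cs l \<beta>, cs m \<kappa>)"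
  have du: "a - c * uh + t ^ l * \<kappa> \<notin> J 1" if "a \<notin> J 1" for a c \<kappa>
  proof -
    have "- (c * uh) + t ^ l * \<kappa> \<in> J 1"
      using tpow_in[of 1 l \<kappa>] l_pos by (intro J_add[OF J_neg[OF J_mult[OF uh]]]) simp
    then show ?thesis using unit_add[OF that] by (metis add_diff_eq add.assoc diff_conv_add_uminus)
  qed
  have "Nset uh wh = ?f ` ?D"
  proof
    show "Nset uh wh \<subseteq> ?f ` ?D"
    proof
      fix g assume "g \<in> Nset uh wh"
      then obtain a b c d where g: "g = mk a b c d" and ad: "a \<notin> J 1" "d \<notin> J 1" and B: "b - c * wh \<in> J m" and C: "d - a + c * uh \<in> J l"
        unfolding Nset_def by blast
      obtain \<beta> where b: "\<forall>n. (b - c * wh) - t ^ m * \<beta> \<in> J n" using J_decpow[OF B] by blast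
      obtain \<kappa> where d: "\<forall>n. (d - a + c * uh) - t ^ l * \<kappa> \<in> J n" using J_decpow[OF C] by blast
      have "g = mk a (c * wh + t ^ m * \<beta>) c (a - c * uh + t ^ l * \<kappa>)"
        unfolding g mk_eq[OF ad ad(1) du[OF ad(1)]] using b[rule_format, of l2] d[rule_format, of l2] by (simp add: algebra_simps)
      then show "g \<in> ?f ` ?D" using ad by (intro image_eqI[of _ _ "(a, c, \<beta>, \<kappa>)"]) auto
    qed
    show "?f ` ?D \<subseteq> Nset uh wh" unfolding Nset_def using du tpow_in[of m m] tpow_in[of l l] by fastforce
  qed
  moreover have "?g ` ?D = (cs l1 ` (- J 1)) \<times> range (cs l2) \<times> range (cs l) \<times> range (cs m)" by (auto simp: image_iff)
  moreover have "card (?f ` ?D) = card (?g ` ?D)"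
  proof (rule card_image_same_kernel, clarify)
    fix a c \<beta> \<kappa> a' c' \<beta>' \<kappa>' assume a: "a \<notin> J 1" "a' \<notin> J 1"
    have "(c * wh + t ^ m * \<beta> - (c' * wh + t ^ m * \<beta>') \<in> J l2 \<longleftrightarrow> \<beta> - \<beta>' \<in> J l) \<and>
      (a - c * uh + t ^ l * \<kappa> - (a' - c' * uh + t ^ l * \<kappa>') \<in> J l2 \<longleftrightarrow> \<kappa> - \<kappa>' \<in> J m)"
      if ac: "a - a' \<in> J l1" "c - c' \<in> J l2"
    proof
      have "c * wh + t ^ m * \<beta> - (c' * wh + t ^ m * \<beta>') - t ^ m * (\<beta> - \<beta>') = (c - c') * wh" by (simp add: algebra_simps)
      then have "c * wh + t ^ m * \<beta> - (c' * wh + t ^ m * \<beta>') \<in> J l2 \<longleftrightarrow> t ^ m * (\<beta> - \<beta>') \<in> J l2"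
        using ac(2) J_mult' by (intro J_cong) simp
      then show "c * wh + t ^ m * \<beta> - (c' * wh + t ^ m * \<beta>') \<in> J l2 \<longleftrightarrow> \<beta> - \<beta>' \<in> J l" using dims by (simp add: J_tpow')
      have a2: "a - a' \<in> J l2" using ac J_mono[of l2 l1] dims by simp
      have "a - c * uh + t ^ l * \<kappa> - (a' - c' * uh + t ^ l * \<kappa>') - t ^ l * (\<kappa> - \<kappa>') = (a - a') - (c - c') * uh"
        by (simp add: algebra_simps)
      then have "a - c * uh + t ^ l * \<kappa> - (a' - c' * uh + t ^ l * \<kappa>') \<in> J l2 \<longleftrightarrow> t ^ l * (\<kappa> - \<kappa>') \<in> J l2"
        using J_diff[OF a2 J_mult'[OF ac(2)]] by (intro J_cong) (simp only:)
      then show "a - c * uh + t ^ l * \<kappa> - (a' - c' * uh + t ^ l * \<kappa>') \<in> J l2 \<longleftrightarrow> \<kappa> - \<kappa>' \<in> J m" using dims by (simp add: J_tpow')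
    qed
    then show "mk a (c * wh + t ^ m * \<beta>) c (a - c * uh + t ^ l * \<kappa>) = mk a' (c' * wh + t ^ m * \<beta>') c' (a' - c' * uh + t ^ l * \<kappa>') \<longleftrightarrow>
      (cs l1 a, cs l2 c, cs l \<beta>, cs m \<kappa>) = (cs l1 a', cs l2 c', cs l \<beta>', cs m \<kappa>')"
      unfolding mk_eq[OF a(1) du[OF a(1)] a(2) du[OF a(2)]] by (auto simp: cs_eq)
  qed
  ultimately have "card (Nset uh wh) = (q ^ (l1 - 1) * (q - 1)) * (q ^ l2 * (q ^ l * q ^ m))"
    using card_cs card_cs_units dims by (simp add: card_cartesian_product)
  moreover have "q ^ (2 * l2) = q ^ l2 * (q ^ l * q ^ m)"
  proof -
    have "2 * l2 = l2 + (l + m)" using dims by simp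
    then have "q ^ (2 * l2) = q ^ (l2 + (l + m))" by (rule arg_cong)
    then show ?thesis by (simp only: power_add)
  qed
  ultimately show ?thesis by simp
qed

lemma Nset_index:
  assumes uh: "uh \<in> J 1" and lt: "left_transversal G (Nset uh wh) xs"
  shows "length xs = q ^ (l2 - 1) * (q - 1)"
proof -
  have "card (carrier G) = length xs * card (Nset uh wh)" by (rule left_transversal.card_index[OF lt])
  then have "card (Nset uh wh) * (q ^ (l2 - 1) * (q - 1)) = card (Nset uh wh) * length xs"
    unfolding card_G card_Nset[OF uh] by (simp add: mult_ac)
  moreover have "card (Nset uh wh) > 0"
    using finite_sub[OF Nset_subgroup] subgroup.one_closed[OF Nset_subgroup] card_gt_0_iff by blast
  ultimately show ?thesis by simp
qed

text \<open>The factor \<open>q ^ (2 * l2)\<close> in the order of the stabilizer is exactly the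
  order of \<open>Kg\<close>, which leaves the number of extensions.\<close>

lemma card_extensions:
  assumes uh: "uh \<in> J 1" and w: "eta_on uh wh \<omega>"
  shows "finite (char_exts G (Nset uh wh) Kg \<omega>) \<and> card (char_exts G (Nset uh wh) Kg \<omega>) = q ^ (l1 - 1) * (q - 1)"
proof -
  have "finite (char_exts G (Nset uh wh) Kg \<omega>) \<and> card (char_exts G (Nset uh wh) Kg \<omega>) * card Kg = card (Nset uh wh)"
    by (rule card_char_exts[OF Nset_subgroup Kg_subgroup Kg_Nset Kchar_is_char[OF w] Nset_comm[OF uh w]])
  then show ?thesis unfolding card_Nset[OF uh] card_Kg using q_pos by simp
qed

lemma one_lt_q: "1 < q"
proof -
  have "cs 1 0 \<noteq> cs 1 1" using one_notin J_neg[of "-1" 1] by (auto simp: cs_eq)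
  moreover have "card {cs 1 0, cs 1 1} \<le> q" unfolding q_def by (rule card_mono[OF finite_cs1]) auto
  ultimately show ?thesis by simp
qed

end

section \<open>Cuspidality in coordinates\<close>

lemma (in group) eigen_is_char:
  assumes K: "subgroup K G" and r: "mat_rep G n r"
    and w: "w \<in> carrier_vec n" "w \<noteq> 0\<^sub>v n" "\<And>k. k \<in> K \<Longrightarrow> r k *\<^sub>v w = \<chi> k \<cdot>\<^sub>v w"
  shows "is_char G K \<chi>"
proof -
  obtain i where i: "i < n" "w $ i \<noteq> 0" using vec_nonzeroE[OF w(1,2)] by blast
  have Kc: "k \<in> carrier G" if "k \<in> K" for k using K that by (simp add: subgroup.mem_carrier)
  have inj: "x = y" if "x \<cdot>\<^sub>v w = y \<cdot>\<^sub>v w" for x y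
  proof -
    have "(x \<cdot>\<^sub>v w) $ i = (y \<cdot>\<^sub>v w) $ i" using that by simp
    then show ?thesis using i w(1) by simp
  qed
  have "\<chi> (h \<otimes> k) = \<chi> h * \<chi> k" if hk: "h \<in> K" "k \<in> K" for h k
  proof (rule inj)
    have "\<chi> (h \<otimes> k) \<cdot>\<^sub>v w = r h *\<^sub>v (r k *\<^sub>v w)"
      using mat_rep_mult[OF r Kc[OF hk(1)] Kc[OF hk(2)] w(1)] w(3)[of "h \<otimes> k"] hk K by (simp add: subgroup.m_closed)
    also have "\<dots> = \<chi> k \<cdot>\<^sub>v (r h *\<^sub>v w)"
      unfolding w(3)[OF hk(2)] by (rule mult_mat_vec[OF mat_rep_carrier[OF r Kc[OF hk(1)]] w(1)])
    also have "\<dots> = (\<chi> h * \<chi> k) \<cdot>\<^sub>v w" unfolding w(3)[OF hk(1)] by (simp add: smult_smult_assoc mult.commute)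
    finally show "\<chi> (h \<otimes> k) \<cdot>\<^sub>v w = (\<chi> h * \<chi> k) \<cdot>\<^sub>v w" .
  qed
  moreover have "\<chi> k \<noteq> 0" if k: "k \<in> K" for k
  proof
    assume "\<chi> k = 0"
    then have "r k *\<^sub>v w = 0\<^sub>v n" unfolding w(3)[OF k] using w(1) by (intro eq_vecI) auto
    then show False using mat_rep_nonzero[OF r Kc[OF k] w(1,2)] by simp
  qed
  ultimately show ?thesis unfolding is_char_def by blast
qed

lemma (in group) comm_in_kerI:
  assumes "subgroup K G" "H \<subseteq> carrier G" "is_char G K \<chi>" "\<And>x y. x \<in> H \<Longrightarrow> y \<in> H \<Longrightarrow> x \<otimes> y = y \<otimes> x"
  shows "comm_in_ker G H K \<chi>"
  unfolding comm_in_ker_def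
proof (intro ballI bexI[of _ \<one>] conjI)
  show "\<chi> \<one> = 1" by (rule is_char_one[OF assms(1,3)])
  show "\<one> \<in> K" using assms(1) by (simp add: subgroup.one_closed)
  fix x y assume "x \<in> H" "y \<in> H"
  moreover from this have "y \<otimes> x \<in> carrier G" using assms(2) by auto
  ultimately show "x \<otimes> y = \<one> \<otimes> (y \<otimes> x)" using assms(4) by simp
qed

context lam_group
begin

text \<open>\<open>U12\<close> and \<open>U21\<close> are the unitriangular matrices of the last
  layer. They lie in \<open>Kg\<close>, and each kind of induction excluded by cuspidality starts
  from a representation that is trivial on one of the two families.\<close>

definition U12 :: "'r \<Rightarrow> 'g" where "U12 b = mk 1 (t ^ (l2 - 1) * b) 0 1"
definition U21 :: "'r \<Rightarrow> 'g" where "U21 c = mk 1 0 (t ^ (l2 - 1) * c) 1"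

lemma U12_km: "U12 b = km 0 (t ^ (l - 1) * b) 0 0"
proof -
  have "l2 - 1 = m + (l - 1)" using dims by simp
  then show ?thesis by (simp add: U12_def km_def power_add mult.assoc)
qed

lemma U21_km: "U21 c = km 0 0 (t ^ (m - 1) * c) 0"
proof -
  have "l2 - 1 = l + (m - 1)" using dims by simp
  then show ?thesis by (simp add: U21_def km_def power_add mult.assoc)
qed

lemma U12_subgroup: "subgroup (range U12) G" and U21_subgroup: "subgroup (range U21) G"
proof -
  show "subgroup (range U12) G"
  proof (rule subgroup_finiteI)
    show "range U12 \<subseteq> carrier G" by (auto simp: U12_km km_closed)
    show "U12 0 \<in> range U12" by blast
    fix a b assume "a \<in> range U12" "b \<in> range U12"
    then obtain x y where "a = U12 x" "b = U12 y" by blast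
    then have "a \<otimes> b = U12 (x + y)" by (simp add: U12_km km_mult distrib_left)
    then show "a \<otimes> b \<in> range U12" by blast
  qed
  show "subgroup (range U21) G"
  proof (rule subgroup_finiteI)
    show "range U21 \<subseteq> carrier G" by (auto simp: U21_km km_closed)
    show "U21 0 \<in> range U21" by blast
    fix a b assume "a \<in> range U21" "b \<in> range U21"
    then obtain x y where "a = U21 x" "b = U21 y" by blast
    then have "a \<otimes> b = U21 (x + y)" by (simp add: U21_km km_mult distrib_left)
    then show "a \<otimes> b \<in> range U21" by blast
  qed
qed

lemma char_commutator:
  assumes "is_char G (carrier G) \<chi>" "x \<in> carrier G" "y \<in> carrier G" "h \<in> carrier G" "x \<otimes> y = h \<otimes> (y \<otimes> x)"
  shows "\<chi> h = 1"
proof -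
  have "\<chi> x * \<chi> y = \<chi> (h \<otimes> (y \<otimes> x))" using assms unfolding is_char_def by metis
  also have "\<dots> = \<chi> h * (\<chi> y * \<chi> x)" using assms unfolding is_char_def by simp
  finally show ?thesis using assms unfolding is_char_def by simp
qed

text \<open>These elements, or their inverses, are commutators of the diagonal matrix (1 + t, 1)
  with a unitriangular matrix one layer higher. Twists are therefore invisible on them. The higher
  layer exists because l2 > 1.\<close>

lemma char_U: assumes chi: "is_char G (carrier G) \<chi>" shows "\<chi> (U12 b) = 1" "\<chi> (U21 c) = 1"
proof -
  have u: "1 + t \<notin> J 1" using unit_1t[of 1 1] by simp
  have "l2 - 1 = Suc (l2 - 2)" "l2 = Suc (l2 - 1)" using dims by simp_all
  then have e: "t ^ (l2 - 1) = t * t ^ (l2 - 2)" and tt: "t * t ^ (l2 - 1) = t ^ l2" by (metis power_Suc)+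
  show "\<chi> (U12 b) = 1"
  proof (rule char_commutator[OF chi])
    show "mk (1 + t) 0 0 1 \<otimes> mk 1 (t ^ (l2 - 2) * b) 0 1 = U12 b \<otimes> (mk 1 (t ^ (l2 - 2) * b) 0 1 \<otimes> mk (1 + t) 0 0 1)"
      unfolding U12_def e using u one_notin by (simp add: mk_mult algebra_simps)
  qed (use u one_notin mk_closed U12_def in auto)
  have t2: "t ^ l2 * x \<in> J l2" for x using tpow_in by blast
  show "\<chi> (U21 c) = 1"
  proof (rule char_commutator[OF chi])
    have "U21 c \<otimes> (mk (1 + t) 0 0 1 \<otimes> mk 1 0 (t ^ (l2 - 2) * c) 1)
      = mk (1 + t) 0 (t ^ (l2 - 1) * c * (1 + t) + t ^ (l2 - 2) * c) 1"
      unfolding U21_def using u one_notin by (simp add: mk_mult algebra_simps)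
    moreover have "mk 1 0 (t ^ (l2 - 2) * c) 1 \<otimes> mk (1 + t) 0 0 1 = mk (1 + t) 0 (t ^ (l2 - 2) * c * (1 + t)) 1"
      using u one_notin by (simp add: mk_mult algebra_simps)
    moreover have "t ^ (l2 - 2) * c * (1 + t) - (t ^ (l2 - 1) * c * (1 + t) + t ^ (l2 - 2) * c) = - (t ^ l2 * c)"
      unfolding tt[symmetric] e by (simp add: algebra_simps)
    ultimately show "mk 1 0 (t ^ (l2 - 2) * c) 1 \<otimes> mk (1 + t) 0 0 1 = U21 c \<otimes> (mk (1 + t) 0 0 1 \<otimes> mk 1 0 (t ^ (l2 - 2) * c) 1)"
      using u one_notin J_neg[OF t2] by (simp add: mk_eq)
  qed (use u one_notin mk_closed U21_def in auto)
qed

text \<open>Modulo \<open>J 1\<close> the terms with uh or \<open>t ^ s\<close> drop out of the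
  conjugated coefficients. Those dual to v and w reduce to e d d and e wh a a, which are units, and
  \<open>\<Psi>\<close> is nontrivial on the last layer.\<close>

lemma eta_conj_nontrivial:
  assumes uh: "uh \<in> J 1" and wh: "wh \<notin> J 1" and w: "eta_on uh wh \<omega>" and g: "g \<in> carrier G"
  shows "\<exists>b. \<omega> (inv g \<otimes> U12 b \<otimes> g) \<noteq> 1" "\<exists>c. \<omega> (inv g \<otimes> U21 c \<otimes> g) \<noteq> 1"
proof -
  obtain a b c d where *: "a \<notin> J 1" "d \<notin> J 1" "g = mk a b c d" using mk_exh[OF g] by blast
  obtain e where e: "e * (a * d - b * c * t ^ s) - 1 \<in> J l" using det_inverse[OF *(1,2)] by blast
  have e1: "e \<notin> J 1"
  proof
    assume "e \<in> J 1"
    then have "e * (a * d - b * c * t ^ s) - (e * (a * d - b * c * t ^ s) - 1) \<in> J 1"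
      by (rule J_diff[OF J_mult' J_mono[OF _ e]]) (use l_pos in simp_all)
    then show False using one_notin by simp
  qed
  note cj = Kchar_conj[OF w *(1,2) e, folded *(3), unfolded Kchar_def, rule_format]
  let ?\<gamma> = "e * (uh * d * c + 1 * d * d - wh * t ^ s * c * c - 0 * t ^ s * c * d)"
  let ?\<beta> = "e * (wh * a * a - uh * b * a - 1 * b * b * t ^ s + 0 * a * b * t ^ s)"
  have ju: "uh * x \<in> J 1" for x using J_mult'[OF uh] .
  have "d * d + (uh * (d * c) - (wh * c * c) * t ^ s) \<notin> J 1"
    by (rule unit_add[OF _ J_diff[OF ju ts_in]]) (use *(2) prime_J in blast)
  then have g1: "?\<gamma> \<notin> J 1" unfolding prime_J[of e] using e1 by (simp add: algebra_simps)
  have "wh * a * a + (- (uh * (b * a)) - (b * b) * t ^ s) \<notin> J 1"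
    by (rule unit_add[OF _ J_diff[OF J_neg[OF ju] ts_in]]) (use *(1) wh prime_J in blast)
  then have b1: "?\<beta> \<notin> J 1" unfolding prime_J[of e] using e1 by (simp add: algebra_simps)
  show "\<exists>b. \<omega> (inv g \<otimes> U12 b \<otimes> g) \<noteq> 1"
  proof (rule ccontr)
    assume h: "\<not> ?thesis"
    have "\<Psi> (t ^ (l - 1) * ?\<gamma> * y) = 1" for y
    proof -
      have "\<omega> (inv g \<otimes> U12 y \<otimes> g) = \<Psi> (?\<gamma> * (t ^ (l - 1) * y))" unfolding U12_km cj by simp
      then show ?thesis using h by (simp add: mult_ac)
    qed
    then have "t ^ (l - 1) * ?\<gamma> \<in> J l" by (rule prim_char_nondegenerate[OF Psi])
    then show False using J_tpow'[of "l - 1" l ?\<gamma>] g1 l_pos by simp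
  qed
  show "\<exists>c. \<omega> (inv g \<otimes> U21 c \<otimes> g) \<noteq> 1"
  proof (rule ccontr)
    assume h: "\<not> ?thesis"
    have "\<epsilon> + (m - 1) = l - 1" using dims by simp
    then have tl: "t ^ \<epsilon> * t ^ (m - 1) = t ^ (l - 1)" by (metis power_add)
    have "\<Psi> (t ^ (l - 1) * ?\<beta> * y) = 1" for y
    proof -
      have "\<omega> (inv g \<otimes> U21 y \<otimes> g) = \<Psi> (t ^ \<epsilon> * (?\<beta> * (t ^ (m - 1) * y)))" unfolding U21_km cj by simp
      also have "t ^ \<epsilon> * (?\<beta> * (t ^ (m - 1) * y)) = t ^ (l - 1) * ?\<beta> * y" unfolding tl[symmetric] by (simp only: mult_ac)
      finally show ?thesis using h by simp
    qed
    then have "t ^ (l - 1) * ?\<beta> \<in> J l" by (rule prim_char_nondegenerate[OF Psi])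
    then show False using J_tpow'[of "l - 1" l ?\<beta>] b1 l_pos by simp
  qed
qed

text \<open>The family \<open>U\<close> acts diagonally through conjugates of \<theta>, each of them
  nontrivial on it, and the twist is trivial there. One nonzero coordinate of \<open>v\<close> gives
  the contradiction.\<close>

lemma ind_no_fixed_vector:
  assumes uh: "uh \<in> J 1" and wh: "wh \<notin> J 1" and th: "is_char G (Nset uh wh) \<theta>" "eta_on uh wh \<theta>"
    and lt: "left_transversal G (Nset uh wh) xs" and chi: "is_char G (carrier G) \<chi>"
    and v: "v \<in> carrier_vec (length xs)" "v \<noteq> 0\<^sub>v (length xs)"
    and U: "U = range U12 \<or> U = range U21"
  shows "\<exists>h\<in>U. (\<chi> h \<cdot>\<^sub>m ind_char G (Nset uh wh) xs \<theta> h) *\<^sub>v v \<noteq> v"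
proof -
  interpret left_transversal G "Nset uh wh" xs by (rule lt)
  obtain i where i: "i < length xs" "v $ i \<noteq> 0" using vec_nonzeroE[OF v] by blast
  have "\<exists>h\<in>U. \<theta> (inv (xs ! i) \<otimes> h \<otimes> xs ! i) \<noteq> 1"
    using eta_conj_nontrivial[OF uh wh th(2) xc[OF i(1)]] U by blast
  then obtain h where h: "h \<in> U" "\<theta> (inv (xs ! i) \<otimes> h \<otimes> xs ! i) \<noteq> 1" by blast
  have hK: "h \<in> Kg" using h(1) U by (auto simp: U12_km U21_km km_in)
  have hc: "h \<in> carrier G" using hK km_closed Kg_def by auto
  have c1: "\<chi> h = 1" using h(1) U char_U[OF chi] by auto
  have "inv (xs ! i) \<otimes> h \<otimes> xs ! i \<in> Nset uh wh" using Kg_normal[OF xc[OF i(1)] hK] Kg_Nset by blast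
  from ind_char_diag[OF hc this i(1) v(1), of \<theta>]
  have "((\<chi> h \<cdot>\<^sub>m ind_char G (Nset uh wh) xs \<theta> h) *\<^sub>v v) $ i = \<theta> (inv (xs ! i) \<otimes> h \<otimes> xs ! i) * v $ i"
  proof -
    have "1 \<cdot>\<^sub>m ind_char G (Nset uh wh) xs \<theta> h = ind_char G (Nset uh wh) xs \<theta> h" by (rule eq_matI) auto
    then show ?thesis using \<open>(ind_char G (Nset uh wh) xs \<theta> h *\<^sub>v v) $ i = _\<close> by (simp only: c1)
  qed
  then have "((\<chi> h \<cdot>\<^sub>m ind_char G (Nset uh wh) xs \<theta> h) *\<^sub>v v) $ i \<noteq> v $ i" using h(2) i(2) by simp
  then show ?thesis using h(1) by metis
qed

subsection \<open>Twists\<close>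

text \<open>The witness is a character of the determinant modulo \<open>P ^ l2\<close>.\<close>

lemma det_char:
  obtains \<chi> where "is_char G (carrier G) \<chi>"
    "\<And>b c z. b = 0 \<or> c = 0 \<Longrightarrow> \<chi> (mk 1 b c (1 + t ^ (l2 - 1) * z)) = \<Psi> (t ^ (l - 1) * (\<kappa> * z))"
proof -
  have lt: "0 < l2 - 1" using dims by simp
  define dt where "dt a b c d = a * d - b * c * t ^ s" for a b c d
  define is_mk where "is_mk g a b c d \<longleftrightarrow> a \<notin> J 1 \<and> d \<notin> J 1 \<and> g = mk a b c d" for g a b c d
  \<comment> \<open>The group element determines b, c and d only modulo \<open>J l2\<close>, hence
    also the determinant.\<close>
  have dt_cong: "dt a b c d - dt a' b' c' d' \<in> J l2" if "is_mk g a b c d" "is_mk g a' b' c' d'" for g a b c d a' b' c' d'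
  proof -
    have "mk a b c d = mk a' b' c' d'" using that unfolding is_mk_def by simp
    then have j: "a - a' \<in> J l1" "b - b' \<in> J l2" "c - c' \<in> J l2" "d - d' \<in> J l2"
      using mk_eq that unfolding is_mk_def by auto
    have "a - a' \<in> J l2" using j(1) J_mono[of l2 l1] dims by simp
    from J_diff[OF J_add[OF J_mult'[OF this, of d] J_mult'[OF j(4), of a']] J_add[OF J_mult'[OF j(2), of "c * t ^ s"] J_mult'[OF j(3), of "b' * t ^ s"]]]
    show ?thesis by (simp add: dt_def algebra_simps)
  qed
  have dt_mult: "\<exists>a'' b'' c'' d''. is_mk (g \<otimes> h) a'' b'' c'' d'' \<and> dt a'' b'' c'' d'' = dt a b c d * dt a' b' c' d'"
    if "is_mk g a b c d" "is_mk h a' b' c' d'" for g h a b c d a' b' c' d'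
  proof (intro exI conjI)
    show "is_mk (g \<otimes> h) (a * a' + b * c' * t ^ s) (a * b' + b * d') (c * a' + d * c') (c * b' * t ^ s + d * d')"
      using that unit_mult unit_mult' mk_mult unfolding is_mk_def by auto
    show "dt (a * a' + b * c' * t ^ s) (a * b' + b * d') (c * a' + d * c') (c * b' * t ^ s + d * d') = dt a b c d * dt a' b' c' d'"
      by (simp add: dt_def algebra_simps)
  qed
  have tz: "t ^ (l2 - 1) * z \<in> J l2 \<longleftrightarrow> z \<in> J 1" for z using J_tpow'[of "l2 - 1" l2 z] dims by simp
  define \<chi> where "\<chi> g = (THE y. \<exists>a b c d z. is_mk g a b c d \<and> dt a b c d - 1 - t ^ (l2 - 1) * z \<in> J l2 \<and> y = \<Psi> (t ^ (l - 1) * (\<kappa> * z)))" for g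
  have chi: "\<chi> g = \<Psi> (t ^ (l - 1) * (\<kappa> * z))" if g: "is_mk g a b c d" "dt a b c d - 1 - t ^ (l2 - 1) * z \<in> J l2" for g a b c d z
    unfolding \<chi>_def
  proof (rule the_equality)
    fix y assume "\<exists>a b c d z. is_mk g a b c d \<and> dt a b c d - 1 - t ^ (l2 - 1) * z \<in> J l2 \<and> y = \<Psi> (t ^ (l - 1) * (\<kappa> * z))"
    then obtain a' b' c' d' z' where h: "is_mk g a' b' c' d'" "dt a' b' c' d' - 1 - t ^ (l2 - 1) * z' \<in> J l2" and y: "y = \<Psi> (t ^ (l - 1) * (\<kappa> * z'))" by blast
    from J_diff[OF J_diff[OF h(2) g(2)] dt_cong[OF h(1) g(1)]]
    have "t ^ (l2 - 1) * (z - z') \<in> J l2" by (simp add: algebra_simps)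
    then have "\<kappa> * (z' - z) \<in> J 1" unfolding tz using J_minus_commute J_mult by blast
    then have "t ^ (l - 1) * (\<kappa> * (z' - z)) \<in> J l" using J_tpow'[of "l - 1" l] l_pos by simp
    then show "y = \<Psi> (t ^ (l - 1) * (\<kappa> * z))" unfolding y by (intro add_char_cong[OF Psi_add]) (simp add: algebra_simps)
  qed (use g in blast)
  \<comment> \<open>On this subgroup the determinant is 1 + \<open>t ^ (l2 - 1) * z\<close>, with z
    well defined modulo \<open>J 1\<close>. It multiplies by adding z because 2 (l2 - 1) \<ge>
    l2.\<close>
  define H where "H = {g. \<exists>a b c d. is_mk g a b c d \<and> dt a b c d - 1 \<in> J (l2 - 1)}"
  have HE: "\<exists>a b c d z. is_mk g a b c d \<and> dt a b c d - 1 - t ^ (l2 - 1) * z \<in> J l2" if "g \<in> H" for g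
    using that J_decpow unfolding H_def by blast
  have HI: "g \<in> H" if "is_mk g a b c d" "dt a b c d - 1 - t ^ (l2 - 1) * z \<in> J l2" for g a b c d z
  proof -
    have "dt a b c d - 1 - t ^ (l2 - 1) * z \<in> J (l2 - 1)" using that(2) J_mono[of "l2 - 1" l2] by simp
    from J_add[OF this tpow_in[of "l2 - 1" "l2 - 1" z]] have "dt a b c d - 1 \<in> J (l2 - 1)" by simp
    then show ?thesis unfolding H_def using that(1) by blast
  qed
  have prod: "g \<otimes> h \<in> H \<and> \<chi> (g \<otimes> h) = \<chi> g * \<chi> h" if gh: "g \<in> H" "h \<in> H" for g h
  proof -
    obtain a b c d z where g: "is_mk g a b c d" "dt a b c d - 1 - t ^ (l2 - 1) * z \<in> J l2" using HE[OF gh(1)] by blast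
    obtain a' b' c' d' z' where h: "is_mk h a' b' c' d'" "dt a' b' c' d' - 1 - t ^ (l2 - 1) * z' \<in> J l2" using HE[OF gh(2)] by blast
    obtain a'' b'' c'' d'' where k: "is_mk (g \<otimes> h) a'' b'' c'' d''" "dt a'' b'' c'' d'' = dt a b c d * dt a' b' c' d'"
      using dt_mult[OF g(1) h(1)] by blast
    have "l2 \<le> (l2 - 1) + (l2 - 1)" using dims by simp
    then have "t ^ ((l2 - 1) + (l2 - 1)) * (z * z') \<in> J l2" using tpow_in by blast
    from J_add[OF J_add[OF J_mult'[OF g(2), of "dt a' b' c' d'"] J_mult[OF h(2), of "1 + t ^ (l2 - 1) * z"]] this]
    have "dt a'' b'' c'' d'' - 1 - t ^ (l2 - 1) * (z + z') \<in> J l2"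
      unfolding k(2) power_add by (simp add: algebra_simps)
    then have "g \<otimes> h \<in> H" "\<chi> (g \<otimes> h) = \<Psi> (t ^ (l - 1) * (\<kappa> * (z + z')))" using HI[OF k(1)] chi[OF k(1)] by auto
    then show ?thesis unfolding chi[OF g] chi[OF h] by (simp add: add_char_add[OF Psi_add] distrib_left)
  qed
  have one: "is_mk \<one> 1 0 0 1" using mk_one one_notin unfolding is_mk_def by simp
  have Hsub: "subgroup H G"
  proof (rule subgroup_finiteI)
    show "H \<subseteq> carrier G" unfolding H_def is_mk_def using mk_closed by auto
    show "\<one> \<in> H" by (rule HI[OF one, of 0]) (simp add: dt_def)
  qed (use prod in blast)
  have nz: "\<chi> g \<noteq> 0" if "g \<in> H" for g using HE[OF that] chi add_char_nonzero[OF Psi_add] by metis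
  have char: "is_char G H \<chi>" unfolding is_char_def using prod nz by blast
  have comm: "comm_in_ker G (carrier G) H \<chi>"
    unfolding comm_in_ker_def
  proof (intro ballI)
    fix x y assume xy: "x \<in> carrier G" "y \<in> carrier G"
    \<comment> \<open>A commutator has determinant 1 modulo \<open>J l2\<close>, so it lies in
      \<open>H\<close> and its character value is 1.\<close>
    let ?k = "(x \<otimes> y) \<otimes> inv (y \<otimes> x)"
    have k: "?k \<in> carrier G" "x \<otimes> y = ?k \<otimes> (y \<otimes> x)" using xy by (simp_all add: m_assoc)
    obtain a b c d where x: "is_mk x a b c d" using mk_exh[OF xy(1)] unfolding is_mk_def by blast
    obtain a' b' c' d' where y: "is_mk y a' b' c' d'" using mk_exh[OF xy(2)] unfolding is_mk_def by blast
    obtain p1 p2 p3 p4 where p: "is_mk ?k p1 p2 p3 p4" using mk_exh[OF k(1)] unfolding is_mk_def by blast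
    obtain r1 r2 r3 r4 where r: "is_mk (y \<otimes> x) r1 r2 r3 r4" "dt r1 r2 r3 r4 = dt a' b' c' d' * dt a b c d" using dt_mult[OF y x] by blast
    obtain s1 s2 s3 s4 where s': "is_mk (x \<otimes> y) s1 s2 s3 s4" "dt s1 s2 s3 s4 = dt a b c d * dt a' b' c' d'" using dt_mult[OF x y] by blast
    obtain u1 u2 u3 u4 where u: "is_mk (?k \<otimes> (y \<otimes> x)) u1 u2 u3 u4" "dt u1 u2 u3 u4 = dt p1 p2 p3 p4 * dt r1 r2 r3 r4" using dt_mult[OF p r(1)] by blast
    have "dt u1 u2 u3 u4 - dt s1 s2 s3 s4 \<in> J l2" by (rule dt_cong[OF u(1)[folded k(2)] s'(1)])
    then have "dt r1 r2 r3 r4 * (dt p1 p2 p3 p4 - 1) \<in> J l2" unfolding u(2) s'(2) r(2) by (simp add: algebra_simps)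
    moreover have "dt r1 r2 r3 r4 \<notin> J 1" using r(1) unit_det unfolding dt_def is_mk_def by blast
    ultimately have "dt p1 p2 p3 p4 - 1 \<in> J l2" using unit_cancel by blast
    then have z: "dt p1 p2 p3 p4 - 1 - t ^ (l2 - 1) * 0 \<in> J l2" by simp
    have "\<chi> ?k = 1" using chi[OF p z] add_char_zero[OF Psi_add] by simp
    then show "\<exists>k\<in>H. \<chi> k = 1 \<and> x \<otimes> y = k \<otimes> (y \<otimes> x)" using HI[OF p z] k(2) by blast
  qed
  \<comment> \<open>The count of extensions from \<open>H\<close> to the whole group shows that
    there is at least one.\<close>
  have "card (char_exts G (carrier G) H \<chi>) * card H = card (carrier G)"
    using card_char_exts[OF subgroup_self Hsub _ char comm] Hsub by (simp add: subgroup.subset)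
  moreover have "card (carrier G) > 0" using finite_carrier one_closed card_gt_0_iff by blast
  ultimately obtain \<theta> where th: "\<theta> \<in> char_exts G (carrier G) H \<chi>" by fastforce
  show thesis
  proof (rule that[of \<theta>])
    show "is_char G (carrier G) \<theta>" using th unfolding char_exts_def by simp
    fix b c z :: 'r assume bc: "b = 0 \<or> c = 0"
    have i: "is_mk (mk 1 b c (1 + t ^ (l2 - 1) * z)) 1 b c (1 + t ^ (l2 - 1) * z)" "dt 1 b c (1 + t ^ (l2 - 1) * z) - 1 - t ^ (l2 - 1) * z \<in> J l2"
      unfolding is_mk_def dt_def using bc unit_1t[OF lt] one_notin by auto
    show "\<theta> (mk 1 b c (1 + t ^ (l2 - 1) * z)) = \<Psi> (t ^ (l - 1) * (\<kappa> * z))"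
      using th HI[OF i] chi[OF i] unfolding char_exts_def by simp
  qed
qed

subsection \<open>Representations without fixed vectors\<close>

text \<open>The upper unitriangular matrices enlarged by the last layer of the upper left entry. The
  group is abelian, and conjugation by lower unitriangular matrices can move part of b into
  x.\<close>

definition tu :: "'r \<Rightarrow> 'r \<Rightarrow> 'g" where "tu x b = mk (1 + t ^ (l1 - 1) * x) b 0 1"

lemma tu_units: "1 + t ^ (l1 - 1) * x \<notin> J 1"
  using unit_1t dims by simp

lemma tu_closed: "tu x b \<in> carrier G"
  unfolding tu_def by (rule mk_closed[OF tu_units one_notin])

lemma tu_mult: "tu x b \<otimes> tu x' b' = tu (x + x') (b + b')"
proof -
  have u: "(1 + t ^ (l1 - 1) * x) * (1 + t ^ (l1 - 1) * x') \<notin> J 1" using prime_J tu_units by blast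
  have "l1 \<le> (l1 - 1) + (l1 - 1)" "l2 \<le> l1 - 1" using dims by auto
  then have j: "t ^ ((l1 - 1) + (l1 - 1)) * y \<in> J l1" "t ^ (l1 - 1) * y \<in> J l2" for y using tpow_in by blast+
  have "tu x b \<otimes> tu x' b' = mk ((1 + t ^ (l1 - 1) * x) * (1 + t ^ (l1 - 1) * x')) ((1 + t ^ (l1 - 1) * x) * b' + b) 0 1"
    unfolding tu_def mk_mult[OF tu_units one_notin tu_units one_notin] by simp
  also have "\<dots> = tu (x + x') (b + b')"
    unfolding tu_def mk_eq[OF u one_notin tu_units one_notin]
    using j(1)[of "x * x'"] j(2)[of "x * b'"] by (simp add: algebra_simps power_add)
  finally show ?thesis .
qed

lemma tu_eq: "tu x b = tu x' b' \<longleftrightarrow> x - x' \<in> J 1 \<and> b - b' \<in> J l2"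
proof -
  have "tu x b = tu x' b' \<longleftrightarrow> t ^ (l1 - 1) * (x - x') \<in> J l1 \<and> b - b' \<in> J l2"
    unfolding tu_def mk_eq[OF tu_units one_notin tu_units one_notin] by (simp add: right_diff_distrib)
  then show ?thesis using J_tpow'[of "l1 - 1" l1 "x - x'"] dims by simp
qed

text \<open>If the character of the upper left entry in the last layer is nontrivial, conjugation by lower
  unitriangular matrices successively removes the character of the upper right entry.\<close>

lemma upper_fixed_vector:
  assumes r: "mat_rep G n r" and al: "\<alpha> \<notin> J 1"
    and w: "w \<in> carrier_vec n" "w \<noteq> 0\<^sub>v n" "\<And>x. r (tu x 0) *\<^sub>v w = \<Psi> (t ^ (l - 1) * (\<alpha> * x)) \<cdot>\<^sub>v w"
  shows "\<exists>v. v \<in> carrier_vec n \<and> v \<noteq> 0\<^sub>v n \<and> (\<forall>b. r (mk 1 b 0 1) *\<^sub>v v = v)"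
proof -
  have P1: "prim_char 1 (\<lambda>x. \<Psi> (t ^ (l - 1) * x))" using prim_char_scale[OF Psi, of "l - 1"] l_pos by simp
  have a1: "add_char 1 (\<lambda>x. \<Psi> (t ^ (l - 1) * x))" using P1 unfolding prim_char_def by simp
  \<comment> \<open>Stage i controls the upper right entries in \<open>J (l2 - i)\<close>; stage l2
    covers all of them.\<close>
  have "\<exists>v. v \<in> carrier_vec n \<and> v \<noteq> 0\<^sub>v n \<and> (\<forall>x. \<forall>b\<in>J (l2 - i). r (tu x b) *\<^sub>v v = \<Psi> (t ^ (l - 1) * (\<alpha> * x)) \<cdot>\<^sub>v v)"
    if "i \<le> l2" for i
    using that
  proof (induct i)
    case 0
    have "r (tu x b) *\<^sub>v w = \<Psi> (t ^ (l - 1) * (\<alpha> * x)) \<cdot>\<^sub>v w" if "b \<in> J (l2 - 0)" for x b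
    proof -
      have "tu x b = tu x 0" unfolding tu_eq using that by simp
      then show ?thesis using w(3)[of x] by (simp only:)
    qed
    then show ?case using w(1,2) by blast
  next
    case (Suc i)
    then obtain v where v: "v \<in> carrier_vec n" "v \<noteq> 0\<^sub>v n"
      and ev: "\<And>x b. b \<in> J (l2 - i) \<Longrightarrow> r (tu x b) *\<^sub>v v = \<Psi> (t ^ (l - 1) * (\<alpha> * x)) \<cdot>\<^sub>v v" by auto
    define j where "j = l2 - Suc i"
    \<comment> \<open>The new layer has depth j, and the conjugating lower entry has depth i.
      Together with \<delta> their product has depth l1 - 1, exactly the last layer of the upper
      left entry.\<close>
    have j: "l2 - i = Suc j" "j + i + s = l1 - 1" using Suc(2) dims by (auto simp: j_def)
    define H where "H k = {tu x b | x b. b \<in> J k}" for k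
    have HI: "tu x b \<in> H k" if "b \<in> J k" for x b k using that unfolding H_def by blast
    have Hsub: "subgroup (H k) G" for k
    proof (rule subgroup_finiteI)
      show "H k \<subseteq> carrier G" unfolding H_def using tu_closed by auto
      show "tu 0 0 \<in> H k" by (rule HI) simp
      fix a b assume "a \<in> H k" "b \<in> H k"
      then obtain x y x' y' where "a = tu x y" "b = tu x' y'" "y \<in> J k" "y' \<in> J k" unfolding H_def by blast
      then show "a \<otimes> b \<in> H k" using HI[OF J_add[of y k y'], of "x + x'"] by (simp add: tu_mult)
    qed
    have HH: "H (Suc j) \<subseteq> H j" unfolding H_def using J_Suc by blast
    define \<chi> where "\<chi> g = (SOME y. r g *\<^sub>v v = y \<cdot>\<^sub>v v)" for g
    have chi: "r k *\<^sub>v v = \<chi> k \<cdot>\<^sub>v v" if "k \<in> H (Suc j)" for k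
      unfolding \<chi>_def by (rule someI_ex) (use that ev j in \<open>auto simp: H_def\<close>)
    have cc: "is_char G (H (Suc j)) \<chi>" by (rule eigen_is_char[OF Hsub r v chi])
    have "comm_in_ker G (H j) (H (Suc j)) \<chi>"
    proof (rule comm_in_kerI[OF Hsub _ cc])
      show "H j \<subseteq> carrier G" using Hsub subgroup.subset by blast
      show "x \<otimes> y = y \<otimes> x" if "x \<in> H j" "y \<in> H j" for x y
        using that unfolding H_def by (auto simp: tu_mult add.commute)
    qed
    then obtain \<theta> w' where th: "\<theta> \<in> char_exts G (H j) (H (Suc j)) \<chi>" and w': "w' \<in> carrier_vec n" "w' \<noteq> 0\<^sub>v n"
      and ew: "\<And>h. h \<in> H j \<Longrightarrow> r h *\<^sub>v w' = \<theta> h \<cdot>\<^sub>v w'"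
      using eigenvector_extend[OF Hsub Hsub HH cc _ r v chi] by metis
    have thc: "is_char G (H j) \<theta>" and thk: "\<And>k. k \<in> H (Suc j) \<Longrightarrow> \<theta> k = \<chi> k" using th unfolding char_exts_def by auto
    have tht: "\<theta> (tu x b) = \<Psi> (t ^ (l - 1) * (\<alpha> * x))" if b: "b \<in> J (Suc j)" for x b
    proof -
      have "\<chi> (tu x b) \<cdot>\<^sub>v v = \<Psi> (t ^ (l - 1) * (\<alpha> * x)) \<cdot>\<^sub>v v" using chi[OF HI[OF b]] ev b j by simp
      moreover obtain p where "p < n" "v $ p \<noteq> 0" using vec_nonzeroE[OF v] by blast
      ultimately have "\<chi> (tu x b) = \<Psi> (t ^ (l - 1) * (\<alpha> * x))"
      proof -
        have "(\<chi> (tu x b) \<cdot>\<^sub>v v) $ p = (\<Psi> (t ^ (l - 1) * (\<alpha> * x)) \<cdot>\<^sub>v v) $ p"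
          using \<open>\<chi> (tu x b) \<cdot>\<^sub>v v = _\<close> by (rule arg_cong)
        then show ?thesis using \<open>p < n\<close> \<open>v $ p \<noteq> 0\<close> v(1) by simp
      qed
      then show ?thesis using thk[OF HI[OF b]] by simp
    qed
    have thmul: "\<theta> (tu x b \<otimes> tu x' b') = \<theta> (tu x b) * \<theta> (tu x' b')" if "b \<in> J j" "b' \<in> J j" for x b x' b'
      using thc HI that unfolding is_char_def by blast
    have tj: "t ^ j * b \<in> J j" for b using tpow_in by blast
    \<comment> \<open>\<open>J j\<close> modulo \<open>J (Suc j)\<close> is a copy of the residue
      field, so the values of \<theta> on the new layer are given by a single residue \<mu>.\<close>
    have "add_char 1 (\<lambda>b. \<theta> (tu 0 (t ^ j * b)))"
      unfolding add_char_def
    proof (intro conjI allI ballI)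
      fix b b'
      show "\<theta> (tu 0 (t ^ j * (b + b'))) = \<theta> (tu 0 (t ^ j * b)) * \<theta> (tu 0 (t ^ j * b'))"
        using thmul[OF tj tj, of 0 b 0 b'] by (simp add: tu_mult distrib_left)
    next
      fix b assume "b \<in> J 1"
      then have "t ^ j * b \<in> J (Suc j)" using J_tpow[of j b 1] by simp
      then show "\<theta> (tu 0 (t ^ j * b)) = 1" using tht add_char_zero[OF Psi_add] by simp
    qed
    then obtain \<mu> where mu: "\<And>b. \<theta> (tu 0 (t ^ j * b)) = \<Psi> (t ^ (l - 1) * (\<mu> * b))"
      using prim_char_duality[OF P1] by blast
    obtain \<alpha>' where al': "\<alpha> * \<alpha>' - 1 \<in> J 1" using J_unit[OF al] by blast
    \<comment> \<open>Conjugation shifts x by - b c. Since \<alpha> c is congruent to \<mu> modulo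
      \<open>J 1\<close>, the shift cancels the character of the new layer; this is where \<alpha>
      must be a unit.\<close>
    define c where "c = \<mu> * \<alpha>'"
    let ?y = "mk 1 0 (t ^ i * c) 1"
    have y: "?y \<in> carrier G" using mk_closed one_notin by blast
    have yt: "?y \<otimes> tu x (t ^ j * b) = tu (x - b * c) (t ^ j * b) \<otimes> ?y" for x b
    proof -
      have tt: "t ^ (l1 - 1) = t ^ j * t ^ i * t ^ s" unfolding j(2)[symmetric] by (simp add: power_add)
      have "l2 \<le> l1 - 1" using dims by simp
      then have jj: "t ^ (l1 - 1) * y \<in> J l2" for y using tpow_in by blast
      have u2: "t ^ i * c * (t ^ j * b) * t ^ s + 1 \<notin> J 1"
        using unit_mult'[OF one_notin one_notin, of "t ^ i * c * (t ^ j * b)"] by simp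
      have u1: "1 + t ^ (l1 - 1) * (x - b * c) + t ^ j * b * (t ^ i * c) * t ^ s \<notin> J 1"
        using unit_add[OF tu_units ts_in] by blast
      have "?y \<otimes> tu x (t ^ j * b) = mk (1 + t ^ (l1 - 1) * x) (t ^ j * b) (t ^ i * c * (1 + t ^ (l1 - 1) * x)) (t ^ i * c * (t ^ j * b) * t ^ s + 1)"
        unfolding tu_def mk_mult[OF one_notin one_notin tu_units one_notin] by simp
      moreover have "tu (x - b * c) (t ^ j * b) \<otimes> ?y = mk (1 + t ^ (l1 - 1) * (x - b * c) + t ^ j * b * (t ^ i * c) * t ^ s) (t ^ j * b) (t ^ i * c) 1"
        unfolding tu_def mk_mult[OF tu_units one_notin one_notin one_notin] by simp
      moreover have "1 + t ^ (l1 - 1) * x - (1 + t ^ (l1 - 1) * (x - b * c) + t ^ j * b * (t ^ i * c) * t ^ s) = 0"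
        unfolding tt by (simp add: algebra_simps)
      moreover have "t ^ i * c * (1 + t ^ (l1 - 1) * x) - t ^ i * c = t ^ (l1 - 1) * (t ^ i * c * x)"
        by (simp add: algebra_simps)
      moreover have "t ^ i * c * (t ^ j * b) * t ^ s + 1 - 1 = t ^ (l1 - 1) * (b * c)" unfolding tt by (simp add: algebra_simps)
      ultimately show ?thesis using mk_eq[OF tu_units u2 u1 one_notin] jj by (simp only: J_zero diff_self)
    qed
    define w'' where "w'' = r (inv ?y) *\<^sub>v w'"
    have iy: "inv ?y \<in> carrier G" using y by simp
    have w'': "w'' \<in> carrier_vec n" "w'' \<noteq> 0\<^sub>v n"
      unfolding w''_def using mat_rep_vec[OF r iy w'(1)] mat_rep_nonzero[OF r iy w'] by auto
    have "r (tu x b) *\<^sub>v w'' = \<Psi> (t ^ (l - 1) * (\<alpha> * x)) \<cdot>\<^sub>v w''" if b: "b \<in> J j" for x b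
    proof -
      obtain b0 where b0: "\<forall>n. b - t ^ j * b0 \<in> J n" using J_decpow[OF b] by blast
      have e: "tu x b = tu x (t ^ j * b0)" unfolding tu_eq using b0 by simp
      let ?h = "tu (x - b0 * c) (t ^ j * b0)"
      have hH: "?h \<in> H j" by (rule HI[OF tj])
      have "tu x b \<otimes> inv ?y = inv ?y \<otimes> ?h"
      proof -
        have "inv ?y \<otimes> (?y \<otimes> tu x (t ^ j * b0)) \<otimes> inv ?y = inv ?y \<otimes> (?h \<otimes> ?y) \<otimes> inv ?y" unfolding yt ..
        then show ?thesis unfolding e using y tu_closed by (simp add: m_assoc)
      qed
      then have "r (tu x b) *\<^sub>v w'' = r (inv ?y \<otimes> ?h) *\<^sub>v w'"
        unfolding w''_def using mat_rep_mult[OF r tu_closed iy w'(1), of x b] by simp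
      also have "\<dots> = r (inv ?y) *\<^sub>v (\<theta> ?h \<cdot>\<^sub>v w')" unfolding mat_rep_mult[OF r iy tu_closed w'(1)] ew[OF hH] ..
      also have "\<dots> = \<theta> ?h \<cdot>\<^sub>v w''" unfolding w''_def by (rule mult_mat_vec[OF mat_rep_carrier[OF r iy] w'(1)])
      also have "\<theta> ?h = \<Psi> (t ^ (l - 1) * (\<alpha> * (x - b0 * c))) * \<Psi> (t ^ (l - 1) * (\<mu> * b0))"
        using thmul[of 0 "t ^ j * b0" "x - b0 * c" 0] tht[of 0 "x - b0 * c"] mu[of b0] tj by (simp add: tu_mult)
      also have "\<dots> = \<Psi> (t ^ (l - 1) * (\<alpha> * (x - b0 * c) + \<mu> * b0))" by (simp add: add_char_add[OF Psi_add] distrib_left)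
      also have "\<dots> = \<Psi> (t ^ (l - 1) * (\<alpha> * x))"
      proof (rule add_char_cong[OF a1])
        show "\<alpha> * (x - b0 * c) + \<mu> * b0 - \<alpha> * x \<in> J 1"
          using J_neg[OF J_mult'[OF al', of "\<mu> * b0"]] by (simp add: c_def algebra_simps)
      qed
      finally show ?thesis .
    qed
    then show ?case using w'' j_def by auto
  qed
  from this[of l2] obtain v where v: "v \<in> carrier_vec n" "v \<noteq> 0\<^sub>v n" and e: "\<And>b. r (tu 0 b) *\<^sub>v v = \<Psi> (t ^ (l - 1) * (\<alpha> * 0)) \<cdot>\<^sub>v v"
    by auto
  have "r (mk 1 b 0 1) *\<^sub>v v = v" for b using e[of b] add_char_zero[OF Psi_add] by (simp add: tu_def)
  then show ?thesis using v by blast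
qed

text \<open>For an eigenvector of \<open>Kg\<close> with coefficients \<alpha>, \<beta>, \<gamma>,
  \<kappa>, hypothesis \<open>A\<close> (no geometric induction) forces \<alpha> into
  \<open>J 1\<close>. Hypotheses \<open>B\<close> and \<open>C\<close> (no infinitesimal induction
  after a twist) force \<gamma> and \<beta> to be units.\<close>

lemma eta_eigenvector:
  assumes r: "mat_rep G n r" and n: "0 < n"
    and A: "\<not> (\<exists>v. v \<in> carrier_vec n \<and> v \<noteq> 0\<^sub>v n \<and> (\<forall>b. r (mk 1 b 0 1) *\<^sub>v v = v))"
    and B: "\<And>\<chi>. is_char G (carrier G) \<chi> \<Longrightarrow> \<not> (\<exists>v. v \<in> carrier_vec n \<and> v \<noteq> 0\<^sub>v n \<and>
        (\<forall>b z. let g = mk 1 (t ^ (l2 - 1) * b) 0 (1 + t ^ (l2 - 1) * z) in \<chi> g \<cdot>\<^sub>v (r g *\<^sub>v v) = v))"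
    and C: "\<And>\<chi>. is_char G (carrier G) \<chi> \<Longrightarrow> \<not> (\<exists>v. v \<in> carrier_vec n \<and> v \<noteq> 0\<^sub>v n \<and>
        (\<forall>c z. let g = mk 1 0 (t ^ (l2 - 1) * c) (1 + t ^ (l2 - 1) * z) in \<chi> g \<cdot>\<^sub>v (r g *\<^sub>v v) = v))"
  shows "\<exists>uh wh \<omega> v. uh \<in> J 1 \<and> wh \<notin> J 1 \<and> eta_on uh wh \<omega> \<and> v \<in> carrier_vec n \<and> v \<noteq> 0\<^sub>v n \<and> (\<forall>k\<in>Kg. r k *\<^sub>v v = \<omega> k \<cdot>\<^sub>v v)"
proof -
  let ?u = "unit_vec n 0 :: complex vec"
  have u: "?u \<in> carrier_vec n" "?u \<noteq> 0\<^sub>v n" using n by (simp, metis index_unit_vec(1) index_zero_vec(1) zero_neq_one)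
  have one: "is_char G {\<one>} (\<lambda>_. 1)" unfolding is_char_def by simp
  have Kc: "k \<in> carrier G" if "k \<in> Kg" for k using that km_closed unfolding Kg_def by auto
  have cm: "comm_in_ker G Kg {\<one>} (\<lambda>_. 1)"
    by (rule comm_in_kerI[OF triv_subgroup _ one Kg_comm]) (use Kc in auto)
  \<comment> \<open>For the trivial subgroup any nonzero vector is an eigenvector, and extending to
    the abelian group \<open>Kg\<close> produces an eigenvector there.\<close>
  have "r k *\<^sub>v ?u = 1 \<cdot>\<^sub>v ?u" if "k \<in> {\<one>}" for k using r that unfolding mat_rep_def by simp
  then obtain \<omega> w where om: "\<omega> \<in> char_exts G Kg {\<one>} (\<lambda>_. 1)" and w: "w \<in> carrier_vec n" "w \<noteq> 0\<^sub>v n"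
    and ew: "\<And>k. k \<in> Kg \<Longrightarrow> r k *\<^sub>v w = \<omega> k \<cdot>\<^sub>v w"
    using eigenvector_extend[OF Kg_subgroup triv_subgroup _ one cm r u] Kg_subgroup subgroup.one_closed by (metis empty_subsetI insert_subset)
  have "is_char G Kg \<omega>" using om unfolding char_exts_def by simp
  then obtain \<alpha> \<beta> \<gamma> \<kappa> where K: "Kchar \<alpha> \<beta> \<gamma> \<kappa> \<omega>" using Kchar_exists by blast
  note Kv = K[unfolded Kchar_def, rule_format]
  have "\<epsilon> + (m - 1) = l - 1" using dims by simp
  then have tl: "t ^ \<epsilon> * t ^ (m - 1) = t ^ (l - 1)" by (metis power_add)
  have Pz: "\<Psi> (t ^ (l - 1) * (x * y)) = 1" if "x \<in> J 1" for x y
  proof -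
    have "t ^ (l - 1) * (x * y) \<in> J l" using J_tpow'[of "l - 1" l] l_pos J_mult'[OF that] by simp
    then show ?thesis using Psi_add unfolding add_char_def by blast
  qed
  have Padd: "\<Psi> (x + y) = \<Psi> x * \<Psi> y" for x y by (rule add_char_add[OF Psi_add])
  have al: "\<alpha> \<in> J 1"
  proof (rule ccontr)
    assume a: "\<alpha> \<notin> J 1"
    have "r (tu x 0) *\<^sub>v w = \<Psi> (t ^ (l - 1) * (\<alpha> * x)) \<cdot>\<^sub>v w" for x
    proof -
      have "l1 - 1 = (m + s) + (l - 1)" using dims by simp
      then have "tu x 0 = km (t ^ (l - 1) * x) 0 0 0" by (simp add: tu_def km_def power_add mult.assoc)
      then show ?thesis using ew[OF km_in, of "t ^ (l - 1) * x" 0 0 0] Kv[of "t ^ (l - 1) * x" 0 0 0] by (simp add: mult_ac)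
    qed
    from upper_fixed_vector[OF r a w this] show False using A by blast
  qed
  have sm: "c \<cdot>\<^sub>v (d \<cdot>\<^sub>v w) = w" if "c * d = 1" for c d using that by (simp add: smult_smult_assoc)
  \<comment> \<open>The twist by - \<kappa> cancels the contribution of the lower right entry in the
    last layer.\<close>
  obtain \<chi> where chi: "is_char G (carrier G) \<chi>"
    "\<And>b c z. b = 0 \<or> c = 0 \<Longrightarrow> \<chi> (mk 1 b c (1 + t ^ (l2 - 1) * z)) = \<Psi> (t ^ (l - 1) * (- \<kappa> * z))"
    using det_char by blast
  have "l2 - 1 = m + (l - 1)" "l2 - 1 = l + (m - 1)" using dims by auto
  then have "t ^ (l2 - 1) = t ^ m * t ^ (l - 1)" "t ^ (l2 - 1) = t ^ l * t ^ (m - 1)" by (metis power_add)+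
  then have e1: "t ^ (l2 - 1) * b = t ^ m * (t ^ (l - 1) * b)" and e2: "t ^ (l2 - 1) * b = t ^ l * (t ^ (m - 1) * b)" for b
    by (metis mult.assoc)+
  have ga: "\<gamma> \<notin> J 1"
  proof
    assume g: "\<gamma> \<in> J 1"
    have "\<chi> h \<cdot>\<^sub>v (r h *\<^sub>v w) = w" if h: "h = mk 1 (t ^ (l2 - 1) * b) 0 (1 + t ^ (l2 - 1) * z)" for b z h
    proof -
      have hk: "h = km 0 (t ^ (l - 1) * b) 0 (t ^ (m - 1) * z)"
        unfolding h km_def by (simp only: e1[of b] e2[of z] mult_zero_right add_0_right)
      have "\<omega> h = \<Psi> (t ^ (l - 1) * (\<gamma> * b)) * \<Psi> (t ^ (l - 1) * (\<kappa> * z))"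
        unfolding hk Kv Padd[symmetric] tl[symmetric] by (intro arg_cong[of _ _ \<Psi>]) (simp add: algebra_simps)
      then have "\<chi> h * \<omega> h = 1"
        unfolding h chi(2)[OF disjI2[OF refl]] Pz[OF g] by (simp add: Padd[symmetric] add_char_zero[OF Psi_add])
      then show ?thesis using ew[OF km_in] sm unfolding hk by simp
    qed
    then show False using B[OF chi(1)] w unfolding Let_def by blast
  qed
  have be: "\<beta> \<notin> J 1"
  proof
    assume g: "\<beta> \<in> J 1"
    have "\<chi> h \<cdot>\<^sub>v (r h *\<^sub>v w) = w" if h: "h = mk 1 0 (t ^ (l2 - 1) * c) (1 + t ^ (l2 - 1) * z)" for c z h
    proof -
      have hk: "h = km 0 0 (t ^ (m - 1) * c) (t ^ (m - 1) * z)"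
        unfolding h km_def by (simp only: e2[of c] e2[of z] mult_zero_right add_0_right)
      have "\<omega> h = \<Psi> (t ^ (l - 1) * (\<beta> * c)) * \<Psi> (t ^ (l - 1) * (\<kappa> * z))"
        unfolding hk Kv Padd[symmetric] tl[symmetric] by (intro arg_cong[of _ _ \<Psi>]) (simp add: algebra_simps)
      then have "\<chi> h * \<omega> h = 1"
        unfolding h chi(2)[OF disjI1[OF refl]] Pz[OF g] by (simp add: Padd[symmetric] add_char_zero[OF Psi_add])
      then show ?thesis using ew[OF km_in] sm unfolding hk by simp
    qed
    then show False using C[OF chi(1)] w unfolding Let_def by blast
  qed
  \<comment> \<open>The first row of \<open>?g\<close> is the second row (\<gamma>, \<kappa>
    \<delta>) of the coefficient matrix, and the second row of \<open>?g\<close> is (0, 1).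
    Conjugating by \<open>?g\<close> therefore turns the second row of the coefficient matrix into
    (1, 0).\<close>
  let ?g = "mk \<gamma> \<kappa> 0 1"
  have gc: "?g \<in> carrier G" by (rule mk_closed[OF ga one_notin])
  obtain e where e: "e * (\<gamma> * 1 - \<kappa> * 0 * t ^ s) - 1 \<in> J l" using det_inverse[OF ga one_notin] by blast
  have e': "e * \<gamma> - 1 \<in> J l" using e by simp
  have em: "e * \<gamma> - 1 \<in> J m" using e' J_mono[of m l] dims by simp
  have e1: "e \<notin> J 1"
  proof
    assume "e \<in> J 1"
    then have "e * \<gamma> - (e * \<gamma> - 1) \<in> J 1" by (rule J_diff[OF J_mult' J_mono[OF _ e']]) (use l_pos in simp_all)
    then show False using one_notin by simp
  qed
  let ?\<omega> = "\<lambda>k. \<omega> (inv ?g \<otimes> k \<otimes> ?g)"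
  let ?uh = "e * (\<alpha> * \<gamma> + \<gamma> * \<kappa> * t ^ s)" and ?wh = "e * (\<beta> * \<gamma> * \<gamma> - \<alpha> * \<kappa> * \<gamma>)"
  have eta: "eta_on ?uh ?wh ?\<omega>"
  proof (rule Kchar_cong[OF Kchar_conj[OF K ga one_notin e]])
    have z: "x \<in> J k" if "x = 0" for x k using that by simp
    show "e * (\<alpha> * 1 * \<gamma> + \<gamma> * 1 * \<kappa> * t ^ s - \<beta> * t ^ s * 0 * \<gamma> - \<kappa> * t ^ s * 0 * \<kappa> * t ^ s) - ?uh \<in> J l"
      by (rule z) (simp add: algebra_simps)
    show "e * (\<beta> * \<gamma> * \<gamma> - \<alpha> * \<kappa> * \<gamma> - \<gamma> * \<kappa> * \<kappa> * t ^ s + \<kappa> * \<gamma> * \<kappa> * t ^ s) - ?wh \<in> J m"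
      by (rule z) (simp add: algebra_simps)
    show "e * (\<alpha> * 1 * 0 + \<gamma> * 1 * 1 - \<beta> * t ^ s * 0 * 0 - \<kappa> * t ^ s * 0 * 1) - 1 \<in> J l" using e' by simp
    show "e * (\<beta> * \<gamma> * 0 - \<alpha> * \<kappa> * 0 - \<gamma> * \<kappa> * 1 + \<kappa> * \<gamma> * 1) - 0 \<in> J m"
      by (rule z) (simp add: algebra_simps)
  qed
  have uh: "?uh \<in> J 1" by (rule J_mult[OF J_add[OF J_mult'[OF al] ts_in]])
  have "\<beta> * \<gamma> * \<gamma> + - (\<alpha> * (\<kappa> * \<gamma>)) \<notin> J 1"
    by (rule unit_add[OF _ J_neg[OF J_mult'[OF al]]]) (use ga be prime_J in blast)
  then have wh: "?wh \<notin> J 1" unfolding prime_J[of e] using e1 by (simp add: algebra_simps)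
  let ?v = "r ?g *\<^sub>v w"
  have v: "?v \<in> carrier_vec n" "?v \<noteq> 0\<^sub>v n" using mat_rep_vec[OF r gc w(1)] mat_rep_nonzero[OF r gc w] by auto
  have "r k *\<^sub>v ?v = ?\<omega> k \<cdot>\<^sub>v ?v" if k: "k \<in> Kg" for k
  proof -
    let ?k = "inv ?g \<otimes> k \<otimes> ?g"
    have kK: "?k \<in> Kg" by (rule Kg_normal[OF gc k])
    have "r k *\<^sub>v ?v = r (k \<otimes> ?g) *\<^sub>v w" by (rule mat_rep_mult[OF r Kc[OF k] gc w(1), symmetric])
    also have "k \<otimes> ?g = ?g \<otimes> ?k" using gc Kc[OF k] by (simp add: m_assoc)
    also have "r (?g \<otimes> ?k) *\<^sub>v w = r ?g *\<^sub>v (\<omega> ?k \<cdot>\<^sub>v w)" unfolding mat_rep_mult[OF r gc Kc[OF kK] w(1)] ew[OF kK] ..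
    also have "\<dots> = \<omega> ?k \<cdot>\<^sub>v ?v" by (rule mult_mat_vec[OF mat_rep_carrier[OF r gc] w(1)])
    finally show ?thesis .
  qed
  then show ?thesis using uh wh eta v by blast
qed

end

section \<open>Lifting to a type class\<close>

text \<open>The product of the integers and of all commutative rings carried by the type \<open>'a\<close>. It is a
  commutative ring in the sense of type classes, and it projects onto every such ring, so that
  computations in a ring given by a record can be carried out with lifts. The integers only serve
  to ensure \<open>0 \<noteq> 1\<close>.\<close>

typedef 'a ringprod = "{F :: int \<times> ('a ring \<Rightarrow> 'a).
    \<forall>S. if cring S then snd F S \<in> carrier S else snd F S = undefined}"
  by (rule exI[of _ "(0, \<lambda>S. if cring S then \<zero>\<^bsub>S\<^esub> else undefined)"])
     (auto intro: abelian_monoid.zero_closed abelian_group.axioms(1) ring.is_abelian_group cring.axioms(1))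

definition comp :: "'a ringprod \<Rightarrow> 'a ring \<Rightarrow> 'a" where "comp x = snd (Rep_ringprod x)"
definition icomp :: "'a ringprod \<Rightarrow> int" where "icomp x = fst (Rep_ringprod x)"
definition mkprod :: "int \<Rightarrow> ('a ring \<Rightarrow> 'a) \<Rightarrow> 'a ringprod" where
  "mkprod i F = Abs_ringprod (i, \<lambda>S. if cring S then F S else undefined)"

lemma comp_carrier: "cring S \<Longrightarrow> comp x S \<in> carrier S"
  using Rep_ringprod[of x] unfolding comp_def by (auto split: if_splits)

lemma ringprod_eqI: "icomp x = icomp y \<Longrightarrow> (\<And>S. cring S \<Longrightarrow> comp x S = comp y S) \<Longrightarrow> x = y"
proof -
  assume i: "icomp x = icomp y" and c: "\<And>S. cring S \<Longrightarrow> comp x S = comp y S"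
  have "comp x S = comp y S" for S
  proof (cases "cring S")
    case False
    then show ?thesis using Rep_ringprod[of x] Rep_ringprod[of y] unfolding comp_def by (auto split: if_splits)
  qed (rule c)
  then have "Rep_ringprod x = Rep_ringprod y" using i unfolding comp_def icomp_def by (intro prod_eqI ext) auto
  then show "x = y" by (simp add: Rep_ringprod_inject)
qed

lemma mkprod:
  assumes "\<And>S. cring S \<Longrightarrow> F S \<in> carrier S"
  shows "icomp (mkprod i F) = i" "cring S \<Longrightarrow> comp (mkprod i F) S = F S"
proof -
  have "Rep_ringprod (mkprod i F) = (i, \<lambda>S. if cring S then F S else undefined)"
    unfolding mkprod_def by (rule Abs_ringprod_inverse) (use assms in auto)
  then show "icomp (mkprod i F) = i" "cring S \<Longrightarrow> comp (mkprod i F) S = F S" by (auto simp: icomp_def comp_def)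
qed

instantiation ringprod :: (type) comm_ring_1
begin

definition "0 = mkprod 0 (\<lambda>S. \<zero>\<^bsub>S\<^esub>)"
definition "1 = mkprod 1 (\<lambda>S. \<one>\<^bsub>S\<^esub>)"
definition "x + y = mkprod (icomp x + icomp y) (\<lambda>S. comp x S \<oplus>\<^bsub>S\<^esub> comp y S)"
definition "x * y = mkprod (icomp x * icomp y) (\<lambda>S. comp x S \<otimes>\<^bsub>S\<^esub> comp y S)"
definition "- x = mkprod (- icomp x) (\<lambda>S. \<ominus>\<^bsub>S\<^esub> comp x S)"
definition "x - y = mkprod (icomp x - icomp y) (\<lambda>S. comp x S \<ominus>\<^bsub>S\<^esub> comp y S)" for x y :: "'a ringprod"

lemma comp_ops:
  assumes "cring S"
  shows "comp 0 S = \<zero>\<^bsub>S\<^esub>" "comp 1 S = \<one>\<^bsub>S\<^esub>" "comp (x + y) S = comp x S \<oplus>\<^bsub>S\<^esub> comp y S"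
    "comp (x * y) S = comp x S \<otimes>\<^bsub>S\<^esub> comp y S" "comp (- x) S = \<ominus>\<^bsub>S\<^esub> comp x S" "comp (x - y) S = comp x S \<ominus>\<^bsub>S\<^esub> comp y S"
  unfolding zero_ringprod_def one_ringprod_def plus_ringprod_def times_ringprod_def uminus_ringprod_def minus_ringprod_def
  by (subst mkprod(2)[OF _ assms]; auto intro: cring.cring_simprules comp_carrier)+

lemma icomp_ops:
  "icomp (0 :: 'a ringprod) = 0" "icomp (1 :: 'a ringprod) = 1" "icomp (x + y) = icomp x + icomp y"
  "icomp (x * y) = icomp x * icomp y" "icomp (- x) = - icomp x" "icomp (x - y) = icomp x - icomp y"
  unfolding zero_ringprod_def one_ringprod_def plus_ringprod_def times_ringprod_def uminus_ringprod_def minus_ringprod_def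
  by (subst mkprod(1); auto intro: cring.cring_simprules comp_carrier)+

instance
proof
  fix a b c :: "'a ringprod"
  show "a + b + c = a + (b + c)" "a + b = b + a" "0 + a = a" "- a + a = 0" "a - b = a + - b"
    "a * b * c = a * (b * c)" "a * b = b * a" "1 * a = a" "(a + b) * c = a * c + b * c"
    by (rule ringprod_eqI; simp add: icomp_ops comp_ops comp_carrier cring.cring_simprules algebra_simps)+
  have "icomp (0 :: 'a ringprod) \<noteq> icomp (1 :: 'a ringprod)" by (simp add: icomp_ops)
  then show "(0 :: 'a ringprod) \<noteq> 1" by metis
qed

end

text \<open>The components of a \<open>ringprod\<close> are indexed by plain ring records, so a ring
  with additional fields enters through its truncation.\<close>

abbreviation trunc :: "('a, 'b) ring_scheme \<Rightarrow> 'a ring" where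
  "trunc R \<equiv> ring.truncate R"

lemma trunc_simps [simp]: "carrier (trunc R) = carrier R" "monoid.mult (trunc R) = monoid.mult R"
  "one (trunc R) = one R" "ring.zero (trunc R) = ring.zero R" "add (trunc R) = add R"
  by (simp_all add: ring.defs)

lemma cring_trunc: assumes "cring R" shows "cring (trunc R)"
proof -
  interpret cring R by fact
  show ?thesis
    by (intro cringI abelian_groupI comm_monoidI)
      (auto simp: a_assoc m_assoc l_distr intro: a_comm m_comm add.l_inv_ex)
qed

lemma trunc_minus: assumes "cring R" "x \<in> carrier R" shows "\<ominus>\<^bsub>trunc R\<^esub> x = \<ominus>\<^bsub>R\<^esub> x"
proof -
  interpret cring R by fact
  interpret T: cring "trunc R" by (rule cring_trunc[OF assms(1)])
  have "\<ominus>\<^bsub>R\<^esub> x \<oplus>\<^bsub>trunc R\<^esub> x = \<zero>\<^bsub>trunc R\<^esub>" using assms by (simp add: l_neg)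
  then show ?thesis using T.minus_equality[of "\<ominus>\<^bsub>R\<^esub> x" x] assms by simp
qed

definition ev :: "('a, 'b) ring_scheme \<Rightarrow> 'a ringprod \<Rightarrow> 'a" where
  "ev R x = comp x (trunc R)"

context cring
begin

lemma ev_closed [simp]: "ev R x \<in> carrier R"
  using comp_carrier[OF cring_trunc[OF is_cring]] by (simp add: ev_def)

lemma ev_simps [simp]: "ev R 0 = \<zero>" "ev R 1 = \<one>" "ev R (x + y) = ev R x \<oplus> ev R y" "ev R (x * y) = ev R x \<otimes> ev R y"
   "ev R (- x) = \<ominus> ev R x"
  using comp_ops[OF cring_trunc[OF is_cring]] trunc_minus[OF is_cring ev_closed] by (simp_all add: ev_def)

lemma ev_diff [simp]: "ev R (x - y) = ev R x \<ominus> ev R y"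
proof -
  have "ev R (x + - y) = ev R x \<oplus> \<ominus> ev R y" by (simp only: ev_simps)
  then show ?thesis by (simp add: a_minus_def)
qed

lemma ev_surj: assumes "a \<in> carrier R" shows "\<exists>x. ev R x = a"
proof -
  \<comment> \<open>The family that is \<open>a\<close> in the component of the given ring and zero
    in all others.\<close>
  let ?F = "\<lambda>S. if S = trunc R then a else \<zero>\<^bsub>S\<^esub>"
  have "?F S \<in> carrier S" if "cring S" for S :: "'a ring"
    using that assms by (auto intro: cring.cring_simprules)
  then have "ev R (mkprod 0 ?F) = a" unfolding ev_def by (subst mkprod(2)) (auto intro: cring_trunc is_cring)
  then show ?thesis by blast
qed

lemma ev_pow: "ev R (x ^ n) = ev R x [^] n"
  by (induct n) (simp_all add: m_comm)

end

section \<open>The quotients of a discrete valuation ring\<close>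

locale dvr_setup = complete_dvr R P for R (structure) and P +
  fixes \<pi> assumes pi: "\<pi> \<in> carrier R" "P = PIdl \<pi>"
begin

abbreviation "I n \<equiv> ideal_pow R P n"

lemma pi_nonzero: "\<pi> \<noteq> \<zero>"
proof
  assume "\<pi> = \<zero>"
  then have "P = {\<zero>}" using pi zero_closed unfolding cgenideal_def by (auto intro!: exI[of _ \<zero>])
  then show False using not_field by simp
qed

text \<open>Powers in the monoid of ideals consist of sums of products. Induction shows that with a
  principal generator single multiples suffice.\<close>

lemma I_iff: "x \<in> I n \<longleftrightarrow> (\<exists>r\<in>carrier R. x = \<pi> [^] n \<otimes> r)"
proof (induct n arbitrary: x)
  case 0
  have "I 0 = carrier R" by (simp add: ideals_set_def)
  then show ?case by auto
next
  case (Suc n)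
  have "I (Suc n) = ideal_prod R (I n) P" unfolding ideals_set_def nat_pow_def by simp
  moreover have "x \<in> ideal_prod R (I n) P \<Longrightarrow> \<exists>r\<in>carrier R. x = \<pi> [^] Suc n \<otimes> r"
  proof (induct rule: ideal_prod.induct)
    case (prod i j)
    then obtain r where "r \<in> carrier R" "i = \<pi> [^] n \<otimes> r" using Suc by blast
    moreover obtain r' where "r' \<in> carrier R" "j = r' \<otimes> \<pi>" using prod pi unfolding cgenideal_def by auto
    ultimately have "i \<otimes> j = \<pi> [^] Suc n \<otimes> (r \<otimes> r')" using pi by (simp add: m_ac)
    then show ?case using \<open>r \<in> carrier R\<close> \<open>r' \<in> carrier R\<close> by blast
  next
    case (sum s1 s2)
    then obtain r r' where "r \<in> carrier R" "r' \<in> carrier R" "s1 = \<pi> [^] Suc n \<otimes> r" "s2 = \<pi> [^] Suc n \<otimes> r'" by blast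
    moreover from this have "s1 \<oplus> s2 = \<pi> [^] Suc n \<otimes> (r \<oplus> r')" using pi by (simp only: r_distr nat_pow_closed)
    ultimately show ?case by blast
  qed
  moreover have "x \<in> ideal_prod R (I n) P" if x: "\<exists>r\<in>carrier R. x = \<pi> [^] Suc n \<otimes> r"
  proof -
    obtain r where r: "r \<in> carrier R" "x = \<pi> [^] Suc n \<otimes> r" using x by blast
    then have "x = (\<pi> [^] n \<otimes> r) \<otimes> (\<one> \<otimes> \<pi>)" using pi by (simp add: m_ac)
    moreover have "\<pi> [^] n \<otimes> r \<in> I n" using Suc r by blast
    moreover have "\<one> \<otimes> \<pi> \<in> P" using pi unfolding cgenideal_def by blast
    ultimately show ?thesis using ideal_prod.prod[of "\<pi> [^] n \<otimes> r" "I n" "\<one> \<otimes> \<pi>" P R] by simp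
  qed
  ultimately show ?case by blast
qed

lemma I_eq: "I n = PIdl (\<pi> [^] n)"
  using I_iff[of _ n] pi unfolding cgenideal_def by (auto simp: m_comm)

lemma I_ideal: "ideal (I n) R"
  unfolding I_eq by (rule cgenideal_ideal) (simp add: pi)

lemma I_1: "I 1 = P"
  unfolding I_eq using pi by simp

text \<open>The preimage of an ideal power under the projection \<open>ev\<close>. Every
  \<open>J n\<close> contains the kernel of \<open>ev\<close>, so a difference lying in all of them
  stands for equality in the ring.\<close>

definition J :: "nat \<Rightarrow> 'a ringprod set" where "J n = {x. ev R x \<in> I n}"
definition t :: "'a ringprod" where "t = (SOME x. ev R x = \<pi>)"
definition cs :: "nat \<Rightarrow> 'a ringprod \<Rightarrow> 'a set" where "cs n x = I n +> ev R x"

lemma ev_t: "ev R t = \<pi>"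
  unfolding t_def using someI_ex[OF ev_surj[OF pi(1)]] .

lemma J_iff: "x \<in> J n \<longleftrightarrow> (\<exists>r. ev R x = \<pi> [^] n \<otimes> ev R r)"
proof -
  have "ev R x \<in> I n \<longleftrightarrow> (\<exists>r. ev R x = \<pi> [^] n \<otimes> ev R r)"
    unfolding I_iff using ev_surj ev_closed by metis
  then show ?thesis by (simp add: J_def)
qed

lemma range_cs: "range (cs n) = carrier (quo R P n)"
proof -
  have "range (cs n) = (\<lambda>a. I n +> a) ` carrier R"
    unfolding cs_def using ev_surj ev_closed by (auto simp: image_iff)
  then show ?thesis unfolding quo_def FactRing_def A_RCOSETS_def' by auto
qed

text \<open>Outside \<open>P\<close>, the ideal generated by \<open>P\<close> and the element is
  everything by maximality, and writing 1 in it gives the inverse modulo \<open>P\<close>.\<close>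

lemma J_unit_1: assumes "x \<notin> J 1" shows "\<exists>y. x * y - 1 \<in> J 1"
proof -
  let ?x = "ev R x"
  have x: "?x \<notin> P" using assms I_1 by (simp add: J_def)
  have id: "ideal (P <+> PIdl ?x) R" by (rule add_ideals) (use I_ideal[of 1] I_1 in \<open>auto intro: cgenideal_ideal\<close>)
  have Pid: "ideal P R" using I_ideal[of 1] I_1 by simp
  have P0: "\<zero> \<in> P" "P \<subseteq> carrier R" using Pid additive_subgroup.zero_closed[of P R] additive_subgroup.a_subset[of P R] by (auto simp: ideal_def)
  have "P \<subseteq> P <+> PIdl ?x"
  proof
    fix p assume p: "p \<in> P"
    have "\<zero> \<in> PIdl ?x" unfolding cgenideal_def by (auto intro!: exI[of _ \<zero>])
    then have "p \<oplus> \<zero> \<in> P <+> PIdl ?x" using p unfolding set_add_def' by blast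
    then show "p \<in> P <+> PIdl ?x" using p P0 by auto
  qed
  moreover have "P <+> PIdl ?x \<subseteq> carrier R" using id additive_subgroup.a_subset by (auto simp: ideal_def)
  ultimately have "P <+> PIdl ?x = P \<or> P <+> PIdl ?x = carrier R" using maximalideal.I_maximal[OF maximal id] by blast
  moreover have "P <+> PIdl ?x \<noteq> P"
  proof
    assume e: "P <+> PIdl ?x = P"
    have "\<zero> \<oplus> ?x \<in> P <+> PIdl ?x" using P0 cgenideal_self[of ?x] unfolding set_add_def' by force
    then show False using e x by simp
  qed
  ultimately have "\<one> \<in> P <+> PIdl ?x" by simp
  then obtain p r where p: "p \<in> P" "r \<in> carrier R" "\<one> = p \<oplus> r \<otimes> ?x" unfolding set_add_def' cgenideal_def by auto
  obtain y where y: "ev R y = r" using ev_surj[OF p(2)] by blast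
  have pc: "p \<in> carrier R" using p P0 by auto
  have "ev R (x * y - 1) = ?x \<otimes> r \<ominus> (p \<oplus> r \<otimes> ?x)" using p(3) y by simp
  also have "\<dots> = \<ominus> p" using pc p(2) by (simp add: a_minus_def minus_add m_comm a_ac r_neg)
  finally have "ev R (x * y - 1) \<in> P" using p(1) Pid additive_subgroup.a_inv_closed by (metis ideal.axioms(1))
  then show ?thesis unfolding J_def I_1 by blast
qed

sublocale fl: filtration J t cs
proof
  fix x y :: "'a ringprod" and m :: nat
  interpret Im: ideal "I m" R by (rule I_ideal)
  show "J 0 = UNIV" unfolding J_def using ev_closed by (auto simp: ideals_set_def)
  show "x \<in> J m \<Longrightarrow> y \<in> J m \<Longrightarrow> x - y \<in> J m" unfolding J_def a_minus_def by (simp add: a_minus_def)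
  show "x \<in> J m \<Longrightarrow> y * x \<in> J m" unfolding J_def by (simp add: Im.I_l_closed)
  show "0 \<in> J m" unfolding J_def by simp
  show "x \<in> J (Suc m) \<Longrightarrow> x \<in> J m"
  proof -
    assume "x \<in> J (Suc m)"
    then obtain r where "ev R x = \<pi> [^] Suc m \<otimes> ev R r" using J_iff by blast
    then have "ev R x = \<pi> [^] m \<otimes> ev R (t * r)" using pi by (simp add: ev_t m_assoc)
    then show "x \<in> J m" using J_iff by blast
  qed
  show "t * x \<in> J (Suc m) \<longleftrightarrow> x \<in> J m"
  proof -
    have "ev R (t * x) = \<pi> [^] Suc m \<otimes> ev R r \<longleftrightarrow> ev R x = \<pi> [^] m \<otimes> ev R r" for r
    proof -
      have "ev R (t * x) = \<pi> [^] Suc m \<otimes> ev R r \<longleftrightarrow> \<pi> \<otimes> ev R x = \<pi> \<otimes> (\<pi> [^] m \<otimes> ev R r)"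
        using pi by (simp add: ev_t m_ac)
      then show ?thesis using m_lcancel[OF pi_nonzero pi(1)] pi by simp
    qed
    then show ?thesis unfolding J_iff by blast
  qed
  show "x \<in> J 1 \<Longrightarrow> \<exists>y. \<forall>n. x - t * y \<in> J n"
  proof -
    assume "x \<in> J 1"
    then obtain r where "ev R x = \<pi> [^] (1::nat) \<otimes> ev R r" using J_iff by blast
    then have "ev R (x - t * r) = \<zero>" using pi by (simp add: ev_t)
    then have "\<forall>n. x - t * r \<in> J n"
      unfolding J_def mem_Collect_eq using additive_subgroup.zero_closed[OF ideal.axioms(1)[OF I_ideal]] by (simp only: simp_thms)
    then show ?thesis by blast
  qed
  show "x \<notin> J 1 \<Longrightarrow> \<exists>y. x * y - 1 \<in> J m"
  proof (induct m)
    case 0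
    then show ?case unfolding J_def using ev_closed[of "x * 0 - 1"] by (intro exI[of _ 0]) (simp add: ideals_set_def del: ev_diff)
  next
    case (Suc m)
    then obtain y where y: "x * y - 1 \<in> J m" by blast
    obtain z where z: "x * z - 1 \<in> J 1" using J_unit_1[OF Suc(2)] by blast
    obtain r where r: "ev R (x * y - 1) = \<pi> [^] m \<otimes> ev R r" using y J_iff by blast
    obtain r' where r': "ev R (x * z - 1) = \<pi> [^] (1::nat) \<otimes> ev R r'" using z J_iff by blast
    \<comment> \<open>The error of the corrected inverse is, up to sign, the product of an error in
      \<open>J m\<close> and one in \<open>J 1\<close>, so the precision grows by one step.\<close>
    have "x * (y - (x * y - 1) * z) - 1 = - ((x * y - 1) * (x * z - 1))" by (simp add: algebra_simps)
    then have "ev R (x * (y - (x * y - 1) * z) - 1) = \<ominus> (ev R (x * y - 1) \<otimes> ev R (x * z - 1))" by (simp only: ev_simps)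
    also have "\<dots> = \<pi> [^] Suc m \<otimes> ev R (- (r * r'))" unfolding r r' using pi by (simp add: m_ac r_minus)
    finally show ?case using J_iff by blast
  qed
  show "1 \<notin> J 1"
  proof
    assume "1 \<in> J 1"
    then have "\<one> \<in> P" unfolding J_def I_1 by simp
    then have "P = carrier R" using ideal.one_imp_carrier I_ideal[of 1] I_1 by simp
    then show False using maximalideal.I_notcarr[OF maximal] by simp
  qed
  show "cs m x = cs m y \<longleftrightarrow> x - y \<in> J m"
    unfolding cs_def J_def using quotient_eq_iff_same_a_r_cos[OF I_ideal ev_closed ev_closed] by simp
  show "finite (range (cs 1))" unfolding range_cs quo_def I_1 by (rule finite_residue)
qed

lemma q_eq: "fl.q = card (carrier (R Quot P))"
  unfolding fl.q_def range_cs quo_def I_1 ..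

lemma quo_one: "\<one>\<^bsub>quo R P n\<^esub> = cs n 1"
  unfolding quo_def FactRing_def cs_def by simp

lemma quo_add: "cs n x \<oplus>\<^bsub>quo R P n\<^esub> cs n y = cs n (x + y)"
  unfolding quo_def FactRing_def cs_def using ideal.a_rcos_sum[OF I_ideal ev_closed ev_closed] by simp

lemma quo_mult: "cs n x \<otimes>\<^bsub>quo R P n\<^esub> cs n y = cs n (x * y)"
  unfolding quo_def FactRing_def cs_def using ideal.rcoset_mult_add[OF I_ideal ev_closed ev_closed] by simp

lemma quo_zero: "\<zero>\<^bsub>quo R P n\<^esub> = cs n 0"
proof -
  interpret ideal "I n" R by (rule I_ideal)
  have "I n +> \<zero> = I n" using a_rcos_zero[OF ideal_axioms zero_closed] a_subset by (simp add: a_coset_add_zero)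
  then show ?thesis unfolding quo_def FactRing_def cs_def by simp
qed

lemma quo_cring: "cring (quo R P n)"
  unfolding quo_def by (rule ideal.quotient_is_cring[OF I_ideal is_cring])

lemma cs_in: "cs n x \<in> carrier (quo R P n)"
  using range_cs by auto

lemma quo_minus: "cs n x \<ominus>\<^bsub>quo R P n\<^esub> cs n y = cs n (x - y)"
proof -
  interpret Q: cring "quo R P n" by (rule quo_cring)
  have "cs n (- y) \<oplus>\<^bsub>quo R P n\<^esub> cs n y = \<zero>\<^bsub>quo R P n\<^esub>" by (simp add: quo_add quo_zero)
  then have "\<ominus>\<^bsub>quo R P n\<^esub> cs n y = cs n (- y)" using Q.minus_equality cs_in by blast
  then show ?thesis unfolding a_minus_def by (simp add: quo_add)
qed

lemma quo_ideal_eq: "quo_ideal R P n k = cs n ` J k"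
proof -
  have "I k \<subseteq> carrier R" by (rule additive_subgroup.a_subset[OF ideal.axioms(1)[OF I_ideal]])
  then have "I k = ev R ` J k" unfolding J_def using ev_surj by (auto simp: image_iff)
  then show ?thesis unfolding quo_ideal_def cs_def by (auto simp: image_iff)
qed

lemma quo_Units: assumes "0 < n" shows "Units (quo R P n) = cs n ` (- J 1)"
proof
  show "Units (quo R P n) \<subseteq> cs n ` (- J 1)"
  proof
    fix C assume "C \<in> Units (quo R P n)"
    then obtain D where D: "C \<in> carrier (quo R P n)" "D \<in> carrier (quo R P n)" "C \<otimes>\<^bsub>quo R P n\<^esub> D = \<one>\<^bsub>quo R P n\<^esub>"
      unfolding Units_def by blast
    then obtain x y where xy: "C = cs n x" "D = cs n y" unfolding range_cs[symmetric] by blast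
    then have "x * y - 1 \<in> J n" using D(3) by (simp add: quo_mult quo_one fl.cs_eq)
    then have "x * y \<notin> J 1" using fl.unit_cong[OF _ assms] fl.one_notin by blast
    then have "x \<notin> J 1" using fl.prime_J by blast
    then show "C \<in> cs n ` (- J 1)" using xy by blast
  qed
  show "cs n ` (- J 1) \<subseteq> Units (quo R P n)"
  proof clarify
    fix x assume "x \<notin> J 1"
    then obtain y where "x * y - 1 \<in> J n" using fl.J_unit by blast
    then have "cs n x \<otimes>\<^bsub>quo R P n\<^esub> cs n y = \<one>\<^bsub>quo R P n\<^esub>" "cs n y \<otimes>\<^bsub>quo R P n\<^esub> cs n x = \<one>\<^bsub>quo R P n\<^esub>"
      by (simp_all add: quo_mult quo_one fl.cs_eq mult.commute)
    then show "cs n x \<in> Units (quo R P n)" unfolding Units_def using cs_in by blast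
  qed
qed

lemma pimul_cs: "pimul R \<pi> k (cs n x) = cs (n + k) (t ^ k * x)"
proof -
  have c: "\<pi> [^] m \<in> carrier R" for m :: nat by (simp add: pi)
  have d: "\<pi> [^] (n + k) = \<pi> [^] k \<otimes> \<pi> [^] n" using pi by (simp add: nat_pow_mult add.commute)
  have e: "\<pi> [^] k \<otimes> (\<pi> [^] n \<otimes> r \<oplus> ev R x) = \<pi> [^] (n + k) \<otimes> r \<oplus> ev R (t ^ k * x)" if "r \<in> carrier R" for r
    unfolding d using that c by (simp add: r_distr m_assoc ev_pow ev_t)
  have set: "cs m y = {\<pi> [^] m \<otimes> r \<oplus> ev R y | r. r \<in> carrier R}" for m y
    unfolding cs_def a_r_coset_def' using I_iff[of _ m] by auto
  show ?thesis unfolding pimul_def set l_coset_def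
  proof (intro Set.equalityI subsetI)
    fix a assume "a \<in> (\<Union>h\<in>{\<pi> [^] n \<otimes> r \<oplus> ev R x |r. r \<in> carrier R}. {\<pi> [^] k \<otimes> h})"
    then obtain r where "r \<in> carrier R" "a = \<pi> [^] k \<otimes> (\<pi> [^] n \<otimes> r \<oplus> ev R x)" by blast
    then show "a \<in> {\<pi> [^] (n + k) \<otimes> r \<oplus> ev R (t ^ k * x) |r. r \<in> carrier R}" using e by blast
  next
    fix a assume "a \<in> {\<pi> [^] (n + k) \<otimes> r \<oplus> ev R (t ^ k * x) |r. r \<in> carrier R}"
    then obtain r where "r \<in> carrier R" "a = \<pi> [^] k \<otimes> (\<pi> [^] n \<otimes> r \<oplus> ev R x)" using e[symmetric] by blast
    then show "a \<in> (\<Union>h\<in>{\<pi> [^] n \<otimes> r \<oplus> ev R x |r. r \<in> carrier R}. {\<pi> [^] k \<otimes> h})" by blast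
  qed
qed

lemma red_cs: assumes "m \<le> n" shows "red R P m (cs n x) = cs m x"
proof -
  interpret m: ideal "I m" R by (rule I_ideal)
  interpret n: ideal "I n" R by (rule I_ideal)
  have sub: "I n \<subseteq> I m"
  proof
    fix a assume "a \<in> I n"
    moreover from this obtain y where "ev R y = a" using ev_surj n.a_subset by blast
    ultimately have "y \<in> J m" using fl.J_mono[OF assms, of y] by (simp add: J_def)
    then show "a \<in> I m" using \<open>ev R y = a\<close> by (simp add: J_def)
  qed
  show ?thesis
  proof
    show "red R P m (cs n x) \<subseteq> cs m x"
    proof
      fix a assume "a \<in> red R P m (cs n x)"
      then obtain i j where ij: "i \<in> I m" "j \<in> I n" "a = i \<oplus> (j \<oplus> ev R x)"
        unfolding red_def cs_def set_add_def' a_r_coset_def' by auto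
      moreover have "i \<in> carrier R" "j \<in> carrier R" using ij m.a_subset n.a_subset by auto
      ultimately have "a = (i \<oplus> j) \<oplus> ev R x" "i \<oplus> j \<in> I m" using sub by (auto simp: a_assoc m.a_closed)
      then show "a \<in> cs m x" unfolding cs_def a_r_coset_def' by blast
    qed
    show "cs m x \<subseteq> red R P m (cs n x)"
    proof
      fix a assume "a \<in> cs m x"
      then obtain i where i: "i \<in> I m" "a = i \<oplus> ev R x" unfolding cs_def a_r_coset_def' by auto
      have "\<zero> \<oplus> ev R x \<in> cs n x" unfolding cs_def a_r_coset_def' using n.zero_closed by blast
      then have "i \<oplus> (\<zero> \<oplus> ev R x) \<in> red R P m (cs n x)" unfolding red_def set_add_def' using i by blast
      then show "a \<in> red R P m (cs n x)" using i by simp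
    qed
  qed
qed

end

section \<open>Automorphism groups of modules\<close>

lemma mod_aut_iff: "f \<in> carrier (mod_aut R M) \<longleftrightarrow> f \<in> extensional (carrier M) \<and> bij_betw f (carrier M) (carrier M) \<and>
   (\<forall>x\<in>carrier M. \<forall>y\<in>carrier M. f (x \<oplus>\<^bsub>M\<^esub> y) = f x \<oplus>\<^bsub>M\<^esub> f y) \<and>
   (\<forall>r\<in>carrier R. \<forall>x\<in>carrier M. f (r \<odot>\<^bsub>M\<^esub> x) = r \<odot>\<^bsub>M\<^esub> f x)"
  unfolding mod_aut_def Bij_def hom_def by (auto dest: bij_betw_apply)

lemma mod_aut_mult: "f \<in> carrier (mod_aut R M) \<Longrightarrow> g \<in> carrier (mod_aut R M) \<Longrightarrow>
    f \<otimes>\<^bsub>mod_aut R M\<^esub> g = compose (carrier M) f g"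
  unfolding mod_aut_def BijGroup_def by simp

lemma mod_aut_one: "\<one>\<^bsub>mod_aut R M\<^esub> = (\<lambda>x\<in>carrier M. x)"
  unfolding mod_aut_def BijGroup_def by simp

text \<open>Closure under both operations suffices, so the lemma serves the module itself,
  submodules obtained by changing the carrier, and the quotient records.\<close>

lemma mod_aut_group:
  assumes a: "\<And>x y. x \<in> carrier M \<Longrightarrow> y \<in> carrier M \<Longrightarrow> x \<oplus>\<^bsub>M\<^esub> y \<in> carrier M"
    and s: "\<And>r x. r \<in> carrier R \<Longrightarrow> x \<in> carrier M \<Longrightarrow> r \<odot>\<^bsub>M\<^esub> x \<in> carrier M"
  shows "group (mod_aut R M)"
proof -
  let ?C = "carrier M" and ?H = "carrier (mod_aut R M)"
  have B: "f \<in> Bij ?C" if "f \<in> ?H" for f using that unfolding mod_aut_iff Bij_def by blast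
  interpret B: group "BijGroup ?C" by (rule group_BijGroup)
  have "subgroup ?H (BijGroup ?C)"
  proof (rule B.subgroupI)
    show "?H \<subseteq> carrier (BijGroup ?C)" using B unfolding BijGroup_def by auto
    have "(\<lambda>x\<in>?C. x) \<in> ?H" unfolding mod_aut_iff using a s by (auto simp: bij_betw_def inj_on_def)
    then show "?H \<noteq> {}" by blast
  next
    fix f assume f: "f \<in> ?H"
    let ?i = "\<lambda>x\<in>?C. inv_into ?C f x"
    have b: "bij_betw f ?C ?C" using f unfolding mod_aut_iff by blast
    have ib: "bij_betw ?i ?C ?C" using bij_betw_inv_into[OF b] by (simp add: bij_betw_restrict_eq)
    have fi: "f (inv_into ?C f x) = x" "inv_into ?C f x \<in> ?C" if "x \<in> ?C" for x
      using that b by (auto simp: bij_betw_def f_inv_into_f inv_into_into)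
    have fi': "inv_into ?C f y = x" if "x \<in> ?C" "f x = y" for x y
      using that b by (auto simp: bij_betw_def)
    have "?i \<in> ?H"
      unfolding mod_aut_iff
    proof (intro conjI ballI)
      show "?i \<in> extensional ?C" by simp
      show "bij_betw ?i ?C ?C" by (rule ib)
      fix x y assume xy: "x \<in> ?C" "y \<in> ?C"
      have "inv_into ?C f (x \<oplus>\<^bsub>M\<^esub> y) = inv_into ?C f x \<oplus>\<^bsub>M\<^esub> inv_into ?C f y"
        by (rule fi') (use f fi xy a in \<open>auto simp: mod_aut_iff\<close>)
      then show "?i (x \<oplus>\<^bsub>M\<^esub> y) = ?i x \<oplus>\<^bsub>M\<^esub> ?i y" using xy a by simp
    next
      fix r x assume rx: "r \<in> carrier R" "x \<in> ?C"
      have "inv_into ?C f (r \<odot>\<^bsub>M\<^esub> x) = r \<odot>\<^bsub>M\<^esub> inv_into ?C f x"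
        by (rule fi') (use f fi rx s in \<open>auto simp: mod_aut_iff\<close>)
      then show "?i (r \<odot>\<^bsub>M\<^esub> x) = r \<odot>\<^bsub>M\<^esub> ?i x" using rx s by simp
    qed
    then show "inv\<^bsub>BijGroup ?C\<^esub> f \<in> ?H" using inv_BijGroup[OF B[OF f]] by simp
  next
    fix f g assume fg: "f \<in> ?H" "g \<in> ?H"
    have gC: "g x \<in> ?C" if "x \<in> ?C" for x using fg that unfolding mod_aut_iff by (blast dest: bij_betw_apply)
    have "compose ?C f g \<in> ?H"
      unfolding mod_aut_iff
    proof (intro conjI ballI)
      show "bij_betw (compose ?C f g) ?C ?C" by (rule bij_betw_compose) (use fg in \<open>auto simp: mod_aut_iff\<close>)
    qed (use fg gC a s in \<open>auto simp: mod_aut_iff compose_def\<close>)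
    then show "f \<otimes>\<^bsub>BijGroup ?C\<^esub> g \<in> ?H" using B[OF fg(1)] B[OF fg(2)] by (simp add: BijGroup_def)
  qed
  then have "group (BijGroup ?C\<lparr>carrier := ?H\<rparr>)" by (rule subgroup.subgroup_is_group[OF _ group_BijGroup])
  moreover have "BijGroup ?C\<lparr>carrier := ?H\<rparr> = mod_aut R M" unfolding mod_aut_def by simp
  ultimately show ?thesis by simp
qed

lemma mod_aut_finite: assumes "finite (carrier M)" shows "finite (carrier (mod_aut R M))"
proof (rule finite_subset)
  show "carrier (mod_aut R M) \<subseteq> carrier M \<rightarrow>\<^sub>E carrier M"
    unfolding PiE_def mod_aut_iff by (auto simp: mod_aut_iff dest: bij_betw_apply)
  show "finite (carrier M \<rightarrow>\<^sub>E carrier M)" using assms by (intro finite_PiE) auto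
qed

locale dvr_lam = dvr_setup +
  fixes l1 l2 :: nat
  assumes lam: "l2 < l1" "1 < l2"
begin

abbreviation "M \<equiv> Mlam R P l1 l2"
abbreviation "G \<equiv> Glam R P l1 l2"

lemma carrier_M: "carrier M = range (cs l1) \<times> range (cs l2)"
  unfolding Mlam_def range_cs by (simp add: ring.defs RDirProd_carrier)

lemma cs_in_M: "(cs l1 x, cs l2 y) \<in> carrier M"
  unfolding carrier_M by simp

lemma M_cases: assumes "p \<in> carrier M" obtains x y where "p = (cs l1 x, cs l2 y)"
  using assms unfolding carrier_M by auto

lemma M_add: "(cs l1 x, cs l2 y) \<oplus>\<^bsub>M\<^esub> (cs l1 x', cs l2 y') = (cs l1 (x + x'), cs l2 (y + y'))"
  unfolding Mlam_def by (simp add: ring.defs monoid.defs RDirProd_def DirProd_def quo_add)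

lemma M_smult: "ev R r \<odot>\<^bsub>M\<^esub> (cs l1 x, cs l2 y) = (cs l1 (r * x), cs l2 (r * y))"
  unfolding Mlam_def using quo_mult by (simp add: ring.defs cs_def)

lemma M_closed: "x \<in> carrier M \<Longrightarrow> y \<in> carrier M \<Longrightarrow> x \<oplus>\<^bsub>M\<^esub> y \<in> carrier M"
  "r \<in> carrier R \<Longrightarrow> x \<in> carrier M \<Longrightarrow> r \<odot>\<^bsub>M\<^esub> x \<in> carrier M"
proof -
  show "x \<in> carrier M \<Longrightarrow> y \<in> carrier M \<Longrightarrow> x \<oplus>\<^bsub>M\<^esub> y \<in> carrier M"
    by (elim M_cases) (simp only: M_add cs_in_M)
  assume r: "r \<in> carrier R" and "x \<in> carrier M"
  then show "r \<odot>\<^bsub>M\<^esub> x \<in> carrier M" using ev_surj[OF r] by (elim M_cases exE) (metis M_smult cs_in_M)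
qed

lemma finite_M: "finite (carrier M)"
  unfolding carrier_M using fl.card_cs by simp

lemma group_G: "group G"
  unfolding Glam_def by (rule mod_aut_group[OF M_closed])

lemma finite_G: "finite (carrier G)"
  unfolding Glam_def by (rule mod_aut_finite[OF finite_M])

definition rp :: "nat \<Rightarrow> 'a set \<Rightarrow> 'a ringprod" where "rp n C = (SOME x. cs n x = C)"

lemma rp_cs: "rp n (cs n x) - x \<in> J n"
  unfolding rp_def fl.cs_eq[symmetric] by (rule someI) simp

text \<open>Defined through representatives. The factor \<delta> = \<open>t ^ (l1 - l2)\<close>
  makes a second coordinate known modulo \<open>J l2\<close> contribute a well-defined class modulo
  \<open>J l1\<close>.\<close>

definition mk :: "'a ringprod \<Rightarrow> 'a ringprod \<Rightarrow> 'a ringprod \<Rightarrow> 'a ringprod \<Rightarrow> 'a lam_aut" where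
  "mk a b c d = (\<lambda>p\<in>carrier M. (cs l1 (a * rp l1 (fst p) + b * t ^ (l1 - l2) * rp l2 (snd p)),
                               cs l2 (c * rp l1 (fst p) + d * rp l2 (snd p))))"

lemma tpow_l1: "x \<in> J l2 \<Longrightarrow> b * t ^ (l1 - l2) * x \<in> J l1"
proof -
  assume "x \<in> J l2"
  then have "t ^ (l1 - l2) * (b * x) \<in> J l1" using lam by (simp add: fl.J_tpow' fl.J_mult)
  then show ?thesis by (simp add: mult_ac)
qed

lemma tpow_l1_iff: "t ^ (l1 - l2) * x \<in> J l1 \<longleftrightarrow> x \<in> J l2"
  using lam by (simp add: fl.J_tpow')

lemma J_l1_l2: "x \<in> J l1 \<Longrightarrow> x \<in> J l2"
  using fl.J_mono[of l2 l1] lam by simp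

lemma mk_apply: "mk a b c d (cs l1 x, cs l2 y) = (cs l1 (a * x + b * t ^ (l1 - l2) * y), cs l2 (c * x + d * y))"
proof -
  have "a * (rp l1 (cs l1 x) - x) + b * t ^ (l1 - l2) * (rp l2 (cs l2 y) - y) \<in> J l1"
    by (rule fl.J_add[OF fl.J_mult[OF rp_cs] tpow_l1[OF rp_cs]])
  moreover have "c * (rp l1 (cs l1 x) - x) + d * (rp l2 (cs l2 y) - y) \<in> J l2"
    by (rule fl.J_add[OF fl.J_mult[OF J_l1_l2[OF rp_cs]] fl.J_mult[OF rp_cs]])
  ultimately show ?thesis unfolding mk_def using cs_in_M by (simp add: fl.cs_eq algebra_simps)
qed

lemma mk_ext: "mk a b c d \<in> extensional (carrier M)"
  unfolding mk_def by simp

lemma mk_eqI: "f \<in> extensional (carrier M) \<Longrightarrow> (\<And>x y. f (cs l1 x, cs l2 y) = mk a b c d (cs l1 x, cs l2 y)) \<Longrightarrow> f = mk a b c d"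
  by (rule extensionalityI[OF _ mk_ext]) (auto elim: M_cases)

lemma mk_in_M: "p \<in> carrier M \<Longrightarrow> mk a b c d p \<in> carrier M"
  by (elim M_cases) (simp only: mk_apply cs_in_M)

lemma mk_closed: assumes ad: "a \<notin> J 1" "d \<notin> J 1" shows "mk a b c d \<in> carrier G"
proof -
  let ?D = "a * d - b * c * t ^ (l1 - l2)"
  have "- (b * c * t ^ (l1 - l2)) \<in> J 1" using fl.tpow_in[of 1 "l1 - l2" "b * c"] lam fl.J_neg by (simp add: mult_ac)
  then have "?D \<notin> J 1" using fl.unit_add[of "a * d" "- (b * c * t ^ (l1 - l2))"] fl.prime_J ad by simp
  then obtain e where e: "?D * e - 1 \<in> J l1" using fl.J_unit by blast
  \<comment> \<open>The adjugate scaled by \<open>e\<close>, which inverts the determinant modulo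
    \<open>J l1\<close> and therefore also modulo \<open>J l2\<close>.\<close>
  let ?i = "mk (d * e) (- b * e) (- c * e) (a * e)"
  have e2: "?D * e - 1 \<in> J l2" using J_l1_l2[OF e] .
  have 1: "?i (mk a b c d p) = p" "mk a b c d (?i p) = p" if p: "p \<in> carrier M" for p
  proof -
    obtain x y where xy: "p = (cs l1 x, cs l2 y)" using M_cases[OF p] by blast
    show "?i (mk a b c d p) = p" unfolding xy mk_apply
      using fl.J_mult'[OF e, of x] fl.J_mult'[OF e2, of y] by (simp add: fl.cs_eq algebra_simps)
    show "mk a b c d (?i p) = p" unfolding xy mk_apply
      using fl.J_mult'[OF e, of x] fl.J_mult'[OF e2, of y] by (simp add: fl.cs_eq algebra_simps)
  qed
  show ?thesis
    unfolding Glam_def mod_aut_iff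
  proof (intro conjI ballI)
    show "mk a b c d \<in> extensional (carrier M)" by (rule mk_ext)
    show "bij_betw (mk a b c d) (carrier M) (carrier M)"
      by (rule bij_betw_byWitness[where f' = ?i]) (use 1 mk_in_M in auto)
    fix p p' assume p: "p \<in> carrier M" "p' \<in> carrier M"
    obtain x y where xy: "p = (cs l1 x, cs l2 y)" using M_cases[OF p(1)] by blast
    obtain x' y' where xy': "p' = (cs l1 x', cs l2 y')" using M_cases[OF p(2)] by blast
    show "mk a b c d (p \<oplus>\<^bsub>M\<^esub> p') = mk a b c d p \<oplus>\<^bsub>M\<^esub> mk a b c d p'"
      unfolding xy xy' M_add mk_apply by (simp add: algebra_simps)
  next
    fix r p assume rp: "r \<in> carrier R" "p \<in> carrier M"
    obtain x y where xy: "p = (cs l1 x, cs l2 y)" using M_cases[OF rp(2)] by blast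
    obtain r' where r': "r = ev R r'" using ev_surj[OF rp(1)] by blast
    show "mk a b c d (r \<odot>\<^bsub>M\<^esub> p) = r \<odot>\<^bsub>M\<^esub> mk a b c d p"
      unfolding xy r' M_smult mk_apply by (simp add: algebra_simps)
  qed
qed

lemma mk_eq: "mk a b c d = mk a' b' c' d' \<longleftrightarrow> a - a' \<in> J l1 \<and> b - b' \<in> J l2 \<and> c - c' \<in> J l2 \<and> d - d' \<in> J l2"
proof
  assume e: "mk a b c d = mk a' b' c' d'"
  have "t ^ (l1 - l2) * (b - b') \<in> J l1"
    using arg_cong[OF e, of "\<lambda>f. f (cs l1 0, cs l2 1)"] unfolding mk_apply by (simp add: fl.cs_eq algebra_simps)
  moreover have "a - a' \<in> J l1" "c - c' \<in> J l2"
    using arg_cong[OF e, of "\<lambda>f. f (cs l1 1, cs l2 0)"] unfolding mk_apply by (simp_all add: fl.cs_eq)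
  moreover have "d - d' \<in> J l2"
    using arg_cong[OF e, of "\<lambda>f. f (cs l1 0, cs l2 1)"] unfolding mk_apply by (simp_all add: fl.cs_eq)
  ultimately show "a - a' \<in> J l1 \<and> b - b' \<in> J l2 \<and> c - c' \<in> J l2 \<and> d - d' \<in> J l2" by (simp add: tpow_l1_iff)
next
  assume h: "a - a' \<in> J l1 \<and> b - b' \<in> J l2 \<and> c - c' \<in> J l2 \<and> d - d' \<in> J l2"
  show "mk a b c d = mk a' b' c' d'"
  proof (rule mk_eqI[OF mk_ext])
    fix x y
    have "(a - a') * x + y * t ^ (l1 - l2) * (b - b') \<in> J l1"
      by (rule fl.J_add[OF fl.J_mult' tpow_l1]) (use h in auto)
    moreover have "(c - c') * x + (d - d') * y \<in> J l2"
      by (rule fl.J_add[OF fl.J_mult' fl.J_mult']) (use h in auto)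
    ultimately show "mk a b c d (cs l1 x, cs l2 y) = mk a' b' c' d' (cs l1 x, cs l2 y)"
      unfolding mk_apply by (simp add: fl.cs_eq algebra_simps)
  qed
qed

lemma mk_mult:
  assumes "a \<notin> J 1" "d \<notin> J 1" "a' \<notin> J 1" "d' \<notin> J 1"
  shows "mk a b c d \<otimes>\<^bsub>G\<^esub> mk a' b' c' d' = mk (a * a' + b * c' * t ^ (l1 - l2)) (a * b' + b * d') (c * a' + d * c') (c * b' * t ^ (l1 - l2) + d * d')"
proof -
  have "mk a b c d \<otimes>\<^bsub>G\<^esub> mk a' b' c' d' = compose (carrier M) (mk a b c d) (mk a' b' c' d')"
    using mk_closed assms unfolding Glam_def by (intro mod_aut_mult) auto
  also have "\<dots> = mk (a * a' + b * c' * t ^ (l1 - l2)) (a * b' + b * d') (c * a' + d * c') (c * b' * t ^ (l1 - l2) + d * d')"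
    by (rule mk_eqI) (simp_all add: compose_def mk_apply cs_in_M algebra_simps)
  finally show ?thesis .
qed

text \<open>The diagonal entries are units because both generators of the module must be hit: a
  diagonal entry in \<open>J 1\<close> would put 1 into \<open>J 1\<close>.\<close>

lemma mk_exh: assumes g: "g \<in> carrier G" shows "\<exists>a b c d. a \<notin> J 1 \<and> d \<notin> J 1 \<and> g = mk a b c d"
proof -
  have gx: "g \<in> extensional (carrier M)" and bij: "bij_betw g (carrier M) (carrier M)"
    and add: "\<And>p p'. p \<in> carrier M \<Longrightarrow> p' \<in> carrier M \<Longrightarrow> g (p \<oplus>\<^bsub>M\<^esub> p') = g p \<oplus>\<^bsub>M\<^esub> g p'"
    and lin: "\<And>r p. p \<in> carrier M \<Longrightarrow> g (ev R r \<odot>\<^bsub>M\<^esub> p) = ev R r \<odot>\<^bsub>M\<^esub> g p"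
    using g ev_closed unfolding Glam_def mod_aut_iff by blast+
  obtain a c where 1: "g (cs l1 1, cs l2 0) = (cs l1 a, cs l2 c)" using bij_betw_apply[OF bij cs_in_M] by (rule M_cases)
  obtain x d where 2: "g (cs l1 0, cs l2 1) = (cs l1 x, cs l2 d)" using bij_betw_apply[OF bij cs_in_M] by (rule M_cases)
  have l: "g (cs l1 y, cs l2 z) = (cs l1 (y * a + z * x), cs l2 (y * c + z * d))" for y z
  proof -
    have "g (cs l1 y, cs l2 z) = g (ev R y \<odot>\<^bsub>M\<^esub> (cs l1 1, cs l2 0) \<oplus>\<^bsub>M\<^esub> ev R z \<odot>\<^bsub>M\<^esub> (cs l1 0, cs l2 1))"
      by (simp add: M_smult M_add)
    also have "\<dots> = ev R y \<odot>\<^bsub>M\<^esub> g (cs l1 1, cs l2 0) \<oplus>\<^bsub>M\<^esub> ev R z \<odot>\<^bsub>M\<^esub> g (cs l1 0, cs l2 1)"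
      using add[OF M_closed(2)[OF ev_closed cs_in_M] M_closed(2)[OF ev_closed cs_in_M]] lin[OF cs_in_M] by simp
    finally show ?thesis unfolding 1 2 M_smult M_add .
  qed
  \<comment> \<open>The second generator is killed by \<open>t ^ l2\<close>, hence so is its image.
    This makes the first coordinate of the image divisible by \<delta> and yields b.\<close>
  have "cs l2 (t ^ l2) = cs l2 0" unfolding fl.cs_eq using fl.tpow_in[of l2 l2 1] by simp
  then have "g (cs l1 0, cs l2 (t ^ l2)) = g (cs l1 0, cs l2 0)" by simp
  then have "t ^ l2 * x \<in> J l1" unfolding l by (simp add: fl.cs_eq)
  then have "x \<in> J (l1 - l2)" using fl.J_tpow'[of l2 l1 x] lam by simp
  then obtain b where b: "\<forall>n. x - t ^ (l1 - l2) * b \<in> J n" using fl.J_decpow by blast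
  have gm: "g = mk a b c d"
  proof (rule mk_eqI[OF gx])
    fix y z
    show "g (cs l1 y, cs l2 z) = mk a b c d (cs l1 y, cs l2 z)"
      unfolding l mk_apply using fl.J_mult[OF b[rule_format, of l1], of z] by (simp add: fl.cs_eq algebra_simps)
  qed
  have tb: "b * t ^ (l1 - l2) * z \<in> J 1" for z using fl.tpow_in[of 1 "l1 - l2" "b * z"] lam by (simp add: mult_ac)
  have "a \<notin> J 1"
  proof
    assume a: "a \<in> J 1"
    have "(cs l1 1, cs l2 0) \<in> g ` carrier M" using bij cs_in_M unfolding bij_betw_def by simp
    then obtain y z where "(cs l1 1, cs l2 0) = mk a b c d (cs l1 y, cs l2 z)" unfolding gm by (auto elim: M_cases)
    then have "1 - (a * y + b * t ^ (l1 - l2) * z) \<in> J l1" unfolding mk_apply by (simp add: fl.cs_eq)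
    then have "1 - (a * y + b * t ^ (l1 - l2) * z) \<in> J 1" using fl.J_mono[of 1 l1] lam by simp
    from fl.J_add[OF this fl.J_add[OF fl.J_mult'[OF a, of y] tb[of z]]] show False using fl.one_notin by simp
  qed
  moreover have "d \<notin> J 1"
  proof
    assume d: "d \<in> J 1"
    have "(cs l1 0, cs l2 1) \<in> g ` carrier M" using bij cs_in_M unfolding bij_betw_def by simp
    then obtain y z where e: "(cs l1 0, cs l2 1) = mk a b c d (cs l1 y, cs l2 z)" unfolding gm by (auto elim: M_cases)
    then have "0 - (a * y + b * t ^ (l1 - l2) * z) \<in> J l1" unfolding mk_apply by (simp add: fl.cs_eq)
    then have "0 - (a * y + b * t ^ (l1 - l2) * z) \<in> J 1" using fl.J_mono[of 1 l1] lam by simp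
    from fl.J_neg[OF fl.J_add[OF this tb[of z]]] have "a * y \<in> J 1" by simp
    then have y: "y \<in> J 1" using \<open>a \<notin> J 1\<close> fl.prime_J by blast
    have "1 - (c * y + d * z) \<in> J l2" using e unfolding mk_apply by (simp add: fl.cs_eq)
    then have "1 - (c * y + d * z) \<in> J 1" using fl.J_mono[of 1 l2] lam by simp
    from fl.J_add[OF this fl.J_add[OF fl.J_mult[OF y, of c] fl.J_mult'[OF d, of z]]] show False using fl.one_notin by simp
  qed
  ultimately show ?thesis using gm by blast
qed

lemma ent_mk:
  "ent11 R P l1 l2 (mk a b c d) = cs l1 a" "ent12 R P l1 l2 (mk a b c d) = cs l1 (b * t ^ (l1 - l2))"
  "ent21 R P l1 l2 (mk a b c d) = cs l2 c" "ent22 R P l1 l2 (mk a b c d) = cs l2 d"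
  unfolding ent11_def ent12_def ent21_def ent22_def quo_one quo_zero mk_apply by simp_all

end

locale dvr_char = dvr_lam +
  fixes l \<epsilon> :: nat and \<psi> :: "'a set \<Rightarrow> complex"
  assumes eps: "\<epsilon> \<in> {0, 1}" "\<epsilon> mod 2 = l2 mod 2" and l: "l = (l2 + \<epsilon>) div 2"
    and psi: "primitive_char R P l \<psi>"
begin

lemma l2_eq: "l2 + \<epsilon> = 2 * l"
proof -
  have "even (l2 + \<epsilon>)" using eps(2) by presburger
  then show ?thesis using l by simp
qed

lemma l_dims: "l = l - \<epsilon> + \<epsilon>" "l2 = l - \<epsilon> + l" "l1 = l2 + (l1 - l2)" "\<epsilon> \<le> 1" "0 < l - \<epsilon>" "0 < l1 - l2" "\<epsilon> \<le> l" "0 < l"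
  using l2_eq lam eps(1) by auto

sublocale gr: lam_group J t cs G mk l1 l2 l \<epsilon> "l - \<epsilon>" "l1 - l2" "\<lambda>x. \<psi> (cs l x)"
proof -
  interpret G: group G by (rule group_G)
  interpret G: finite_grp G by unfold_locales (rule finite_G)
  show "lam_group J t cs G mk l1 l2 l \<epsilon> (l - \<epsilon>) (l1 - l2) (\<lambda>x. \<psi> (cs l x))"
  proof
    show "l = l - \<epsilon> + \<epsilon>" "l2 = l - \<epsilon> + l" "l1 = l2 + (l1 - l2)" "\<epsilon> \<le> 1" "0 < l - \<epsilon>" "0 < l1 - l2" "1 < l2"
      using l_dims lam by auto
    show "fl.prim_char l (\<lambda>x. \<psi> (cs l x))"
      unfolding fl.prim_char_def fl.add_char_def
    proof (intro conjI allI ballI)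
      have h: "\<psi> \<in> hom (add_monoid (quo R P l)) complex_units" using psi unfolding primitive_char_def by blast
      show add: "\<psi> (cs l (x + y)) = \<psi> (cs l x) * \<psi> (cs l y)" for x y
        using hom_mult[OF h, of "cs l x" "cs l y"] cs_in by (simp add: quo_add complex_units_def)
      show "0 < l" by (rule l_dims)
      show "\<psi> (cs l x) = 1" if "x \<in> J l" for x
      proof -
        have "cs l x = cs l 0" using that by (simp add: fl.cs_eq)
        moreover have "\<psi> (cs l 0) = \<psi> (cs l 0) * \<psi> (cs l 0)" using add[of 0 0] by simp
        moreover have "\<psi> (cs l 0) \<noteq> 0" using hom_in_carrier[OF h, of "cs l 0"] cs_in by (simp add: complex_units_def)
        ultimately show ?thesis by simp
      qed
      show "\<exists>x\<in>J (l - 1). \<psi> (cs l x) \<noteq> 1" using psi unfolding primitive_char_def quo_ideal_eq by blast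
    qed
  qed (rule mk_closed mk_exh mk_eq mk_mult; assumption)+
qed

end

section \<open>Twists and pullbacks\<close>

lemma hom_complex_units_iff: "\<chi> \<in> hom (G\<lparr>carrier := H\<rparr>) complex_units \<longleftrightarrow> is_char G H \<chi>"
  unfolding hom_def complex_units_def is_char_def by auto

lemma hom_complex_units_iff': "\<chi> \<in> hom G complex_units \<longleftrightarrow> is_char G (carrier G) \<chi>"
  unfolding hom_def complex_units_def is_char_def by auto

context group
begin

lemma twist_vec: "A \<in> carrier_mat n n \<Longrightarrow> v \<in> carrier_vec n \<Longrightarrow> (c \<cdot>\<^sub>m A) *\<^sub>v v = c \<cdot>\<^sub>v (A *\<^sub>v (v :: complex vec))"
  by (rule eq_vecI) (auto simp: scalar_prod_def sum_distrib_left mult.assoc)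

lemma twist_mat_rep:
  assumes r: "mat_rep G n r" and chi: "is_char G (carrier G) \<chi>"
  shows "mat_rep G n (\<lambda>g. \<chi> g \<cdot>\<^sub>m r g)"
  unfolding mat_rep_def
proof (intro conjI ballI)
  have rc: "r g \<in> carrier_mat n n" if "g \<in> carrier G" for g using mat_rep_carrier[OF r that] .
  show "\<chi> g \<cdot>\<^sub>m r g \<in> carrier_mat n n" if "g \<in> carrier G" for g using rc[OF that] by simp
  show "\<chi> (g \<otimes> h) \<cdot>\<^sub>m r (g \<otimes> h) = (\<chi> g \<cdot>\<^sub>m r g) * (\<chi> h \<cdot>\<^sub>m r h)" if gh: "g \<in> carrier G" "h \<in> carrier G" for g h
  proof -
    have "\<chi> (g \<otimes> h) = \<chi> g * \<chi> h" "r (g \<otimes> h) = r g * r h" using chi r gh unfolding is_char_def mat_rep_def by auto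
    then show ?thesis using rc[OF gh(1)] rc[OF gh(2)]
      by (auto simp: scalar_prod_def sum_distrib_left mult_ac intro!: eq_matI)
  qed
  have "\<chi> \<one> = 1" by (rule is_char_one[OF subgroup_self chi])
  moreover have "1 \<cdot>\<^sub>m (1\<^sub>m n :: complex mat) = 1\<^sub>m n" by (rule eq_matI) auto
  ultimately show "\<chi> \<one> \<cdot>\<^sub>m r \<one> = 1\<^sub>m n" using r unfolding mat_rep_def by simp
qed

lemma twist_irreducible:
  assumes irr: "irreducible_rep G \<rho>" and chi: "is_char G (carrier G) \<chi>"
  shows "irreducible_rep G (twist \<chi> \<rho>)"
proof -
  obtain n r where rho: "\<rho> = (n, r)" by (cases \<rho>)
  have r: "mat_rep G n r" "0 < n" and W: "\<And>W. invariant_subspace G n r W \<Longrightarrow> W = {0\<^sub>v n} \<or> W = carrier_vec n"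
    using irr rho irreducible_rep_iff by auto
  have "invariant_subspace G n r W" if h: "invariant_subspace G n (\<lambda>g. \<chi> g \<cdot>\<^sub>m r g) W" for W
    unfolding invariant_subspace_def
  proof (intro conjI ballI)
    fix g v assume g: "g \<in> carrier G" "v \<in> W"
    have vc: "v \<in> carrier_vec n" using h g unfolding invariant_subspace_def by blast
    have c: "\<chi> g \<noteq> 0" using chi g unfolding is_char_def by blast
    have "(\<chi> g \<cdot>\<^sub>m r g) *\<^sub>v v \<in> W" using h g unfolding invariant_subspace_def by blast
    then have "inverse (\<chi> g) \<cdot>\<^sub>v (\<chi> g \<cdot>\<^sub>v (r g *\<^sub>v v)) \<in> W"
      unfolding twist_vec[OF mat_rep_carrier[OF r(1) g(1)] vc] using h unfolding invariant_subspace_def by blast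
    then show "r g *\<^sub>v v \<in> W" using c by (simp add: smult_smult_assoc)
  qed (use h in \<open>auto simp: invariant_subspace_def\<close>)
  then show ?thesis
    unfolding irreducible_rep_iff twist_def rho fst_conv snd_conv using twist_mat_rep[OF r(1) chi] r(2) W by blast
qed

end

lemma is_rep_one: assumes "group L" "is_rep L \<sigma>" shows "snd \<sigma> \<one>\<^bsub>L\<^esub> = 1\<^sub>m (fst \<sigma>)"
  using assms group.is_rep_iff[OF assms(1)] unfolding mat_rep_def by blast

section \<open>The parabolic subgroups\<close>

context dvr_lam
begin

interpretation G: group G by (rule group_G)
interpretation G: finite_grp G by unfold_locales (rule finite_G)

lemma finite_units_quo: "finite (carrier (units_of (quo R P n)))"
  using fl.card_cs[of n] unfolding units_of_carrier range_cs Units_def by (rule_tac finite_subset[of _ "carrier (quo R P n)"]) auto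

lemma group_units_quo: "group (units_of (quo R P n))"
  by (rule monoid.units_group) (rule comm_monoid.axioms(1)[OF cring.axioms(2)[OF quo_cring]])

abbreviation "Levi \<equiv> units_of (quo R P l1) \<times>\<times> units_of (quo R P l2)"

lemma group_Levi: "group Levi" and finite_Levi: "finite (carrier Levi)"
  by (rule DirProd_group[OF group_units_quo group_units_quo]) (simp add: DirProd_def finite_units_quo)

definition Pplus where "Pplus = {g \<in> carrier G. ent21 R P l1 l2 g = \<zero>\<^bsub>quo R P l2\<^esub>}"
definition Pminus where "Pminus = {g \<in> carrier G. ent12 R P l1 l2 g = \<zero>\<^bsub>quo R P l1\<^esub>}"
abbreviation "ent_diag g \<equiv> (ent11 R P l1 l2 g, ent22 R P l1 l2 g)"

lemma Pplus_iff: "mk a b c d \<in> Pplus \<longleftrightarrow> mk a b c d \<in> carrier G \<and> c \<in> J l2"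
  unfolding Pplus_def by (auto simp: ent_mk quo_zero fl.cs_eq)

lemma Pminus_iff: "mk a b c d \<in> Pminus \<longleftrightarrow> mk a b c d \<in> carrier G \<and> b \<in> J l2"
  unfolding Pminus_def using tpow_l1_iff[of b] by (auto simp: ent_mk quo_zero fl.cs_eq mult.commute)

lemma Pplus_subgroup: "subgroup Pplus G" and Pminus_subgroup: "subgroup Pminus G"
proof -
  have one: "mk 1 0 0 1 \<in> Pplus" "mk 1 0 0 1 \<in> Pminus"
    unfolding Pplus_iff Pminus_iff using mk_closed fl.one_notin by auto
  have *: "g \<otimes>\<^bsub>G\<^esub> h \<in> Pplus" if gh: "g \<in> Pplus" "h \<in> Pplus" for g h
  proof -
    have gc: "g \<in> carrier G" "h \<in> carrier G" using gh unfolding Pplus_def by auto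
    obtain a b c d where g: "a \<notin> J 1" "d \<notin> J 1" "g = mk a b c d" using mk_exh[OF gc(1)] by blast
    obtain a' b' c' d' where h: "a' \<notin> J 1" "d' \<notin> J 1" "h = mk a' b' c' d'" using mk_exh[OF gc(2)] by blast
    have "c * a' + d * c' \<in> J l2"
      by (rule fl.J_add[OF fl.J_mult' fl.J_mult]) (use gh in \<open>auto simp: g h Pplus_iff\<close>)
    moreover have "g \<otimes>\<^bsub>G\<^esub> h \<in> carrier G" using gc by simp
    ultimately show ?thesis unfolding g h mk_mult[OF g(1,2) h(1,2)] Pplus_iff by simp
  qed
  show "subgroup Pplus G" by (rule G.subgroup_finiteI[OF _ one(1) *]) (auto simp: Pplus_def)
  have *: "g \<otimes>\<^bsub>G\<^esub> h \<in> Pminus" if gh: "g \<in> Pminus" "h \<in> Pminus" for g h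
  proof -
    have gc: "g \<in> carrier G" "h \<in> carrier G" using gh unfolding Pminus_def by auto
    obtain a b c d where g: "a \<notin> J 1" "d \<notin> J 1" "g = mk a b c d" using mk_exh[OF gc(1)] by blast
    obtain a' b' c' d' where h: "a' \<notin> J 1" "d' \<notin> J 1" "h = mk a' b' c' d'" using mk_exh[OF gc(2)] by blast
    have "a * b' + b * d' \<in> J l2"
      by (rule fl.J_add[OF fl.J_mult fl.J_mult']) (use gh in \<open>auto simp: g h Pminus_iff\<close>)
    moreover have "g \<otimes>\<^bsub>G\<^esub> h \<in> carrier G" using gc by simp
    ultimately show ?thesis unfolding g h mk_mult[OF g(1,2) h(1,2)] Pminus_iff by simp
  qed
  show "subgroup Pminus G" by (rule G.subgroup_finiteI[OF _ one(2) *]) (auto simp: Pminus_def)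
qed

lemma Pplus_hom: "g \<in> Pplus \<Longrightarrow> ent_diag g \<in> carrier Levi"
  "g \<in> Pplus \<Longrightarrow> h \<in> Pplus \<Longrightarrow> ent_diag (g \<otimes>\<^bsub>G\<^esub> h) = ent_diag g \<otimes>\<^bsub>Levi\<^esub> ent_diag h"
proof -
  have l: "0 < l1" "0 < l2" using lam by auto
  { fix g assume g: "g \<in> Pplus"
    then have "g \<in> carrier G" unfolding Pplus_def by auto
    then obtain a b c d where g: "a \<notin> J 1" "d \<notin> J 1" "g = mk a b c d" using mk_exh by blast
    show "ent_diag g \<in> carrier Levi"
      unfolding g ent_mk DirProd_def units_of_def quo_Units[OF l(1)] quo_Units[OF l(2)] using g by simp }
  assume gh: "g \<in> Pplus" "h \<in> Pplus"
  then have gc: "g \<in> carrier G" "h \<in> carrier G" unfolding Pplus_def by auto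
  obtain a b c d where g: "a \<notin> J 1" "d \<notin> J 1" "g = mk a b c d" using mk_exh[OF gc(1)] by blast
  obtain a' b' c' d' where h: "a' \<notin> J 1" "d' \<notin> J 1" "h = mk a' b' c' d'" using mk_exh[OF gc(2)] by blast
  have j: "c \<in> J l2" "c' \<in> J l2" using gh by (auto simp: g h Pplus_iff)
  have "cs l1 (a * a' + b * c' * t ^ (l1 - l2)) = cs l1 (a * a')"
    unfolding fl.cs_eq using tpow_l1[OF j(2), of b] by (simp add: mult_ac)
  moreover have "cs l2 (c * b' * t ^ (l1 - l2) + d * d') = cs l2 (d * d')"
    unfolding fl.cs_eq using fl.J_mult'[OF j(1), of "b' * t ^ (l1 - l2)"] by (simp add: mult.assoc)
  ultimately show "ent_diag (g \<otimes>\<^bsub>G\<^esub> h) = ent_diag g \<otimes>\<^bsub>Levi\<^esub> ent_diag h"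
    unfolding g h mk_mult[OF g(1,2) h(1,2)] ent_mk by (simp add: units_of_def quo_mult)
qed

lemma Levi_one: "\<one>\<^bsub>Levi\<^esub> = (cs l1 1, cs l2 1)"
  by (simp add: units_of_def quo_one)

definition submod :: "('a set \<times> 'a set) set \<Rightarrow> bool" where
  "submod N \<longleftrightarrow> N \<subseteq> carrier M \<and> N \<noteq> {} \<and> (\<forall>x\<in>N. \<forall>y\<in>N. x \<oplus>\<^bsub>M\<^esub> y \<in> N) \<and> (\<forall>r\<in>carrier R. \<forall>x\<in>N. r \<odot>\<^bsub>M\<^esub> x \<in> N)"

text \<open>All submodules needed are of this shape: the multiples of \<pi>, the domains of
  restriction, and, with i = l1, the kernels of the quotient maps.\<close>

lemma submod_product: "submod (cs l1 ` J i \<times> cs l2 ` J j)"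
  unfolding submod_def
proof (intro conjI ballI)
  show "cs l1 ` J i \<times> cs l2 ` J j \<subseteq> carrier M" unfolding carrier_M by auto
  show "cs l1 ` J i \<times> cs l2 ` J j \<noteq> {}" using fl.J_zero by blast
  fix p p' assume "p \<in> cs l1 ` J i \<times> cs l2 ` J j" "p' \<in> cs l1 ` J i \<times> cs l2 ` J j"
  then obtain x y x' y' where "p = (cs l1 x, cs l2 y)" "p' = (cs l1 x', cs l2 y')" "x \<in> J i" "y \<in> J j" "x' \<in> J i" "y' \<in> J j" by auto
  then show "p \<oplus>\<^bsub>M\<^esub> p' \<in> cs l1 ` J i \<times> cs l2 ` J j" by (simp add: M_add fl.J_add)
next
  fix r p assume r: "r \<in> carrier R" and "p \<in> cs l1 ` J i \<times> cs l2 ` J j"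
  then obtain x y where "p = (cs l1 x, cs l2 y)" "x \<in> J i" "y \<in> J j" by auto
  moreover obtain r' where "r = ev R r'" using ev_surj[OF r] by blast
  ultimately show "r \<odot>\<^bsub>M\<^esub> p \<in> cs l1 ` J i \<times> cs l2 ` J j" by (simp add: M_smult fl.J_mult)
qed

abbreviation "stab N \<equiv> stabilizer G image N"

lemma stab_subgroup: assumes "submod N" shows "subgroup (stab N) G"
proof (rule G.subgroup_finiteI)
  have N: "N \<subseteq> carrier M" using assms unfolding submod_def by blast
  show "stab N \<subseteq> carrier G" unfolding stabilizer_def by auto
  have "\<one>\<^bsub>G\<^esub> ` N = N" unfolding Glam_def mod_aut_one using N by force
  then show "\<one>\<^bsub>G\<^esub> \<in> stab N" unfolding stabilizer_def by simp
  fix g h assume gh: "g \<in> stab N" "h \<in> stab N"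
  then have gc: "g \<in> carrier G" "h \<in> carrier G" "g ` N = N" "h ` N = N" unfolding stabilizer_def by auto
  have "(g \<otimes>\<^bsub>G\<^esub> h) ` N = g ` (h ` N)"
    using mod_aut_mult gc(1,2) N unfolding Glam_def by (force simp: compose_def image_iff)
  then show "g \<otimes>\<^bsub>G\<^esub> h \<in> stab N" unfolding stabilizer_def using gc by simp
qed

lemma G_maps: assumes "g \<in> carrier G"
  shows "bij_betw g (carrier M) (carrier M)" "p \<in> carrier M \<Longrightarrow> g p \<in> carrier M"
    "p \<in> carrier M \<Longrightarrow> p' \<in> carrier M \<Longrightarrow> g (p \<oplus>\<^bsub>M\<^esub> p') = g p \<oplus>\<^bsub>M\<^esub> g p'"
    "r \<in> carrier R \<Longrightarrow> p \<in> carrier M \<Longrightarrow> g (r \<odot>\<^bsub>M\<^esub> p) = r \<odot>\<^bsub>M\<^esub> g p"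
  using assms unfolding Glam_def mod_aut_iff by (auto dest: bij_betw_apply)

lemma G_mult: "g \<in> carrier G \<Longrightarrow> h \<in> carrier G \<Longrightarrow> p \<in> carrier M \<Longrightarrow> (g \<otimes>\<^bsub>G\<^esub> h) p = g (h p)"
  unfolding Glam_def by (simp add: mod_aut_mult compose_def)

abbreviation "sub_group N \<equiv> mod_aut R (M\<lparr>carrier := N\<rparr>)"

lemma sub_group: assumes "submod N" shows "group (sub_group N)" "finite (carrier (sub_group N))"
proof -
  show "group (sub_group N)" by (rule mod_aut_group) (use assms in \<open>auto simp: submod_def\<close>)
  have "finite N" using assms finite_M finite_subset unfolding submod_def by blast
  then show "finite (carrier (sub_group N))" by (intro mod_aut_finite) simp
qed

lemma sub_group_one: "\<one>\<^bsub>sub_group N\<^esub> = (\<lambda>x\<in>N. x)"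
  by (simp add: mod_aut_one)

lemma sub_hom:
  assumes N: "submod N"
  shows "g \<in> stab N \<Longrightarrow> restrict g N \<in> carrier (sub_group N)"
    "g \<in> stab N \<Longrightarrow> h \<in> stab N \<Longrightarrow> restrict (g \<otimes>\<^bsub>G\<^esub> h) N = restrict g N \<otimes>\<^bsub>sub_group N\<^esub> restrict h N"
proof -
  have NM: "x \<in> carrier M" if "x \<in> N" for x using N that unfolding submod_def by blast
  { fix g assume "g \<in> stab N"
    then have g: "g \<in> carrier G" "g ` N = N" unfolding stabilizer_def by auto
    have "inj_on g N" using G_maps(1)[OF g(1)] N unfolding bij_betw_def submod_def by (meson inj_on_subset)
    then have "bij_betw (restrict g N) N N" using g unfolding bij_betw_restrict_eq by (simp add: bij_betw_def)
    then show r: "restrict g N \<in> carrier (sub_group N)"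
      unfolding mod_aut_iff using G_maps(3,4)[OF g(1)] NM N by (auto simp: submod_def) }
  note c = this
  assume gh: "g \<in> stab N" "h \<in> stab N"
  then have g: "g \<in> carrier G" "h \<in> carrier G" "g ` N = N" "h ` N = N" unfolding stabilizer_def by auto
  have "restrict (g \<otimes>\<^bsub>G\<^esub> h) N = compose N (restrict g N) (restrict h N)"
    using g(4) by (auto simp: compose_def restrict_def fun_eq_iff G_mult[OF g(1,2) NM])
  then show "restrict (g \<otimes>\<^bsub>G\<^esub> h) N = restrict g N \<otimes>\<^bsub>sub_group N\<^esub> restrict h N"
    using mod_aut_mult[OF c[OF gh(1)] c[OF gh(2)]] by simp
qed

end

context dvr_lam
begin

interpretation G: group G by (rule group_G)
interpretation G: finite_grp G by unfold_locales (rule finite_G)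

abbreviation "quot_group N \<equiv> mod_aut R (quot_module M N)"
abbreviation "Nker k \<equiv> {cs l1 0} \<times> cs l2 ` J k"

lemma Nker_eq: "Nker k = cs l1 ` J l1 \<times> cs l2 ` J k"
proof -
  have "cs l1 ` J l1 = {cs l1 0}"
  proof
    show "cs l1 ` J l1 \<subseteq> {cs l1 0}" using fl.cs_eq[of l1 _ 0] by auto
    show "{cs l1 0} \<subseteq> cs l1 ` J l1" using fl.J_zero by blast
  qed
  then show ?thesis by simp
qed

lemma Nker_submod: "submod (Nker k)"
  unfolding Nker_eq by (rule submod_product)

definition coset :: "nat \<Rightarrow> 'a set \<times> 'a set \<Rightarrow> ('a set \<times> 'a set) set" where
  "coset k p = (\<lambda>n. n \<oplus>\<^bsub>M\<^esub> p) ` Nker k"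

lemma coset_mem: "(cs l1 x', cs l2 y') \<in> coset k (cs l1 x, cs l2 y) \<longleftrightarrow> x' - x \<in> J l1 \<and> (\<exists>j\<in>J k. y' - (j + y) \<in> J l2)"
proof -
  have "coset k (cs l1 x, cs l2 y) = (\<lambda>j. (cs l1 x, cs l2 (j + y))) ` J k"
    unfolding coset_def by (auto simp: M_add image_iff)
  then show ?thesis by (auto simp: fl.cs_eq image_iff)
qed

lemma coset_sub: "p \<in> carrier M \<Longrightarrow> coset k p \<subseteq> carrier M"
  using Nker_submod M_closed(1) unfolding coset_def submod_def by blast

lemma coset_explicit: "coset k (cs l1 x, cs l2 y) = (\<lambda>j. (cs l1 x, cs l2 (j + y))) ` J k"
  unfolding coset_def by (auto simp: M_add image_iff)

lemma coset_add: "p \<in> carrier M \<Longrightarrow> p' \<in> carrier M \<Longrightarrow> coset k p <+>\<^bsub>M\<^esub> coset k p' = coset k (p \<oplus>\<^bsub>M\<^esub> p')"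
proof (elim M_cases)
  fix x y x' y' assume e: "p = (cs l1 x, cs l2 y)" "p' = (cs l1 x', cs l2 y')"
  show "coset k p <+>\<^bsub>M\<^esub> coset k p' = coset k (p \<oplus>\<^bsub>M\<^esub> p')"
  proof
    show "coset k p <+>\<^bsub>M\<^esub> coset k p' \<subseteq> coset k (p \<oplus>\<^bsub>M\<^esub> p')"
    proof
      fix v assume "v \<in> coset k p <+>\<^bsub>M\<^esub> coset k p'"
      then obtain j j' where j: "j \<in> J k" "j' \<in> J k" "v = (cs l1 x, cs l2 (j + y)) \<oplus>\<^bsub>M\<^esub> (cs l1 x', cs l2 (j' + y'))"
        unfolding e coset_explicit set_add_def' by auto
      then have "v = (cs l1 (x + x'), cs l2 ((j + j') + (y + y')))" by (simp add: M_add algebra_simps)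
      then show "v \<in> coset k (p \<oplus>\<^bsub>M\<^esub> p')" unfolding e M_add coset_explicit using fl.J_add[OF j(1,2)] by blast
    qed
    show "coset k (p \<oplus>\<^bsub>M\<^esub> p') \<subseteq> coset k p <+>\<^bsub>M\<^esub> coset k p'"
    proof
      fix v assume "v \<in> coset k (p \<oplus>\<^bsub>M\<^esub> p')"
      then obtain j where j: "j \<in> J k" "v = (cs l1 (x + x'), cs l2 (j + (y + y')))" unfolding e M_add coset_explicit by auto
      then have "v = (cs l1 x, cs l2 (j + y)) \<oplus>\<^bsub>M\<^esub> (cs l1 x', cs l2 (0 + y'))" by (simp add: M_add algebra_simps)
      then show "v \<in> coset k p <+>\<^bsub>M\<^esub> coset k p'" unfolding e coset_explicit set_add_def' using j(1) fl.J_zero by blast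
    qed
  qed
qed

lemma coset_smult: "r \<in> carrier R \<Longrightarrow> p \<in> carrier M \<Longrightarrow>
    Nker k <+>\<^bsub>M\<^esub> ((\<lambda>x. r \<odot>\<^bsub>M\<^esub> x) ` coset k p) = coset k (r \<odot>\<^bsub>M\<^esub> p)"
proof (elim M_cases)
  fix x y assume r: "r \<in> carrier R" and e: "p = (cs l1 x, cs l2 y)"
  obtain r' where r': "r = ev R r'" using ev_surj[OF r] by blast
  show ?thesis
  proof
    show "Nker k <+>\<^bsub>M\<^esub> ((\<lambda>x. r \<odot>\<^bsub>M\<^esub> x) ` coset k p) \<subseteq> coset k (r \<odot>\<^bsub>M\<^esub> p)"
    proof
      fix v assume "v \<in> Nker k <+>\<^bsub>M\<^esub> ((\<lambda>x. r \<odot>\<^bsub>M\<^esub> x) ` coset k p)"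
      then obtain i j where j: "i \<in> J k" "j \<in> J k" "v = (cs l1 0, cs l2 i) \<oplus>\<^bsub>M\<^esub> (r \<odot>\<^bsub>M\<^esub> (cs l1 x, cs l2 (j + y)))"
        unfolding e coset_explicit set_add_def' by auto
      then have "v = (cs l1 (r' * x), cs l2 ((i + r' * j) + r' * y))" by (simp add: r' M_add M_smult algebra_simps)
      then show "v \<in> coset k (r \<odot>\<^bsub>M\<^esub> p)" unfolding e r' M_smult coset_explicit using fl.J_add[OF j(1) fl.J_mult[OF j(2)]] by blast
    qed
    show "coset k (r \<odot>\<^bsub>M\<^esub> p) \<subseteq> Nker k <+>\<^bsub>M\<^esub> ((\<lambda>x. r \<odot>\<^bsub>M\<^esub> x) ` coset k p)"
    proof
      fix v assume "v \<in> coset k (r \<odot>\<^bsub>M\<^esub> p)"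
      then obtain j where j: "j \<in> J k" "v = (cs l1 (r' * x), cs l2 (j + r' * y))" unfolding e r' M_smult coset_explicit by auto
      then have v: "v = (cs l1 0, cs l2 j) \<oplus>\<^bsub>M\<^esub> (r \<odot>\<^bsub>M\<^esub> (cs l1 x, cs l2 (0 + y)))" by (simp add: r' M_add M_smult)
      have "(cs l1 x, cs l2 (0 + y)) \<in> coset k p" unfolding e coset_explicit using fl.J_zero by blast
      then show "v \<in> Nker k <+>\<^bsub>M\<^esub> ((\<lambda>x. r \<odot>\<^bsub>M\<^esub> x) ` coset k p)" unfolding set_add_def' using v j(1) by blast
    qed
  qed
qed

lemma quot_carrier: "carrier (quot_module M (Nker k)) = coset k ` carrier M"
  unfolding quot_module_def by (auto simp: ring.defs FactRing_def A_RCOSETS_def' a_r_coset_def' coset_def)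

lemma quot_add: "C \<oplus>\<^bsub>quot_module M N\<^esub> D = C <+>\<^bsub>M\<^esub> D"
  unfolding quot_module_def by (simp add: ring.defs FactRing_def)

lemma quot_smult: "r \<odot>\<^bsub>quot_module M N\<^esub> C = N <+>\<^bsub>M\<^esub> ((\<lambda>x. r \<odot>\<^bsub>M\<^esub> x) ` C)"
  unfolding quot_module_def by (simp add: ring.defs)

lemma quot_group: "group (quot_group (Nker k))" "finite (carrier (quot_group (Nker k)))"
proof -
  show "group (quot_group (Nker k))"
    by (rule mod_aut_group) (auto simp: quot_carrier quot_add quot_smult coset_add coset_smult M_closed)
  show "finite (carrier (quot_group (Nker k)))"
    by (rule mod_aut_finite) (simp add: quot_carrier finite_M)
qed

definition qact :: "nat \<Rightarrow> 'a lam_aut \<Rightarrow> ('a set \<times> 'a set) set \<Rightarrow> ('a set \<times> 'a set) set" where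
  "qact k g = (\<lambda>C\<in>carrier (quot_module M (Nker k)). g ` C)"

lemma image_coset: assumes g: "g \<in> stab (Nker k)" and p: "p \<in> carrier M"
  shows "g ` coset k p = coset k (g p)"
proof -
  have gc: "g \<in> carrier G" "g ` Nker k = Nker k" using g unfolding stabilizer_def by auto
  have NM: "n \<in> carrier M" if "n \<in> Nker k" for n using Nker_submod that unfolding submod_def by blast
  have "g ` coset k p = (\<lambda>n. g n \<oplus>\<^bsub>M\<^esub> g p) ` Nker k"
    unfolding coset_def image_image by (rule image_cong) (use G_maps(3)[OF gc(1) NM p] in auto)
  also have "\<dots> = (\<lambda>n. n \<oplus>\<^bsub>M\<^esub> g p) ` (g ` Nker k)" by (simp only: image_image)
  finally show ?thesis unfolding gc(2) coset_def .
qed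

lemma quot_hom:
  "g \<in> stab (Nker k) \<Longrightarrow> qact k g \<in> carrier (quot_group (Nker k))"
  "g \<in> stab (Nker k) \<Longrightarrow> h \<in> stab (Nker k) \<Longrightarrow> qact k (g \<otimes>\<^bsub>G\<^esub> h) = qact k g \<otimes>\<^bsub>quot_group (Nker k)\<^esub> qact k h"
proof -
  let ?Q = "quot_module M (Nker k)"
  { fix g assume g: "g \<in> stab (Nker k)"
    then have gc: "g \<in> carrier G" unfolding stabilizer_def by auto
    have act: "qact k g (coset k p) = coset k (g p)" if "p \<in> carrier M" for p
      unfolding qact_def quot_carrier using that image_coset[OF g that] by simp
    show "qact k g \<in> carrier (quot_group (Nker k))"
      unfolding mod_aut_iff
    proof (intro conjI ballI)
      show "qact k g \<in> extensional (carrier ?Q)" unfolding qact_def by simp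
      have "inj_on g (carrier M)" using G_maps(1)[OF gc] unfolding bij_betw_def by blast
      then have inj: "inj_on (qact k g) (carrier ?Q)"
      proof (intro inj_onI)
        fix C D assume ginj: "inj_on g (carrier M)" and CD: "C \<in> carrier ?Q" "D \<in> carrier ?Q" "qact k g C = qact k g D"
        have "C \<subseteq> carrier M" "D \<subseteq> carrier M" using CD coset_sub unfolding quot_carrier by blast+
        moreover have "g ` C = g ` D" using CD unfolding qact_def by simp
        ultimately show "C = D" using inj_on_image_eq_iff[OF ginj] by blast
      qed
      have "qact k g ` carrier ?Q = coset k ` (g ` carrier M)"
        unfolding quot_carrier image_image by (rule image_cong) (use act in auto)
      also have "g ` carrier M = carrier M" using G_maps(1)[OF gc] unfolding bij_betw_def by blast
      finally show "bij_betw (qact k g) (carrier ?Q) (carrier ?Q)" using inj unfolding bij_betw_def quot_carrier by simp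
      fix C D assume "C \<in> carrier ?Q" "D \<in> carrier ?Q"
      then obtain p p' where "C = coset k p" "D = coset k p'" "p \<in> carrier M" "p' \<in> carrier M" unfolding quot_carrier by blast
      then show "qact k g (C \<oplus>\<^bsub>?Q\<^esub> D) = qact k g C \<oplus>\<^bsub>?Q\<^esub> qact k g D"
        by (simp add: quot_add coset_add act M_closed G_maps(2,3)[OF gc])
    next
      fix r C assume "r \<in> carrier R" "C \<in> carrier ?Q"
      then obtain p where "r \<in> carrier R" "C = coset k p" "p \<in> carrier M" unfolding quot_carrier by blast
      then show "qact k g (r \<odot>\<^bsub>?Q\<^esub> C) = r \<odot>\<^bsub>?Q\<^esub> qact k g C"
        by (simp add: quot_smult coset_smult act M_closed G_maps(2,4)[OF gc])
    qed }
  note c = this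
  assume gh: "g \<in> stab (Nker k)" "h \<in> stab (Nker k)"
  then have g: "g \<in> carrier G" "h \<in> carrier G" unfolding stabilizer_def by auto
  have "qact k (g \<otimes>\<^bsub>G\<^esub> h) = compose (carrier ?Q) (qact k g) (qact k h)"
  proof
    fix C
    show "qact k (g \<otimes>\<^bsub>G\<^esub> h) C = compose (carrier ?Q) (qact k g) (qact k h) C"
    proof (cases "C \<in> carrier ?Q")
      case True
      then obtain p where p: "C = coset k p" "p \<in> carrier M" unfolding quot_carrier by blast
      have "(g \<otimes>\<^bsub>G\<^esub> h) ` C = g ` (h ` C)"
        unfolding image_image by (rule image_cong) (use G_mult[OF g] coset_sub[OF p(2)] p(1) in auto)
      moreover have "h ` C \<in> carrier ?Q" unfolding p(1) image_coset[OF gh(2) p(2)] quot_carrier using G_maps(2)[OF g(2) p(2)] by blast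
      ultimately show ?thesis using True unfolding qact_def compose_def by simp
    next
      case False
      then show ?thesis unfolding qact_def compose_def by simp
    qed
  qed
  then show "qact k (g \<otimes>\<^bsub>G\<^esub> h) = qact k g \<otimes>\<^bsub>quot_group (Nker k)\<^esub> qact k h"
    using mod_aut_mult[OF c[OF gh(1)] c[OF gh(2)]] by simp
qed

lemma ker_mu_eq: "ker_mu R P l1 l2 k = Nker k"
  unfolding ker_mu_def quo_zero quo_ideal_eq ..

abbreviation "Nsub k \<equiv> range (cs l1) \<times> cs l2 ` J k"

lemma sub_mu_eq: "sub_mu R P l1 l2 k = Nsub (l2 - k)"
  unfolding sub_mu_def range_cs quo_ideal_eq ..

lemma Nsub_submod: "submod (Nsub k)"
  using submod_product[of 0 k] by simp

lemma piM_submod: "submod ((\<lambda>x. \<pi> \<odot>\<^bsub>M\<^esub> x) ` carrier M)"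
proof -
  have pm: "\<pi> \<odot>\<^bsub>M\<^esub> (cs l1 x, cs l2 y) = (cs l1 (t * x), cs l2 (t * y))" for x y
    using M_smult[of t x y] by (simp only: ev_t)
  have e: "(\<lambda>x. \<pi> \<odot>\<^bsub>M\<^esub> x) ` carrier M = cs l1 ` J 1 \<times> cs l2 ` J 1"
  proof
    show "(\<lambda>x. \<pi> \<odot>\<^bsub>M\<^esub> x) ` carrier M \<subseteq> cs l1 ` J 1 \<times> cs l2 ` J 1"
      using fl.J_mult'[OF fl.t_in] by (auto elim!: M_cases simp: pm)
    show "cs l1 ` J 1 \<times> cs l2 ` J 1 \<subseteq> (\<lambda>x. \<pi> \<odot>\<^bsub>M\<^esub> x) ` carrier M"
    proof clarify
      fix x y assume xy: "x \<in> J 1" "y \<in> J 1"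
      obtain x' where x': "\<forall>n. x - t * x' \<in> J n" using fl.J_dec[OF xy(1)] by blast
      obtain y' where y': "\<forall>n. y - t * y' \<in> J n" using fl.J_dec[OF xy(2)] by blast
      have "(cs l1 x, cs l2 y) = \<pi> \<odot>\<^bsub>M\<^esub> (cs l1 x', cs l2 y')"
        unfolding pm using x' y' by (simp add: fl.cs_eq)
      then show "(cs l1 x, cs l2 y) \<in> (\<lambda>x. \<pi> \<odot>\<^bsub>M\<^esub> x) ` carrier M" using cs_in_M by blast
    qed
  qed
  show ?thesis unfolding e by (rule submod_product)
qed

lemma cs_t: "cs l1 (x + t ^ (l2 - 1) * b * t ^ (l1 - l2) * (t * y)) = cs l1 x" "cs l2 (t ^ (l2 - 1) * c * (t * x) + y) = cs l2 y"
proof -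
  have "t ^ (l2 - 1) * t ^ (l1 - l2) * t = t ^ (l2 - 1 + (l1 - l2) + 1)" "t ^ (l2 - 1) * t = t ^ (l2 - 1 + 1)"
    by (simp_all only: power_add power_one_right)
  moreover have "l2 - 1 + (l1 - l2) + 1 = l1" "l2 - 1 + 1 = l2" using lam by auto
  ultimately have e: "t ^ (l2 - 1) * t ^ (l1 - l2) * t = t ^ l1" "t ^ (l2 - 1) * t = t ^ l2" by simp_all
  have "t ^ (l2 - 1) * b * t ^ (l1 - l2) * (t * y) = t ^ (l2 - 1) * t ^ (l1 - l2) * t * (b * y)" by (simp only: mult_ac)
  then show "cs l1 (x + t ^ (l2 - 1) * b * t ^ (l1 - l2) * (t * y)) = cs l1 x" unfolding fl.cs_eq e using fl.tpow_in[of l1 l1] by simp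
  have "t ^ (l2 - 1) * c * (t * x) = t ^ (l2 - 1) * t * (c * x)" by (simp only: mult_ac)
  then show "cs l2 (t ^ (l2 - 1) * c * (t * x) + y) = cs l2 y" unfolding fl.cs_eq e using fl.tpow_in[of l2 l2] by simp
qed

text \<open>The factor \<open>t\<close> of the second coordinate completes
  \<open>t ^ (l2 - 1)\<close> times \<delta> to \<open>t ^ l1\<close>, which vanishes in the first
  coordinate.\<close>

lemma U12_fixes: "mk 1 (t ^ (l2 - 1) * b) 0 1 (cs l1 x, cs l2 (t * y)) = (cs l1 x, cs l2 (t * y))"
  unfolding mk_apply using cs_t(1) by simp

lemma U21_fixes: "mk 1 0 (t ^ (l2 - 1) * c) 1 (cs l1 (t * x), cs l2 y) = (cs l1 (t * x), cs l2 y)"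
  unfolding mk_apply using cs_t(2) by simp

lemma U12_fixes_Nsub: assumes "0 < k" "p \<in> Nsub k" shows "mk 1 (t ^ (l2 - 1) * b) 0 1 p = p"
proof -
  obtain x y where xy: "p = (cs l1 x, cs l2 y)" "y \<in> J k" using assms by auto
  then have "y \<in> J 1" using fl.J_mono[of 1 k] assms by simp
  then obtain y' where "\<forall>n. y - t * y' \<in> J n" using fl.J_dec by blast
  then have "p = (cs l1 x, cs l2 (t * y'))" unfolding xy by (simp add: fl.cs_eq)
  then show ?thesis using U12_fixes by simp
qed

lemma U21_fixes_Nker: "p \<in> Nker k \<Longrightarrow> mk 1 0 (t ^ (l2 - 1) * c) 1 p = p"
  using U21_fixes[of c 0] by auto

text \<open>The second coordinate changes by a multiple of \<open>t ^ (l2 - 1)\<close>, which lies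
  in \<open>J k\<close> and so is absorbed by the kernel.\<close>

lemma U21_fixes_cosets: assumes k: "k \<le> l2 - 1" and C: "C \<in> carrier (quot_module M (Nker k))"
  shows "mk 1 0 (t ^ (l2 - 1) * c) 1 ` C = C"
proof -
  let ?h = "mk 1 0 (t ^ (l2 - 1) * c) 1"
  have hG: "?h \<in> carrier G" using mk_closed fl.one_notin by blast
  have "?h ` Nker k = Nker k"
  proof -
    have "?h ` Nker k = (\<lambda>p. p) ` Nker k" by (rule image_cong[OF refl]) (rule U21_fixes_Nker)
    then show ?thesis by simp
  qed
  then have st: "?h \<in> stab (Nker k)" unfolding stabilizer_def using hG by simp
  obtain p where p: "C = coset k p" "p \<in> carrier M" using C unfolding quot_carrier by blast
  obtain x y where xy: "p = (cs l1 x, cs l2 y)" using M_cases[OF p(2)] by blast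
  have "?h ` C = coset k (?h p)" unfolding p(1) by (rule image_coset[OF st p(2)])
  also have "?h p = (cs l1 x, cs l2 (t ^ (l2 - 1) * c * x + y))" unfolding xy mk_apply by simp
  also have "coset k \<dots> = coset k p"
  proof -
    have j: "t ^ (l2 - 1) * c * x \<in> J k" using fl.tpow_in[OF k, of "c * x"] by (simp add: mult.assoc)
    let ?z = "t ^ (l2 - 1) * c * x"
    show ?thesis unfolding xy coset_explicit
    proof
      show "(\<lambda>j. (cs l1 x, cs l2 (j + (?z + y)))) ` J k \<subseteq> (\<lambda>j. (cs l1 x, cs l2 (j + y))) ` J k"
      proof clarify
        fix i assume i: "i \<in> J k"
        have "(cs l1 x, cs l2 (i + (?z + y))) = (cs l1 x, cs l2 ((i + ?z) + y))" by (simp add: add.assoc)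
        then show "(cs l1 x, cs l2 (i + (?z + y))) \<in> (\<lambda>j. (cs l1 x, cs l2 (j + y))) ` J k" using fl.J_add[OF i j] by blast
      qed
      show "(\<lambda>j. (cs l1 x, cs l2 (j + y))) ` J k \<subseteq> (\<lambda>j. (cs l1 x, cs l2 (j + (?z + y)))) ` J k"
      proof clarify
        fix i assume i: "i \<in> J k"
        have "(cs l1 x, cs l2 (i + y)) = (cs l1 x, cs l2 ((i - ?z) + (?z + y)))" by (simp add: algebra_simps)
        then show "(cs l1 x, cs l2 (i + y)) \<in> (\<lambda>j. (cs l1 x, cs l2 (j + (?z + y)))) ` J k" using fl.J_diff[OF i j] by blast
      qed
    qed
  qed
  finally show ?thesis unfolding p(1) .
qed

subsection \<open>Representations containing fixed vectors are not cuspidal\<close>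

text \<open>An element of \<open>Pplus\<close> with trivial diagonal is upper unitriangular, so
  \<open>v\<close> is fixed by the kernel of the map to \<open>Levi\<close> and reciprocity
  applies.\<close>

lemma geom_if_fixed:
  assumes irr: "irreducible_rep G \<rho>" and v: "v \<in> carrier_vec (fst \<rho>)" "v \<noteq> 0\<^sub>v (fst \<rho>)"
    and fixed: "\<And>b. snd \<rho> (mk 1 b 0 1) *\<^sub>v v = v"
  shows "\<exists>\<tau>. geom_induced R P l1 l2 \<tau> \<and> rep_contained G \<rho> \<tau>"
proof -
  have "\<exists>\<sigma>. is_rep Levi \<sigma> \<and> rep_contained G \<rho> (ind_rep G Pplus (pullback ent_diag \<sigma>))"
  proof (rule G.fixed_vector_contained[OF irr Pplus_subgroup group_Levi finite_Levi Pplus_hom v])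
    fix g assume g: "g \<in> Pplus" and one: "ent_diag g = \<one>\<^bsub>Levi\<^esub>"
    then have "g \<in> carrier G" unfolding Pplus_def by auto
    then obtain a b c d where m: "a \<notin> J 1" "d \<notin> J 1" "g = mk a b c d" using mk_exh by blast
    have "a - 1 \<in> J l1" "d - 1 \<in> J l2" "c \<in> J l2"
      using one g unfolding Levi_one m ent_mk Pplus_iff by (auto simp: fl.cs_eq)
    then have "g = mk 1 b 0 1" unfolding m mk_eq by simp
    then show "snd \<rho> g *\<^sub>v v = v" using fixed by simp
  qed
  then obtain \<sigma> where s: "is_rep Levi \<sigma>" "rep_contained G \<rho> (ind_rep G Pplus (pullback ent_diag \<sigma>))" by blast
  have "geom_induced R P l1 l2 (ind_rep G Pplus (pullback ent_diag \<sigma>))"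
    unfolding geom_induced_def using s(1) by (intro exI[of _ \<sigma>] conjI bexI[of _ Pplus]) (auto simp: Pplus_def)
  then show ?thesis using s(2) by blast
qed

text \<open>Uses \<mu> = (l1, l2 - 1): an element restricting to the identity on the submodule is
  trivial in the first column and differs from 1 in the second only in the last layer, hence is of
  the form in \<open>fixed\<close>.\<close>

lemma inf_if_fixed_12:
  assumes irr: "irreducible_rep G \<rho>" and v: "v \<in> carrier_vec (fst \<rho>)" "v \<noteq> 0\<^sub>v (fst \<rho>)"
    and fixed: "\<And>b z. snd \<rho> (mk 1 (t ^ (l2 - 1) * b) 0 (1 + t ^ (l2 - 1) * z)) *\<^sub>v v = v"
  shows "\<exists>\<tau>. inf_induced R P l1 l2 \<tau> \<and> rep_contained G \<rho> \<tau>"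
proof -
  let ?N = "sub_mu R P l1 l2 (l2 - 1)"
  have N: "?N = Nsub 1" unfolding sub_mu_eq using lam by simp
  have sm: "submod ?N" unfolding N by (rule Nsub_submod)
  have "\<exists>\<sigma>. is_rep (sub_group ?N) \<sigma> \<and> rep_contained G \<rho> (ind_rep G (stab ?N) (pullback (\<lambda>g. restrict g ?N) \<sigma>))"
  proof (rule G.fixed_vector_contained[OF irr stab_subgroup[OF sm] sub_group[OF sm] sub_hom[OF sm] v])
    fix g assume g: "g \<in> stab ?N" and one: "restrict g ?N = \<one>\<^bsub>sub_group ?N\<^esub>"
    then have "g \<in> carrier G" unfolding stabilizer_def by auto
    then obtain a b c d where m: "a \<notin> J 1" "d \<notin> J 1" "g = mk a b c d" using mk_exh by blast
    have id: "g p = p" if "p \<in> ?N" for p using fun_cong[OF one, of p] that unfolding sub_group_one by simp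
    have "t \<in> J 1" by (rule fl.t_in)
    then have "(cs l1 1, cs l2 0) \<in> ?N" "(cs l1 0, cs l2 t) \<in> ?N" unfolding N using fl.J_zero by blast+
    from id[OF this(1)] id[OF this(2)]
    have j: "a - 1 \<in> J l1" "c \<in> J l2" "b * t ^ (l1 - l2) * t \<in> J l1" "d * t - t \<in> J l2"
      unfolding m mk_apply by (simp_all add: fl.cs_eq)
    have "t ^ (l1 - l2) * (t * b) \<in> J l1" using j(3) by (simp add: mult_ac)
    then have "t ^ 1 * b \<in> J l2" unfolding tpow_l1_iff by simp
    then have "b \<in> J (l2 - 1)" using fl.J_tpow'[of 1 l2 b] lam by simp
    then obtain b' where b: "\<forall>n. b - t ^ (l2 - 1) * b' \<in> J n" using fl.J_decpow by blast
    have "t ^ 1 * (d - 1) \<in> J l2" using j(4) by (simp add: algebra_simps)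
    then have "d - 1 \<in> J (l2 - 1)" using fl.J_tpow'[of 1 l2 "d - 1"] lam by simp
    then obtain z where z: "\<forall>n. (d - 1) - t ^ (l2 - 1) * z \<in> J n" using fl.J_decpow by blast
    have "g = mk 1 (t ^ (l2 - 1) * b') 0 (1 + t ^ (l2 - 1) * z)"
      unfolding m mk_eq using j b z by (simp add: algebra_simps)
    then show "snd \<rho> g *\<^sub>v v = v" using fixed by simp
  qed
  then obtain \<sigma> where s: "is_rep (sub_group ?N) \<sigma>" "rep_contained G \<rho> (ind_rep G (stab ?N) (pullback (\<lambda>g. restrict g ?N) \<sigma>))" by blast
  have "inf_induced R P l1 l2 (ind_rep G (stab ?N) (pullback (\<lambda>g. restrict g ?N) \<sigma>))"
    unfolding inf_induced_def Let_def
  proof (intro exI[of _ "l2 - 1"] conjI disjI1 exI[of _ \<sigma>])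
    show "0 < l2 - 1" "l2 - 1 < l2" using lam by auto
  qed (rule s(1), rule refl)
  then show ?thesis using s(2) by blast
qed

text \<open>The quotient counterpart of \<open>inf_if_fixed_12\<close>: an element acting trivially
  modulo the last layer of the second summand is trivial in the first row and differs from 1 in the
  second only in that layer.\<close>

lemma inf_if_fixed_21:
  assumes irr: "irreducible_rep G \<rho>" and v: "v \<in> carrier_vec (fst \<rho>)" "v \<noteq> 0\<^sub>v (fst \<rho>)"
    and fixed: "\<And>c z. snd \<rho> (mk 1 0 (t ^ (l2 - 1) * c) (1 + t ^ (l2 - 1) * z)) *\<^sub>v v = v"
  shows "\<exists>\<tau>. inf_induced R P l1 l2 \<tau> \<and> rep_contained G \<rho> \<tau>"
proof -
  let ?k = "l2 - 1"
  let ?N = "Nker ?k"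
  have "\<exists>\<sigma>. is_rep (quot_group ?N) \<sigma> \<and> rep_contained G \<rho> (ind_rep G (stab ?N) (pullback (qact ?k) \<sigma>))"
  proof (rule G.fixed_vector_contained[OF irr stab_subgroup[OF Nker_submod] quot_group quot_hom v])
    fix g assume g: "g \<in> stab ?N" and one: "qact ?k g = \<one>\<^bsub>quot_group ?N\<^esub>"
    then have "g \<in> carrier G" unfolding stabilizer_def by auto
    then obtain a b c d where m: "a \<notin> J 1" "d \<notin> J 1" "g = mk a b c d" using mk_exh by blast
    have id: "g p \<in> coset ?k p" if p: "p \<in> carrier M" for p
    proof -
      have C: "coset ?k p \<in> carrier (quot_module M ?N)" unfolding quot_carrier using p by blast
      have "g ` coset ?k p = coset ?k p"
        using fun_cong[OF one, of "coset ?k p"] C unfolding mod_aut_one qact_def by simp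
      moreover obtain x y where "p = (cs l1 x, cs l2 y)" using M_cases[OF p] by blast
      then have "p \<in> coset ?k p" using fl.J_zero by (auto simp: coset_mem intro: bexI[of _ 0])
      ultimately show ?thesis by blast
    qed
    obtain j1 where 1: "a - 1 \<in> J l1" "j1 \<in> J ?k" "c - j1 \<in> J l2"
      using id[OF cs_in_M, of 1 0] unfolding m mk_apply by (auto simp: coset_mem)
    obtain j2 where 2: "b * t ^ (l1 - l2) \<in> J l1" "j2 \<in> J ?k" "d - (j2 + 1) \<in> J l2"
      using id[OF cs_in_M, of 0 1] unfolding m mk_apply by (auto simp: coset_mem)
    have b: "b \<in> J l2" using 2(1) tpow_l1_iff[of b] by (simp add: mult.commute)
    obtain c' where c: "\<forall>n. j1 - t ^ ?k * c' \<in> J n" using fl.J_decpow[OF 1(2)] by blast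
    obtain z where z: "\<forall>n. j2 - t ^ ?k * z \<in> J n" using fl.J_decpow[OF 2(2)] by blast
    have "g = mk 1 0 (t ^ ?k * c') (1 + t ^ ?k * z)"
      unfolding m mk_eq using 1 b fl.J_add[OF 1(3) c[rule_format]] fl.J_add[OF 2(3) z[rule_format]] by (simp add: algebra_simps)
    then show "snd \<rho> g *\<^sub>v v = v" using fixed by simp
  qed
  then obtain \<sigma> where s: "is_rep (quot_group ?N) \<sigma>" "rep_contained G \<rho> (ind_rep G (stab ?N) (pullback (qact ?k) \<sigma>))" by blast
  have "inf_induced R P l1 l2 (ind_rep G (stab ?N) (pullback (qact ?k) \<sigma>))"
    unfolding inf_induced_def Let_def
  proof (intro exI[of _ "l2 - 1"] conjI disjI2 exI[of _ \<sigma>])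
    show "0 < l2 - 1" "l2 - 1 < l2" using lam by auto
    show "is_rep (quot_group (ker_mu R P l1 l2 ?k)) \<sigma>" unfolding ker_mu_eq by (rule s(1))
    show "ind_rep G (stab ?N) (pullback (qact ?k) \<sigma>) = ind_rep G (stab (ker_mu R P l1 l2 ?k))
        (pullback (\<lambda>g. \<lambda>C\<in>carrier (quot_module M (ker_mu R P l1 l2 ?k)). g ` C) \<sigma>)"
      unfolding ker_mu_eq qact_def ..
  qed
  then show ?thesis using s(2) by blast
qed

end

section \<open>The cuspidal representations\<close>

context dvr_char
begin

abbreviation "m \<equiv> l - \<epsilon>"
abbreviation "KG \<equiv> K_group R P \<pi> l1 l2 l \<epsilon>"
abbreviation "eta' uh wh \<equiv> eta R P \<pi> l1 l2 l \<epsilon> \<psi> uh wh"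
abbreviation "rho \<theta> u0 w0 \<equiv> rho_ext R P \<pi> l1 l2 l \<epsilon> \<psi> (cs l u0) (cs m w0) \<theta>"

lemma dims2: "l + (l1 - l) = l1" "m + (l2 - l + \<epsilon>) = l2" "l2 - l + \<epsilon> = l" "l1 - l = m + (l1 - l2)" "m + \<epsilon> = l"
  using l_dims l2_eq lam by auto

lemma K_coords_iff:
  "K_coords R P \<pi> l1 l2 l \<epsilon> (mk a b c d) (cs l u) (cs l v) (cs m w) (cs m z) \<longleftrightarrow> mk a b c d = gr.km u v w z"
proof -
  have "b * t ^ (l1 - l2) - t ^ (l1 - l) * v = t ^ (l1 - l2) * (b - t ^ m * v)"
    unfolding dims2(4) power_add by (simp add: algebra_simps)
  then have "cs l1 (b * t ^ (l1 - l2)) = cs l1 (t ^ (l1 - l) * v) \<longleftrightarrow> b - t ^ m * v \<in> J l2"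
    unfolding fl.cs_eq by (simp only: tpow_l1_iff)
  then show ?thesis
    unfolding K_coords_def ent_mk pimul_cs dims2(1,2,3) quo_one quo_add gr.km_def mk_eq
    using dims2(2)[unfolded dims2(3)] by (simp add: cs_in quo_add fl.cs_eq dims2(4))
qed

lemma K_group_eq: "KG = gr.Kg"
proof
  show "KG \<subseteq> gr.Kg"
  proof
    fix g assume "g \<in> KG"
    then obtain U V W Z where g: "g \<in> carrier G" and k: "K_coords R P \<pi> l1 l2 l \<epsilon> g U V W Z" unfolding K_group_def by blast
    then obtain u v w z where c: "U = cs l u" "V = cs l v" "W = cs m w" "Z = cs m z"
      unfolding K_coords_def range_cs[symmetric] by blast
    obtain a b c' d where "g = mk a b c' d" using mk_exh[OF g] by blast
    then have "g = gr.km u v w z" using k unfolding c using K_coords_iff by blast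
    then show "g \<in> gr.Kg" using gr.km_in by simp
  qed
  show "gr.Kg \<subseteq> KG"
  proof
    fix g assume "g \<in> gr.Kg"
    then obtain u v w z where g: "g = gr.km u v w z" by (rule gr.Kg_E)
    have "K_coords R P \<pi> l1 l2 l \<epsilon> g (cs l u) (cs l v) (cs m w) (cs m z)"
      using K_coords_iff g unfolding gr.km_def by blast
    then show "g \<in> KG" unfolding K_group_def using g gr.km_closed by blast
  qed
qed

lemma eta_value: "eta' (cs l u0) (cs m w0) (gr.km u v w z) = \<psi> (cs l (u0 * u + v + t ^ \<epsilon> * (w0 * w)))"
proof -
  let ?f = "\<lambda>U V W. \<psi> (cs l u0 \<otimes>\<^bsub>quo R P l\<^esub> U \<oplus>\<^bsub>quo R P l\<^esub> V \<oplus>\<^bsub>quo R P l\<^esub> pimul R \<pi> \<epsilon> (cs m w0 \<otimes>\<^bsub>quo R P m\<^esub> W))"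
  have f: "?f (cs l u) (cs l v) (cs m w) = \<psi> (cs l (u0 * u + v + t ^ \<epsilon> * (w0 * w)))" for u v w
    by (simp add: quo_mult pimul_cs dims2(5) quo_add)
  have k: "K_coords R P \<pi> l1 l2 l \<epsilon> (gr.km u v w z) U V W Z \<longleftrightarrow> U = cs l u \<and> V = cs l v \<and> W = cs m w \<and> Z = cs m z" for U V W Z
  proof
    assume K: "K_coords R P \<pi> l1 l2 l \<epsilon> (gr.km u v w z) U V W Z"
    then obtain u' v' w' z' where c: "U = cs l u'" "V = cs l v'" "W = cs m w'" "Z = cs m z'"
      unfolding K_coords_def range_cs[symmetric] by blast
    have "gr.km u v w z = gr.km u' v' w' z'" using K unfolding c gr.km_def K_coords_iff by (simp only: gr.km_def)
    then show "U = cs l u \<and> V = cs l v \<and> W = cs m w \<and> Z = cs m z"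
      unfolding gr.km_eq c using fl.J_minus_commute by (simp add: fl.cs_eq)
  next
    assume "U = cs l u \<and> V = cs l v \<and> W = cs m w \<and> Z = cs m z"
    then show "K_coords R P \<pi> l1 l2 l \<epsilon> (gr.km u v w z) U V W Z" unfolding gr.km_def using K_coords_iff gr.km_def by simp
  qed
  have "(THE y. \<exists>U V W Z. K_coords R P \<pi> l1 l2 l \<epsilon> (gr.km u v w z) U V W Z \<and> y = ?f U V W) = ?f (cs l u) (cs l v) (cs m w)"
    unfolding k by (rule the_equality) auto
  then show ?thesis unfolding eta_def K_group_eq using gr.km_in f by simp
qed

lemma eta_Kchar: "gr.eta_on u0 w0 (eta' (cs l u0) (cs m w0))"
  unfolding gr.Kchar_def eta_value by simp

lemma N_stab_eq: "N_stab R P \<pi> l1 l2 l \<epsilon> \<psi> (cs l u0) (cs m w0) = gr.Nset u0 w0"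
proof -
  let ?e = "eta' (cs l u0) (cs m w0)"
  have "char_conj G gr.Kg g ?e = ?e \<longleftrightarrow> (\<forall>k\<in>gr.Kg. ?e (inv\<^bsub>G\<^esub> g \<otimes>\<^bsub>G\<^esub> k \<otimes>\<^bsub>G\<^esub> g) = ?e k)" for g
  proof
    show "\<forall>k\<in>gr.Kg. ?e (inv\<^bsub>G\<^esub> g \<otimes>\<^bsub>G\<^esub> k \<otimes>\<^bsub>G\<^esub> g) = ?e k" if h: "char_conj G gr.Kg g ?e = ?e"
    proof
      fix k assume "k \<in> gr.Kg"
      then show "?e (inv\<^bsub>G\<^esub> g \<otimes>\<^bsub>G\<^esub> k \<otimes>\<^bsub>G\<^esub> g) = ?e k" using fun_cong[OF h, of k] unfolding char_conj_def by simp
    qed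
    assume h: "\<forall>k\<in>gr.Kg. ?e (inv\<^bsub>G\<^esub> g \<otimes>\<^bsub>G\<^esub> k \<otimes>\<^bsub>G\<^esub> g) = ?e k"
    show "char_conj G gr.Kg g ?e = ?e"
    proof
      fix k show "char_conj G gr.Kg g ?e k = ?e k"
        by (cases "k \<in> gr.Kg") (use h in \<open>auto simp: char_conj_def eta_def K_group_eq\<close>)
    qed
  qed
  then show ?thesis unfolding N_stab_def stabilizer_def K_group_eq gr.Nset_iff_stab[OF eta_Kchar] by simp
qed

lemma eta_ext_eq: "eta_ext R P \<pi> l1 l2 l \<epsilon> \<psi> (cs l u0) (cs m w0)
    = char_exts G (gr.Nset u0 w0) gr.Kg (eta' (cs l u0) (cs m w0))"
  unfolding eta_ext_def N_stab_eq K_group_eq char_exts_def hom_complex_units_iff by blast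

lemma quo_ideal_l: "quo_ideal R P l 1 = cs l ` J 1"
  by (rule quo_ideal_eq)

lemma Units_m: "Units (quo R P m) = cs m ` (- J 1)"
  by (rule quo_Units) (rule l_dims)

text \<open>The entry \<delta> b determines b modulo \<open>J l2\<close>, and m \<le> l2, so the
  class of b modulo \<open>J m\<close> is meaningful and the conditions become those of
  \<open>Nset\<close>.\<close>

lemma stab_matrices:
  "N_stab R P \<pi> l1 l2 l \<epsilon> \<psi> (cs l u0) (cs m w0) =
          {g \<in> carrier G. \<exists>b \<in> carrier (quo R P l2).
             ent12 R P l1 l2 g = pimul R \<pi> (l1 - l2) b \<and>
             red R P m b = red R P m (ent21 R P l1 l2 g) \<otimes>\<^bsub>quo R P m\<^esub> cs m w0 \<and>
             red R P l (ent22 R P l1 l2 g) =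
               red R P l (ent11 R P l1 l2 g)
                 \<ominus>\<^bsub>quo R P l\<^esub> red R P l (ent21 R P l1 l2 g) \<otimes>\<^bsub>quo R P l\<^esub> cs l u0}"
    (is "_ = {g \<in> carrier G. ?R g}")
proof -
  have le: "m \<le> l2" "l \<le> l2" "l \<le> l1" "l2 + (l1 - l2) = l1" using l_dims lam by auto
  have iff: "?R (mk a b c d) \<longleftrightarrow> b - c * w0 \<in> J m \<and> d - a + c * u0 \<in> J l" for a b c d
  proof -
    have b12: "cs l1 (b * t ^ (l1 - l2)) = cs l1 (t ^ (l1 - l2) * b') \<longleftrightarrow> b - b' \<in> J l2" for b'
      unfolding fl.cs_eq using tpow_l1_iff[of "b - b'"] by (simp add: algebra_simps)
    note b12' = b12[unfolded fl.cs_eq]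
    have "?R (mk a b c d) \<longleftrightarrow> (\<exists>b'. b - b' \<in> J l2 \<and> b' - c * w0 \<in> J m \<and> d - (a - c * u0) \<in> J l)"
      unfolding ent_mk range_cs[symmetric] using le
      by (simp add: pimul_cs red_cs quo_mult quo_minus b12' fl.cs_eq)
    also have "\<dots> \<longleftrightarrow> b - c * w0 \<in> J m \<and> d - a + c * u0 \<in> J l"
    proof
      assume "\<exists>b'. b - b' \<in> J l2 \<and> b' - c * w0 \<in> J m \<and> d - (a - c * u0) \<in> J l"
      then obtain b' where b': "b - b' \<in> J l2" "b' - c * w0 \<in> J m" "d - (a - c * u0) \<in> J l" by blast
      have "b - b' \<in> J m" using fl.J_mono[OF le(1) b'(1)] .
      from fl.J_add[OF this b'(2)] b'(3) show "b - c * w0 \<in> J m \<and> d - a + c * u0 \<in> J l" by (simp add: algebra_simps)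
    next
      assume "b - c * w0 \<in> J m \<and> d - a + c * u0 \<in> J l"
      then show "\<exists>b'. b - b' \<in> J l2 \<and> b' - c * w0 \<in> J m \<and> d - (a - c * u0) \<in> J l"
        by (intro exI[of _ b]) (simp add: algebra_simps)
    qed
    finally show ?thesis .
  qed
  show ?thesis unfolding N_stab_eq
  proof (intro Set.set_eqI iffI)
    fix g assume "g \<in> gr.Nset u0 w0"
    then obtain a b c d where g: "g = mk a b c d" "a \<notin> J 1" "d \<notin> J 1" "b - c * w0 \<in> J m \<and> d - a + c * u0 \<in> J l"
      unfolding gr.Nset_def by blast
    have "?R g" unfolding g(1) iff by (rule g(4))
    then show "g \<in> {g \<in> carrier G. ?R g}" using mk_closed[OF g(2,3)] g(1) by blast
  next
    fix g assume "g \<in> {g \<in> carrier G. ?R g}"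
    then have g: "g \<in> carrier G" "?R g" by blast+
    obtain a b c d where m: "a \<notin> J 1" "d \<notin> J 1" "g = mk a b c d" using mk_exh[OF g(1)] by blast
    have "b - c * w0 \<in> J m \<and> d - a + c * u0 \<in> J l" using g(2) unfolding m(3) iff .
    then show "g \<in> gr.Nset u0 w0" unfolding gr.Nset_def using m by blast
  qed
qed

lemma ext_char:
  assumes "\<theta> \<in> eta_ext R P \<pi> l1 l2 l \<epsilon> \<psi> (cs l u0) (cs m w0)"
  shows "is_char G (gr.Nset u0 w0) \<theta>" "gr.eta_on u0 w0 \<theta>" "\<theta> \<in> extensional (gr.Nset u0 w0)"
proof -
  have th: "\<theta> \<in> char_exts G (gr.Nset u0 w0) gr.Kg (eta' (cs l u0) (cs m w0))" using assms unfolding eta_ext_eq .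
  then show "is_char G (gr.Nset u0 w0) \<theta>" "\<theta> \<in> extensional (gr.Nset u0 w0)" unfolding char_exts_def by auto
  show "gr.eta_on u0 w0 \<theta>" by (rule gr.Kchar_eqI[OF _ eta_Kchar]) (use th in \<open>auto simp: char_exts_def\<close>)
qed

lemma card_eta_ext:
  assumes "u0 \<in> J 1"
  shows "finite (eta_ext R P \<pi> l1 l2 l \<epsilon> \<psi> (cs l u0) (cs m w0))"
    "card (eta_ext R P \<pi> l1 l2 l \<epsilon> \<psi> (cs l u0) (cs m w0)) = fl.q ^ (l1 - 1) * (fl.q - 1)"
  using gr.card_extensions[OF assms eta_Kchar] unfolding eta_ext_eq by auto

lemma rho_eq: "rho \<theta> u0 w0 = ind_rep G (gr.Nset u0 w0) (char_rep \<theta>)"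
  unfolding rho_ext_def N_stab_eq ..

lemma rho_facts:
  assumes u0: "u0 \<in> J 1" and th: "\<theta> \<in> eta_ext R P \<pi> l1 l2 l \<epsilon> \<psi> (cs l u0) (cs m w0)"
  obtains xs where "left_transversal G (gr.Nset u0 w0) xs" "rho \<theta> u0 w0 = (length xs, ind_char G (gr.Nset u0 w0) xs \<theta>)"
    "irreducible_rep G (rho \<theta> u0 w0)" "length xs = fl.q ^ (l2 - 1) * (fl.q - 1)"
proof -
  obtain xs where lt: "left_transversal G (gr.Nset u0 w0) xs" and e: "rho \<theta> u0 w0 = (length xs, ind_char G (gr.Nset u0 w0) xs \<theta>)"
    using gr.ind_rep_char_cases[OF gr.Nset_subgroup] unfolding rho_eq by metis
  have "irreducible_rep G (rho \<theta> u0 w0)"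
    unfolding e
  proof (rule left_transversal.ind_char_irreducible[OF lt ext_char(1)[OF th] gr.Kg_subgroup gr.Kg_Nset])
    show "inv\<^bsub>G\<^esub> g \<otimes>\<^bsub>G\<^esub> k \<otimes>\<^bsub>G\<^esub> g \<in> gr.Kg" if "g \<in> carrier G" "k \<in> gr.Kg" for g k using gr.Kg_normal that .
    show "g \<in> gr.Nset u0 w0" if "g \<in> carrier G" "\<forall>k\<in>gr.Kg. \<theta> (inv\<^bsub>G\<^esub> g \<otimes>\<^bsub>G\<^esub> k \<otimes>\<^bsub>G\<^esub> g) = \<theta> k" for g
      unfolding gr.Nset_iff_stab[OF ext_char(2)[OF th]] using that by blast
  qed
  moreover have "length xs = fl.q ^ (l2 - 1) * (fl.q - 1)" by (rule gr.Nset_index[OF u0 lt])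
  ultimately show thesis using that[OF lt e] by blast
qed

text \<open>Containment would give a nonzero vector fixed by \<open>U\<close> through
  \<open>contained_fixed_vector\<close>, against \<open>ind_no_fixed_vector\<close>. This one
  argument covers all kinds of induction.\<close>

lemma rho_not_contained:
  assumes u0: "u0 \<in> J 1" and w0: "w0 \<notin> J 1" and th: "\<theta> \<in> eta_ext R P \<pi> l1 l2 l \<epsilon> \<psi> (cs l u0) (cs m w0)"
    and chi: "is_char G (carrier G) \<chi>" and Q: "subgroup Q G" and U: "U = range gr.U12 \<or> U = range gr.U21" "U \<subseteq> Q"
    and triv: "\<And>h. h \<in> U \<Longrightarrow> snd \<tau> h = 1\<^sub>m (fst \<tau>)"
  shows "\<not> rep_contained G (twist \<chi> (rho \<theta> u0 w0)) (ind_rep G Q \<tau>)"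
proof
  assume c: "rep_contained G (twist \<chi> (rho \<theta> u0 w0)) (ind_rep G Q \<tau>)"
  obtain xs where lt: "left_transversal G (gr.Nset u0 w0) xs" and e: "rho \<theta> u0 w0 = (length xs, ind_char G (gr.Nset u0 w0) xs \<theta>)"
    and irr: "irreducible_rep G (rho \<theta> u0 w0)" using rho_facts[OF u0 th] by blast
  let ?s = "\<lambda>g. \<chi> g \<cdot>\<^sub>m ind_char G (gr.Nset u0 w0) xs \<theta> g"
  have n: "0 < length xs" and r: "mat_rep G (length xs) (ind_char G (gr.Nset u0 w0) xs \<theta>)"
    using irr unfolding e gr.irreducible_rep_iff by auto
  have s: "mat_rep G (length xs) ?s" by (rule gr.twist_mat_rep[OF r chi])
  have Us: "subgroup U G" using U(1) gr.U12_subgroup gr.U21_subgroup by blast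
  obtain v where v: "v \<in> carrier_vec (length xs)" "v \<noteq> 0\<^sub>v (length xs)" "\<And>h. h \<in> U \<Longrightarrow> ?s h *\<^sub>v v = v"
    using gr.contained_fixed_vector[OF s n Q Us U(2) triv c[unfolded twist_def e fst_conv snd_conv]] by blast
  show False
    using gr.ind_no_fixed_vector[OF u0 w0 ext_char(1,2)[OF th] lt chi v(1,2) U(1)] v(3) by blast
qed

lemma U12_G: "gr.U12 b \<in> carrier G" and U21_G: "gr.U21 b \<in> carrier G"
  by (simp_all add: gr.U12_km gr.U21_km gr.km_closed)

lemma fixes_stab: "h \<in> carrier G \<Longrightarrow> (\<And>p. p \<in> N \<Longrightarrow> h p = p) \<Longrightarrow> h \<in> stab N"
  unfolding stabilizer_def by auto

text \<open>\<open>U12\<close> acts trivially in induction from \<open>Pplus\<close>, in the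
  submodule version and in pullbacks from the multiples of \<pi>; \<open>U21\<close> does so for
  \<open>Pminus\<close> and for the quotient version.\<close>

lemma rho_cuspidal:
  assumes u0: "u0 \<in> J 1" and w0: "w0 \<notin> J 1" and th: "\<theta> \<in> eta_ext R P \<pi> l1 l2 l \<epsilon> \<psi> (cs l u0) (cs m w0)"
  shows "cuspidal_rep R P \<pi> l1 l2 (rho \<theta> u0 w0)"
proof -
  obtain xs where lt: "left_transversal G (gr.Nset u0 w0) xs" and e: "rho \<theta> u0 w0 = (length xs, ind_char G (gr.Nset u0 w0) xs \<theta>)"
    and irr: "irreducible_rep G (rho \<theta> u0 w0)" using rho_facts[OF u0 th] by blast
  have n: "0 < length xs" using irr unfolding e gr.irreducible_rep_iff by auto
  let ?N = "(\<lambda>x. \<pi> \<odot>\<^bsub>M\<^esub> x) ` carrier M"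
  have prim: "\<not> (\<exists>\<sigma>. is_rep (sub_group ?N) \<sigma> \<and> rep_iso G (twist \<chi> (rho \<theta> u0 w0)) (pullback (\<lambda>g. restrict g ?N) \<sigma>))"
    if chi: "is_char G (carrier G) \<chi>" for \<chi>
  proof
    assume "\<exists>\<sigma>. is_rep (sub_group ?N) \<sigma> \<and> rep_iso G (twist \<chi> (rho \<theta> u0 w0)) (pullback (\<lambda>g. restrict g ?N) \<sigma>)"
    then obtain \<sigma> where s: "is_rep (sub_group ?N) \<sigma>" and iso: "rep_iso G (twist \<chi> (rho \<theta> u0 w0)) (pullback (\<lambda>g. restrict g ?N) \<sigma>)" by blast
    let ?r = "\<lambda>g. \<chi> g \<cdot>\<^sub>m ind_char G (gr.Nset u0 w0) xs \<theta> g" and ?n = "length xs"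
    obtain T where nf: "?n = fst \<sigma>" and T: "T \<in> carrier (GL ?n)" and int: "\<And>g. g \<in> carrier G \<Longrightarrow> T * ?r g = snd \<sigma> (restrict g ?N) * T"
      using iso unfolding rep_iso_def twist_def pullback_def e by auto
    obtain S where S: "S \<in> carrier (GL ?n)" "S * T = 1\<^sub>m ?n" using GL_E[OF T] by metis
    have Tc: "T \<in> carrier_mat ?n ?n" and Sc: "S \<in> carrier_mat ?n ?n" using T S GL_carrier_mat by auto
    have rc: "?r g \<in> carrier_mat ?n ?n" for g by simp
    \<comment> \<open>An isomorphism with a pullback conjugates \<open>?r h\<close> to the value of
      \<sigma> at the identity, because \<open>U12\<close> fixes all multiples of \<pi>.\<close>
    have one: "?r h = 1\<^sub>m ?n" if hU: "h \<in> range gr.U12" for h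
    proof -
      have hG: "h \<in> carrier G" using hU U12_G by blast
      obtain b where b: "h = mk 1 (t ^ (l2 - 1) * b) 0 1" using hU by (auto simp: gr.U12_def)
      have "h p = p" if pN: "p \<in> ?N" for p
      proof -
        obtain p' where p': "p = \<pi> \<odot>\<^bsub>M\<^esub> p'" "p' \<in> carrier M" using pN by blast
        obtain x y where xy: "p' = (cs l1 x, cs l2 y)" using M_cases[OF p'(2)] by blast
        have "p = (cs l1 (t * x), cs l2 (t * y))" unfolding p'(1) xy using M_smult[of t x y] by (simp only: ev_t)
        then show ?thesis unfolding b using U12_fixes by simp
      qed
      then have "restrict h ?N = \<one>\<^bsub>sub_group ?N\<^esub>" unfolding sub_group_one by (auto simp: restrict_def)
      then have "snd \<sigma> (restrict h ?N) = 1\<^sub>m ?n" using is_rep_one[OF sub_group(1)[OF piM_submod] s] nf by simp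
      then have "T * ?r h = T" using int[OF hG] Tc by simp
      then have "(S * T) * ?r h = S * T" using assoc_mult_mat[OF Sc Tc rc] by simp
      then show ?thesis unfolding S(2) left_mult_one_mat[OF rc] .
    qed
    let ?u = "unit_vec ?n 0 :: complex vec"
    have u: "?u \<in> carrier_vec ?n" "?u \<noteq> 0\<^sub>v ?n" using n by (simp, metis index_unit_vec(1) index_zero_vec(1) zero_neq_one)
    obtain h where "h \<in> range gr.U12" "?r h *\<^sub>v ?u \<noteq> ?u"
      using gr.ind_no_fixed_vector[OF u0 w0 ext_char(1,2)[OF th] lt chi u disjI1[OF refl]] by blast
    then show False using one[of h] by simp
  qed
  have "\<not> rep_contained G (twist \<chi> (rho \<theta> u0 w0)) \<tau>" if chi: "is_char G (carrier G) \<chi>" and tau: "geom_induced R P l1 l2 \<tau> \<or> inf_induced R P l1 l2 \<tau>" for \<chi> \<tau>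
    using tau
  proof
    assume "geom_induced R P l1 l2 \<tau>"
    then obtain \<sigma> Q where s: "is_rep Levi \<sigma>" and Q: "Q = Pplus \<or> Q = Pminus" and tau: "\<tau> = ind_rep G Q (pullback ent_diag \<sigma>)"
      unfolding geom_induced_def Pplus_def Pminus_def by blast
    have s1: "snd (pullback ent_diag \<sigma>) h = 1\<^sub>m (fst (pullback ent_diag \<sigma>))" if "h = mk 1 b c 1" for h b c
      using is_rep_one[OF group_Levi s] unfolding that pullback_def Levi_one by (simp add: ent_mk)
    from Q show ?thesis
    proof
      assume Q: "Q = Pplus"
      have "range gr.U12 \<subseteq> Pplus" using U12_G unfolding gr.U12_def by (auto simp: Pplus_iff)
      moreover have "snd (pullback ent_diag \<sigma>) h = 1\<^sub>m (fst (pullback ent_diag \<sigma>))" if "h \<in> range gr.U12" for h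
        using that s1 by (auto simp: gr.U12_def)
      ultimately show ?thesis unfolding tau Q
        by (rule rho_not_contained[OF u0 w0 th chi Pplus_subgroup disjI1[OF refl]])
    next
      assume Q: "Q = Pminus"
      have "range gr.U21 \<subseteq> Pminus" using U21_G unfolding gr.U21_def by (auto simp: Pminus_iff)
      moreover have "snd (pullback ent_diag \<sigma>) h = 1\<^sub>m (fst (pullback ent_diag \<sigma>))" if "h \<in> range gr.U21" for h
        using that s1 by (auto simp: gr.U21_def)
      ultimately show ?thesis unfolding tau Q
        by (rule rho_not_contained[OF u0 w0 th chi Pminus_subgroup disjI2[OF refl]])
    qed
  next
    assume "inf_induced R P l1 l2 \<tau>"
    then obtain k where k: "0 < k" "k < l2" and c: "(\<exists>\<sigma>. is_rep (sub_group (Nsub (l2 - k))) \<sigma> \<and>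
         \<tau> = ind_rep G (stab (Nsub (l2 - k))) (pullback (\<lambda>g. restrict g (Nsub (l2 - k))) \<sigma>)) \<or>
        (\<exists>\<sigma>. is_rep (quot_group (Nker k)) \<sigma> \<and> \<tau> = ind_rep G (stab (Nker k)) (pullback (qact k) \<sigma>))"
      unfolding inf_induced_def Let_def sub_mu_eq ker_mu_eq qact_def by blast
    from c show ?thesis
    proof
      let ?N = "Nsub (l2 - k)"
      assume "\<exists>\<sigma>. is_rep (sub_group ?N) \<sigma> \<and> \<tau> = ind_rep G (stab ?N) (pullback (\<lambda>g. restrict g ?N) \<sigma>)"
      then obtain \<sigma> where s: "is_rep (sub_group ?N) \<sigma>" and tau: "\<tau> = ind_rep G (stab ?N) (pullback (\<lambda>g. restrict g ?N) \<sigma>)" by blast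
      have fix1: "h p = p" if "h \<in> range gr.U12" "p \<in> ?N" for h p
        using U12_fixes_Nsub[of "l2 - k" p] that k unfolding gr.U12_def by auto
      show ?thesis unfolding tau
      proof (rule rho_not_contained[OF u0 w0 th chi stab_subgroup[OF Nsub_submod] disjI1[OF refl]])
        show "range gr.U12 \<subseteq> stab ?N"
        proof
          fix h assume h: "h \<in> range gr.U12"
          show "h \<in> stab ?N" by (rule fixes_stab) (use h U12_G fix1[OF h] in blast)+
        qed
        fix h assume h: "h \<in> range gr.U12"
        have "restrict h ?N = \<one>\<^bsub>sub_group ?N\<^esub>" unfolding sub_group_one using fix1[OF h] by (auto simp: restrict_def)
        then show "snd (pullback (\<lambda>g. restrict g ?N) \<sigma>) h = 1\<^sub>m (fst (pullback (\<lambda>g. restrict g ?N) \<sigma>))"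
          using is_rep_one[OF sub_group(1)[OF Nsub_submod] s] by (simp add: pullback_def)
      qed
    next
      assume "\<exists>\<sigma>. is_rep (quot_group (Nker k)) \<sigma> \<and> \<tau> = ind_rep G (stab (Nker k)) (pullback (qact k) \<sigma>)"
      then obtain \<sigma> where s: "is_rep (quot_group (Nker k)) \<sigma>" and tau: "\<tau> = ind_rep G (stab (Nker k)) (pullback (qact k) \<sigma>)" by blast
      show ?thesis unfolding tau
      proof (rule rho_not_contained[OF u0 w0 th chi stab_subgroup[OF Nker_submod] disjI2[OF refl]])
        show "range gr.U21 \<subseteq> stab (Nker k)"
        proof
          fix h assume h: "h \<in> range gr.U21"
          then obtain b where b: "h = mk 1 0 (t ^ (l2 - 1) * b) 1" unfolding gr.U21_def by blast
          show "h \<in> stab (Nker k)"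
          proof (rule fixes_stab)
            show "h \<in> carrier G" using h U21_G by blast
            show "h p = p" if "p \<in> Nker k" for p unfolding b by (rule U21_fixes_Nker[OF that])
          qed
        qed
        fix h assume "h \<in> range gr.U21"
        then obtain b where b: "h = mk 1 0 (t ^ (l2 - 1) * b) 1" unfolding gr.U21_def by blast
        have "h ` C = C" if "C \<in> carrier (quot_module M (Nker k))" for C
          unfolding b by (rule U21_fixes_cosets[OF _ that]) (use k in simp)
        then have "qact k h = \<one>\<^bsub>quot_group (Nker k)\<^esub>" unfolding qact_def mod_aut_one by (intro restrict_ext) blast
        then show "snd (pullback (qact k) \<sigma>) h = 1\<^sub>m (fst (pullback (qact k) \<sigma>))"
          using is_rep_one[OF quot_group(1) s] by (simp add: pullback_def)
      qed
    qed
  qed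
  with irr prim show ?thesis
    unfolding cuspidal_rep_def primitive_rep_def Let_def by (simp add: hom_complex_units_iff')
qed

text \<open>Restriction to \<open>Kg\<close> makes the two characters \<eta> conjugate, hence equal
  in their parameters. Only then do both extensions live on the same stabilizer and can be compared
  by \<open>rep_iso_ind_eq\<close>.\<close>

lemma rho_distinct:
  assumes u0: "u0 \<in> J 1" and u1: "u1 \<in> J 1"
    and th: "\<theta> \<in> eta_ext R P \<pi> l1 l2 l \<epsilon> \<psi> (cs l u0) (cs m w0)" and th': "\<theta>' \<in> eta_ext R P \<pi> l1 l2 l \<epsilon> \<psi> (cs l u1) (cs m w1)"
    and iso: "rep_iso G (rho \<theta> u0 w0) (rho \<theta>' u1 w1)"
  shows "cs l u0 = cs l u1 \<and> cs m w0 = cs m w1 \<and> \<theta> = \<theta>'"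
proof -
  note t = ext_char[OF th] and t' = ext_char[OF th']
  have norm: "inv\<^bsub>G\<^esub> g \<otimes>\<^bsub>G\<^esub> k \<otimes>\<^bsub>G\<^esub> g \<in> gr.Kg" if "g \<in> carrier G" "k \<in> gr.Kg" for g k using gr.Kg_normal that .
  obtain g where g: "g \<in> carrier G" "\<And>k. k \<in> gr.Kg \<Longrightarrow> \<theta>' (inv\<^bsub>G\<^esub> g \<otimes>\<^bsub>G\<^esub> k \<otimes>\<^bsub>G\<^esub> g) = \<theta> k"
    using gr.rep_iso_ind_conj[OF gr.Nset_subgroup t(1) gr.Nset_subgroup iso[unfolded rho_eq] gr.Kg_Nset gr.Kg_Nset norm] by blast
  have e: "cs l u0 = cs l u1" "cs m w0 = cs m w1"
    using gr.eta_conj_eq[OF t(2) t'(2) g] by (simp_all add: fl.cs_eq)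
  \<comment> \<open>\<open>Nset\<close> is written with lifts but depends only on their residue
    classes, as its description through \<open>N_stab\<close> shows.\<close>
  have N: "gr.Nset u1 w1 = gr.Nset u0 w0" using N_stab_eq e by metis
  have t'': "gr.eta_on u0 w0 \<theta>'"
    by (rule gr.Kchar_cong[OF t'(2)]) (use e in \<open>auto simp: fl.cs_eq fl.J_minus_commute\<close>)
  have ag: "\<theta> k = \<theta>' k" if "k \<in> gr.Kg" for k by (rule gr.Kchar_agree[OF t(2) t'' that])
  have "\<theta> n = \<theta>' n" if "n \<in> gr.Nset u0 w0" for n
  proof (rule gr.rep_iso_ind_eq[OF gr.Nset_subgroup t(1) t'(1)[unfolded N] iso[unfolded rho_eq N] gr.Kg_Nset norm _ that])
    fix g assume g: "g \<in> carrier G" "\<forall>k\<in>gr.Kg. \<theta>' (inv\<^bsub>G\<^esub> g \<otimes>\<^bsub>G\<^esub> k \<otimes>\<^bsub>G\<^esub> g) = \<theta> k"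
    then show "g \<in> gr.Nset u0 w0" unfolding gr.Nset_iff_stab[OF t''] using ag by simp
  qed
  then have "\<theta> = \<theta>'" using t(3) t'(3)[unfolded N] by (intro extensionalityI) auto
  then show ?thesis using e by blast
qed

text \<open>The three hypotheses of \<open>eta_eigenvector\<close> are verified by turning a
  forbidden fixed vector into containment in a geometrically or an infinitesimally induced
  representation.\<close>

lemma cuspidal_is_rho:
  assumes cusp: "cuspidal_rep R P \<pi> l1 l2 \<rho>"
  shows "\<exists>u0\<in>J 1. \<exists>w0. w0 \<notin> J 1 \<and> (\<exists>\<theta>\<in>eta_ext R P \<pi> l1 l2 l \<epsilon> \<psi> (cs l u0) (cs m w0). rep_iso G \<rho> (rho \<theta> u0 w0))"
proof -
  obtain n r where rho: "\<rho> = (n, r)" by (cases \<rho>)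
  have irr: "irreducible_rep G \<rho>" using cusp unfolding cuspidal_rep_def primitive_rep_def by blast
  have nc: "\<not> rep_contained G (twist \<chi> \<rho>) \<tau>" if "is_char G (carrier G) \<chi>" "geom_induced R P l1 l2 \<tau> \<or> inf_induced R P l1 l2 \<tau>" for \<chi> \<tau>
    using cusp that hom_complex_units_iff'[of \<chi> G] unfolding cuspidal_rep_def by blast
  have r: "mat_rep G n r" and n: "0 < n" using irr unfolding rho gr.irreducible_rep_iff by auto
  have tv: "snd (twist \<chi> \<rho>) g *\<^sub>v v = \<chi> g \<cdot>\<^sub>v (r g *\<^sub>v v)" if "g \<in> carrier G" "v \<in> carrier_vec n" for \<chi> g v
    unfolding twist_def rho using gr.twist_vec[OF mat_rep_carrier[OF r that(1)] that(2)] by simp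
  have ft: "fst (twist \<chi> \<rho>) = n" for \<chi> by (simp add: twist_def rho)
  have lt: "0 < l2 - 1" using lam by simp
  have unit: "1 + t ^ (l2 - 1) * z \<notin> J 1" for z by (rule fl.unit_1t[OF lt])
  have "\<exists>uh wh \<omega> v. uh \<in> J 1 \<and> wh \<notin> J 1 \<and> gr.eta_on uh wh \<omega> \<and> v \<in> carrier_vec n \<and> v \<noteq> 0\<^sub>v n \<and> (\<forall>k\<in>gr.Kg. r k *\<^sub>v v = \<omega> k \<cdot>\<^sub>v v)"
  proof (rule gr.eta_eigenvector[OF r n])
    show "\<not> (\<exists>v. v \<in> carrier_vec n \<and> v \<noteq> 0\<^sub>v n \<and> (\<forall>b. r (mk 1 b 0 1) *\<^sub>v v = v))"
    proof
      assume "\<exists>v. v \<in> carrier_vec n \<and> v \<noteq> 0\<^sub>v n \<and> (\<forall>b. r (mk 1 b 0 1) *\<^sub>v v = v)"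
      then obtain v where v: "v \<in> carrier_vec n" "v \<noteq> 0\<^sub>v n" "\<And>b. r (mk 1 b 0 1) *\<^sub>v v = v" by blast
      have one: "is_char G (carrier G) (\<lambda>_. 1)" unfolding is_char_def by simp
      have "snd (twist (\<lambda>_. 1) \<rho>) (mk 1 b 0 1) *\<^sub>v v = v" for b
        using tv[OF mk_closed[OF fl.one_notin fl.one_notin] v(1)] v(3) by simp
      then have "\<exists>\<tau>. geom_induced R P l1 l2 \<tau> \<and> rep_contained G (twist (\<lambda>_. 1) \<rho>) \<tau>"
        by (intro geom_if_fixed[OF gr.twist_irreducible[OF irr one]]) (use v ft in auto)
      then show False using nc[OF one] by blast
    qed
    show "\<not> (\<exists>v. v \<in> carrier_vec n \<and> v \<noteq> 0\<^sub>v n \<and>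
        (\<forall>b z. let g = mk 1 (t ^ (l2 - 1) * b) 0 (1 + t ^ (l2 - 1) * z) in \<chi> g \<cdot>\<^sub>v (r g *\<^sub>v v) = v))" if chi: "is_char G (carrier G) \<chi>" for \<chi>
    proof
      assume "\<exists>v. v \<in> carrier_vec n \<and> v \<noteq> 0\<^sub>v n \<and>
        (\<forall>b z. let g = mk 1 (t ^ (l2 - 1) * b) 0 (1 + t ^ (l2 - 1) * z) in \<chi> g \<cdot>\<^sub>v (r g *\<^sub>v v) = v)"
      then obtain v where v: "v \<in> carrier_vec n" "v \<noteq> 0\<^sub>v n"
        "\<And>b z. \<chi> (mk 1 (t ^ (l2 - 1) * b) 0 (1 + t ^ (l2 - 1) * z)) \<cdot>\<^sub>v (r (mk 1 (t ^ (l2 - 1) * b) 0 (1 + t ^ (l2 - 1) * z)) *\<^sub>v v) = v"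
        unfolding Let_def by blast
      have "snd (twist \<chi> \<rho>) (mk 1 (t ^ (l2 - 1) * b) 0 (1 + t ^ (l2 - 1) * z)) *\<^sub>v v = v" for b z
        using tv[OF mk_closed[OF fl.one_notin unit] v(1)] v(3) by simp
      then have "\<exists>\<tau>. inf_induced R P l1 l2 \<tau> \<and> rep_contained G (twist \<chi> \<rho>) \<tau>"
        by (intro inf_if_fixed_12[OF gr.twist_irreducible[OF irr chi]]) (use v ft in auto)
      then show False using nc[OF chi] by blast
    qed
    show "\<not> (\<exists>v. v \<in> carrier_vec n \<and> v \<noteq> 0\<^sub>v n \<and>
        (\<forall>c z. let g = mk 1 0 (t ^ (l2 - 1) * c) (1 + t ^ (l2 - 1) * z) in \<chi> g \<cdot>\<^sub>v (r g *\<^sub>v v) = v))" if chi: "is_char G (carrier G) \<chi>" for \<chi>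
    proof
      assume "\<exists>v. v \<in> carrier_vec n \<and> v \<noteq> 0\<^sub>v n \<and>
        (\<forall>c z. let g = mk 1 0 (t ^ (l2 - 1) * c) (1 + t ^ (l2 - 1) * z) in \<chi> g \<cdot>\<^sub>v (r g *\<^sub>v v) = v)"
      then obtain v where v: "v \<in> carrier_vec n" "v \<noteq> 0\<^sub>v n"
        "\<And>c z. \<chi> (mk 1 0 (t ^ (l2 - 1) * c) (1 + t ^ (l2 - 1) * z)) \<cdot>\<^sub>v (r (mk 1 0 (t ^ (l2 - 1) * c) (1 + t ^ (l2 - 1) * z)) *\<^sub>v v) = v"
        unfolding Let_def by blast
      have "snd (twist \<chi> \<rho>) (mk 1 0 (t ^ (l2 - 1) * c) (1 + t ^ (l2 - 1) * z)) *\<^sub>v v = v" for c z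
        using tv[OF mk_closed[OF fl.one_notin unit] v(1)] v(3) by simp
      then have "\<exists>\<tau>. inf_induced R P l1 l2 \<tau> \<and> rep_contained G (twist \<chi> \<rho>) \<tau>"
        by (intro inf_if_fixed_21[OF gr.twist_irreducible[OF irr chi]]) (use v ft in auto)
      then show False using nc[OF chi] by blast
    qed
  qed
  then obtain u0 w0 \<omega> v where u0: "u0 \<in> J 1" and w0: "w0 \<notin> J 1" and om: "gr.eta_on u0 w0 \<omega>"
    and v: "v \<in> carrier_vec n" "v \<noteq> 0\<^sub>v n" and ev: "\<And>k. k \<in> gr.Kg \<Longrightarrow> r k *\<^sub>v v = \<omega> k \<cdot>\<^sub>v v" by blast
  let ?e = "eta' (cs l u0) (cs m w0)"
  have ev': "r k *\<^sub>v v = ?e k \<cdot>\<^sub>v v" if "k \<in> gr.Kg" for k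
    using ev[OF that] gr.Kchar_agree[OF om eta_Kchar that] by simp
  \<comment> \<open>\<open>Nset_comm\<close> allows the passage from an eigenvector of
    \<open>Kg\<close> to one of the whole stabilizer, whose eigenvalues are the required
    extension.\<close>
  obtain \<theta> w where th: "\<theta> \<in> char_exts G (gr.Nset u0 w0) gr.Kg ?e" and w: "w \<in> carrier_vec n" "w \<noteq> 0\<^sub>v n"
    "\<And>h. h \<in> gr.Nset u0 w0 \<Longrightarrow> r h *\<^sub>v w = \<theta> h \<cdot>\<^sub>v w"
    using gr.eigenvector_extend[OF gr.Nset_subgroup gr.Kg_subgroup gr.Kg_Nset gr.Kchar_is_char[OF eta_Kchar]
        gr.Nset_comm[OF u0 eta_Kchar] r v ev'] by blast
  have th': "\<theta> \<in> eta_ext R P \<pi> l1 l2 l \<epsilon> \<psi> (cs l u0) (cs m w0)" unfolding eta_ext_eq by (rule th)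
  have "irreducible_rep G (rho \<theta> u0 w0)" using rho_facts[OF u0 th'] by blast
  then have "rep_iso G \<rho> (rho \<theta> u0 w0)"
    unfolding rho_eq by (intro gr.eigenvector_ind_iso[OF irr gr.Nset_subgroup ext_char(1)[OF th']]) (use w rho in auto)
  then show ?thesis using u0 w0 th' by blast
qed

end

section \<open>Counting isomorphism classes\<close>

lemma rep_iso_sym:
  assumes "is_rep G \<rho>" "is_rep G \<sigma>" "group G" "rep_iso G \<rho> \<sigma>" shows "rep_iso G \<sigma> \<rho>"
proof -
  interpret group G by fact
  obtain n r s where e: "\<rho> = (n, r)" "\<sigma> = (n, s)" using assms(4) unfolding rep_iso_def by (cases \<rho>, cases \<sigma>) auto
  obtain T where T: "T \<in> carrier (GL n)" "\<And>g. g \<in> carrier G \<Longrightarrow> T * r g = s g * T" using assms(4) unfolding rep_iso_def e by auto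
  obtain S where S: "S \<in> carrier (GL n)" "T * S = 1\<^sub>m n" "S * T = 1\<^sub>m n" using GL_E[OF T(1)] by metis
  have Tc: "T \<in> carrier_mat n n" and Sc: "S \<in> carrier_mat n n" using T S GL_carrier_mat by auto
  have "S * s g = r g * S" if g: "g \<in> carrier G" for g
  proof -
    have rc: "r g \<in> carrier_mat n n" and sc: "s g \<in> carrier_mat n n"
      using assms(1,2) g unfolding is_rep_iff e mat_rep_def by auto
    have "S * s g = (S * s g) * (T * S)" unfolding S(2) using Sc sc by simp
    also have "\<dots> = ((S * s g) * T) * S" by (rule assoc_mult_mat[OF mult_carrier_mat[OF Sc sc] Tc Sc, symmetric])
    also have "(S * s g) * T = S * (s g * T)" by (rule assoc_mult_mat[OF Sc sc Tc])
    also have "s g * T = T * r g" by (rule T(2)[OF g, symmetric])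
    also have "S * (T * r g) = (S * T) * r g" by (rule assoc_mult_mat[OF Sc Tc rc, symmetric])
    also have "\<dots> = r g" unfolding S(3) using rc by simp
    finally show ?thesis .
  qed
  then show ?thesis unfolding rep_iso_def e using S(1) by auto
qed

lemma rep_iso_trans:
  assumes "is_rep G \<rho>" "is_rep G \<sigma>" "is_rep G \<tau>" "group G" "rep_iso G \<rho> \<sigma>" "rep_iso G \<sigma> \<tau>" shows "rep_iso G \<rho> \<tau>"
proof -
  interpret group G by fact
  obtain n r where e1: "\<rho> = (n, r)" by (cases \<rho>)
  have n: "fst \<sigma> = n" "fst \<tau> = n" using assms(5,6) unfolding rep_iso_def e1 by auto
  obtain s where e2: "\<sigma> = (n, s)" using n(1) by (cases \<sigma>) simp
  obtain u where e3: "\<tau> = (n, u)" using n(2) by (cases \<tau>) simp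
  note e = e1 e2 e3
  obtain T where T: "T \<in> carrier (GL n)" "\<And>g. g \<in> carrier G \<Longrightarrow> T * r g = s g * T" using assms(5) unfolding rep_iso_def e by auto
  obtain S where S: "S \<in> carrier (GL n)" "\<And>g. g \<in> carrier G \<Longrightarrow> S * s g = u g * S" using assms(6) unfolding rep_iso_def e by auto
  have Tc: "T \<in> carrier_mat n n" and Sc: "S \<in> carrier_mat n n" using T S GL_carrier_mat by auto
  interpret GL: group "GL n" by (rule group_GL)
  have ST: "S * T \<in> carrier (GL n)" using GL.m_closed[OF S(1) T(1)] by (simp add: GL_simps)
  have "(S * T) * r g = u g * (S * T)" if g: "g \<in> carrier G" for g
  proof -
    have rc: "r g \<in> carrier_mat n n" and sc: "s g \<in> carrier_mat n n" and uc: "u g \<in> carrier_mat n n"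
      using assms(1,2,3) g unfolding is_rep_iff e mat_rep_def by auto
    have "(S * T) * r g = S * (T * r g)" by (rule assoc_mult_mat[OF Sc Tc rc])
    also have "\<dots> = S * (s g * T)" unfolding T(2)[OF g] ..
    also have "\<dots> = (S * s g) * T" by (rule assoc_mult_mat[OF Sc sc Tc, symmetric])
    also have "\<dots> = (u g * S) * T" unfolding S(2)[OF g] ..
    also have "\<dots> = u g * (S * T)" by (rule assoc_mult_mat[OF uc Sc Tc])
    finally show ?thesis .
  qed
  then show ?thesis unfolding rep_iso_def e using ST by auto
qed

context dvr_char
begin

lemma cuspidal_is_rep: "cuspidal_rep R P \<pi> l1 l2 \<rho> \<Longrightarrow> is_rep G \<rho>"
  unfolding cuspidal_rep_def primitive_rep_def irreducible_rep_def by blast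

text \<open>Classes correspond to triples of uh, wh and an extension: \<open>q ^ (l - 1)\<close>,
  then \<open>q ^ (m - 1) * (q - 1)\<close>, then \<open>q ^ (l1 - 1) * (q - 1)\<close> choices. The
  exponents combine by l + m = l2.\<close>

lemma card_cuspidal:
  "card ({\<rho>. cuspidal_rep R P \<pi> l1 l2 \<rho>} //
      {(\<rho>, \<sigma>). cuspidal_rep R P \<pi> l1 l2 \<rho> \<and> cuspidal_rep R P \<pi> l1 l2 \<sigma> \<and> rep_iso G \<rho> \<sigma>})
    = fl.q ^ (l1 + l2 - 3) * (fl.q - 1) ^ 2"
proof -
  let ?C = "{\<rho>. cuspidal_rep R P \<pi> l1 l2 \<rho>}"
  let ?E = "{(\<rho>, \<sigma>). cuspidal_rep R P \<pi> l1 l2 \<rho> \<and> cuspidal_rep R P \<pi> l1 l2 \<sigma> \<and> rep_iso G \<rho> \<sigma>}"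
  let ?X = "SIGMA (uh, wh) : cs l ` J 1 \<times> cs m ` (- J 1). eta_ext R P \<pi> l1 l2 l \<epsilon> \<psi> uh wh"
  let ?F = "\<lambda>((uh, wh), \<theta>). rho_ext R P \<pi> l1 l2 l \<epsilon> \<psi> uh wh \<theta>"
  have XE: "\<exists>u0 w0 \<theta>. u0 \<in> J 1 \<and> w0 \<notin> J 1 \<and> \<theta> \<in> eta_ext R P \<pi> l1 l2 l \<epsilon> \<psi> (cs l u0) (cs m w0) \<and> x = ((cs l u0, cs m w0), \<theta>)"
    if "x \<in> ?X" for x using that by auto
  have FC: "?F x \<in> ?C" if "x \<in> ?X" for x using XE[OF that] rho_cuspidal by auto
  have inj: "x = y" if xy: "x \<in> ?X" "y \<in> ?X" "rep_iso G (?F x) (?F y)" for x y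
  proof -
    obtain u0 w0 \<theta> where x: "u0 \<in> J 1" "\<theta> \<in> eta_ext R P \<pi> l1 l2 l \<epsilon> \<psi> (cs l u0) (cs m w0)" "x = ((cs l u0, cs m w0), \<theta>)"
      using XE[OF xy(1)] by blast
    obtain u1 w1 \<theta>' where y: "u1 \<in> J 1" "\<theta>' \<in> eta_ext R P \<pi> l1 l2 l \<epsilon> \<psi> (cs l u1) (cs m w1)" "y = ((cs l u1, cs m w1), \<theta>')"
      using XE[OF xy(2)] by blast
    have "rep_iso G (rho \<theta> u0 w0) (rho \<theta>' u1 w1)" using xy(3) unfolding x(3) y(3) by simp
    from rho_distinct[OF x(1) y(1) x(2) y(2) this] show ?thesis unfolding x(3) y(3) by simp
  qed
  have surj: "\<exists>x\<in>?X. rep_iso G \<rho> (?F x)" if rC: "\<rho> \<in> ?C" for \<rho>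
  proof -
    obtain u0 w0 \<theta> where "u0 \<in> J 1" "w0 \<notin> J 1" "\<theta> \<in> eta_ext R P \<pi> l1 l2 l \<epsilon> \<psi> (cs l u0) (cs m w0)" "rep_iso G \<rho> (rho \<theta> u0 w0)"
      using cuspidal_is_rho rC by blast
    then show ?thesis by (intro bexI[of _ "((cs l u0, cs m w0), \<theta>)"]) auto
  qed
  have sym: "rep_iso G \<sigma> \<rho>" if "\<rho> \<in> ?C" "\<sigma> \<in> ?C" "rep_iso G \<rho> \<sigma>" for \<rho> \<sigma>
    using rep_iso_sym[OF _ _ group_G] cuspidal_is_rep that by blast
  have trans: "rep_iso G \<rho> \<tau>" if "\<rho> \<in> ?C" "\<sigma> \<in> ?C" "\<tau> \<in> ?C" "rep_iso G \<rho> \<sigma>" "rep_iso G \<sigma> \<tau>" for \<rho> \<sigma> \<tau>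
    using rep_iso_trans[OF _ _ _ group_G] cuspidal_is_rep that by blast
  have cls: "?E `` {\<rho>} = ?E `` {\<sigma>}" if "\<rho> \<in> ?C" "\<sigma> \<in> ?C" "rep_iso G \<rho> \<sigma>" for \<rho> \<sigma>
  proof (intro Set.set_eqI iffI)
    fix \<tau> assume "\<tau> \<in> ?E `` {\<rho>}"
    then show "\<tau> \<in> ?E `` {\<sigma>}" using that trans[of \<sigma> \<rho> \<tau>] sym[OF that] by auto
  next
    fix \<tau> assume "\<tau> \<in> ?E `` {\<sigma>}"
    then show "\<tau> \<in> ?E `` {\<rho>}" using that trans[of \<rho> \<sigma> \<tau>] by auto
  qed
  have "bij_betw (\<lambda>x. ?E `` {?F x}) ?X (?C // ?E)"
    unfolding bij_betw_def
  proof
    show "inj_on (\<lambda>x. ?E `` {?F x}) ?X"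
    proof (rule inj_onI)
      fix x y assume x: "x \<in> ?X" and y: "y \<in> ?X" and e: "?E `` {?F x} = ?E `` {?F y}"
      \<comment> \<open>Reflexivity of the isomorphism relation at \<open>?F y\<close> is obtained
        from \<open>surj\<close> followed by \<open>inj\<close>.\<close>
      obtain z where z: "z \<in> ?X" "rep_iso G (?F y) (?F z)" using surj[OF FC[OF y]] by blast
      have "z = y" using inj[OF y z(1) z(2)] by simp
      then have "?F y \<in> ?E `` {?F y}" using z FC[OF y] by auto
      then have "?F y \<in> ?E `` {?F x}" using e by simp
      then have "rep_iso G (?F x) (?F y)" by auto
      then show "x = y" by (rule inj[OF x y])
    qed
    show "(\<lambda>x. ?E `` {?F x}) ` ?X = ?C // ?E"
    proof
      show "(\<lambda>x. ?E `` {?F x}) ` ?X \<subseteq> ?C // ?E" using quotientI[OF FC] by blast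
      show "?C // ?E \<subseteq> (\<lambda>x. ?E `` {?F x}) ` ?X"
      proof
        fix D assume "D \<in> ?C // ?E"
        then obtain \<rho> where r: "\<rho> \<in> ?C" "D = ?E `` {\<rho>}" by (rule quotientE)
        obtain x where x: "x \<in> ?X" "rep_iso G \<rho> (?F x)" using surj[OF r(1)] by blast
        have "D = ?E `` {?F x}" unfolding r(2) by (rule cls[OF r(1) FC[OF x(1)] x(2)])
        then show "D \<in> (\<lambda>x. ?E `` {?F x}) ` ?X" using x(1) by blast
      qed
    qed
  qed
  then have "card (?C // ?E) = card ?X" by (rule bij_betw_same_card[symmetric])
  also have "card ?X = (\<Sum>p\<in>cs l ` J 1 \<times> cs m ` (- J 1). card (case p of (uh, wh) \<Rightarrow> eta_ext R P \<pi> l1 l2 l \<epsilon> \<psi> uh wh))"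
  proof (rule card_SigmaI)
    have "finite (range (cs l))" "finite (range (cs m))" using fl.card_cs by auto
    then show "finite (cs l ` J 1 \<times> cs m ` (- J 1))"
      by (intro finite_cartesian_product) (auto intro: finite_subset[OF image_mono[OF subset_UNIV]])
    show "\<forall>p\<in>cs l ` J 1 \<times> cs m ` (- J 1). finite (case p of (uh, wh) \<Rightarrow> eta_ext R P \<pi> l1 l2 l \<epsilon> \<psi> uh wh)"
      using card_eta_ext(1) by auto
  qed
  also have "\<dots> = (\<Sum>p\<in>cs l ` J 1 \<times> cs m ` (- J 1). fl.q ^ (l1 - 1) * (fl.q - 1))"
    by (rule sum.cong) (use card_eta_ext(2) in auto)
  also have "\<dots> = fl.q ^ (l - 1) * (fl.q ^ (m - 1) * (fl.q - 1)) * (fl.q ^ (l1 - 1) * (fl.q - 1))"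
    using fl.card_cs_J[of 1 l] fl.card_cs_units[of m] l_dims by (simp add: card_cartesian_product)
  also have "\<dots> = fl.q ^ ((l - 1) + (m - 1) + (l1 - 1)) * (fl.q - 1) ^ 2"
    by (simp add: power_add power2_eq_square mult_ac)
  also have "(l - 1) + (m - 1) + (l1 - 1) = l1 + l2 - 3" using l_dims lam by auto
  finally show ?thesis .
qed

end

theorem theorem6p3:
  fixes R :: "('a, 'b) ring_scheme" and P :: "'a set" and \<pi> :: 'a
    and l1 l2 l \<epsilon> q :: nat and \<psi> :: "'a set \<Rightarrow> complex"
  assumes dvr: "complete_dvr R P"
    and uniformizer: "\<pi> \<in> carrier R" "P = PIdl\<^bsub>R\<^esub> \<pi>"
    and q: "q = card (carrier (R Quot P))"
    and lambda: "l1 > l2" "l2 > 1"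
    and eps: "\<epsilon> \<in> {0, 1}" "\<epsilon> mod 2 = l2 mod 2"
    and l: "l = (l2 + \<epsilon>) div 2"
    and psi: "primitive_char R P l \<psi>"
  shows
    "(\<forall>uh \<in> quo_ideal R P l 1. \<forall>wh \<in> Units (quo R P (l - \<epsilon>)).
        N_stab R P \<pi> l1 l2 l \<epsilon> \<psi> uh wh =
          {g \<in> carrier (Glam R P l1 l2). \<exists>b \<in> carrier (quo R P l2).
             ent12 R P l1 l2 g = pimul R \<pi> (l1 - l2) b \<and>
             red R P (l - \<epsilon>) b =
               red R P (l - \<epsilon>) (ent21 R P l1 l2 g) \<otimes>\<^bsub>quo R P (l - \<epsilon>)\<^esub> wh \<and>
             red R P l (ent22 R P l1 l2 g) =
               red R P l (ent11 R P l1 l2 g)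
                 \<ominus>\<^bsub>quo R P l\<^esub> red R P l (ent21 R P l1 l2 g) \<otimes>\<^bsub>quo R P l\<^esub> uh})
     \<and> (\<forall>uh \<in> quo_ideal R P l 1. \<forall>wh \<in> Units (quo R P (l - \<epsilon>)).
          eta_ext R P \<pi> l1 l2 l \<epsilon> \<psi> uh wh \<noteq> {})
     \<and> (\<forall>uh \<in> quo_ideal R P l 1. \<forall>wh \<in> Units (quo R P (l - \<epsilon>)).
          \<forall>\<theta> \<in> eta_ext R P \<pi> l1 l2 l \<epsilon> \<psi> uh wh.
            irreducible_rep (Glam R P l1 l2) (rho_ext R P \<pi> l1 l2 l \<epsilon> \<psi> uh wh \<theta>) \<and>
            cuspidal_rep R P \<pi> l1 l2 (rho_ext R P \<pi> l1 l2 l \<epsilon> \<psi> uh wh \<theta>) \<and>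
            fst (rho_ext R P \<pi> l1 l2 l \<epsilon> \<psi> uh wh \<theta>) = q ^ (l2 - 1) * (q - 1))
     \<and> (\<forall>uh \<in> quo_ideal R P l 1. \<forall>wh \<in> Units (quo R P (l - \<epsilon>)).
        \<forall>uh' \<in> quo_ideal R P l 1. \<forall>wh' \<in> Units (quo R P (l - \<epsilon>)).
          \<forall>\<theta> \<in> eta_ext R P \<pi> l1 l2 l \<epsilon> \<psi> uh wh. \<forall>\<theta>' \<in> eta_ext R P \<pi> l1 l2 l \<epsilon> \<psi> uh' wh'.
            (uh, wh, \<theta>) \<noteq> (uh', wh', \<theta>') \<longrightarrow>
              \<not> rep_iso (Glam R P l1 l2) (rho_ext R P \<pi> l1 l2 l \<epsilon> \<psi> uh wh \<theta>)
                                        (rho_ext R P \<pi> l1 l2 l \<epsilon> \<psi> uh' wh' \<theta>'))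
     \<and> (\<forall>\<rho>. cuspidal_rep R P \<pi> l1 l2 \<rho> \<longrightarrow>
          (\<exists>uh \<in> quo_ideal R P l 1. \<exists>wh \<in> Units (quo R P (l - \<epsilon>)).
             \<exists>\<theta> \<in> eta_ext R P \<pi> l1 l2 l \<epsilon> \<psi> uh wh.
               rep_iso (Glam R P l1 l2) \<rho> (rho_ext R P \<pi> l1 l2 l \<epsilon> \<psi> uh wh \<theta>)))
     \<and> card ({\<rho>. cuspidal_rep R P \<pi> l1 l2 \<rho>} //
              {(\<rho>, \<sigma>). cuspidal_rep R P \<pi> l1 l2 \<rho> \<and> cuspidal_rep R P \<pi> l1 l2 \<sigma> \<and>
                 rep_iso (Glam R P l1 l2) \<rho> \<sigma>})
          = q ^ (l1 + l2 - 3) * (q - 1) ^ 2"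
proof -
  interpret dvr_char R P \<pi> l1 l2 l \<epsilon> \<psi>
    by (intro dvr_char.intro dvr_lam.intro dvr_setup.intro dvr_setup_axioms.intro dvr_lam_axioms.intro dvr_char_axioms.intro)
      (use assms in auto)
  have qq: "fl.q = q" unfolding q by (rule q_eq)
  have cases: "\<exists>u0 w0. uh = cs l u0 \<and> u0 \<in> J 1 \<and> wh = cs (l - \<epsilon>) w0 \<and> w0 \<notin> J 1"
    if "uh \<in> quo_ideal R P l 1" "wh \<in> Units (quo R P (l - \<epsilon>))" for uh wh
    using that unfolding quo_ideal_l Units_m by blast
  show ?thesis
  proof (intro conjI ballI allI impI, goal_cases)
    case (1 uh wh)
    from cases[OF 1] show ?case using stab_matrices by blast
  next
    case (2 uh wh)
    from cases[OF 2] obtain u0 w0 where u: "uh = cs l u0" "u0 \<in> J 1" "wh = cs (l - \<epsilon>) w0" by blast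
    \<comment> \<open>Existence of an extension is read off its count, which is positive since the
      residue field has more than one element.\<close>
    have "0 < q ^ (l1 - 1) * (q - 1)" using gr.one_lt_q unfolding qq by simp
    then show ?case using card_eta_ext[OF u(2), of w0] unfolding u(1,3) qq by auto
  next
    case (3 uh wh \<theta>)
    from cases[OF 3(1,2)] obtain u0 w0 where u: "uh = cs l u0" "u0 \<in> J 1" "wh = cs (l - \<epsilon>) w0" by blast
    show ?case using rho_facts[OF u(2) 3(3)[unfolded u(1,3)]] unfolding u(1,3) by blast
  next
    case (4 uh wh \<theta>)
    from cases[OF 4(1,2)] show ?case using rho_cuspidal 4(3) by blast
  next
    case (5 uh wh \<theta>)
    from cases[OF 5(1,2)] obtain u0 w0 where u: "uh = cs l u0" "u0 \<in> J 1" "wh = cs (l - \<epsilon>) w0" by blast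
    obtain xs where "rho \<theta> u0 w0 = (length xs, ind_char G (gr.Nset u0 w0) xs \<theta>)" "length xs = q ^ (l2 - 1) * (q - 1)"
      using rho_facts[OF u(2) 5(3)[unfolded u(1,3)]] unfolding qq by metis
    then show ?case unfolding u(1,3) by simp
  next
    case (6 uh wh uh' wh' \<theta> \<theta>')
    from cases[OF 6(1,2)] obtain u0 w0 where u: "uh = cs l u0" "u0 \<in> J 1" "wh = cs (l - \<epsilon>) w0" by blast
    from cases[OF 6(3,4)] obtain u1 w1 where u': "uh' = cs l u1" "u1 \<in> J 1" "wh' = cs (l - \<epsilon>) w1" by blast
    show ?case
      using rho_distinct[OF u(2) u'(2) 6(5)[unfolded u(1,3)] 6(6)[unfolded u'(1,3)]] 6(7) unfolding u(1,3) u'(1,3) by blast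
  next
    case (7 \<rho>)
    obtain u0 w0 \<theta> where "u0 \<in> J 1" "w0 \<notin> J 1" "\<theta> \<in> eta_ext R P \<pi> l1 l2 l \<epsilon> \<psi> (cs l u0) (cs m w0)" "rep_iso G \<rho> (rho \<theta> u0 w0)"
      using cuspidal_is_rho[OF 7] by blast
    then show ?case unfolding quo_ideal_l Units_m by blast
  next
    case 8
    show ?case using card_cuspidal unfolding qq .
  qed
qed

end
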